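(* Let $L:\mathcal{D}'(\mathbb{R}^d)\to\mathcal{D}'(\mathbb{R}^d)$ be a continuous linear operator. Then $L$ is a Hadamard operator (i.e. $L\in\mathcal{M}(\mathbb{R}^d)$) if and only if there exist $T\in\mathcal{O}_H'(\mathbb{R}^d)$ and $\varepsilon>0$ with $\operatorname{supp}T\subset W_\varepsilon$ such that $L(S)=S\star T$ for all $S\in\mathcal{D}'(\mathbb{R}^d)$, where $(S\star T)\varphi=S_y\big(T_x\varphi(xy)\big)$ for $\varphi\in\mathcal{D}(\mathbb{R}^d)$. In this case the eigenvalues $m_\alpha$ defined by $L(x^\alpha)=m_\alpha x^\alpha$ are $m_\alpha=T_x\Big(\frac{\sigma(x)}{x^{\alpha+\mathbf 1}}\Big)$, $\alpha\in\mathbb{N}_0^d$.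
   Context: $\mathbb{R}_*=\mathbb{R}\setminus\{0\}$. For $x,y\in\mathbb{R}^d$, $xy=(x_1y_1,\dots,x_dy_d)$ and, for $y\in\mathbb{R}_*^d$, $x/y$ is the coordinatewise quotient; $\mathbf 1=(1,\dots,1)$. For $x\in\mathbb{R}_*^d$, $\sigma(x)=\prod_{j=1}^d x_j/|x_j|$, and $x^{-\gamma}=1/x^\gamma$. For $\varepsilon>0$, $W_\varepsilon=\{x\in\mathbb{R}^d:\min_j|x_j|\ge\varepsilon\}$. A Hadamard operator on $\mathcal{D}'(\mathbb{R}^d)$ is a continuous linear operator $L$ on $\mathcal{D}'(\mathbb{R}^d)$ such that for every $\alpha\in\mathbb{N}_0^d$ the monomial $x^\alpha$ is an eigenvector, $L(x^\alpha)=m_\alpha x^\alpha$; the set of these is $\mathcal{M}(\mathbb{R}^d)$. Euler derivatives are $\theta_j=x_j\partial_j$, $\theta^\beta=\theta_1^{\beta_1}\cdots\theta_d^{\beta_d}$. $\mathcal{O}_H'(\mathbb{R}^d)$ is the set of $T\in\mathcal{D}'(\mathbb{R}^d)$ such that for every $k\in\mathbb{N}_0$ there are finitely many measurable functions $t_\beta$ with $(1+|x|^2)^{k/2}t_\beta\in L_\infty(\mathbb{R}^d)$ and $T=\sum_\beta\theta^\beta t_\beta$ (in the sense of distributions). For $T$ as in the statement and $\varphi\in\mathcal{D}(\mathbb{R}^d)$, the function $y\mapsto T_x\varphi(xy)$, $y\in\mathbb{R}_*^d$, extends to a function in $\mathcal{D}(\mathbb{R}^d)$, to which $S$ is applied.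 *)

theory Defs
  imports "HOL-Analysis.Analysis"
begin

definition pd :: "'n::finite \<Rightarrow> (real^'n \<Rightarrow> complex) \<Rightarrow> real^'n \<Rightarrow> complex" where
  "pd j f x = vector_derivative (\<lambda>t. f (x + t *\<^sub>R axis j 1)) (at 0)"

fun iterpd :: "'n::finite list \<Rightarrow> (real^'n \<Rightarrow> complex) \<Rightarrow> real^'n \<Rightarrow> complex" where
  "iterpd [] f = f"
| "iterpd (j # js) f = pd j (iterpd js f)"

definition smooth_fn :: "(real^'n::finite \<Rightarrow> complex) \<Rightarrow> bool" where
  "smooth_fn f \<longleftrightarrow> (\<forall>js. continuous_on UNIV (iterpd js f) \<and>
     (\<forall>j x. (\<lambda>t. iterpd js f (x + t *\<^sub>R axis j 1)) differentiable (at 0)))"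

definition tsupp :: "(real^'n::finite \<Rightarrow> complex) \<Rightarrow> (real^'n) set" where
  "tsupp f = closure {x. f x \<noteq> 0}"

definition test_fn :: "(real^'n::finite \<Rightarrow> complex) \<Rightarrow> bool" where
  "test_fn f \<longleftrightarrow> smooth_fn f \<and> compact (tsupp f)"

definition D_conv :: "(nat \<Rightarrow> real^'n::finite \<Rightarrow> complex) \<Rightarrow> (real^'n \<Rightarrow> complex) \<Rightarrow> bool" where
  "D_conv fs f \<longleftrightarrow> (\<forall>n. test_fn (fs n)) \<and> test_fn f \<and>
     (\<exists>K. compact K \<and> (\<forall>n. tsupp (fs n) \<subseteq> K)) \<and>
     (\<forall>js. uniform_limit UNIV (\<lambda>n. iterpd js (fs n)) (iterpd js f) sequentially)"

text \<open>Distributions: (sequentially) continuous linear functionals on D, normalised to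
  vanish on non-test functions so that equality of distributions is plain equality.\<close>
definition is_distr :: "((real^'n::finite \<Rightarrow> complex) \<Rightarrow> complex) \<Rightarrow> bool" where
  "is_distr T \<longleftrightarrow> (\<forall>f. \<not> test_fn f \<longrightarrow> T f = 0) \<and>
     (\<forall>a f g. test_fn f \<and> test_fn g \<longrightarrow> T (\<lambda>x. a * f x + g x) = a * T f + T g) \<and>
     (\<forall>fs f. D_conv fs f \<longrightarrow> (\<lambda>n. T (fs n)) \<longlonglongrightarrow> T f)"

text \<open>Continuous linear operators on D'(R^d) (continuity = sequential continuity,
  sequential convergence in D' being pointwise convergence on test functions).\<close>
definition cont_lin_op ::
  "(((real^'n::finite \<Rightarrow> complex) \<Rightarrow> complex) \<Rightarrow> ((real^'n \<Rightarrow> complex) \<Rightarrow> complex)) \<Rightarrow> bool" where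
  "cont_lin_op L \<longleftrightarrow> (\<forall>S. is_distr S \<longrightarrow> is_distr (L S)) \<and>
     (\<forall>a S R. is_distr S \<and> is_distr R \<longrightarrow>
        L (\<lambda>f. a * S f + R f) = (\<lambda>f. a * L S f + L R f)) \<and>
     (\<forall>Ss S. (\<forall>n. is_distr (Ss n)) \<and> is_distr S \<and>
        (\<forall>f. test_fn f \<longrightarrow> (\<lambda>n. Ss n f) \<longlonglongrightarrow> S f) \<longrightarrow>
        (\<forall>f. test_fn f \<longrightarrow> (\<lambda>n. L (Ss n) f) \<longlonglongrightarrow> L S f))"

definition regdist :: "(real^'n::finite \<Rightarrow> complex) \<Rightarrow> (real^'n \<Rightarrow> complex) \<Rightarrow> complex" where
  "regdist g f = (if test_fn f then (\<integral>x. g x * f x \<partial>lborel) else 0)"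

definition monomial :: "('n::finite \<Rightarrow> nat) \<Rightarrow> (real^'n \<Rightarrow> complex) \<Rightarrow> complex" where
  "monomial \<alpha> = regdist (\<lambda>x. complex_of_real (\<Prod>j\<in>UNIV. (x $ j) ^ (\<alpha> j)))"

definition hadamard_op ::
  "(((real^'n::finite \<Rightarrow> complex) \<Rightarrow> complex) \<Rightarrow> ((real^'n \<Rightarrow> complex) \<Rightarrow> complex)) \<Rightarrow> bool" where
  "hadamard_op L \<longleftrightarrow> cont_lin_op L \<and>
     (\<forall>\<alpha>. \<exists>m. L (monomial \<alpha>) = (\<lambda>f. m * monomial \<alpha> f))"

text \<open>Transpose of the Euler derivative theta_j = x_j d_j: theta_j^t f = -(f + x_j d_j f).\<close>
definition euler_t :: "'n::finite \<Rightarrow> (real^'n \<Rightarrow> complex) \<Rightarrow> real^'n \<Rightarrow> complex" where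
  "euler_t j f x = - (f x + complex_of_real (x $ j) * pd j f x)"

fun euler_tw :: "'n::finite list \<Rightarrow> (real^'n \<Rightarrow> complex) \<Rightarrow> real^'n \<Rightarrow> complex" where
  "euler_tw [] f = f"
| "euler_tw (j # js) f = euler_t j (euler_tw js f)"

text \<open>The distribution theta_{w_1} ... theta_{w_m} t for a function t, applied to f.\<close>
definition euler_dist :: "'n::finite list \<Rightarrow> (real^'n \<Rightarrow> complex) \<Rightarrow> (real^'n \<Rightarrow> complex) \<Rightarrow> complex" where
  "euler_dist w t f = (\<integral>x. t x * euler_tw (rev w) f x \<partial>lborel)"

text \<open>The space O'_H(R^d). Finitely many multi-indices beta are encoded as a finite set of
  words over the coordinate indices (Euler derivatives commute).\<close>
definition OH_dist :: "((real^'n::finite \<Rightarrow> complex) \<Rightarrow> complex) \<Rightarrow> bool" where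
  "OH_dist T \<longleftrightarrow> is_distr T \<and>
     (\<forall>k::nat. \<exists>W t. finite W \<and>
        (\<forall>w\<in>W. t w \<in> borel_measurable lborel \<and>
           (\<exists>C. AE x in lborel. norm (complex_of_real ((1 + (norm x)\<^sup>2) powr (real k / 2)) * t w x) \<le> C)) \<and>
        (\<forall>f. test_fn f \<longrightarrow> T f = (\<Sum>w\<in>W. euler_dist w (t w) f)))"

definition dsupp :: "((real^'n::finite \<Rightarrow> complex) \<Rightarrow> complex) \<Rightarrow> (real^'n) set" where
  "dsupp T = - {x. \<exists>U. open U \<and> x \<in> U \<and> (\<forall>f. test_fn f \<and> tsupp f \<subseteq> U \<longrightarrow> T f = 0)}"

definition Wset :: "real \<Rightarrow> (real^'n::finite) set" where
  "Wset \<epsilon> = {x. \<forall>j. \<epsilon> \<le> \<bar>x $ j\<bar>}"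

text \<open>Multiplicative convolution (S * T) f = S_y (T_x f(xy)), where S is applied to the
  (unique) test function extending y \<mapsto> T_x f(xy) from R_*^d.\<close>
definition mstar ::
  "((real^'n::finite \<Rightarrow> complex) \<Rightarrow> complex) \<Rightarrow> ((real^'n \<Rightarrow> complex) \<Rightarrow> complex)
    \<Rightarrow> (real^'n \<Rightarrow> complex) \<Rightarrow> complex" where
  "mstar S T f = (if test_fn f then
      S (THE g. test_fn g \<and> (\<forall>y. (\<forall>j. y $ j \<noteq> 0) \<longrightarrow> g y = T (\<lambda>x. f (x * y))))
    else 0)"

text \<open>Value of T (in O'_H, support away from the coordinate hyperplanes) on a function g
  that is smooth off the coordinate hyperplanes: T_x(g) = lim T(rho(x/n) chi(x) g(x)) for
  every cut-off rho (test function = 1 near 0) and every smooth chi that is 1 on a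
  neighbourhood of supp T and 0 near the coordinate hyperplanes.\<close>
definition ext_value ::
  "((real^'n::finite \<Rightarrow> complex) \<Rightarrow> complex) \<Rightarrow> (real^'n \<Rightarrow> complex) \<Rightarrow> complex \<Rightarrow> bool" where
  "ext_value T g c \<longleftrightarrow>
     (\<forall>rf cf. test_fn rf \<and> (\<exists>r>0. \<forall>x\<in>ball 0 r. rf x = 1) \<and> smooth_fn cf \<and>
        (\<exists>U. open U \<and> dsupp T \<subseteq> U \<and> (\<forall>x\<in>U. cf x = 1)) \<and>
        (\<exists>\<delta>>0. \<forall>x. (\<exists>j. \<bar>x $ j\<bar> < \<delta>) \<longrightarrow> cf x = 0) \<longrightarrow>
        (\<lambda>n. T (\<lambda>x. rf ((1 / real (Suc n)) *\<^sub>R x) * cf x * g x)) \<longlonglongrightarrow> c)"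

definition sigma_sgn :: "real^'n::finite \<Rightarrow> real" where
  "sigma_sgn x = (\<Prod>j\<in>UNIV. x $ j / \<bar>x $ j\<bar>)"

definition eig_fn :: "('n::finite \<Rightarrow> nat) \<Rightarrow> real^'n \<Rightarrow> complex" where
  "eig_fn \<alpha> x = complex_of_real (sigma_sgn x / (\<Prod>j\<in>UNIV. (x $ j) ^ (\<alpha> j + 1)))"

end

theory Submission
  imports Defs
begin

text \<open>A continuous operator on distributions is the transpose of an operator \<open>G\<close> on test functions.
  By density of the monomials, \<open>G\<close> commutes with all dilations and Euler derivatives as soon as the monomials are
  eigenvectors, so \<open>G f y = T (\<lambda>x. f (x * y))\<close> off the coordinate hyperplanes, where \<open>T\<close> is the image of the point
  mass at 1. The bounded support of \<open>G f\<close>, uniformly for \<open>f\<close> supported in a fixed box (Banach--Steinhaus), keeps the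
  support of \<open>T\<close> away from the hyperplanes. On the hyperplanes \<open>G f\<close> is flat for \<open>f\<close> supported in the open
  positive orthant; this turns into rapid decay of the multiplicative convolutions of \<open>T\<close> with such \<open>f\<close>.
  Writing the point mass at 1, in logarithmic coordinates, as a kernel plus a convergent series of \<open>N\<close>-fold derivatives
  of kernels then represents \<open>T\<close> as a finite sum of Euler derivatives of rapidly decaying functions.
  Conversely, such a representation lets one differentiate \<open>T (\<lambda>x. f (x * y))\<close> under the integral sign, up to the
  hyperplanes, and dominated convergence identifies the eigenvalues.\<close>


text \<open>Off the hyperplanes \<open>G f\<close> is read off from \<open>T\<close> by dilation; no
  dilation of the point 1 reaches the hyperplanes, and this is the obstacle. What remains at a point
  with y_j = 0 is algebra: the functional U sending f to the b-th j-derivative of \<open>G f\<close>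
  there satisfies U(theta_j f) = b U(f), and the reflection of x_j multiplies U by (-1)^b. The two
  relations together annihilate every x_j^(b+1) h, and a test function supported in the open
  positive orthant is divisible by any power of x_j. Decay of T at infinity is this flatness seen at
  y = 1 / z. The estimates cost some number m of derivatives of the kernel. The increments of the
  approximate identity are therefore N-fold derivatives with N = d + m + 1: one factor 2 is gained
  per scale and the series converges, while the N derivatives pass to the test function as Euler
  derivatives. Since m depends on the order of decay, each order has its own representation. The
  converse has the matching difficulty: a y-derivative costs a power of x, so each order of
  differentiation uses another representation, and continuity across the hyperplanes makes them
  agree.\<close>

section \<open>Partial derivatives and smooth functions\<close>

definition hpd :: "'n::finite \<Rightarrow> (real^'n \<Rightarrow> complex) \<Rightarrow> complex \<Rightarrow> real^'n \<Rightarrow> bool" where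
  "hpd j f d x \<longleftrightarrow> ((\<lambda>t. f (x + t *\<^sub>R axis j 1)) has_vector_derivative d) (at 0)"

text \<open>\<open>pd\<close> is a choice operator and says nothing about existence.
  \<open>hpd\<close> carries existence and value together, so the calculus rules are proved for it
  and \<open>pd\<close> is only read off at the end.\<close>

lemma hpd_pd: "hpd j f d x \<Longrightarrow> pd j f x = d"
  unfolding hpd_def pd_def by (rule vector_derivative_at)

text \<open>\<open>hpd\<close> speaks of the parameter value 0 only. Shifting the base point gives
  the derivative along the whole line, the form used by the mean value and integral
  theorems.\<close>

lemma hpd_line:
  assumes "\<And>s. hpd j f (d (x + s *\<^sub>R axis j 1)) (x + s *\<^sub>R axis j 1)"
  shows "((\<lambda>t. f (x + t *\<^sub>R axis j 1)) has_vector_derivative d (x + t *\<^sub>R axis j 1)) (at t within S)"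
proof -
  have "((\<lambda>s. f ((x + t *\<^sub>R axis j 1) + s *\<^sub>R axis j 1)) has_vector_derivative d (x + t *\<^sub>R axis j 1)) (at (t - t))"
    using assms[of t] by (simp add: hpd_def)
  moreover have "((\<lambda>s. s - t) has_vector_derivative 1) (at t)"
    by (auto intro!: derivative_eq_intros)
  ultimately have "((\<lambda>s. f ((x + t *\<^sub>R axis j 1) + s *\<^sub>R axis j 1)) \<circ> (\<lambda>s. s - t)
      has_vector_derivative 1 *\<^sub>R d (x + t *\<^sub>R axis j 1)) (at t)"
    by (intro vector_diff_chain_at)
  then show ?thesis
    by - (rule has_vector_derivative_at_within, simp add: o_def scaleR_left_diff_distrib)
qed

text \<open>Smoothness by coinduction: iterated derivatives cannot leave a class of continuous
  functions that is closed under every partial derivative. This replaces formulas for higher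
  derivatives.\<close>

lemma smooth_coinduct:
  assumes "f \<in> P" and "\<And>f. f \<in> P \<Longrightarrow> continuous_on UNIV f"
    and "\<And>f j. f \<in> P \<Longrightarrow> \<exists>g\<in>P. \<forall>x. hpd j f (g x) x"
  shows "smooth_fn f"
proof -
  have P: "iterpd js f \<in> P" for js
  proof (induction js)
    case (Cons j js)
    then obtain g where g: "g \<in> P" "\<And>x. hpd j (iterpd js f) (g x) x" using assms(3) by meson
    have "pd j (iterpd js f) = g" using g(2) hpd_pd by blast
    then show ?case using g by simp
  qed (simp add: assms)
  show ?thesis unfolding smooth_fn_def
  proof (intro allI conjI)
    fix js j x
    obtain g where "\<And>x. hpd j (iterpd js f) (g x) x" using assms(3)[OF P] by meson
    then show "(\<lambda>t. iterpd js f (x + t *\<^sub>R axis j 1)) differentiable (at 0)"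
      unfolding hpd_def by (rule differentiableI_vector)
  qed (use P assms in blast)
qed

lemma iterpd_append: "iterpd (as @ bs) f = iterpd as (iterpd bs f)"
  by (induction as) auto

lemma iterpd_snoc: "iterpd (js @ [j]) f = iterpd js (pd j f)"
  by (simp add: iterpd_append)

lemma smooth_iterpd: "smooth_fn f \<Longrightarrow> smooth_fn (iterpd js f)"
  unfolding smooth_fn_def by (simp flip: iterpd_append)

lemma smooth_pd: "smooth_fn f \<Longrightarrow> smooth_fn (pd j f)"
  using smooth_iterpd[of f "[j]"] by simp

lemma smooth_cont: "smooth_fn f \<Longrightarrow> continuous_on S f"
  unfolding smooth_fn_def by (metis iterpd.simps(1) continuous_on_subset subset_UNIV)

lemma smooth_hpd: "smooth_fn f \<Longrightarrow> hpd j f (pd j f x) x"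
proof -
  assume "smooth_fn f"
  then have "(\<lambda>t. iterpd [] f (x + t *\<^sub>R axis j 1)) differentiable (at 0)"
    unfolding smooth_fn_def by blast
  then show ?thesis by (simp add: hpd_def pd_def vector_derivative_works)
qed

lemma hpd_linear: "hpd j f d x \<Longrightarrow> hpd j g e x \<Longrightarrow> hpd j (\<lambda>x. a * f x + g x) (a * d + e) x"
  unfolding hpd_def by (auto intro!: derivative_eq_intros has_vector_derivative_mult_right)

lemma hpd_add: "hpd j f d x \<Longrightarrow> hpd j g e x \<Longrightarrow> hpd j (\<lambda>x. f x + g x) (d + e) x"
  using hpd_linear[of j f d x g e 1] by simp

lemma hpd_mult: "hpd j f d x \<Longrightarrow> hpd j g e x \<Longrightarrow> hpd j (\<lambda>x. f x * g x) (d * g x + f x * e) x"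
  unfolding hpd_def by (auto intro!: derivative_eq_intros has_vector_derivative_mult simp: add.commute)

lemma hpd_const: "hpd j (\<lambda>x. c) 0 x"
  unfolding hpd_def by auto

lemma smooth_const [simp]: "smooth_fn (\<lambda>x. c)"
  by (rule smooth_coinduct[where P = "range (\<lambda>c x. c)"]) (auto intro: hpd_const)

lemma smooth_linear:
  fixes f g :: "real^'n::finite \<Rightarrow> complex"
  assumes "smooth_fn f" "smooth_fn g"
  shows "smooth_fn (\<lambda>x. a * f x + g x)"
proof (rule smooth_coinduct[where P = "{(\<lambda>x. a * f x + g x) | f g. smooth_fn f \<and> smooth_fn g}"])
  fix h :: "real^'n \<Rightarrow> complex" and j
  assume "h \<in> {(\<lambda>x. a * f x + g x) | f g. smooth_fn f \<and> smooth_fn g}"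
  then obtain f g where h: "h = (\<lambda>x. a * f x + g x)" "smooth_fn f" "smooth_fn g" by auto
  show "continuous_on UNIV h" unfolding h
    using h by (intro continuous_intros smooth_cont)
  show "\<exists>g\<in>{(\<lambda>x. a * f x + g x) | f g. smooth_fn f \<and> smooth_fn g}. \<forall>x. hpd j h (g x) x"
    using smooth_pd[OF h(2), of j] smooth_pd[OF h(3), of j] h
    by (intro bexI[of _ "\<lambda>x. a * pd j f x + pd j g x"]) (auto intro: hpd_linear smooth_hpd)
qed (use assms in auto)

lemma smooth_add: "smooth_fn f \<Longrightarrow> smooth_fn g \<Longrightarrow> smooth_fn (\<lambda>x. f x + g x)"
  using smooth_linear[of f g 1] by simp

lemma smooth_cmult: "smooth_fn f \<Longrightarrow> smooth_fn (\<lambda>x. a * f x)"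
  using smooth_linear[of f "\<lambda>x. 0" a] by simp

lemma smooth_diff: "smooth_fn f \<Longrightarrow> smooth_fn g \<Longrightarrow> smooth_fn (\<lambda>x. f x - g x)"
  using smooth_linear[of g f "-1"] by simp

lemma smooth_sum: "(\<And>i. i \<in> I \<Longrightarrow> smooth_fn (f i)) \<Longrightarrow> smooth_fn (\<lambda>x. \<Sum>i\<in>I. f i x)"
  by (induction I rule: infinite_finite_induct) (auto intro: smooth_add)

text \<open>A single product is not stable under differentiation; finite sums of products are, by
  the Leibniz rule. They form the invariant class for \<open>smooth_coinduct\<close>.\<close>

inductive_set prod_closure :: "(real^'n::finite \<Rightarrow> complex) set" where
  prod_closure_mult: "smooth_fn f \<Longrightarrow> smooth_fn g \<Longrightarrow> (\<lambda>x. f x * g x) \<in> prod_closure"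
| prod_closure_add: "f \<in> prod_closure \<Longrightarrow> g \<in> prod_closure \<Longrightarrow> (\<lambda>x. f x + g x) \<in> prod_closure"

lemma smooth_mult:
  assumes "smooth_fn f" "smooth_fn g"
  shows "smooth_fn (\<lambda>x. f x * g x)"
proof (rule smooth_coinduct[where P = prod_closure])
  show "(\<lambda>x. f x * g x) \<in> prod_closure" using assms by (rule prod_closure_mult)
next
  fix h :: "real^'a \<Rightarrow> complex" assume "h \<in> prod_closure"
  then show "continuous_on UNIV h"
    by induction (auto intro: continuous_on_add continuous_on_mult dest: smooth_cont)
next
  fix h :: "real^'a \<Rightarrow> complex" and j assume "h \<in> prod_closure"
  then show "\<exists>g\<in>prod_closure. \<forall>x. hpd j h (g x) x"
  proof induction
    case (prod_closure_mult f g)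
    then have "(\<lambda>x. pd j f x * g x + f x * pd j g x) \<in> prod_closure"
      by (intro prod_closure.intros smooth_pd)
    moreover have "hpd j (\<lambda>x. f x * g x) (pd j f x * g x + f x * pd j g x) x" for x
      using prod_closure_mult by (intro hpd_mult smooth_hpd)
    ultimately show ?case
      by (intro bexI[of _ "\<lambda>x. pd j f x * g x + f x * pd j g x"] allI)
  next
    case (prod_closure_add f g)
    then obtain f' g' where "f' \<in> prod_closure" "\<forall>x. hpd j f (f' x) x"
        "g' \<in> prod_closure" "\<forall>x. hpd j g (g' x) x" by auto
    then show ?case
      by (intro bexI[of _ "\<lambda>x. f' x + g' x"]) (auto intro: hpd_add prod_closure.intros)
  qed
qed

lemma smooth_prod: "(\<And>i. i \<in> I \<Longrightarrow> smooth_fn (f i)) \<Longrightarrow> smooth_fn (\<lambda>x. \<Prod>i\<in>I. f i x)"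
  by (induction I rule: infinite_finite_induct) (auto intro: smooth_mult)

lemma pd_linear: "smooth_fn f \<Longrightarrow> smooth_fn g \<Longrightarrow> pd j (\<lambda>x. a * f x + g x) = (\<lambda>x. a * pd j f x + pd j g x)"
  by (rule ext) (intro hpd_pd hpd_linear smooth_hpd)

lemma pd_mult: "smooth_fn f \<Longrightarrow> smooth_fn g \<Longrightarrow> pd j (\<lambda>x. f x * g x) = (\<lambda>x. pd j f x * g x + f x * pd j g x)"
  by (rule ext) (intro hpd_pd hpd_mult smooth_hpd)

lemma pd_const [simp]: "pd j (\<lambda>x. c) = (\<lambda>x. 0)"
  by (rule ext) (intro hpd_pd hpd_const)

lemma pd_cmult: "smooth_fn f \<Longrightarrow> pd j (\<lambda>x. a * f x) = (\<lambda>x. a * pd j f x)"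
  using pd_linear[of f "\<lambda>x. 0" j a] by simp

lemma iterpd_zero [simp]: "iterpd js (\<lambda>x. 0) = (\<lambda>x. 0)"
  by (induction js) auto

lemma iterpd_linear:
  "smooth_fn f \<Longrightarrow> smooth_fn g \<Longrightarrow> iterpd js (\<lambda>x. a * f x + g x) = (\<lambda>x. a * iterpd js f x + iterpd js g x)"
  by (induction js) (auto simp: pd_linear smooth_iterpd)

lemma iterpd_cmult: "smooth_fn f \<Longrightarrow> iterpd js (\<lambda>x. a * f x) = (\<lambda>x. a * iterpd js f x)"
  using iterpd_linear[of f "\<lambda>x. 0" js a] by simp

lemma iterpd_add: "smooth_fn f \<Longrightarrow> smooth_fn g \<Longrightarrow> iterpd js (\<lambda>x. f x + g x) = (\<lambda>x. iterpd js f x + iterpd js g x)"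
  using iterpd_linear[of f g js 1] by simp

lemma iterpd_diff: "smooth_fn f \<Longrightarrow> smooth_fn g \<Longrightarrow> iterpd js (\<lambda>x. f x - g x) = (\<lambda>x. iterpd js f x - iterpd js g x)"
  using iterpd_linear[of g f js "-1"] by (simp add: fun_eq_iff)

lemma iterpd_sum: "finite I \<Longrightarrow> (\<And>i. i \<in> I \<Longrightarrow> smooth_fn (f i)) \<Longrightarrow>
   iterpd js (\<lambda>x. \<Sum>i\<in>I. a i * f i x) = (\<lambda>x. \<Sum>i\<in>I. a i * iterpd js (f i) x)"
proof (induction I rule: finite_induct)
  case (insert i I)
  have "smooth_fn (\<lambda>x. \<Sum>i\<in>I. a i * f i x)" using insert by (intro smooth_sum smooth_cmult) auto
  then show ?case using insert by (simp add: iterpd_linear)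
qed simp

section \<open>Smooth functions of one real variable and a smooth step\<close>

definition smooth1 :: "(real \<Rightarrow> real) \<Rightarrow> bool" where
  "smooth1 u \<longleftrightarrow> (\<exists>D::nat \<Rightarrow> real \<Rightarrow> real. D 0 = u \<and> (\<forall>n t. (D n has_real_derivative D (Suc n) t) (at t)))"

lemma smooth1_coinduct:
  assumes "u \<in> P" "\<And>f. f \<in> P \<Longrightarrow> \<exists>g\<in>P. \<forall>t. (f has_real_derivative g t) (at t)"
  shows "smooth1 u"
proof -
  have "\<exists>D::nat \<Rightarrow> real \<Rightarrow> real. \<forall>n. (D n \<in> P \<and> (n = 0 \<longrightarrow> D n = u)) \<and>
      (\<forall>t. (D n has_real_derivative D (Suc n) t) (at t))"
    by (rule dependent_nat_choice[of "\<lambda>n g. g \<in> P \<and> (n = 0 \<longrightarrow> g = u)"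
        "\<lambda>n f g. \<forall>t. (f has_real_derivative g t) (at t)"]) (use assms in blast)+
  then show ?thesis unfolding smooth1_def by blast
qed

lemma smooth1_D: "smooth1 u \<Longrightarrow> \<exists>v. smooth1 v \<and> (\<forall>t. (u has_real_derivative v t) (at t))"
  unfolding smooth1_def
proof (elim exE conjE)
  fix D :: "nat \<Rightarrow> real \<Rightarrow> real"
  assume D: "D 0 = u" "\<forall>n t. (D n has_real_derivative D (Suc n) t) (at t)"
  show "\<exists>v. (\<exists>D. D 0 = v \<and> (\<forall>n t. (D n has_real_derivative D (Suc n) t) (at t))) \<and>
        (\<forall>t. (u has_real_derivative v t) (at t))"
    by (intro exI[of _ "D 1"] conjI exI[of _ "\<lambda>n. D (Suc n)"]) (use D in auto)
qed

lemma smooth1_const: "smooth1 (\<lambda>t. c)"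
  by (rule smooth1_coinduct[where P = "range (\<lambda>c t. c)"]) (auto intro!: derivative_eq_intros bexI[of _ "\<lambda>t. 0"])

lemma smooth1_id: "smooth1 (\<lambda>t. t)"
  by (rule smooth1_coinduct[where P = "insert (\<lambda>t. t) (range (\<lambda>c t. c))"])
    (auto intro!: derivative_eq_intros intro: bexI[of _ "\<lambda>t. 0"])

lemma smooth1_exp: "smooth1 exp"
  by (rule smooth1_coinduct[where P = "{exp}"]) (auto intro!: derivative_eq_intros)

lemma smooth1_affine:
  assumes "smooth1 u" shows "smooth1 (\<lambda>t. u (a * t + b))"
proof (rule smooth1_coinduct[where P = "{(\<lambda>t. c * u (a * t + b)) | c u. smooth1 u}"])
  show "(\<lambda>t. u (a * t + b)) \<in> {(\<lambda>t. c * u (a * t + b)) | c u. smooth1 u}"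
    using assms by (auto intro!: exI[of _ 1] exI[of _ u])
next
  fix f assume "f \<in> {(\<lambda>t. c * u (a * t + b)) | c u. smooth1 u}"
  then obtain c u where f: "f = (\<lambda>t. c * u (a * t + b))" "smooth1 u" by auto
  then obtain v where v: "smooth1 v" "\<And>t. (u has_real_derivative v t) (at t)" using smooth1_D by blast
  have "(f has_real_derivative (c * a) * v (a * t + b)) (at t)" for t
    unfolding f by (rule derivative_eq_intros DERIV_chain2[OF v(2)] refl | simp)+
  then show "\<exists>g\<in>{(\<lambda>t. c * u (a * t + b)) | c u. smooth1 u}. \<forall>t. (f has_real_derivative g t) (at t)"
    using v(1) by (intro bexI[of _ "\<lambda>t. (c * a) * v (a * t + b)"]) auto
qed

inductive_set alg1 :: "(real \<Rightarrow> real) set" where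
  alg1_mult: "smooth1 f \<Longrightarrow> smooth1 g \<Longrightarrow> (\<lambda>x. f x * g x) \<in> alg1"
| alg1_add: "f \<in> alg1 \<Longrightarrow> g \<in> alg1 \<Longrightarrow> (\<lambda>x. f x + g x) \<in> alg1"

lemma alg1_deriv: "f \<in> alg1 \<Longrightarrow> \<exists>g\<in>alg1. \<forall>t. (f has_real_derivative g t) (at t)"
proof (induction rule: alg1.induct)
  case (alg1_mult f g)
  obtain f' where f': "smooth1 f'" "\<forall>t. (f has_real_derivative f' t) (at t)"
    using alg1_mult smooth1_D by blast
  obtain g' where g': "smooth1 g'" "\<forall>t. (g has_real_derivative g' t) (at t)"
    using alg1_mult smooth1_D by blast
  show ?case
    by (intro bexI[of _ "\<lambda>t. f' t * g t + g' t * f t"] alg1.intros)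
      (use f' g' alg1_mult in \<open>auto intro!: DERIV_mult\<close>)
next
  case (alg1_add f g)
  then obtain f' g' where "f' \<in> alg1" "g' \<in> alg1" "\<forall>t. (f has_real_derivative f' t) (at t)"
    "\<forall>t. (g has_real_derivative g' t) (at t)" by auto
  then show ?case
    by (intro bexI[of _ "\<lambda>t. f' t + g' t"] alg1.intros) (auto intro!: DERIV_add)
qed

lemma smooth1_alg1: "f \<in> alg1 \<Longrightarrow> smooth1 f"
  by (rule smooth1_coinduct[where P = alg1]) (auto intro: alg1_deriv)

lemma smooth1_mult: "smooth1 f \<Longrightarrow> smooth1 g \<Longrightarrow> smooth1 (\<lambda>t. f t * g t)"
  by (rule smooth1_alg1) (rule alg1_mult)

lemma smooth1_add: "smooth1 f \<Longrightarrow> smooth1 g \<Longrightarrow> smooth1 (\<lambda>t. f t + g t)"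
proof -
  assume "smooth1 f" "smooth1 g"
  then have "(\<lambda>t. f t * 1 + g t * 1) \<in> alg1"
    by (intro alg1.intros smooth1_const)
  then show ?thesis by (auto dest: smooth1_alg1)
qed

lemma smooth1_inverse:
  assumes "smooth1 f" "\<And>t. f t \<noteq> 0"
  shows "smooth1 (\<lambda>t. 1 / f t)"
\<comment> \<open>Quotients with a free smooth numerator and a free power of f form an invariant
  class: the derivative of g / f^n is (g' f - n g f') / f^(n+1).\<close>
proof (rule smooth1_coinduct[where P = "{(\<lambda>t. g t / f t ^ n) | g n. smooth1 g}"])
  show "(\<lambda>t. 1 / f t) \<in> {(\<lambda>t. g t / f t ^ n) | g n. smooth1 g}"
    by (auto intro!: exI[of _ "\<lambda>t. 1"] exI[of _ 1] smooth1_const)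
next
  fix h assume "h \<in> {(\<lambda>t. g t / f t ^ n) | g n. smooth1 g}"
  then obtain g n where h: "h = (\<lambda>t. g t / f t ^ n)" "smooth1 g" by auto
  obtain f' where f': "smooth1 f'" "\<And>t. (f has_real_derivative f' t) (at t)" using smooth1_D assms by blast
  obtain g' where g': "smooth1 g'" "\<And>t. (g has_real_derivative g' t) (at t)" using smooth1_D h by blast
  have "(h has_real_derivative (g' t * f t + (- real n) * (g t * f' t)) / f t ^ Suc n) (at t)" for t
  proof -
    have "(h has_real_derivative (g' t * f t ^ n - g t * (real n * f t ^ (n - 1) * f' t)) / (f t ^ n * f t ^ n)) (at t)"
      unfolding h by (rule derivative_eq_intros f' g' refl | simp add: assms)+
    moreover have "(g' t * f t ^ n - g t * (real n * f t ^ (n - 1) * f' t)) / (f t ^ n * f t ^ n)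
       = (g' t * f t + (- real n) * (g t * f' t)) / f t ^ Suc n"
      \<comment> \<open>For n = 0 the exponent n - 1 truncates, but its coefficient
        vanishes.\<close>
      using assms(2)[of t] by (cases n) (auto simp: field_simps)
    ultimately show ?thesis by simp
  qed
  moreover have "smooth1 (\<lambda>t. g' t * f t + (- real n) * (g t * f' t))"
    using f' g' h assms by (intro smooth1_add smooth1_mult smooth1_const)
  ultimately show "\<exists>g\<in>{(\<lambda>t. g t / f t ^ n) | g n. smooth1 g}. \<forall>t. (h has_real_derivative g t) (at t)"
    by (intro bexI[of _ "\<lambda>t. (g' t * f t + (- real n) * (g t * f' t)) / f t ^ Suc n"])
      (auto intro!: exI[of _ "\<lambda>t. g' t * f t + (- real n) * (g t * f' t)"] exI[of _ "Suc n"])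
qed

text \<open>The powers of t are there because differentiation sends number n of this family to a
  combination of numbers n + 1 and n + 2, so that the span of the family is invariant.\<close>

definition flat_exp :: "nat \<Rightarrow> real \<Rightarrow> real" where
  "flat_exp n t = (if t > 0 then exp (- 1 / t) / t ^ n else 0)"

lemma flat_exp_tendsto: "((\<lambda>t. flat_exp n t) \<longlongrightarrow> 0) (at 0)"
proof -
  have "((\<lambda>u::real. u ^ n / exp u) \<longlongrightarrow> 0) at_top" by (rule tendsto_power_div_exp_0)
  then have "((\<lambda>t::real. inverse t ^ n / exp (inverse t)) \<longlongrightarrow> 0) (at_right 0)"
    by (rule filterlim_compose[OF _ filterlim_inverse_at_top_right])
  then have "((\<lambda>t. flat_exp n t) \<longlongrightarrow> 0) (at_right 0)"
    by (rule Lim_transform_eventually)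
      (auto simp: flat_exp_def eventually_at_filter exp_minus divide_simps)
  moreover have "((\<lambda>t. flat_exp n t) \<longlongrightarrow> 0) (at_left 0)"
    by (rule Lim_transform_eventually[of "\<lambda>t. 0"]) (auto simp: flat_exp_def eventually_at_filter)
  ultimately show ?thesis by (simp add: filterlim_at_split)
qed

lemma flat_exp_deriv:
  "(flat_exp n has_real_derivative (- real n) * flat_exp (n + 1) t + flat_exp (n + 2) t) (at t)"
proof (cases t "0 :: real" rule: linorder_cases)
  case greater
  have "((\<lambda>t. exp (- 1 / t) / t ^ n) has_real_derivative
      (exp (-1/t) * (1/t\<^sup>2) * t ^ n - exp (-1/t) * (real n * t ^ (n - 1))) / (t ^ n * t ^ n)) (at t)"
    using greater by (auto intro!: derivative_eq_intros simp: power2_eq_square)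
  moreover have "(exp (-1/t) * (1/t\<^sup>2) * t ^ n - exp (-1/t) * (real n * t ^ (n - 1))) / (t ^ n * t ^ n)
     = (- real n) * flat_exp (n + 1) t + flat_exp (n + 2) t"
    using greater by (cases n) (auto simp: flat_exp_def field_simps power2_eq_square)
  ultimately have "((\<lambda>t. exp (- 1 / t) / t ^ n) has_real_derivative
     (- real n) * flat_exp (n + 1) t + flat_exp (n + 2) t) (at t)" by simp
  then show ?thesis
    by (rule has_field_derivative_transform_within_open[of _ _ _ "{0<..}"])
      (use greater in \<open>auto simp: flat_exp_def\<close>)
next
  case less
  have "((\<lambda>t. 0) has_real_derivative 0) (at t)" by simp
  then have "(flat_exp n has_real_derivative 0) (at t)"
    by (rule has_field_derivative_transform_within_open[of _ _ _ "{..<0}"])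
      (use less in \<open>auto simp: flat_exp_def\<close>)
  then show ?thesis using less by (simp add: flat_exp_def)
next
  case equal
  \<comment> \<open>The difference quotient of \<open>flat_exp n\<close> at 0 is
    \<open>flat_exp (Suc n)\<close>, whose limit is already known.\<close>
  have "((\<lambda>h. (flat_exp n (0 + h) - flat_exp n 0) / h) \<longlongrightarrow> 0) (at 0)"
    by (rule Lim_transform_eventually[OF flat_exp_tendsto[of "Suc n"]])
      (auto simp: flat_exp_def eventually_at_filter)
  then show ?thesis using equal by (simp add: DERIV_def flat_exp_def)
qed

inductive_set flat_span :: "(real \<Rightarrow> real) set" where
  "flat_exp n \<in> flat_span"
| "f \<in> flat_span \<Longrightarrow> g \<in> flat_span \<Longrightarrow> (\<lambda>t. a * f t + g t) \<in> flat_span"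

lemma smooth1_flat: "smooth1 (flat_exp n)"
proof (rule smooth1_coinduct[where P = flat_span])
  fix f assume "f \<in> flat_span"
  then show "\<exists>g\<in>flat_span. \<forall>t. (f has_real_derivative g t) (at t)"
  proof induction
    case (1 n)
    show ?case
      using flat_exp_deriv[of n] flat_span.intros(2)[OF flat_span.intros(1) flat_span.intros(1)]
      by (intro bexI[of _ "\<lambda>t. (- real n) * flat_exp (n + 1) t + flat_exp (n + 2) t"] allI)
  next
    case (2 f g a)
    then obtain f' g' where "f' \<in> flat_span" "g' \<in> flat_span" "\<forall>t. (f has_real_derivative f' t) (at t)"
      "\<forall>t. (g has_real_derivative g' t) (at t)" by auto
    then show ?case
      by (intro bexI[of _ "\<lambda>t. a * f' t + g' t"]) (auto intro!: DERIV_add DERIV_cmult flat_span.intros)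
  qed
qed (rule flat_span.intros)

text \<open>The usual smooth transition from 0 on t <= 0 to 1 on t >= 1. The argument
  \<open>- 1 * t + 1\<close> has the shape expected by \<open>smooth1_affine\<close>.\<close>

definition step1 :: "real \<Rightarrow> real" where
  "step1 t = flat_exp 0 t * (1 / (flat_exp 0 t + flat_exp 0 (- 1 * t + 1)))"

lemma smooth1_step: "smooth1 step1"
proof -
  have "flat_exp 0 t + flat_exp 0 (- 1 * t + 1) \<noteq> 0" for t
    by (cases "t > 0"; cases "t < 1") (auto simp: flat_exp_def intro!: less_imp_neq[THEN not_sym] add_pos_pos)
  then show ?thesis unfolding step1_def[abs_def]
    by (intro smooth1_mult smooth1_inverse smooth1_add smooth1_affine smooth1_flat)
qed

lemma step1_simps: "t \<le> 0 \<Longrightarrow> step1 t = 0" "t \<ge> 1 \<Longrightarrow> step1 t = 1" "0 \<le> step1 t" "step1 t \<le> 1"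
proof -
  have "0 < exp (- (1 / t)) + exp (- (1 / (1 - t)))" for t :: real
    by (simp add: add_pos_pos)
  then show "t \<le> 0 \<Longrightarrow> step1 t = 0" "t \<ge> 1 \<Longrightarrow> step1 t = 1" "0 \<le> step1 t" "step1 t \<le> 1"
    by (auto simp: step1_def flat_exp_def divide_le_eq not_less intro: less_imp_le)
qed

lemma smooth_coord:
  assumes "smooth1 u" shows "smooth_fn (\<lambda>x. complex_of_real (u (x $ j)))"
proof (rule smooth_coinduct[where P = "{(\<lambda>x. c * complex_of_real (u (x $ j))) | c u. smooth1 u}"])
  show "(\<lambda>x. complex_of_real (u (x $ j))) \<in> {(\<lambda>x. c * complex_of_real (u (x $ j))) | c u. smooth1 u}"
    using assms by (auto intro!: exI[of _ 1] exI[of _ u])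
next
  fix f :: "real^'a \<Rightarrow> complex" and i
  assume "f \<in> {(\<lambda>x. c * complex_of_real (u (x $ j))) | c u. smooth1 u}"
  then obtain c u where f: "f = (\<lambda>x. c * complex_of_real (u (x $ j)))" "smooth1 u" by auto
  obtain v where v: "smooth1 v" "\<And>t. (u has_real_derivative v t) (at t)" using smooth1_D f by blast
  have cont: "continuous_on UNIV u" by (meson DERIV_continuous_on has_field_derivative_at_within v(2))
  show "continuous_on UNIV f" unfolding f
    by (intro continuous_intros continuous_on_compose2[OF cont]) auto
  \<comment> \<open>The free constant c of the class P absorbs derivatives in other directions,
    which are 0.\<close>
  have "hpd i f ((if i = j then c else 0) * complex_of_real (v (x $ j))) x" for x
  proof (cases "i = j")
    case True
    have "((\<lambda>t. u (x $ j + t)) has_real_derivative v (x $ j)) (at 0)"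
      using DERIV_shift[of u "v (x$j)" 0 "x $ j"] v(2)[of "x$j"] by (simp add: add.commute)
    then have "((\<lambda>t. complex_of_real (u (x $ j + t))) has_vector_derivative complex_of_real (v (x $ j))) (at 0)"
      by (rule has_vector_derivative_of_real[unfolded has_real_derivative_iff_has_vector_derivative[symmetric]])
    then show ?thesis using True unfolding hpd_def f
      by (auto simp: axis_def intro!: has_vector_derivative_mult_right)
  next
    case False
    then show ?thesis unfolding hpd_def f by (auto simp: axis_def)
  qed
  moreover have "(\<lambda>x. (if i = j then c else 0) * complex_of_real (v (x $ j)))
      \<in> {(\<lambda>x. c * complex_of_real (u (x $ j))) | c u. smooth1 u}"
    using v(1) by blast
  ultimately show "\<exists>g\<in>{(\<lambda>x. c * complex_of_real (u (x $ j))) | c u. smooth1 u}. \<forall>x. hpd i f (g x) x"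
    by (intro bexI[of _ "\<lambda>x. (if i = j then c else 0) * complex_of_real (v (x $ j))"] allI)
qed


section \<open>Locality of partial derivatives\<close>

lemma pd_cong_open:
  assumes "open U" "x \<in> U" "\<And>y. y \<in> U \<Longrightarrow> f y = g y"
  shows "pd j f x = pd j g x"
proof -
  have "isCont (\<lambda>t. x + t *\<^sub>R axis j (1::real)) 0" by (intro continuous_intros)
  then have "\<forall>\<^sub>F t in nhds 0. x + t *\<^sub>R axis j 1 \<in> U"
    using assms(1,2) unfolding isCont_def tendsto_def eventually_at_filter
    by (elim allE[of _ U]) (auto elim: eventually_mono)
  then have "\<forall>\<^sub>F t in nhds 0. t \<in> UNIV \<longrightarrow> f (x + t *\<^sub>R axis j 1) = g (x + t *\<^sub>R axis j 1)"
    by (rule eventually_mono) (use assms in auto)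
  then show ?thesis unfolding pd_def by (rule vector_derivative_cong_eq) auto
qed

lemma iterpd_cong_open:
  assumes "open U" "x \<in> U" "\<And>y. y \<in> U \<Longrightarrow> f y = g y"
  shows "iterpd js f x = iterpd js g x"
  using assms(2)
proof (induction js arbitrary: x)
  case (Cons j js)
  show ?case using pd_cong_open[OF assms(1) Cons(2), of "iterpd js f" "iterpd js g" j] Cons by simp
qed (use assms in auto)

subsection \<open>Affine substitutions\<close>

text \<open>The chain-rule factor that a word of partial derivatives picks up under x -> x * a. Read
  as a function of a, it is a monomial of degree \<open>length js\<close>.\<close>

definition cw :: "'n::finite list \<Rightarrow> real^'n \<Rightarrow> complex" where
  "cw js a = prod_list (map (\<lambda>j. complex_of_real (a $ j)) js)"

lemma cw_simps [simp]: "cw [] a = 1" "cw (j # js) a = complex_of_real (a $ j) * cw js a"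
  by (auto simp: cw_def)

lemma cont_cw: "continuous_on S (cw js)"
  by (induction js) (auto intro!: continuous_intros simp: cw_def)

lemma hpd_affine:
  fixes a b :: "real^'n::finite"
  assumes "\<And>y. hpd j f (d y) y"
  shows "hpd j (\<lambda>x. f (x * a + b)) (complex_of_real (a $ j) * d (x * a + b)) x"
proof -
  have eq: "(x + t *\<^sub>R axis j 1) * a + b = (x * a + b) + (a $ j * t) *\<^sub>R axis j 1" for t
    by (auto simp: vec_eq_iff axis_def algebra_simps)
  have "((\<lambda>t. f ((x * a + b) + t *\<^sub>R axis j 1)) has_vector_derivative d (x * a + b)) (at (a $ j * 0))"
    using assms[of "x * a + b"] by (simp add: hpd_def)
  moreover have "((\<lambda>t. a $ j * t) has_vector_derivative a $ j) (at 0)"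
    by (auto intro!: derivative_eq_intros)
  ultimately have "((\<lambda>t. f ((x * a + b) + t *\<^sub>R axis j 1)) \<circ> (\<lambda>t. a $ j * t) has_vector_derivative a $ j *\<^sub>R d (x * a + b)) (at 0)"
    by (intro vector_diff_chain_at)
  then show ?thesis unfolding hpd_def eq o_def by (simp add: scaleR_conv_of_real[of _ "_ :: complex"])
qed

lemma vec_mult_cont [continuous_intros]:
  fixes f g :: "'a::topological_space \<Rightarrow> real^'n::finite"
  shows "continuous_on S f \<Longrightarrow> continuous_on S g \<Longrightarrow> continuous_on S (\<lambda>x. f x * g x)"
  unfolding times_vec_def by (intro continuous_intros)

lemma smooth_affine:
  fixes a b :: "real^'n::finite"
  assumes "smooth_fn f" shows "smooth_fn (\<lambda>x. f (x * a + b))"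
proof (rule smooth_coinduct[where P = "{(\<lambda>x. c * f (x * a + b)) | c f. smooth_fn f}"])
  show "(\<lambda>x. f (x * a + b)) \<in> {(\<lambda>x. c * f (x * a + b)) | c f. smooth_fn f}"
    using assms by (auto intro!: exI[of _ 1] exI[of _ f])
next
  fix h :: "real^'n \<Rightarrow> complex" and j
  assume "h \<in> {(\<lambda>x. c * f (x * a + b)) | c f. smooth_fn f}"
  then obtain c f where h: "h = (\<lambda>x. c * f (x * a + b))" "smooth_fn f" by auto
  show "continuous_on UNIV h" unfolding h
    by (intro continuous_intros continuous_on_compose2[OF smooth_cont[OF h(2), of UNIV]]) auto
  have "hpd j (\<lambda>x. c * f (x * a + b) + 0) (c * (complex_of_real (a $ j) * pd j f (x * a + b)) + 0) x" for x
    by (intro hpd_linear hpd_affine hpd_const smooth_hpd h)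
  then have "hpd j h ((c * complex_of_real (a $ j)) * pd j f (x * a + b)) x" for x
    by (simp add: h mult.assoc)
  then show "\<exists>g\<in>{(\<lambda>x. c * f (x * a + b)) | c f. smooth_fn f}. \<forall>x. hpd j h (g x) x"
    using smooth_pd[OF h(2)]
    by (intro bexI[of _ "\<lambda>x. (c * complex_of_real (a $ j)) * pd j f (x * a + b)"]) auto
qed

lemma pd_affine: "smooth_fn f \<Longrightarrow> pd j (\<lambda>x. f (x * a + b)) = (\<lambda>x. complex_of_real (a $ j) * pd j f (x * a + b))"
  by (rule ext) (intro hpd_pd hpd_affine smooth_hpd)

lemma iterpd_affine: "smooth_fn f \<Longrightarrow> iterpd js (\<lambda>x. f (x * a + b)) = (\<lambda>x. cw js a * iterpd js f (x * a + b))"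
proof (induction js)
  case (Cons j js)
  then show ?case
    by (simp add: pd_cmult smooth_affine smooth_iterpd pd_affine mult_ac)
qed auto

lemma smooth_dil: "smooth_fn f \<Longrightarrow> smooth_fn (\<lambda>x. f (x * a))"
  using smooth_affine[of f a 0] by simp

lemma iterpd_dil: "smooth_fn f \<Longrightarrow> iterpd js (\<lambda>x. f (x * a)) = (\<lambda>x. cw js a * iterpd js f (x * a))"
  using iterpd_affine[of f js a 0] by simp

subsection \<open>Test functions\<close>

text \<open>Compact support is handled throughout as a radius beyond which the function vanishes.
  For the zero function R may be negative, whence the later \<open>max R0 0\<close>.\<close>

lemma test_fn_iff: "test_fn f \<longleftrightarrow> smooth_fn f \<and> (\<exists>R. \<forall>x. norm x > R \<longrightarrow> f x = 0)"
proof -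
  have "compact (tsupp f) \<longleftrightarrow> (\<exists>R. \<forall>x. norm x > R \<longrightarrow> f x = 0)"
  proof
    assume "compact (tsupp f)"
    then obtain R where R: "\<And>x. x \<in> tsupp f \<Longrightarrow> norm x \<le> R"
      using compact_imp_bounded bounded_iff by metis
    have "f x = 0" if "norm x > R" for x
      using R[of x] that closure_subset[of "{x. f x \<noteq> 0}"] unfolding tsupp_def by fastforce
    then show "\<exists>R. \<forall>x. norm x > R \<longrightarrow> f x = 0" by blast
  next
    assume "\<exists>R. \<forall>x. norm x > R \<longrightarrow> f x = 0"
    then obtain R where R: "\<And>x. norm x > R \<Longrightarrow> f x = 0" by auto
    have "tsupp f \<subseteq> cball 0 R" unfolding tsupp_def
      by (rule closure_minimal) (use R in \<open>force simp: not_less[symmetric]\<close>)+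
    then show "compact (tsupp f)"
      by (metis bounded_cball bounded_subset closed_closure compact_eq_bounded_closed tsupp_def)
  qed
  then show ?thesis by (simp add: test_fn_def)
qed

lemma test_smooth: "test_fn f \<Longrightarrow> smooth_fn f" by (simp add: test_fn_def)

lemma test_zero [simp]: "test_fn (\<lambda>x. 0)" by (simp add: test_fn_iff)

lemma iterpd_zero_outside:
  assumes "closed K" "\<And>x. x \<notin> K \<Longrightarrow> f x = 0" "x \<notin> K"
  shows "iterpd js f x = 0"
  using iterpd_cong_open[of "- K" x f "\<lambda>x. 0" js] assms by auto

lemma iterpd_zero_norm:
  assumes "\<And>x. norm x > R \<Longrightarrow> f x = 0" "norm x > R"
  shows "iterpd js f x = 0"
  by (rule iterpd_zero_outside[where K = "cball 0 R"]) (use assms in auto)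

lemma test_iterpd: "test_fn f \<Longrightarrow> test_fn (iterpd js f)"
  unfolding test_fn_iff using smooth_iterpd iterpd_zero_norm by metis

lemma test_pd: "test_fn f \<Longrightarrow> test_fn (pd j f)"
  using test_iterpd[of f "[j]"] by simp

lemma test_mult: "test_fn f \<Longrightarrow> smooth_fn g \<Longrightarrow> test_fn (\<lambda>x. f x * g x)"
  unfolding test_fn_iff using smooth_mult by (metis mult_zero_left)

lemma test_mult2: "smooth_fn f \<Longrightarrow> test_fn g \<Longrightarrow> test_fn (\<lambda>x. f x * g x)"
  using test_mult[of g f] by (simp add: mult.commute)

lemma test_linear:
  assumes "test_fn f" "test_fn g" shows "test_fn (\<lambda>x. a * f x + g x)"
proof -
  obtain R R' where "\<forall>x. norm x > R \<longrightarrow> f x = 0" "\<forall>x. norm x > R' \<longrightarrow> g x = 0"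
    using assms unfolding test_fn_iff by auto
  then have "\<forall>x. norm x > max R R' \<longrightarrow> a * f x + g x = 0" by auto
  then show ?thesis using assms unfolding test_fn_iff by (blast intro: smooth_linear)
qed

lemma test_add: "test_fn f \<Longrightarrow> test_fn g \<Longrightarrow> test_fn (\<lambda>x. f x + g x)"
  using test_linear[of f g 1] by simp

lemma test_cmult: "test_fn f \<Longrightarrow> test_fn (\<lambda>x. a * f x)"
  using test_linear[of f "\<lambda>x. 0" a] by simp

lemma test_diff: "test_fn f \<Longrightarrow> test_fn g \<Longrightarrow> test_fn (\<lambda>x. f x - g x)"
  using test_linear[of g f "-1"] by simp

lemma test_sum: "(\<And>i. i \<in> I \<Longrightarrow> test_fn (f i)) \<Longrightarrow> test_fn (\<lambda>x. \<Sum>i\<in>I. f i x)"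
  by (induction I rule: infinite_finite_induct) (auto intro: test_add)

lemma test_affine:
  fixes a b :: "real^'n::finite"
  assumes "test_fn f" "\<And>j. a $ j \<noteq> 0" shows "test_fn (\<lambda>x. f (x * a + b))"
proof -
  obtain R where R: "\<And>x. norm x > R \<Longrightarrow> f x = 0" using assms unfolding test_fn_iff by auto
  define m where "m = (\<Sum>j\<in>UNIV. inverse \<bar>a $ j\<bar>)"
  have m: "inverse \<bar>a $ j\<bar> \<le> m" for j unfolding m_def
    by (rule member_le_sum) auto
  have m0: "0 \<le> m" unfolding m_def by (auto intro!: sum_nonneg)
  have "f (x * a + b) = 0" if x: "norm x > (\<Sum>j\<in>(UNIV::'n set). m * (\<bar>R\<bar> + norm b))" for x
  proof (rule ccontr)
    assume "f (x * a + b) \<noteq> 0"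
    then have "norm (x * a + b) \<le> R" using R by force
    have "\<bar>x $ j\<bar> \<le> m * (\<bar>R\<bar> + norm b)" for j
    proof -
      have "\<bar>(x * a + b) $ j\<bar> \<le> \<bar>R\<bar>" using component_le_norm_cart[of "x * a + b" j] \<open>norm _ \<le> R\<close> by linarith
      then have "\<bar>x $ j * a $ j\<bar> \<le> \<bar>R\<bar> + norm b" using component_le_norm_cart[of b j] by simp
      then have "\<bar>x $ j\<bar> * \<bar>a $ j\<bar> * inverse \<bar>a $ j\<bar> \<le> (\<bar>R\<bar> + norm b) * inverse \<bar>a $ j\<bar>"
        by (intro mult_right_mono) (auto simp: abs_mult)
      then have "\<bar>x $ j\<bar> \<le> (\<bar>R\<bar> + norm b) * inverse \<bar>a $ j\<bar>" using assms(2)[of j] by (simp add: mult.assoc)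
      also have "\<dots> \<le> (\<bar>R\<bar> + norm b) * m" using m by (intro mult_left_mono) auto
      finally show ?thesis by (simp add: mult.commute)
    qed
    then have "norm x \<le> (\<Sum>j\<in>(UNIV::'n set). m * (\<bar>R\<bar> + norm b))"
      by (intro order_trans[OF norm_le_l1_cart] sum_mono)
    then show False using x by linarith
  qed
  then show ?thesis unfolding test_fn_iff using smooth_affine assms unfolding test_fn_iff by blast
qed

lemma test_dil: "test_fn f \<Longrightarrow> (\<And>j. a $ j \<noteq> 0) \<Longrightarrow> test_fn (\<lambda>x. f (x * a))"
  using test_affine[of f a 0] by simp

lemma test_bounded:
  assumes "test_fn f" shows "\<exists>C>0. \<forall>x. norm (iterpd js f x) \<le> C"
proof -
  obtain R where R: "\<And>x. norm x > R \<Longrightarrow> f x = 0" using assms unfolding test_fn_iff by auto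
  have "compact (iterpd js f ` cball 0 R)"
    by (intro compact_continuous_image smooth_cont smooth_iterpd test_smooth assms) auto
  then obtain C where C: "C > 0" "\<forall>y\<in>iterpd js f ` cball 0 R. norm y \<le> C"
    using compact_imp_bounded bounded_pos by blast
  have "norm (iterpd js f x) \<le> C" for x
    using C iterpd_zero_norm[of R f x js] R by (cases "norm x \<le> R") auto
  then show ?thesis using C by blast
qed

lemma test_uniform_cont:
  assumes "test_fn f" shows "uniformly_continuous_on UNIV f"
proof -
  obtain R where R: "\<And>x. norm x > R \<Longrightarrow> f x = 0" using assms unfolding test_fn_iff by auto
  \<comment> \<open>The margin 1 matches the bound d <= 1 below: two points closer than 1 either
    both lie in the larger ball or both lie outside the support.\<close>
  have "uniformly_continuous_on (cball 0 (R + 1)) f"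
    by (intro compact_uniformly_continuous smooth_cont test_smooth assms) auto
  then have *: "\<exists>d>0. \<forall>x\<in>cball 0 (R+1). \<forall>y\<in>cball 0 (R+1). dist y x < d \<longrightarrow> dist (f y) (f x) < e" if "e > 0" for e
    using that unfolding uniformly_continuous_on_def by blast
  show ?thesis unfolding uniformly_continuous_on_def
  proof (intro allI impI)
    fix e :: real assume e: "e > 0"
    obtain d where d: "d > 0" "\<forall>x\<in>cball 0 (R+1). \<forall>y\<in>cball 0 (R+1). dist y x < d \<longrightarrow> dist (f y) (f x) < e"
      using *[OF e] by blast
    show "\<exists>d>0. \<forall>x\<in>UNIV. \<forall>y\<in>UNIV. dist y x < d \<longrightarrow> dist (f y) (f x) < e"
    proof (intro exI[of _ "min d 1"] conjI ballI impI)
      fix x y :: "real^'a" assume "dist y x < min d 1"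
      then have xy: "dist y x < d" "dist y x < 1" by auto
      then have n: "norm y \<le> norm x + 1" "norm x \<le> norm y + 1"
        using norm_triangle_ineq2[of x y] norm_triangle_ineq2[of y x]
        by (auto simp: dist_norm norm_minus_commute)
      show "dist (f y) (f x) < e"
      proof (cases "norm x \<le> R + 1 \<and> norm y \<le> R + 1")
        case True
        then show ?thesis using d xy by auto
      next
        case False
        then have "f x = 0" "f y = 0" using R n by force+
        then show ?thesis using e by simp
      qed
    qed (use d in auto)
  qed
qed

lemma D_conv_iff: "D_conv fs f \<longleftrightarrow> (\<forall>n. test_fn (fs n)) \<and> test_fn f \<and>
   (\<exists>R. \<forall>n x. norm x > R \<longrightarrow> fs n x = 0) \<and>
   (\<forall>js. \<forall>e>0. \<exists>N. \<forall>n\<ge>N. \<forall>x. norm (iterpd js (fs n) x - iterpd js f x) < e)"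
proof -
  have "(\<exists>K. compact K \<and> (\<forall>n. tsupp (fs n) \<subseteq> K)) \<longleftrightarrow> (\<exists>R. \<forall>n x. norm x > R \<longrightarrow> fs n x = 0)" (is "?A \<longleftrightarrow> ?B")
  proof
    assume ?A
    then obtain K where K: "compact K" "\<And>n. tsupp (fs n) \<subseteq> K" by auto
    then obtain R where R: "\<And>x. x \<in> K \<Longrightarrow> norm x \<le> R" using compact_imp_bounded bounded_iff by metis
    have "fs n x = 0" if "norm x > R" for n x
    proof (rule ccontr)
      assume "fs n x \<noteq> 0"
      then have "x \<in> tsupp (fs n)" unfolding tsupp_def using closure_subset[of "{x. fs n x \<noteq> 0}"] by auto
      then show False using K(2)[of n] R[of x] that by auto
    qed
    then show ?B by blast
  next
    assume ?B
    then obtain R where R: "\<And>n x. norm x > R \<Longrightarrow> fs n x = 0" by auto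
    have "tsupp (fs n) \<subseteq> cball 0 R" for n unfolding tsupp_def
      by (rule closure_minimal) (use R in \<open>force simp: not_less[symmetric]\<close>)+
    then show ?A by (intro exI[of _ "cball 0 R"]) auto
  qed
  then show ?thesis
    unfolding D_conv_def uniform_limit_iff eventually_sequentially dist_norm by auto
qed

lemma tsupp_zero: "x \<notin> tsupp f \<Longrightarrow> f x = 0"
  unfolding tsupp_def using closure_subset[of "{x. f x \<noteq> 0}"] by auto

lemma tsupp_subset: "closed K \<Longrightarrow> (\<And>x. x \<notin> K \<Longrightarrow> f x = 0) \<Longrightarrow> tsupp f \<subseteq> K"
  unfolding tsupp_def by (rule closure_minimal) auto

subsection \<open>Cut-off functions\<close>

text \<open>A product of one-dimensional plateaus: 1 on the closed box of half-width r about c, and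
  0 as soon as one coordinate is off by 2 r or more. The arguments have the shape a * t + b of
  \<open>smooth1_affine\<close>.\<close>

definition boxcut :: "real^'n::finite \<Rightarrow> real \<Rightarrow> real^'n \<Rightarrow> complex" where
  "boxcut c r x = (\<Prod>j\<in>UNIV. complex_of_real (step1 ((1/r) * (x $ j) + (2 - c $ j / r))) *
      complex_of_real (step1 ((-1/r) * (x $ j) + (2 + c $ j / r))))"

text \<open>The cut-off at the coordinate hyperplanes: 0 when some coordinate has modulus at most r,
  1 when all have modulus at least 2 r. In each coordinate at most one of the two steps is
  non-zero.\<close>

definition planecut :: "real \<Rightarrow> real^'n::finite \<Rightarrow> complex" where
  "planecut r x = (\<Prod>j\<in>UNIV. complex_of_real (step1 ((1/r) * (x $ j) + (- 1))) +
      complex_of_real (step1 ((-1/r) * (x $ j) + (- 1))))"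

lemma smooth_boxcut: "smooth_fn (boxcut c r)"
  unfolding boxcut_def[abs_def]
  by (intro smooth_prod smooth_mult smooth_coord smooth1_affine smooth1_step)

lemma smooth_planecut: "smooth_fn (planecut r)"
  unfolding planecut_def[abs_def]
  by (intro smooth_prod smooth_add smooth_coord smooth1_affine smooth1_step)

lemma boxcut_1: "r > 0 \<Longrightarrow> (\<And>j. \<bar>x $ j - c $ j\<bar> \<le> r) \<Longrightarrow> boxcut c r x = 1"
  unfolding boxcut_def
proof (intro prod.neutral ballI)
  fix j assume "r > 0" "\<And>j. \<bar>x $ j - c $ j\<bar> \<le> r"
  then have "\<bar>x $ j - c $ j\<bar> / r \<le> 1" by simp
  then have "\<bar>(x $ j - c $ j) / r\<bar> \<le> 1" using \<open>r > 0\<close> by simp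
  then have "(1/r) * (x $ j) + (2 - c $ j / r) \<ge> 1" "(-1/r) * (x $ j) + (2 + c $ j / r) \<ge> 1"
    by (auto simp: diff_divide_distrib)
  then show "complex_of_real (step1 ((1/r) * (x $ j) + (2 - c $ j / r))) *
      complex_of_real (step1 ((-1/r) * (x $ j) + (2 + c $ j / r))) = 1"
    by (simp add: step1_simps)
qed

lemma boxcut_0: assumes "r > 0" "2 * r \<le> \<bar>x $ j - c $ j\<bar>" shows "boxcut c r x = 0"
proof -
  have "2 \<le> \<bar>x $ j - c $ j\<bar> / r" using assms by (simp add: le_divide_eq)
  then have "2 \<le> \<bar>(x $ j - c $ j) / r\<bar>" using assms by simp
  then have "(1/r) * (x $ j) + (2 - c $ j / r) \<le> 0 \<or> (-1/r) * (x $ j) + (2 + c $ j / r) \<le> 0"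
    by (auto simp: diff_divide_distrib)
  then show ?thesis unfolding boxcut_def
    by (intro prod_zero bexI[of _ j]) (auto simp: step1_simps)
qed

lemma boxcut_real: "\<exists>t. boxcut c r x = complex_of_real t \<and> 0 \<le> t \<and> t \<le> 1"
  unfolding boxcut_def
  by (rule exI[of _ "\<Prod>j\<in>UNIV. step1 ((1/r) * (x $ j) + (2 - c $ j / r)) * step1 ((-1/r) * (x $ j) + (2 + c $ j / r))"])
    (auto intro!: prod_nonneg prod_le_1 mult_nonneg_nonneg mult_le_one simp: step1_simps)

lemma test_boxcut: assumes "r > 0" shows "test_fn (boxcut c r)"
proof -
  have "boxcut c r x = 0" if "norm x > (\<Sum>j\<in>(UNIV::'a set). 2 * r + \<bar>c $ j\<bar>)" for x
  proof (rule ccontr)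
    assume "boxcut c r x \<noteq> 0"
    then have "\<bar>x $ j - c $ j\<bar> < 2 * r" for j using boxcut_0[OF assms] by (meson not_less)
    then have "\<bar>x $ j\<bar> \<le> 2 * r + \<bar>c $ j\<bar>" for j
      using abs_triangle_ineq2[of "x $ j" "c $ j"] by (meson add_mono_thms_linordered_semiring(3) diff_le_eq le_less_trans less_imp_le)
    then have "norm x \<le> (\<Sum>j\<in>(UNIV::'a set). 2 * r + \<bar>c $ j\<bar>)"
      by (intro order_trans[OF norm_le_l1_cart] sum_mono)
    then show False using that by linarith
  qed
  then show ?thesis unfolding test_fn_iff using smooth_boxcut by blast
qed

lemma planecut_1: "r > 0 \<Longrightarrow> (\<And>j. 2 * r \<le> \<bar>x $ j\<bar>) \<Longrightarrow> planecut r x = 1"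
  unfolding planecut_def
proof (intro prod.neutral ballI)
  fix j assume r: "r > 0" "\<And>j. 2 * r \<le> \<bar>x $ j\<bar>"
  then have "2 \<le> \<bar>x $ j\<bar> / r" by (simp add: le_divide_eq)
  then have "2 \<le> \<bar>x $ j / r\<bar>" using \<open>r > 0\<close> by simp
  then have "(1/r) * (x $ j) + (- 1) \<ge> 1 \<and> (-1/r) * (x $ j) + (- 1) \<le> 0 \<or>
      (1/r) * (x $ j) + (- 1) \<le> 0 \<and> (-1/r) * (x $ j) + (- 1) \<ge> 1" by auto
  then show "complex_of_real (step1 ((1/r) * (x $ j) + (- 1))) +
      complex_of_real (step1 ((-1/r) * (x $ j) + (- 1))) = 1"
    by (auto simp: step1_simps)
qed

lemma planecut_0: assumes "r > 0" "\<bar>x $ j\<bar> \<le> r" shows "planecut r x = 0"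
proof -
  have "\<bar>x $ j\<bar> / r \<le> 1" using assms by simp
  then have "\<bar>x $ j / r\<bar> \<le> 1" using assms by simp
  then have "(1/r) * (x $ j) + (- 1) \<le> 0 \<and> (-1/r) * (x $ j) + (- 1) \<le> 0" by (auto simp: abs_le_iff simp del: abs_divide)
  then show ?thesis unfolding planecut_def
    by (intro prod_zero bexI[of _ j]) (auto simp: step1_simps)
qed


subsection \<open>Continuous linear operations on test functions and distributions\<close>

text \<open>The continuous linear operators on test functions, that is, those along which
  distributions can be transposed.\<close>

definition dop :: "((real^'n::finite \<Rightarrow> complex) \<Rightarrow> (real^'n \<Rightarrow> complex)) \<Rightarrow> bool" where
  "dop M \<longleftrightarrow> (\<forall>f. test_fn f \<longrightarrow> test_fn (M f)) \<and>
     (\<forall>a f g. test_fn f \<and> test_fn g \<longrightarrow> M (\<lambda>x. a * f x + g x) = (\<lambda>x. a * M f x + M g x)) \<and>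
     (\<forall>fs f. D_conv fs f \<longrightarrow> D_conv (\<lambda>n. M (fs n)) (M f))"

text \<open>Imposes the convention that distributions vanish on functions that are not test
  functions, so that identities between transposed distributions become plain equalities.\<close>

definition ddist :: "((real^'n::finite \<Rightarrow> complex) \<Rightarrow> complex) \<Rightarrow> (real^'n \<Rightarrow> complex) \<Rightarrow> complex" where
  "ddist u f = (if test_fn f then u f else 0)"

lemma ddist_test [simp]: "test_fn f \<Longrightarrow> ddist u f = u f"
  by (simp add: ddist_def)

lemma distr_nontest: "is_distr T \<Longrightarrow> \<not> test_fn f \<Longrightarrow> T f = 0"
  by (auto simp: is_distr_def)

lemma distr_linear: "is_distr T \<Longrightarrow> test_fn f \<Longrightarrow> test_fn g \<Longrightarrow> T (\<lambda>x. a * f x + g x) = a * T f + T g"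
  by (auto simp: is_distr_def)

lemma distr_conv: "is_distr T \<Longrightarrow> D_conv fs f \<Longrightarrow> (\<lambda>n. T (fs n)) \<longlonglongrightarrow> T f"
  by (auto simp: is_distr_def)

lemma distr_zero: "is_distr T \<Longrightarrow> T (\<lambda>x. 0) = 0"
  using distr_linear[of T "\<lambda>x. 0" "\<lambda>x. 0" 1] by simp

lemma distr_cmult: "is_distr T \<Longrightarrow> test_fn f \<Longrightarrow> T (\<lambda>x. a * f x) = a * T f"
  using distr_linear[of T f "\<lambda>x. 0" a] by (simp add: distr_zero)

lemma distr_add: "is_distr T \<Longrightarrow> test_fn f \<Longrightarrow> test_fn g \<Longrightarrow> T (\<lambda>x. f x + g x) = T f + T g"
  using distr_linear[of T f g 1] by simp

lemma distr_diff: "is_distr T \<Longrightarrow> test_fn f \<Longrightarrow> test_fn g \<Longrightarrow> T (\<lambda>x. f x - g x) = T f - T g"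
  using distr_linear[of T g f "-1"] by simp

lemma distr_sum:
  assumes T: "is_distr T" and "finite I" "\<And>i. i \<in> I \<Longrightarrow> test_fn (f i)"
  shows "T (\<lambda>x. \<Sum>i\<in>I. a i * f i x) = (\<Sum>i\<in>I. a i * T (f i))"
  using assms(2,3)
proof (induction I rule: finite_induct)
  case (insert i I)
  have "test_fn (\<lambda>x. \<Sum>i\<in>I. a i * f i x)" using insert by (intro test_sum test_cmult) auto
  then show ?case using insert by (simp add: distr_linear[OF T])
qed (simp add: distr_zero[OF T])

lemma D_convD:
  assumes "D_conv fs f"
  shows "test_fn (fs n)" "test_fn f" "\<exists>R. \<forall>n x. norm x > R \<longrightarrow> fs n x = 0"
    "e > 0 \<Longrightarrow> \<exists>N. \<forall>n\<ge>N. \<forall>x. norm (iterpd js (fs n) x - iterpd js f x) < e"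
  using assms unfolding D_conv_iff by auto

lemma D_conv_limit:
  assumes "D_conv fs f" shows "(\<lambda>n. iterpd js (fs n) x) \<longlonglongrightarrow> iterpd js f x"
  unfolding LIMSEQ_iff using D_convD(4)[OF assms] by metis

lemma D_conv_support:
  assumes "D_conv fs f" "\<And>n x. norm x > R \<Longrightarrow> fs n x = 0" "norm x > R"
  shows "f x = 0"
  using D_conv_limit[OF assms(1), of "[]" x] assms by (simp add: LIMSEQ_const_iff)

lemma D_conv_radius:
  assumes "D_conv fs f"
  shows "\<exists>R>0. (\<forall>n x. norm x > R \<longrightarrow> fs n x = 0) \<and> (\<forall>x. norm x > R \<longrightarrow> f x = 0)"
proof -
  obtain R where R: "\<And>n x. norm x > R \<Longrightarrow> fs n x = 0" using D_convD(3)[OF assms] by auto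
  then show ?thesis
    using D_conv_support[OF assms, of "max R 1"] by (intro exI[of _ "max R 1"]) auto
qed

lemma distr_ddist:
  fixes T :: "(real^'n::finite \<Rightarrow> complex) \<Rightarrow> complex"
  assumes "is_distr T" "dop M" shows "is_distr (ddist (\<lambda>f. T (M f)))"
  unfolding is_distr_def
proof (intro conjI allI impI)
  fix fs and f :: "real^'n \<Rightarrow> complex" assume c: "D_conv fs f"
  have "(\<lambda>n. T (M (fs n))) \<longlonglongrightarrow> T (M f)"
    by (rule distr_conv) (use assms c in \<open>auto simp: dop_def\<close>)
  then show "(\<lambda>n. ddist (\<lambda>f. T (M f)) (fs n)) \<longlonglongrightarrow> ddist (\<lambda>f. T (M f)) f"
    using D_convD(1,2)[OF c] by simp
qed (use assms in \<open>auto simp: dop_def ddist_def distr_linear test_linear\<close>)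

lemma dop_comp: "dop M \<Longrightarrow> dop N \<Longrightarrow> dop (\<lambda>f. M (N f))"
  unfolding dop_def by auto

lemma dop_pd: "dop (pd j)"
  unfolding dop_def
proof (intro conjI allI impI)
  fix fs :: "nat \<Rightarrow> real^'a \<Rightarrow> complex" and f assume c: "D_conv fs f"
  obtain R where R: "\<And>n x. norm x > R \<Longrightarrow> fs n x = 0" using D_convD(3)[OF c] by auto
  then have "\<forall>n x. norm x > R \<longrightarrow> pd j (fs n) x = 0"
    using iterpd_zero_norm[of R _ _ "[j]"] by auto
  then show "D_conv (\<lambda>n. pd j (fs n)) (pd j f)"
    using c unfolding D_conv_iff by (auto intro: test_pd simp flip: iterpd_snoc)
qed (auto intro: test_pd pd_linear test_smooth)

lemma dopD:
  assumes "dop M"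
  shows "test_fn f \<Longrightarrow> test_fn (M f)"
    "test_fn f \<Longrightarrow> test_fn g \<Longrightarrow> M (\<lambda>x. a * f x + g x) = (\<lambda>x. a * M f x + M g x)"
    "D_conv fs f \<Longrightarrow> D_conv (\<lambda>n. M (fs n)) (M f)"
  using assms unfolding dop_def by auto

lemma dop_linear:
  fixes M N :: "(real^'n::finite \<Rightarrow> complex) \<Rightarrow> (real^'n \<Rightarrow> complex)"
  assumes MN: "dop M" "dop N" shows "dop (\<lambda>f x. a * M f x + N f x)"
  unfolding dop_def
proof (intro conjI allI impI)
  fix fs :: "nat \<Rightarrow> real^'n \<Rightarrow> complex" and f
  assume c: "D_conv fs f"
  then have M: "D_conv (\<lambda>n. M (fs n)) (M f)" and N: "D_conv (\<lambda>n. N (fs n)) (N f)" using MN by (auto dest: dopD(3))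
  obtain R R' where R: "\<And>n x. norm x > R \<Longrightarrow> M (fs n) x = 0" "\<And>n x. norm x > R' \<Longrightarrow> N (fs n) x = 0"
    using D_convD(3)[OF M] D_convD(3)[OF N] by auto
  note t = D_convD(1,2)[OF M] D_convD(1,2)[OF N]
  show "D_conv (\<lambda>n x. a * M (fs n) x + N (fs n) x) (\<lambda>x. a * M f x + N f x)"
    unfolding D_conv_iff
  proof (intro conjI allI impI)
    show "\<exists>R. \<forall>n x. R < norm x \<longrightarrow> a * M (fs n) x + N (fs n) x = 0"
      by (rule exI[of _ "max R R'"]) (use R in auto)
    fix js and e :: real assume e: "e > 0"
    obtain N1 where N1: "\<forall>n\<ge>N1. \<forall>x. norm (iterpd js (M (fs n)) x - iterpd js (M f) x) < e / (2 * (norm a + 1))"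
      using D_convD(4)[OF M, of "e / (2 * (norm a + 1))" js] e by (auto simp: add_nonneg_pos)
    obtain N2 where N2: "\<forall>n\<ge>N2. \<forall>x. norm (iterpd js (N (fs n)) x - iterpd js (N f) x) < e / 2"
      using D_convD(4)[OF N, of "e / 2" js] e by auto
    show "\<exists>N'. \<forall>n\<ge>N'. \<forall>x. norm (iterpd js (\<lambda>x. a * M (fs n) x + N (fs n) x) x -
        iterpd js (\<lambda>x. a * M f x + N f x) x) < e"
    proof (intro exI[of _ "max N1 N2"] allI impI)
      fix n x assume n: "n \<ge> max N1 N2"
      let ?p = "iterpd js (M (fs n)) x - iterpd js (M f) x" and ?q = "iterpd js (N (fs n)) x - iterpd js (N f) x"
      have "norm (a * ?p + ?q) \<le> norm a * norm ?p + norm ?q"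
        by (metis norm_mult norm_triangle_ineq)
      also have "\<dots> < (norm a + 1) * (e / (2 * (norm a + 1))) + e / 2"
      proof (rule add_le_less_mono)
        show "norm a * norm ?p \<le> (norm a + 1) * (e / (2 * (norm a + 1)))"
          using N1[rule_format, of n x] n by (intro mult_mono) auto
        show "norm ?q < e / 2" using N2 n by auto
      qed
      also have "\<dots> = e" using add_nonneg_pos[of "norm a" 1] by (simp add: field_simps)
      finally show "norm (iterpd js (\<lambda>x. a * M (fs n) x + N (fs n) x) x -
          iterpd js (\<lambda>x. a * M f x + N f x) x) < e"
        unfolding iterpd_linear[OF t(1)[THEN test_smooth] t(3)[THEN test_smooth]]
          iterpd_linear[OF t(2)[THEN test_smooth] t(4)[THEN test_smooth]] by (simp add: algebra_simps)
    qed
  qed (use t in \<open>auto intro: test_linear\<close>)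
next
  fix f :: "real^'n \<Rightarrow> complex" assume "test_fn f"
  then show "test_fn (\<lambda>x. a * M f x + N f x)" by (intro test_linear dopD(1)[OF MN(1)] dopD(1)[OF MN(2)])
next
  fix b and f g :: "real^'n \<Rightarrow> complex" assume fg: "test_fn f \<and> test_fn g"
  show "(\<lambda>x. a * M (\<lambda>x. b * f x + g x) x + N (\<lambda>x. b * f x + g x) x) =
      (\<lambda>x. b * (a * M f x + N f x) + (a * M g x + N g x))"
    unfolding dopD(2)[OF MN(1) conjunct1[OF fg] conjunct2[OF fg]]
      dopD(2)[OF MN(2) conjunct1[OF fg] conjunct2[OF fg]] by (simp add: algebra_simps)
qed

lemma dop_id: "dop (\<lambda>f. f)" by (simp add: dop_def)

lemma dop_zero: "dop (\<lambda>f x. 0)" by (simp add: dop_def D_conv_iff)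

text \<open>The induction peels off the innermost derivative: \<open>pd j\<close> of a product is a
  sum of two products of the same kind, one with \<open>pd j g\<close> and one with the sequence
  \<open>pd j (fs n)\<close>, and the remaining word is shorter. At the empty word it suffices that
  g is bounded on the common support ball.\<close>

lemma uniform_mult:
  assumes g: "smooth_fn g" and "D_conv fs f"
  shows "e > 0 \<Longrightarrow> \<exists>N. \<forall>n\<ge>N. \<forall>x. norm (iterpd js (\<lambda>x. g x * fs n x) x - iterpd js (\<lambda>x. g x * f x) x) < e"
  using assms
proof (induction js arbitrary: g fs f e rule: rev_induct)
  case Nil
  obtain R where R: "\<And>n x. norm x > R \<Longrightarrow> fs n x = 0" "\<And>x. norm x > R \<Longrightarrow> f x = 0"
    using D_conv_radius[OF Nil(3)] by auto
  have "compact (g ` cball 0 R)"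
    by (intro compact_continuous_image smooth_cont Nil) auto
  then obtain C where C: "C > 0" "\<forall>y\<in>g ` cball 0 R. norm y \<le> C"
    using compact_imp_bounded bounded_pos by blast
  obtain N where N: "\<forall>n\<ge>N. \<forall>x. norm (fs n x - f x) < e / C"
    using D_convD(4)[OF Nil(3), of "e/C" "[]"] C Nil by auto
  have "norm (g x * fs n x - g x * f x) < e" if "n \<ge> N" for n x
  proof (cases "norm x \<le> R")
    case True
    have "norm (g x * fs n x - g x * f x) = norm (g x) * norm (fs n x - f x)"
      by (simp add: norm_mult flip: right_diff_distrib)
    also have "\<dots> \<le> C * norm (fs n x - f x)" using C True by (intro mult_right_mono) auto
    also have "\<dots> < C * (e / C)" using C N that by (intro mult_strict_left_mono) auto
    finally show ?thesis using C by simp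
  qed (use R \<open>e > 0\<close> in auto)
  then show ?case by auto
next
  case (snoc j js)
  obtain N1 where N1: "\<forall>n\<ge>N1. \<forall>x. norm (iterpd js (\<lambda>x. pd j g x * fs n x) x - iterpd js (\<lambda>x. pd j g x * f x) x) < e/2"
    using snoc.IH[of "e/2" "pd j g" fs f] snoc.prems by (auto intro: smooth_pd)
  have "D_conv (\<lambda>n. pd j (fs n)) (pd j f)" by (rule dopD(3)[OF dop_pd snoc.prems(3)])
  then obtain N2 where N2: "\<forall>n\<ge>N2. \<forall>x. norm (iterpd js (\<lambda>x. g x * pd j (fs n) x) x - iterpd js (\<lambda>x. g x * pd j f x) x) < e/2"
    using snoc.IH[of "e/2" g "\<lambda>n. pd j (fs n)" "pd j f"] snoc.prems by auto
  note t = D_convD(1,2)[OF snoc.prems(3), THEN test_smooth]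
  show ?case
  proof (intro exI[of _ "max N1 N2"] allI impI)
    fix n x assume n: "n \<ge> max N1 N2"
    have *: "iterpd js (pd j (\<lambda>x. g x * h x)) x = iterpd js (\<lambda>x. pd j g x * h x) x + iterpd js (\<lambda>x. g x * pd j h x) x"
      if "smooth_fn h" for h
      using that snoc.prems by (simp add: pd_mult iterpd_add smooth_mult smooth_pd)
    have "norm (iterpd js (\<lambda>x. pd j g x * fs n x) x - iterpd js (\<lambda>x. pd j g x * f x) x +
       (iterpd js (\<lambda>x. g x * pd j (fs n) x) x - iterpd js (\<lambda>x. g x * pd j f x) x)) < e/2 + e/2"
      using N1 N2 n by (intro le_less_trans[OF norm_triangle_ineq] add_strict_mono) auto
    then show "norm (iterpd (js @ [j]) (\<lambda>x. g x * fs n x) x - iterpd (js @ [j]) (\<lambda>x. g x * f x) x) < e"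
      unfolding iterpd_snoc *[OF t(1)] *[OF t(2)] by (simp add: algebra_simps)
  qed
qed

lemma dop_mult: assumes "smooth_fn g" shows "dop (\<lambda>f x. g x * f x)"
  unfolding dop_def
proof (intro conjI allI impI)
  fix fs :: "nat \<Rightarrow> real^'a \<Rightarrow> complex" and f assume c: "D_conv fs f"
  obtain R where R: "\<And>n x. norm x > R \<Longrightarrow> fs n x = 0" using D_convD(3)[OF c] by auto
  show "D_conv (\<lambda>n x. g x * fs n x) (\<lambda>x. g x * f x)"
    unfolding D_conv_iff
  proof (intro conjI allI impI)
    show "\<exists>R. \<forall>n x. R < norm x \<longrightarrow> g x * fs n x = 0" using R by (intro exI[of _ R]) auto
  qed (use uniform_mult[OF assms c] D_convD(1,2)[OF c] assms in \<open>auto intro: test_mult2\<close>)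
next
  fix f :: "real^'a \<Rightarrow> complex" assume "test_fn f"
  then show "test_fn (\<lambda>x. g x * f x)" by (rule test_mult2[OF assms])
qed (auto simp: algebra_simps)

lemma dop_affine:
  fixes a b :: "real^'n::finite"
  assumes a: "\<And>j. a $ j \<noteq> 0" shows "dop (\<lambda>f x. f (x * a + b))"
  unfolding dop_def
proof (intro conjI allI impI)
  fix fs :: "nat \<Rightarrow> real^'n \<Rightarrow> complex" and f assume c: "D_conv fs f"
  note t = D_convD(1,2)[OF c]
  obtain R where R0: "R > 0" "\<And>n x. norm x > R \<Longrightarrow> fs n x = 0" using D_conv_radius[OF c] by auto
  \<comment> \<open>A cut-off equal to 1 on the common support serves as a carrier: the support
    radius of its composition with the affine map bounds those of all \<open>fs n\<close> at
    once.\<close>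
  have "test_fn (boxcut 0 R)" using test_boxcut R0 by auto
  then have "test_fn (\<lambda>x. boxcut 0 R (x * a + b))" using a by (rule test_affine)
  then obtain S where S: "\<And>x. norm x > S \<Longrightarrow> boxcut 0 R (x * a + b) = 0" unfolding test_fn_iff by auto
  have "fs n (x * a + b) = 0" if "norm x > S" for n x
  proof (rule ccontr)
    assume "fs n (x * a + b) \<noteq> 0"
    then have "norm (x * a + b) \<le> R" using R0(2)[of "x * a + b" n] by fastforce
    then have "\<bar>(x * a + b) $ j\<bar> \<le> R" for j using component_le_norm_cart order_trans by blast
    then have "boxcut 0 R (x * a + b) = 1" using R0 by (intro boxcut_1) auto
    then show False using S[OF that] by simp
  qed
  then have S': "\<exists>R. \<forall>n x. R < norm x \<longrightarrow> fs n (x * a + b) = 0" by blast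
  show "D_conv (\<lambda>n x. fs n (x * a + b)) (\<lambda>x. f (x * a + b))"
    unfolding D_conv_iff
  proof (intro conjI allI impI S')
    fix js and e :: real assume e: "e > 0"
    have pos: "norm (cw js a) + 1 > 0" by (simp add: add_nonneg_pos)
    obtain N where N: "\<forall>n\<ge>N. \<forall>x. norm (iterpd js (fs n) x - iterpd js f x) < e / (norm (cw js a) + 1)"
      using D_convD(4)[OF c, of "e / (norm (cw js a) + 1)" js] e pos by auto
    have "norm (cw js a * iterpd js (fs n) (x * a + b) - cw js a * iterpd js f (x * a + b)) < e" if "n \<ge> N" for n x
    proof -
      have "norm (cw js a * iterpd js (fs n) (x * a + b) - cw js a * iterpd js f (x * a + b))
        = norm (cw js a) * norm (iterpd js (fs n) (x * a + b) - iterpd js f (x * a + b))"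
        by (simp add: norm_mult flip: right_diff_distrib)
      also have "\<dots> \<le> norm (cw js a) * (e / (norm (cw js a) + 1))"
        using N that by (intro mult_left_mono) (auto intro: less_imp_le)
      also have "\<dots> < e" using e pos by (simp add: field_simps)
      finally show ?thesis .
    qed
    then show "\<exists>N. \<forall>n\<ge>N. \<forall>x. norm (iterpd js (\<lambda>x. fs n (x * a + b)) x - iterpd js (\<lambda>x. f (x * a + b)) x) < e"
      using t by (auto simp: iterpd_affine test_smooth)
  qed (use t a in \<open>auto intro: test_affine\<close>)
qed (use a in \<open>auto intro: test_affine\<close>)

lemma dop_dil: "(\<And>j. a $ j \<noteq> 0) \<Longrightarrow> dop (\<lambda>f x. f (x * a))"
  using dop_affine[of a 0] by simp

lemma distr_delta: "is_distr (ddist (\<lambda>f. iterpd js f y))"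
  unfolding is_distr_def
proof (intro conjI allI impI)
  fix fs :: "nat \<Rightarrow> real^'a \<Rightarrow> complex" and f assume c: "D_conv fs f"
  show "(\<lambda>n. ddist (\<lambda>f. iterpd js f y) (fs n)) \<longlonglongrightarrow> ddist (\<lambda>f. iterpd js f y) f"
    using D_convD(1,2)[OF c] D_conv_limit[OF c] by simp
qed (auto simp: ddist_def iterpd_linear test_linear test_smooth)

definition delta :: "real^'n::finite \<Rightarrow> (real^'n \<Rightarrow> complex) \<Rightarrow> complex" where
  "delta y = ddist (\<lambda>f. f y)"

lemma is_distr_delta: "is_distr (delta y)"
  using distr_delta[of "[]" y] by (simp add: delta_def)

lemma is_distr_linear:
  assumes "is_distr S" "is_distr R" shows "is_distr (\<lambda>f. a * S f + R f)"
  using assms unfolding is_distr_def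
  by (auto simp: algebra_simps intro!: tendsto_add tendsto_mult)

lemma is_distr_zero: "is_distr (\<lambda>f. 0)" by (simp add: is_distr_def)

lemma is_distr_cmult: "is_distr S \<Longrightarrow> is_distr (\<lambda>f. a * S f)"
  using is_distr_linear[OF _ is_distr_zero, of S a] by simp

lemma integrable_mult_test:
  assumes h: "\<And>R. set_integrable lborel (cball 0 R) h" and f: "continuous_on UNIV f" "\<And>x. norm x > R \<Longrightarrow> f x = 0"
  shows "integrable lborel (\<lambda>x. h x * f x :: complex)"
proof -
  have "compact (f ` cball 0 R)"
    by (intro compact_continuous_image continuous_on_subset[OF f(1)]) auto
  then obtain C where C: "C > 0" "\<forall>y\<in>f ` cball 0 R. norm y \<le> C"
    using compact_imp_bounded bounded_pos by blast
  have m: "f \<in> borel_measurable lborel"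
    using borel_measurable_continuous_onI[OF f(1)] by simp
  have "integrable lborel (\<lambda>x. (indicator (cball 0 R) x *\<^sub>R h x) * f x)"
  proof (rule Bochner_Integration.integrable_bound)
    show "integrable lborel (\<lambda>x. C * norm (indicator (cball 0 R) x *\<^sub>R h x))"
      by (rule Bochner_Integration.integrable_mult_right, rule integrable_norm)
        (use h[of R] in \<open>simp add: set_integrable_def\<close>)
    show "(\<lambda>x. (indicator (cball 0 R) x *\<^sub>R h x) * f x) \<in> borel_measurable lborel"
      by (rule borel_measurable_times[OF _ m])
        (use h[of R] in \<open>auto simp: set_integrable_def intro: borel_measurable_integrable\<close>)
    show "AE x in lborel. norm (indicator (cball 0 R) x *\<^sub>R h x * f x) \<le> norm (C * norm (indicator (cball 0 R) x *\<^sub>R h x))"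
      using C by (intro AE_I2) (auto simp: indicator_def norm_mult mult.commute intro!: mult_right_mono)
  qed
  moreover have "(\<lambda>x. (indicator (cball 0 R) x *\<^sub>R h x) * f x) = (\<lambda>x. h x * f x)"
    using f(2) by (force simp: indicator_def)
  ultimately show ?thesis by simp
qed

lemma set_integrable_continuous_cball:
  "continuous_on UNIV h \<Longrightarrow> set_integrable lborel (cball 0 R) (h :: 'a::euclidean_space \<Rightarrow> complex)"
  unfolding set_integrable_def
  by (rule borel_integrable_compact) (auto intro: continuous_on_subset)

lemma regdist_distr:
  assumes h: "\<And>R. set_integrable lborel (cball 0 R) h"
  shows "is_distr (regdist h)"
  unfolding is_distr_def
proof (intro conjI allI impI)
  fix f :: "real^'a \<Rightarrow> complex" assume "\<not> test_fn f"
  then show "regdist h f = 0" by (simp add: regdist_def)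
next
  fix a and f g :: "real^'a \<Rightarrow> complex" assume t: "test_fn f \<and> test_fn g"
  have i: "integrable lborel (\<lambda>x. h x * f x)" if "test_fn f" for f
  proof -
    obtain R where "\<And>x. norm x > R \<Longrightarrow> f x = 0" using \<open>test_fn f\<close> unfolding test_fn_iff by auto
    then show ?thesis by (rule integrable_mult_test[OF h smooth_cont[OF test_smooth[OF that]]])
  qed
  have "(\<integral>x. h x * (a * f x + g x) \<partial>lborel) = (\<integral>x. a * (h x * f x) + h x * g x \<partial>lborel)"
    by (simp add: algebra_simps)
  also have "\<dots> = a * (\<integral>x. h x * f x \<partial>lborel) + (\<integral>x. h x * g x \<partial>lborel)"
    using i t by simp
  finally show "regdist h (\<lambda>x. a * f x + g x) = a * regdist h f + regdist h g"
    using t by (simp add: regdist_def test_linear)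
next
  fix fs :: "nat \<Rightarrow> real^'a \<Rightarrow> complex" and f assume c: "D_conv fs f"
  note t = D_convD(1,2)[OF c]
  obtain R where R: "\<And>n x. norm x > R \<Longrightarrow> fs n x = 0" "\<And>x. norm x > R \<Longrightarrow> f x = 0"
    using D_conv_radius[OF c] by auto
  \<comment> \<open>Only from N on are the functions dominated by B + 1; the sequence is shifted by
    N and \<open>LIMSEQ_offset\<close> undoes the shift.\<close>
  obtain N where N: "\<forall>n\<ge>N. \<forall>x. norm (fs n x - f x) < 1" using D_convD(4)[OF c, of 1 "[]"] by auto
  obtain B where B: "B > 0" "\<forall>x. norm (f x) \<le> B" using test_bounded[OF t(2), of "[]"] by auto
  have i: "integrable lborel (\<lambda>x. indicator (cball 0 R) x *\<^sub>R h x)"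
    using h[of R] by (simp add: set_integrable_def)
  have "(\<lambda>n. \<integral>x. h x * fs (n + N) x \<partial>lborel) \<longlonglongrightarrow> (\<integral>x. h x * f x \<partial>lborel)"
  proof (rule integral_dominated_convergence[where w = "\<lambda>x. (B + 1) * norm (indicator (cball 0 R) x *\<^sub>R h x)"])
    show "(\<lambda>x. h x * f x) \<in> borel_measurable lborel" "\<And>n. (\<lambda>x. h x * fs (n + N) x) \<in> borel_measurable lborel"
      using integrable_mult_test[OF h smooth_cont[OF test_smooth] R(2)]
        integrable_mult_test[OF h smooth_cont[OF test_smooth] R(1)] t
      by (auto intro!: borel_measurable_integrable)
    show "integrable lborel (\<lambda>x. (B + 1) * norm (indicator (cball 0 R) x *\<^sub>R h x))"
      by (intro Bochner_Integration.integrable_mult_right integrable_norm i)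
    show "AE x in lborel. (\<lambda>n. h x * fs (n + N) x) \<longlonglongrightarrow> h x * f x"
      using D_conv_limit[OF c, of "[]"] by (intro AE_I2 tendsto_mult tendsto_const LIMSEQ_ignore_initial_segment) auto
    show "AE x in lborel. norm (h x * fs (n + N) x) \<le> (B + 1) * norm (indicator (cball 0 R) x *\<^sub>R h x)" for n
    proof (rule AE_I2)
      fix x
      have "norm (fs (n + N) x) \<le> norm (f x) + norm (fs (n + N) x - f x)"
        using norm_triangle_ineq[of "f x" "fs (n+N) x - f x"] by simp
      also have "\<dots> \<le> B + 1" using B N by (intro add_mono) (auto intro: less_imp_le)
      finally have "norm (fs (n + N) x) \<le> B + 1" .
      then have "norm (h x) * norm (fs (n + N) x) \<le> norm (h x) * (B + 1)" by (intro mult_left_mono) auto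
      then show "norm (h x * fs (n + N) x) \<le> (B + 1) * norm (indicator (cball 0 R) x *\<^sub>R h x)"
        using R(1)[of x "n + N"] by (auto simp: indicator_def norm_mult mult.commute)
    qed
  qed
  then have "(\<lambda>n. \<integral>x. h x * fs n x \<partial>lborel) \<longlonglongrightarrow> (\<integral>x. h x * f x \<partial>lborel)"
    by (rule LIMSEQ_offset)
  then show "(\<lambda>n. regdist h (fs n)) \<longlonglongrightarrow> regdist h f"
    using t by (simp add: regdist_def)
qed

subsection \<open>Vanishing off the support\<close>

text \<open>In place of a partition of unity, f is multiplied by factors 1 - \<open>boxcut\<close>,
  one for each box of a finite cover of its support. Each factor changes f by a function living in a
  box on which T vanishes, and after the last one the product is identically 0.\<close>

lemma dsupp_vanish:
  fixes f :: "real^'n::finite \<Rightarrow> complex"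
  assumes T: "is_distr T" and f: "test_fn f" and U: "open U" "dsupp T \<subseteq> U" "\<And>x. x \<in> U \<Longrightarrow> f x = 0"
  shows "T f = 0"
proof -
  define K where "K = tsupp f"
  have K: "compact K" using f by (simp add: K_def test_fn_def)
  have "K \<subseteq> - U" unfolding K_def by (rule tsupp_subset) (use U in auto)
  \<comment> \<open>A local abbreviation, distinct from the constant of the same name further on: T
    kills the test functions living in the box of half-width 2 r about p, the support box of
    \<open>boxcut p r\<close>.\<close>
  define scale_order where "scale_order p r \<longleftrightarrow> r > 0 \<and> (\<forall>h. test_fn h \<longrightarrow> (\<forall>x. (\<exists>j. 2 * r < \<bar>x $ j - p $ j\<bar>) \<longrightarrow> h x = 0) \<longrightarrow> T h = 0)"
    for p :: "real^'n" and r
  have "\<exists>r. scale_order p r" if p: "p \<in> K" for p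
  proof -
    have "p \<notin> dsupp T" using p \<open>K \<subseteq> - U\<close> U by auto
    then obtain V where V: "open V" "p \<in> V" "\<And>h. test_fn h \<Longrightarrow> tsupp h \<subseteq> V \<Longrightarrow> T h = 0"
      unfolding dsupp_def by auto
    obtain e where e: "e > 0" "ball p e \<subseteq> V" using V openE by blast
    \<comment> \<open>A box of half-width 2 r has l1-radius 2 r d = e / 2, hence fits into the ball
      of radius e.\<close>
    define r where "r = e / (4 * real CARD('n))"
    have r0: "r > 0" unfolding r_def using e by simp
    let ?K = "{x. \<forall>j. \<bar>x $ j - p $ j\<bar> \<le> 2 * r}"
    have cl: "closed ?K"
      by (intro closed_Collect_all closed_Collect_le continuous_intros)
    have "?K \<subseteq> ball p e"
    proof
      fix x assume "x \<in> ?K"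
      then have "norm (x - p) \<le> (\<Sum>j\<in>(UNIV::'n set). 2 * r)"
        by (intro order_trans[OF norm_le_l1_cart] sum_mono) auto
      also have "\<dots> < e" using e by (simp add: r_def)
      finally show "x \<in> ball p e" by (simp add: dist_norm norm_minus_commute)
    qed
    have "scale_order p r" unfolding scale_order_def
    proof (intro conjI r0 allI impI)
      fix h :: "real^'n \<Rightarrow> complex"
      assume h: "test_fn h" "\<forall>x. (\<exists>j. 2 * r < \<bar>x $ j - p $ j\<bar>) \<longrightarrow> h x = 0"
      have "tsupp h \<subseteq> ?K"
      proof (rule tsupp_subset[OF cl])
        fix x assume "x \<notin> ?K"
        then have "\<exists>j. 2 * r < \<bar>x $ j - p $ j\<bar>" by (simp add: not_le)
        then show "h x = 0" using h(2) by simp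
      qed
      then have "tsupp h \<subseteq> V" using e(2) \<open>?K \<subseteq> ball p e\<close> by order
      then show "T h = 0" by (rule V(3)[OF h(1)])
    qed
    then show ?thesis by blast
  qed
  then obtain r where r: "\<And>p. p \<in> K \<Longrightarrow> scale_order p (r p)" by metis
  define B where "B p = {x. \<forall>j. \<bar>x $ j - p $ j\<bar> < r p}" for p
  have "B p = (\<Inter>j. {x. \<bar>x $ j - p $ j\<bar> < r p})" for p unfolding B_def by auto
  then have "open (B p)" for p
    by (simp only:) (intro open_INT open_Collect_less continuous_intros ballI finite_class.finite_UNIV)
  moreover have "K \<subseteq> (\<Union>p\<in>K. B p)" using r unfolding B_def scale_order_def by auto
  ultimately obtain F where F: "F \<subseteq> K" "finite F" "K \<subseteq> (\<Union>p\<in>F. B p)"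
    using compactE_image[OF K, of K B] by auto
  have "T (\<lambda>x. f x * (\<Prod>p\<in>F. 1 - boxcut p (r p) x)) = T f" using F(2,1)
  proof (induction F rule: finite_induct)
    case (insert p F)
    define h where "h = (\<lambda>x. f x * (\<Prod>p\<in>F. 1 - boxcut p (r p) x))"
    have h: "test_fn h" unfolding h_def
      by (intro test_mult f smooth_prod smooth_diff smooth_const smooth_boxcut)
    have g: "scale_order p (r p)" using insert r by auto
    then have rp: "r p > 0" by (simp add: scale_order_def)
    have t: "test_fn (\<lambda>x. h x * boxcut p (r p) x)" by (intro test_mult h smooth_boxcut)
    have "T (\<lambda>x. h x * boxcut p (r p) x) = 0"
    proof -
      have "\<forall>x. (\<exists>j. 2 * r p < \<bar>x $ j - p $ j\<bar>) \<longrightarrow> h x * boxcut p (r p) x = 0"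
        using boxcut_0[OF rp] by (auto dest: less_imp_le)
      then show ?thesis using g t unfolding scale_order_def by blast
    qed
    moreover have "(\<lambda>x. f x * (\<Prod>p\<in>insert p F. 1 - boxcut p (r p) x)) = (\<lambda>x. h x - h x * boxcut p (r p) x)"
      using insert by (simp add: h_def algebra_simps)
    ultimately show ?case using insert distr_diff[OF T h t] by (simp add: h_def)
  qed simp
  moreover have "f x * (\<Prod>p\<in>F. 1 - boxcut p (r p) x) = 0" for x
  proof (cases "f x = 0")
    case False
    then have "x \<in> K" using tsupp_zero K_def by metis
    then obtain p where p: "p \<in> F" "x \<in> B p" using F by auto
    then have "boxcut p (r p) x = 1" using r[of p] F unfolding B_def scale_order_def
      by (intro boxcut_1) (auto intro: less_imp_le)
    then show ?thesis using p F by (auto intro!: prod_zero bexI[of _ p])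
  qed simp
  ultimately show ?thesis using distr_zero[OF T] by simp
qed


subsection \<open>Integrals depending on a parameter\<close>

text \<open>Dominated convergence is a statement about sequences, so derivatives are tested along
  null sequences. Discarding finitely many terms permits the assumption |X n| <= 1, where the
  dominating bounds are available.\<close>

lemma hvd_sequentially:
  fixes f :: "real \<Rightarrow> complex"
  assumes "\<And>X. (\<And>n. X n \<noteq> 0) \<Longrightarrow> X \<longlonglongrightarrow> 0 \<Longrightarrow> (\<And>n. \<bar>X n\<bar> \<le> 1) \<Longrightarrow> (\<lambda>n. (f (X n) - f 0) / of_real (X n)) \<longlonglongrightarrow> d"
  shows "(f has_vector_derivative d) (at 0)"
proof -
  have "((\<lambda>t. (f t - f 0) / of_real t) \<longlongrightarrow> d) (at 0)"
    unfolding tendsto_at_iff_sequentially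
  proof (intro allI impI)
    fix X :: "nat \<Rightarrow> real" assume X: "\<forall>i. X i \<in> UNIV - {0}" "X \<longlonglongrightarrow> 0"
    obtain N where N: "\<And>n. n \<ge> N \<Longrightarrow> \<bar>X n\<bar> < 1" using LIMSEQ_D[OF X(2), of 1] by auto
    have "(\<lambda>n. (f (X (n + N)) - f 0) / of_real (X (n + N))) \<longlonglongrightarrow> d"
      by (rule assms) (use X N LIMSEQ_ignore_initial_segment[OF X(2), of N] in \<open>auto intro: less_imp_le\<close>)
    then have "(\<lambda>n. (f (X n) - f 0) / of_real (X n)) \<longlonglongrightarrow> d" by (rule LIMSEQ_offset)
    then show "((\<lambda>t. (f t - f 0) / of_real t) \<circ> X) \<longlonglongrightarrow> d" by (simp add: o_def)
  qed
  then have "((\<lambda>t. norm ((f t - f 0) / of_real t - d)) \<longlongrightarrow> 0) (at 0)"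
    by (intro tendsto_norm_zero) (simp add: LIM_zero)
  then have "((\<lambda>t. norm (f t - f 0 - t *\<^sub>R d) / norm t) \<longlongrightarrow> 0) (at 0)"
  proof (rule Lim_transform_eventually)
    have "norm ((f t - f 0) / of_real t - d) = norm (f t - f 0 - t *\<^sub>R d) / norm t" if "t \<noteq> 0" for t
    proof -
      have "(f t - f 0) / of_real t - d = (f t - f 0 - t *\<^sub>R d) / of_real t"
        using that by (simp add: diff_divide_distrib scaleR_conv_of_real)
      then show ?thesis by (simp add: norm_divide)
    qed
    then show "\<forall>\<^sub>F t in at 0. norm ((f t - f 0) / of_real t - d) = norm (f t - f 0 - t *\<^sub>R d) / norm t"
      by (auto simp: eventually_at_filter)
  qed
  then show ?thesis
    unfolding has_vector_derivative_def has_derivative_at by (simp add: bounded_linear_scaleR_left)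
qed

lemma norm_diff_le_derivative:
  fixes f :: "real \<Rightarrow> complex"
  assumes "\<And>t. (f has_vector_derivative f' t) (at t)" "\<And>t. \<bar>t\<bar> \<le> \<bar>s\<bar> \<Longrightarrow> norm (f' t) \<le> B"
  shows "norm (f s - f 0) \<le> B * \<bar>s\<bar>"
proof -
  have "norm (f s - f 0) \<le> B * norm (s - 0)"
  proof (rule differentiable_bound[where S = "closed_segment 0 s" and f' = "\<lambda>t h. h *\<^sub>R f' t"])
    fix t assume t: "t \<in> closed_segment 0 s"
    show "(f has_derivative (\<lambda>h. h *\<^sub>R f' t)) (at t within closed_segment 0 s)"
      using assms(1)[of t] unfolding has_vector_derivative_def by (rule has_derivative_at_withinI)
    have "norm (f' t) \<le> B" using t by (intro assms(2)) (auto simp: closed_segment_eq_real_ivl split: if_splits)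
    then show "onorm (\<lambda>h. h *\<^sub>R f' t) \<le> B"
      by (intro onorm_le) (simp add: mult.commute[of B] mult_left_mono)
  qed auto
  then show ?thesis by simp
qed

text \<open>Differentiation under the integral: the mean value inequality turns the bound w on the
  derivative for |t| <= 1 into the same bound on the difference quotients.\<close>

lemma hvd_integral:
  fixes f f' :: "'b \<Rightarrow> real \<Rightarrow> complex"
  assumes d: "\<And>y t. y \<in> space M \<Longrightarrow> ((\<lambda>s. f y s) has_vector_derivative f' y t) (at t)"
    and i: "\<And>t. integrable M (\<lambda>y. f y t)" and m: "(\<lambda>y. f' y 0) \<in> borel_measurable M"
    and w: "integrable M w" and b: "\<And>y t. y \<in> space M \<Longrightarrow> \<bar>t\<bar> \<le> 1 \<Longrightarrow> norm (f' y t) \<le> w y"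
  shows "((\<lambda>t. \<integral>y. f y t \<partial>M) has_vector_derivative (\<integral>y. f' y 0 \<partial>M)) (at 0)"
proof (rule hvd_sequentially)
  fix X :: "nat \<Rightarrow> real" assume X: "\<And>n. X n \<noteq> 0" "X \<longlonglongrightarrow> 0" "\<And>n. \<bar>X n\<bar> \<le> 1"
  have "(\<lambda>n. \<integral>y. (f y (X n) - f y 0) / of_real (X n) \<partial>M) \<longlonglongrightarrow> (\<integral>y. f' y 0 \<partial>M)"
  proof (rule integral_dominated_convergence[OF m _ w])
    show "(\<lambda>y. (f y (X n) - f y 0) / of_real (X n)) \<in> borel_measurable M" for n
      using i[of "X n"] i[of 0] by (auto intro!: borel_measurable_divide borel_measurable_diff borel_measurable_integrable)
    show "AE y in M. (\<lambda>n. (f y (X n) - f y 0) / of_real (X n)) \<longlonglongrightarrow> f' y 0"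
    proof (rule AE_I2)
      fix y assume y: "y \<in> space M"
      have "((\<lambda>t. norm (f y t - f y 0 - t *\<^sub>R f' y 0) / norm t) \<longlongrightarrow> 0) (at 0)"
        using d[OF y, of 0] unfolding has_vector_derivative_def has_derivative_at by simp
      then have "(\<lambda>n. norm (f y (X n) - f y 0 - X n *\<^sub>R f' y 0) / norm (X n)) \<longlonglongrightarrow> 0"
        using X(1,2) unfolding tendsto_at_iff_sequentially by (auto simp: o_def)
      moreover have "norm (f y (X n) - f y 0 - X n *\<^sub>R f' y 0) / norm (X n) =
          norm ((f y (X n) - f y 0) / of_real (X n) - f' y 0)" for n
      proof -
        have "(f y (X n) - f y 0) / of_real (X n) - f' y 0 = (f y (X n) - f y 0 - X n *\<^sub>R f' y 0) / of_real (X n)"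
          using X(1)[of n] by (simp add: diff_divide_distrib scaleR_conv_of_real)
        then show ?thesis by (simp add: norm_divide)
      qed
      ultimately have "(\<lambda>n. (f y (X n) - f y 0) / of_real (X n) - f' y 0) \<longlonglongrightarrow> 0"
        by (simp add: tendsto_norm_zero_iff)
      then show "(\<lambda>n. (f y (X n) - f y 0) / of_real (X n)) \<longlonglongrightarrow> f' y 0" by (rule LIM_zero_cancel)
    qed
    show "AE y in M. norm ((f y (X n) - f y 0) / of_real (X n)) \<le> w y" for n
    proof (rule AE_I2)
      fix y assume y: "y \<in> space M"
      have "norm (f y (X n) - f y 0) \<le> w y * \<bar>X n\<bar>"
        by (rule norm_diff_le_derivative[OF d[OF y]]) (use b[OF y] X(3)[of n] in auto)
      then show "norm ((f y (X n) - f y 0) / of_real (X n)) \<le> w y"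
        using X(1)[of n] by (simp add: norm_divide divide_le_eq)
    qed
  qed
  then show "(\<lambda>n. ((\<integral>y. f y (X n) \<partial>M) - (\<integral>y. f y 0 \<partial>M)) / of_real (X n)) \<longlonglongrightarrow> (\<integral>y. f' y 0 \<partial>M)"
    using i by simp
qed

lemma cont_integral:
  fixes f :: "'a::metric_space \<Rightarrow> 'b \<Rightarrow> complex"
  assumes c: "\<And>y. y \<in> space M \<Longrightarrow> continuous_on UNIV (\<lambda>x. f x y)"
    and m: "\<And>x. f x \<in> borel_measurable M" and w: "integrable M w"
    and b: "\<And>x y. y \<in> space M \<Longrightarrow> norm (f x y) \<le> w y"
  shows "continuous_on UNIV (\<lambda>x. \<integral>y. f x y \<partial>M)"
  unfolding continuous_on_sequentially
proof (intro allI ballI impI; elim conjE)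
  fix X :: "nat \<Rightarrow> 'a" and a assume X: "X \<longlonglongrightarrow> a"
  have "(\<lambda>n. \<integral>y. f (X n) y \<partial>M) \<longlonglongrightarrow> (\<integral>y. f a y \<partial>M)"
  proof (rule integral_dominated_convergence[OF m m w])
    show "AE y in M. (\<lambda>n. f (X n) y) \<longlonglongrightarrow> f a y"
      using c X by (auto simp: continuous_on_sequentially o_def)
  qed (use b in auto)
  then show "((\<lambda>x. \<integral>y. f x y \<partial>M) \<circ> X) \<longlonglongrightarrow> (\<integral>y. f a y \<partial>M)" by (simp add: o_def)
qed

lemma integrable_cc:
  fixes c :: "'b::euclidean_space \<Rightarrow> complex"
  assumes "continuous_on UNIV c" "\<And>y. norm y > R \<Longrightarrow> c y = 0"
  shows "integrable lborel c"
proof -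
  have "integrable lborel (\<lambda>y. indicator (cball 0 R) y *\<^sub>R c y)"
    using set_integrable_continuous_cball[OF assms(1), of R] by (simp add: set_integrable_def)
  moreover have "(\<lambda>y. indicator (cball 0 R) y *\<^sub>R c y) = c"
    using assms(2) by (force simp: indicator_def)
  ultimately show ?thesis by simp
qed

lemma continuous_borel: "continuous_on UNIV (c :: 'b::euclidean_space \<Rightarrow> complex) \<Longrightarrow> c \<in> borel_measurable lborel"
  by (simp add: borel_measurable_continuous_onI)

lemma emeasure_cball_fin: "emeasure lborel (cball (0::'b::euclidean_space) R) < top"
  using emeasure_bounded_finite[OF bounded_cball, of "0::'b" R] by (simp add: less_top)

subsection \<open>Riemann sums over a grid\<close>

definition grid :: "nat \<Rightarrow> 'b::euclidean_space \<Rightarrow> 'b" where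
  "grid m y = (\<Sum>i\<in>Basis. (real_of_int \<lfloor>real (Suc m) * (y \<bullet> i)\<rfloor> / real (Suc m)) *\<^sub>R i)"

lemma grid_dist: "norm (grid m y - y) \<le> real DIM('b) / real (Suc m)" for y :: "'b::euclidean_space"
proof -
  have "grid m y - y = (\<Sum>i\<in>Basis. (real_of_int \<lfloor>real (Suc m) * (y \<bullet> i)\<rfloor> / real (Suc m) - y \<bullet> i) *\<^sub>R i)"
    unfolding grid_def by (simp add: scaleR_left_diff_distrib sum_subtractf euclidean_representation)
  also have "norm \<dots> \<le> (\<Sum>i\<in>(Basis::'b set). 1 / real (Suc m))"
  proof (rule order_trans[OF norm_sum], rule sum_mono)
    fix i :: 'b assume i: "i \<in> Basis"
    let ?z = "real (Suc m) * (y \<bullet> i)"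
    have "real_of_int \<lfloor>?z\<rfloor> / real (Suc m) - y \<bullet> i = (real_of_int \<lfloor>?z\<rfloor> - ?z) / real (Suc m)"
      by (simp add: diff_divide_distrib del: of_nat_Suc)
    then have "\<bar>real_of_int \<lfloor>?z\<rfloor> / real (Suc m) - y \<bullet> i\<bar> = \<bar>real_of_int \<lfloor>?z\<rfloor> - ?z\<bar> / real (Suc m)"
      by (simp del: of_nat_Suc)
    also have "\<dots> \<le> 1 / real (Suc m)"
      by (rule divide_right_mono) linarith+
    finally show "norm ((real_of_int \<lfloor>?z\<rfloor> / real (Suc m) - y \<bullet> i) *\<^sub>R i) \<le> 1 / real (Suc m)"
      using i by simp
  qed
  finally show ?thesis by simp
qed

lemma grid_tendsto: "(\<lambda>m. grid m y) \<longlonglongrightarrow> y"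
proof -
  have "(\<lambda>m. real DIM('a) / real (Suc m)) \<longlonglongrightarrow> 0"
    by (rule LIMSEQ_Suc[OF lim_const_over_n])
  then have "(\<lambda>m. norm (grid m y - y)) \<longlonglongrightarrow> 0"
    by (rule tendsto_sandwich[OF _ _ tendsto_const, rotated 2]) (intro always_eventually allI grid_dist norm_ge_zero)+
  then show ?thesis by (simp add: tendsto_norm_zero_iff LIM_zero_iff)
qed

lemma finite_grid: "finite (grid m ` cball (0::'b::euclidean_space) R)"
proof -
  define N where "N = \<lceil>real (Suc m) * R\<rceil> + 1"
  let ?P = "Pi\<^sub>E (Basis :: 'b set) (\<lambda>_. {-N..N})"
  let ?g = "\<lambda>k. (\<Sum>i\<in>(Basis::'b set). (real_of_int (k i) / real (Suc m)) *\<^sub>R i)"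
  have "grid m ` cball 0 R \<subseteq> ?g ` ?P"
  proof
    fix x assume "x \<in> grid m ` cball (0::'b) R"
    then obtain y where y: "norm y \<le> R" "x = grid m y" by auto
    let ?k = "restrict (\<lambda>i. \<lfloor>real (Suc m) * (y \<bullet> i)\<rfloor>) Basis"
    have "\<lfloor>real (Suc m) * (y \<bullet> i)\<rfloor> \<in> {-N..N}" if "i \<in> Basis" for i
    proof -
      have "\<bar>y \<bullet> i\<bar> \<le> R" using Basis_le_norm[OF that, of y] y by simp
      then have "\<bar>real (Suc m) * (y \<bullet> i)\<bar> \<le> real (Suc m) * R"
        by (simp add: abs_mult mult_left_mono del: of_nat_Suc)
      moreover have "\<lfloor>z\<rfloor> \<in> {- (\<lceil>w\<rceil> + 1)..\<lceil>w\<rceil> + 1}" if "\<bar>z\<bar> \<le> w" for z w :: real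
        using that by (simp; linarith)
      ultimately show ?thesis unfolding N_def by blast
    qed
    then have "?k \<in> ?P" by (auto simp: PiE_def)
    moreover have "x = ?g ?k" unfolding y grid_def by (intro sum.cong) auto
    ultimately show "x \<in> ?g ` ?P" by blast
  qed
  moreover have "finite ?P" by (intro finite_PiE) auto
  ultimately show ?thesis using finite_subset by blast
qed

lemma grid_measurable [measurable]: "grid m \<in> borel_measurable borel"
  unfolding grid_def[abs_def]
  by (intro borel_measurable_sum borel_measurable_scaleR borel_measurable_divide borel_measurable_const
      measurable_compose[OF _ borel_measurable_real_floor]) auto

definition wt :: "nat \<Rightarrow> real \<Rightarrow> 'b::euclidean_space \<Rightarrow> complex" where
  "wt m R p = complex_of_real (measure lborel (cball 0 R \<inter> grid m -` {p}))"

text \<open>On a ball the composition of c with \<open>grid m\<close> takes finitely many values, so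
  its integral is a finite sum. Riemann sums thereby become integrals to which dominated convergence
  applies.\<close>

lemma grid_sum:
  fixes c :: "'b::euclidean_space \<Rightarrow> complex"
  shows "(\<integral>y. indicator (cball 0 R) y *\<^sub>R c (grid m y) \<partial>lborel) = (\<Sum>p\<in>grid m ` cball 0 R. wt m R p * c p)"
proof -
  let ?P = "grid m ` cball (0::'b) R" and ?A = "\<lambda>p. cball (0::'b) R \<inter> grid m -` {p}"
  have A: "?A p \<in> sets lborel" for p
  proof -
    have "grid m -` {p} \<inter> space borel \<in> sets borel" by (rule measurable_sets[OF grid_measurable]) auto
    then show ?thesis by (auto intro!: sets.Int)
  qed
  have fin: "emeasure lborel (?A p) < \<infinity>" for p
    by (rule le_less_trans[OF emeasure_mono[of _ "cball 0 R"]]) (auto simp: emeasure_cball_fin)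
  have eq: "indicator (cball 0 R) y *\<^sub>R c (grid m y) = (\<Sum>p\<in>?P. indicator (?A p) y *\<^sub>R c p)" for y
  proof (cases "y \<in> cball 0 R")
    case True
    have "(\<Sum>p\<in>?P. indicator (?A p) y *\<^sub>R c p) = (\<Sum>p\<in>?P. if p = grid m y then c p else 0)"
      using True by (intro sum.cong) (auto simp: indicator_def)
    also have "\<dots> = c (grid m y)" using True finite_grid[of m R] by (subst sum.delta) auto
    finally show ?thesis using True by simp
  qed (auto simp: indicator_def)
  have "(\<integral>y. indicator (cball 0 R) y *\<^sub>R c (grid m y) \<partial>lborel) = (\<Sum>p\<in>?P. \<integral>y. indicator (?A p) y *\<^sub>R c p \<partial>lborel)"
    unfolding eq by (rule Bochner_Integration.integral_sum)
      (intro integrable_scaleR_left integrable_real_indicator A fin)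
  also have "\<dots> = (\<Sum>p\<in>?P. wt m R p * c p)"
  proof (rule sum.cong)
    fix p
    have "(\<integral>y. indicator (?A p) y *\<^sub>R c p \<partial>lborel) = (\<integral>y. indicator (?A p) y \<partial>lborel) *\<^sub>R c p"
      by (rule integral_scaleR_left) (intro integrable_real_indicator A fin)
    then show "(\<integral>y. indicator (?A p) y *\<^sub>R c p \<partial>lborel) = wt m R p * c p"
      by (simp add: wt_def scaleR_conv_of_real)
  qed simp
  finally show ?thesis .
qed

lemma riemann_sum:
  fixes c :: "'b::euclidean_space \<Rightarrow> complex"
  assumes c: "continuous_on UNIV c" and R: "\<And>y. norm y > R \<Longrightarrow> c y = 0"
  shows "(\<lambda>m. \<Sum>p\<in>grid m ` cball 0 (R + DIM('b)). wt m (R + DIM('b)) p * c p) \<longlonglongrightarrow> (\<integral>y. c y \<partial>lborel)"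
proof -
  let ?R = "R + real DIM('b)"
  have "compact (c ` cball 0 R)"
    by (intro compact_continuous_image continuous_on_subset[OF c]) auto
  then obtain C where C: "C > 0" "\<forall>y\<in>c ` cball 0 R. norm y \<le> C"
    using compact_imp_bounded bounded_pos by blast
  then have C': "norm (c y) \<le> C" for y using R[of y] by (cases "norm y \<le> R") auto
  have "(\<lambda>m. \<integral>y. indicator (cball 0 ?R) y *\<^sub>R c (grid m y) \<partial>lborel) \<longlonglongrightarrow> (\<integral>y. indicator (cball 0 ?R) y *\<^sub>R c y \<partial>lborel)"
  proof (rule integral_dominated_convergence[where w = "\<lambda>y. C * indicator (cball 0 ?R) y"])
    have m [measurable]: "c \<in> borel_measurable borel" using continuous_borel[OF c] by simp
    show "(\<lambda>y. indicator (cball 0 ?R) y *\<^sub>R c y) \<in> borel_measurable lborel"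
      by (intro borel_measurable_scaleR borel_measurable_indicator) auto
    show "(\<lambda>y. indicator (cball 0 ?R) y *\<^sub>R c (grid m y)) \<in> borel_measurable lborel" for m
      using measurable_compose[OF grid_measurable m, of m] by (intro borel_measurable_scaleR borel_measurable_indicator) auto
    show "integrable lborel (\<lambda>y. C * indicator (cball 0 ?R) y)"
      by (intro Bochner_Integration.integrable_mult_right integrable_real_indicator) (auto simp: emeasure_cball_fin)
    show "AE y in lborel. (\<lambda>m. indicator (cball 0 ?R) y *\<^sub>R c (grid m y)) \<longlonglongrightarrow> indicator (cball 0 ?R) y *\<^sub>R c y"
      by (intro AE_I2 tendsto_scaleR tendsto_const continuous_on_tendsto_compose[OF c grid_tendsto]) auto
    show "AE y in lborel. norm (indicator (cball 0 ?R) y *\<^sub>R c (grid m y)) \<le> C * indicator (cball 0 ?R) y" for m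
      using C' by (intro AE_I2) (auto simp: indicator_def)
  qed
  moreover have "(\<lambda>y. indicator (cball 0 ?R) y *\<^sub>R c y) = c"
    using R by (force simp: indicator_def)
  ultimately show ?thesis by (simp add: grid_sum)
qed

subsection \<open>Families of test functions and Fubini for distributions\<close>

text \<open>Derivatives are taken in x only; in the parameter y joint continuity is all that is
  demanded.\<close>

definition cfam :: "('y::topological_space \<Rightarrow> real^'n::finite \<Rightarrow> complex) \<Rightarrow> bool" where
  "cfam F \<longleftrightarrow> (\<forall>y. smooth_fn (F y)) \<and> (\<forall>js. continuous_on UNIV (\<lambda>p. iterpd js (F (fst p)) (snd p)))"

lemma cfam_const: "smooth_fn f \<Longrightarrow> cfam (\<lambda>y. f)"
  unfolding cfam_def
  by (auto intro!: continuous_on_compose2[OF smooth_cont[OF smooth_iterpd, of _ UNIV] continuous_on_snd[OF continuous_on_id]])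

lemma cfam_affine:
  assumes f: "smooth_fn f" and ab: "continuous_on UNIV a" "continuous_on UNIV b"
  shows "cfam (\<lambda>y x. f (x * a y + b y))"
  unfolding cfam_def
proof (intro conjI allI smooth_affine f)
  fix js
  have "continuous_on UNIV (\<lambda>p. cw js (a (fst p)) * iterpd js f (snd p * a (fst p) + b (fst p)))"
    by (intro continuous_intros continuous_on_compose2[OF cont_cw[of UNIV]] continuous_on_compose2[OF ab(1)]
        continuous_on_compose2[OF ab(2)] continuous_on_compose2[OF smooth_cont[OF smooth_iterpd[OF f], of UNIV]]) auto
  then show "continuous_on UNIV (\<lambda>p. iterpd js (\<lambda>x. f (x * a (fst p) + b (fst p))) (snd p))"
    using f by (simp add: iterpd_affine)
qed

lemma cfam_pd: "cfam F \<Longrightarrow> cfam (\<lambda>y. pd j (F y))"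
  unfolding cfam_def by (auto intro: smooth_pd simp flip: iterpd_snoc)

lemma cfam_mult:
  assumes "cfam F" "cfam G"
  shows "cfam (\<lambda>y x. F y x * G y x)"
proof -
  have "continuous_on UNIV (\<lambda>p. iterpd js (\<lambda>x. F (fst p) x * G (fst p) x) (snd p))" for js
    using assms
  proof (induction js arbitrary: F G rule: rev_induct)
    case Nil
    have "continuous_on UNIV (\<lambda>p. iterpd [] (F (fst p)) (snd p))" "continuous_on UNIV (\<lambda>p. iterpd [] (G (fst p)) (snd p))"
      using Nil unfolding cfam_def by blast+
    then show ?case by (auto intro: continuous_on_mult)
  next
    case (snoc j js)
    have s: "smooth_fn (F y)" "smooth_fn (G y)" for y using snoc.prems by (auto simp: cfam_def)
    have "iterpd (js @ [j]) (\<lambda>x. F y x * G y x) x =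
      iterpd js (\<lambda>x. pd j (F y) x * G y x) x + iterpd js (\<lambda>x. F y x * pd j (G y) x) x" for y x
      using s by (simp add: iterpd_snoc pd_mult iterpd_add smooth_mult smooth_pd)
    then show ?case
      using snoc.IH[OF cfam_pd[OF snoc.prems(1)] snoc.prems(2)] snoc.IH[OF snoc.prems(1) cfam_pd[OF snoc.prems(2)]]
      by (simp add: continuous_on_add)
  qed
  then show ?thesis using assms unfolding cfam_def by (auto intro: smooth_mult)
qed

lemma cfam_scale:
  assumes "continuous_on UNIV c" "cfam F" shows "cfam (\<lambda>y x. c y * F y x)"
  unfolding cfam_def
proof (intro conjI allI)
  have s: "smooth_fn (F y)" for y using assms by (auto simp: cfam_def)
  then show "smooth_fn (\<lambda>x. c y * F y x)" for y by (rule smooth_cmult)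
  fix js
  have "continuous_on UNIV (\<lambda>p. iterpd js (F (fst p)) (snd p))" using assms by (simp add: cfam_def)
  then have "continuous_on UNIV (\<lambda>p. c (fst p) * iterpd js (F (fst p)) (snd p))"
    by (intro continuous_intros continuous_on_compose2[OF assms(1)]) auto
  then show "continuous_on UNIV (\<lambda>p. iterpd js (\<lambda>x. c (fst p) * F (fst p) x) (snd p))"
    using s by (simp add: iterpd_cmult)
qed

lemma cc_uniform:
  fixes h :: "'b::euclidean_space \<Rightarrow> 'c::euclidean_space \<Rightarrow> complex"
  assumes h: "continuous_on UNIV (\<lambda>p. h (fst p) (snd p))"
    and R: "\<And>y x. norm y > R \<Longrightarrow> h y x = 0" "\<And>y x. norm x > R \<Longrightarrow> h y x = 0"
  shows "\<exists>C>0. \<forall>y x. norm (h y x) \<le> C"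
    and "e > 0 \<Longrightarrow> \<exists>d>0. \<forall>y y' x. norm (y' - y) < d \<longrightarrow> norm (h y' x - h y x) < e"
proof -
  let ?K = "cball 0 (R + 1) \<times> cball 0 R :: ('b \<times> 'c) set" and ?h = "\<lambda>p. h (fst p) (snd p)"
  have K: "compact ?K" by (intro compact_Times) auto
  have cK: "continuous_on ?K ?h" by (rule continuous_on_subset[OF h]) auto
  have "compact (?h ` ?K)" by (rule compact_continuous_image[OF cK K])
  then obtain C where C: "C > 0" "\<forall>z\<in>?h ` ?K. norm z \<le> C"
    using compact_imp_bounded bounded_pos by blast
  have "norm (h y x) \<le> C" for y x
  proof (cases "norm y \<le> R \<and> norm x \<le> R")
    case True
    then have "(y, x) \<in> ?K" by auto
    then show ?thesis using C by force
  qed (use R C in \<open>auto simp: not_le\<close>)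
  then show "\<exists>C>0. \<forall>y x. norm (h y x) \<le> C" using C by blast
  assume e: "e > 0"
  have "uniformly_continuous_on ?K ?h" by (rule compact_uniformly_continuous[OF cK K])
  then obtain d where d: "d > 0" "\<And>p q. p \<in> ?K \<Longrightarrow> q \<in> ?K \<Longrightarrow> dist q p < d \<Longrightarrow> dist (?h q) (?h p) < e"
    using e unfolding uniformly_continuous_on_def by meson
  show "\<exists>d>0. \<forall>y y' x. norm (y' - y) < d \<longrightarrow> norm (h y' x - h y x) < e"
  proof (intro exI[of _ "min d 1"] conjI allI impI)
    fix y y' :: 'b and x assume y: "norm (y' - y) < min d 1"
    have n: "norm y' \<le> norm y + 1" "norm y \<le> norm y' + 1"
      using y norm_triangle_ineq2[of y y'] norm_triangle_ineq2[of y' y] by (auto simp: norm_minus_commute)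
    show "norm (h y' x - h y x) < e"
    proof (cases "norm x \<le> R \<and> (norm y \<le> R \<or> norm y' \<le> R)")
      case True
      then have "norm x \<le> R" "norm y \<le> R + 1" "norm y' \<le> R + 1" using n by auto
      then show ?thesis using d(2)[of "(y, x)" "(y', x)"] y by (auto simp: dist_norm)
    qed (use R e in \<open>auto simp: not_le\<close>)
  qed (use d in auto)
qed

text \<open>Families with compact support in parameter and variable together: the setting in which a
  distribution can be exchanged with the integral over the parameter.\<close>

locale cc_family =
  fixes F :: "'b::euclidean_space \<Rightarrow> real^'n::finite \<Rightarrow> complex" and R :: real
  assumes fam: "cfam F" and zy: "\<And>y x. norm y > R \<Longrightarrow> F y x = 0" and zx: "\<And>y x. norm x > R \<Longrightarrow> F y x = 0"
begin

lemma smooth: "smooth_fn (F y)" using fam by (simp add: cfam_def)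

lemma joint: "continuous_on UNIV (\<lambda>p. iterpd js (F (fst p)) (snd p))" using fam by (simp add: cfam_def)

lemma zeros: "norm y > R \<Longrightarrow> iterpd js (F y) x = 0" "norm x > R \<Longrightarrow> iterpd js (F y) x = 0"
proof -
  assume "norm y > R"
  then have "F y = (\<lambda>x. 0)" using zy by auto
  then show "iterpd js (F y) x = 0" by simp
qed (use iterpd_zero_norm zx in blast)

lemma test: "test_fn (F y)" unfolding test_fn_iff using smooth zx by blast

lemma cont1: "continuous_on UNIV (\<lambda>y. iterpd js (F y) x)"
  by (rule continuous_on_compose2[OF joint, of _ "\<lambda>y. (y, x)", simplified]) (intro continuous_intros)

lemma integrable1: "integrable lborel (\<lambda>y. iterpd js (F y) x)"
  by (rule integrable_cc[OF cont1]) (rule zeros)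

lemma bound: "\<exists>C>0. \<forall>y x. norm (iterpd js (F y) x) \<le> C * indicator (cball 0 R) y"
proof -
  obtain C where C: "C > 0" "\<And>y x. norm (iterpd js (F y) x) \<le> C"
    using cc_uniform(1)[where h = "\<lambda>y. iterpd js (F y)", OF joint zeros] by blast
  show ?thesis
  proof (intro exI[of _ C] conjI allI C)
    show "norm (iterpd js (F y) x) \<le> C * indicator (cball 0 R) y" for y x
      using C(2)[of y x] zeros(1)[of y js x] by (cases "norm y \<le> R") auto
  qed
qed

lemma uniform:
  assumes "e > 0"
  obtains d where "d > 0" "\<And>y y' x. norm (y' - y) < d \<Longrightarrow> norm (iterpd js (F y') x - iterpd js (F y) x) < e"
proof -
  have "\<exists>d>0. \<forall>y y' x. norm (y' - y) < d \<longrightarrow> norm (iterpd js (F y') x - iterpd js (F y) x) < e"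
    by (rule cc_uniform(2)[where h = "\<lambda>y. iterpd js (F y)", OF joint zeros assms])
  then show ?thesis using that by blast
qed

lemma w_integrable: "integrable lborel (\<lambda>y. C * indicator (cball (0::'b) R) y :: real)"
  by (intro Bochner_Integration.integrable_mult_right integrable_real_indicator) (auto simp: emeasure_cball_fin)

lemma int_cont: "continuous_on UNIV (\<lambda>x. \<integral>y. iterpd js (F y) x \<partial>lborel)"
proof -
  obtain C where "\<And>y x. norm (iterpd js (F y) x) \<le> C * indicator (cball 0 R) y" using bound by meson
  then show ?thesis
    by (intro cont_integral[OF _ _ w_integrable[of C]] smooth_cont smooth_iterpd smooth continuous_borel cont1)
qed

lemma int_hpd: "hpd j (\<lambda>x. \<integral>y. iterpd js (F y) x \<partial>lborel) (\<integral>y. iterpd (j # js) (F y) x \<partial>lborel) x"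
proof -
  obtain C where C: "\<And>y x. norm (iterpd (j#js) (F y) x) \<le> C * indicator (cball 0 R) y" using bound by meson
  have "((\<lambda>t. \<integral>y. iterpd js (F y) (x + t *\<^sub>R axis j 1) \<partial>lborel) has_vector_derivative
      (\<integral>y. iterpd (j#js) (F y) (x + 0 *\<^sub>R axis j 1) \<partial>lborel)) (at 0)"
  proof (rule hvd_integral[OF _ _ _ w_integrable[of C]])
    show "((\<lambda>t. iterpd js (F y) (x + t *\<^sub>R axis j 1)) has_vector_derivative iterpd (j # js) (F y) (x + t *\<^sub>R axis j 1)) (at t)" for y t
      unfolding iterpd.simps by (rule hpd_line) (intro smooth_hpd smooth_iterpd smooth)
  qed (use C integrable1 continuous_borel[OF cont1] in blast)+
  then show ?thesis by (simp add: hpd_def)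
qed

lemma int_smooth: "smooth_fn (\<lambda>x. \<integral>y. F y x \<partial>lborel)"
proof (rule smooth_coinduct[where P = "range (\<lambda>js x. \<integral>y. iterpd js (F y) x \<partial>lborel)"])
  show "(\<lambda>x. \<integral>y. F y x \<partial>lborel) \<in> range (\<lambda>js x. \<integral>y. iterpd js (F y) x \<partial>lborel)"
    by (rule image_eqI[of _ _ "[]"]) auto
next
  fix f and j :: 'n assume "f \<in> range (\<lambda>js x. \<integral>y. iterpd js (F y) x \<partial>lborel)"
  then obtain js where f: "f = (\<lambda>x. \<integral>y. iterpd js (F y) x \<partial>lborel)" by auto
  show "continuous_on UNIV f" unfolding f by (rule int_cont)
  show "\<exists>g\<in>range (\<lambda>js x. \<integral>y. iterpd js (F y) x \<partial>lborel). \<forall>x. hpd j f (g x) x"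
    unfolding f by (rule bexI[OF _ rangeI[of _ "j # js"]]) (intro allI int_hpd)
qed

lemma iterpd_int: "iterpd js (\<lambda>x. \<integral>y. F y x \<partial>lborel) = (\<lambda>x. \<integral>y. iterpd js (F y) x \<partial>lborel)"
proof (induction js)
  case (Cons j js)
  then show ?case using int_hpd[THEN hpd_pd, of j js] by auto
qed simp

lemma int_test: "test_fn (\<lambda>x. \<integral>y. F y x \<partial>lborel)"
  unfolding test_fn_iff using int_smooth zx by (intro conjI exI[of _ R]) auto

lemma D_conv_family: assumes "X \<longlonglongrightarrow> y" shows "D_conv (\<lambda>n. F (X n)) (F y)"
  unfolding D_conv_iff
proof (intro conjI allI impI test)
  show "\<exists>R. \<forall>n x. norm x > R \<longrightarrow> F (X n) x = 0" using zx by blast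
  fix js and e :: real assume "e > 0"
  then obtain d where d: "d > 0" "\<And>y y' x. norm (y' - y) < d \<Longrightarrow> norm (iterpd js (F y') x - iterpd js (F y) x) < e"
    using uniform[where js = js] by blast
  obtain N where "\<forall>n\<ge>N. norm (X n - y) < d" using LIMSEQ_D[OF assms d(1)] by blast
  then show "\<exists>N. \<forall>n\<ge>N. \<forall>x. norm (iterpd js (F (X n)) x - iterpd js (F y) x) < e"
    using d(2) by blast
qed

lemma distr_family_cont:
  assumes "is_distr T" shows "continuous_on UNIV (\<lambda>y. T (F y))"
  unfolding continuous_on_sequentially o_def using distr_conv[OF assms D_conv_family] by auto

lemma distr_family_zero: "is_distr T \<Longrightarrow> norm y > R \<Longrightarrow> T (F y) = 0"
  using zy distr_zero[of T] by (metis ext)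

text \<open>The Riemann sums in y converge to the integral in D, since all x-derivatives are
  uniformly continuous in y, uniformly in x. By linearity T maps them to Riemann sums of the
  continuous function y -> T (F y).\<close>

theorem distr_fubini:
  assumes T: "is_distr T"
  shows "T (\<lambda>x. \<integral>y. F y x \<partial>lborel) = (\<integral>y. T (F y) \<partial>lborel)"
proof -
  let ?R = "R + real DIM('b)"
  let ?P = "\<lambda>m. grid m ` cball (0::'b) ?R"
  let ?G = "\<lambda>m x. \<Sum>p\<in>?P m. wt m ?R p * F p x"
  have "D_conv ?G (\<lambda>x. \<integral>y. F y x \<partial>lborel)"
    unfolding D_conv_iff
  proof (intro conjI allI impI int_test)
    show "test_fn (?G m)" for m by (intro test_sum test_cmult test)
    show "\<exists>R. \<forall>n x. norm x > R \<longrightarrow> ?G n x = 0" using zx by (intro exI[of _ R]) auto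
    fix js and e :: real assume e: "e > 0"
    define V where "V = measure lborel (cball (0::'b) ?R)"
    have V: "V \<ge> 0" by (simp add: V_def)
    then have "e / (V + 1) > 0" using e by (intro divide_pos_pos) auto
    then obtain d where d: "d > 0" "\<And>y y' x. norm (y' - y) < d \<Longrightarrow> norm (iterpd js (F y') x - iterpd js (F y) x) < e / (V + 1)"
      using uniform[where js = js] by blast
    obtain N where N: "real DIM('b) / real (Suc N) < d"
    proof -
      have "(\<lambda>m. real DIM('b) / real (Suc m)) \<longlonglongrightarrow> 0" by (rule LIMSEQ_Suc[OF lim_const_over_n])
      from LIMSEQ_D[OF this d(1)] obtain N where "\<forall>n\<ge>N. norm (real DIM('b) / real (Suc n) - 0) < d" by blast
      then have "norm (real DIM('b) / real (Suc N) - 0) < d" by blast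
      then show ?thesis using that by simp
    qed
    have "norm (iterpd js (?G m) x - iterpd js (\<lambda>x. \<integral>y. F y x \<partial>lborel) x) < e" if m: "m \<ge> N" for m x
    proof -
      have "iterpd js (?G m) x = (\<Sum>p\<in>?P m. wt m ?R p * iterpd js (F p) x)"
        by (rule fun_cong[OF iterpd_sum[OF finite_grid smooth]])
      also have "\<dots> = (\<integral>y. indicator (cball 0 ?R) y *\<^sub>R iterpd js (F (grid m y)) x \<partial>lborel)"
        by (rule grid_sum[symmetric])
      finally have 1: "iterpd js (?G m) x = (\<integral>y. indicator (cball 0 ?R) y *\<^sub>R iterpd js (F (grid m y)) x \<partial>lborel)" .
      have eq: "(\<lambda>y. indicator (cball 0 ?R) y *\<^sub>R iterpd js (F y) x) = (\<lambda>y. iterpd js (F y) x)"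
        using zeros(1) by (force simp: indicator_def)
      obtain C where C: "C > 0" "\<And>y x. norm (iterpd js (F y) x) \<le> C * indicator (cball 0 R) y" using bound by meson
      have wi: "integrable lborel (\<lambda>y. c * indicator (cball (0::'b) ?R) y :: real)" for c
        by (intro Bochner_Integration.integrable_mult_right integrable_real_indicator) (auto simp: emeasure_cball_fin)
      have meas: "(\<lambda>y. iterpd js (F y) x) \<in> borel_measurable borel" using continuous_borel[OF cont1] by simp
      have i1: "integrable lborel (\<lambda>y. indicator (cball 0 ?R) y *\<^sub>R iterpd js (F (grid m y)) x)"
      proof (rule Bochner_Integration.integrable_bound[OF wi[of C]])
        have "(\<lambda>y. iterpd js (F (grid m y)) x) \<in> borel_measurable borel"
          by (rule measurable_compose[OF grid_measurable meas])
        then show "(\<lambda>y. indicator (cball 0 ?R) y *\<^sub>R iterpd js (F (grid m y)) x) \<in> borel_measurable lborel"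
          by (intro borel_measurable_scaleR borel_measurable_indicator) auto
        have "norm (iterpd js (F z) x) \<le> C" for z using C(2)[of z x] C(1) by (cases "norm z \<le> R") auto
        then show "AE y in lborel. norm (indicator (cball 0 ?R) y *\<^sub>R iterpd js (F (grid m y)) x) \<le> norm (C * indicator (cball 0 ?R) y)"
          using C(1) by (intro AE_I2) (auto simp: indicator_def)
      qed
      have i2: "integrable lborel (\<lambda>y. indicator (cball 0 ?R) y *\<^sub>R iterpd js (F y) x)"
        unfolding eq by (rule integrable1)
      have "norm (iterpd js (?G m) x - (\<integral>y. iterpd js (F y) x \<partial>lborel)) =
         norm (\<integral>y. indicator (cball 0 ?R) y *\<^sub>R iterpd js (F (grid m y)) x - indicator (cball 0 ?R) y *\<^sub>R iterpd js (F y) x \<partial>lborel)"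
        unfolding 1 using Bochner_Integration.integral_diff[OF i1 i2] eq by simp
      also have "\<dots> \<le> (\<integral>y. (e / (V + 1)) * indicator (cball (0::'b) ?R) y \<partial>lborel)"
      proof (rule Bochner_Integration.integral_norm_bound_integral)
        show "integrable lborel (\<lambda>y. indicator (cball 0 ?R) y *\<^sub>R iterpd js (F (grid m y)) x - indicator (cball 0 ?R) y *\<^sub>R iterpd js (F y) x)"
          by (rule Bochner_Integration.integrable_diff[OF i1 i2])
        show "integrable lborel (\<lambda>y. (e / (V + 1)) * indicator (cball (0::'b) ?R) y)" by (rule wi)
        fix y :: 'b
        have "norm (grid m y - y) < d"
        proof -
          have "real DIM('b) / real (Suc m) \<le> real DIM('b) / real (Suc N)" using m by (intro divide_left_mono) auto
          then show ?thesis using grid_dist[of m y] N by linarith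
        qed
        then have "norm (iterpd js (F (grid m y)) x - iterpd js (F y) x) < e / (V + 1)" by (rule d)
        then show "norm (indicator (cball 0 ?R) y *\<^sub>R iterpd js (F (grid m y)) x - indicator (cball 0 ?R) y *\<^sub>R iterpd js (F y) x)
           \<le> (e / (V + 1)) * indicator (cball 0 ?R) y"
          by (auto simp: indicator_def)
      qed
      also have "\<dots> = e / (V + 1) * V" by (simp add: V_def)
      also have "\<dots> < e" using e V by (simp add: field_simps)
      finally show ?thesis by (simp add: iterpd_int)
    qed
    then show "\<exists>N. \<forall>n\<ge>N. \<forall>x. norm (iterpd js (?G n) x - iterpd js (\<lambda>x. \<integral>y. F y x \<partial>lborel) x) < e" by blast
  qed
  moreover have "T (?G m) = (\<Sum>p\<in>?P m. wt m ?R p * T (F p))" for m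
    by (rule distr_sum[OF T finite_grid test])
  ultimately have c1: "(\<lambda>m. \<Sum>p\<in>?P m. wt m ?R p * T (F p)) \<longlonglongrightarrow> T (\<lambda>x. \<integral>y. F y x \<partial>lborel)"
    by (auto dest: distr_conv[OF T])
  have "(\<lambda>m. \<Sum>p\<in>?P m. wt m ?R p * T (F p)) \<longlonglongrightarrow> (\<integral>y. T (F y) \<partial>lborel)"
    by (rule riemann_sum[OF distr_family_cont[OF T] distr_family_zero[OF T]])
  then show ?thesis by (rule LIMSEQ_unique[OF c1])
qed

end


subsection \<open>Density of monomials and of point masses\<close>

lemma Basis_cart: "(Basis :: (real^'n::finite) set) = range (\<lambda>j. axis j 1)"
  by (auto simp: Basis_vec_def)

lemma prod_Basis_cart: "(\<Prod>i\<in>(Basis :: (real^'n::finite) set). g i) = (\<Prod>j\<in>UNIV. g (axis j 1))"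
  unfolding Basis_cart by (subst prod.reindex) (auto simp: inj_on_def axis_eq_axis)

lemma integral_affine_cart:
  fixes a t :: "real^'n::finite" and f :: "real^'n \<Rightarrow> complex"
  assumes a: "\<And>j. a $ j \<noteq> 0" and f: "f \<in> borel_measurable lborel"
  shows "(\<integral>x. f x \<partial>lborel) = complex_of_real (\<Prod>j\<in>UNIV. \<bar>a $ j\<bar>) * (\<integral>x. f (x * a + t) \<partial>lborel)"
proof -
  have T: "t + (\<Sum>j\<in>Basis. (a \<bullet> j * (x \<bullet> j)) *\<^sub>R j) = x * a + t" for x
  proof -
    have "(\<Sum>j\<in>Basis. (a \<bullet> j * (x \<bullet> j)) *\<^sub>R j) = x * a"
    proof -
      have "inj (\<lambda>j. axis j (1::real) :: real^'n)" by (auto simp: inj_on_def axis_eq_axis)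
      then have "(\<Sum>j\<in>Basis. (a \<bullet> j * (x \<bullet> j)) *\<^sub>R j) = (\<Sum>j\<in>UNIV. (a $ j * x $ j) *\<^sub>R axis j 1)"
        unfolding Basis_cart by (subst sum.reindex) (auto simp: inner_axis)
      also have "\<dots> = x * a"
        using basis_expansion[of "x * a"] by (simp add: scalar_mult_eq_scaleR mult.commute)
      finally show ?thesis .
    qed
    then show ?thesis by simp
  qed
  have "lborel = density (distr lborel borel (\<lambda>x. t + (\<Sum>j\<in>Basis. (a \<bullet> j * (x \<bullet> j)) *\<^sub>R j))) (\<lambda>_. ennreal (\<Prod>j\<in>Basis. \<bar>a \<bullet> j\<bar>))"
    by (rule lborel_affine_euclidean) (use a in \<open>auto simp: Basis_cart inner_axis\<close>)
  then have L: "lborel = density (distr lborel borel (\<lambda>x. x * a + t)) (\<lambda>_. ennreal (\<Prod>j\<in>UNIV. \<bar>a $ j\<bar>))"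
    unfolding T prod_Basis_cart by (simp add: inner_axis)
  have m: "(\<lambda>x. x * a + t) \<in> borel_measurable lborel"
    using borel_measurable_continuous_onI[of "\<lambda>x. x * a + t"] by (simp add: continuous_on_add vec_mult_cont)
  have "(\<integral>x. f x \<partial>lborel) = (\<integral>x. (\<Prod>j\<in>UNIV. \<bar>a $ j\<bar>) *\<^sub>R f x \<partial>distr lborel borel (\<lambda>x. x * a + t))"
    by (subst L, rule integral_density) (use f in \<open>auto intro!: prod_nonneg\<close>)
  also have "\<dots> = (\<Prod>j\<in>UNIV. \<bar>a $ j\<bar>) *\<^sub>R (\<integral>x. f x \<partial>distr lborel borel (\<lambda>x. x * a + t))"
    by simp
  also have "(\<integral>x. f x \<partial>distr lborel borel (\<lambda>x. x * a + t)) = (\<integral>x. f (x * a + t) \<partial>lborel)"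
    by (rule integral_distr) (use m f in auto)
  finally show ?thesis by (simp add: scaleR_conv_of_real)
qed

text \<open>The normalising constant of the mollifier. The type argument carries the dimension,
  which n does not determine.\<close>

definition mass :: "'n::finite itself \<Rightarrow> nat \<Rightarrow> real" where
  "mass _ n = (\<integral>x. Re (boxcut (0::real^'n) (1 / real (Suc n)) x) \<partial>lborel)"

definition moll :: "nat \<Rightarrow> real^'n::finite \<Rightarrow> complex" where
  "moll n x = complex_of_real (1 / mass TYPE('n) n) * boxcut 0 (1 / real (Suc n)) x"

lemma boxcut_Re: "boxcut c r x = complex_of_real (Re (boxcut c r x))" "0 \<le> Re (boxcut c r x)" "Re (boxcut c r x) \<le> 1"
  using boxcut_real[of c r x] by auto

lemma test_cont: "test_fn f \<Longrightarrow> continuous_on S f"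
  by (intro smooth_cont test_smooth)

lemma test_integrable: "test_fn f \<Longrightarrow> integrable lborel f"
  unfolding test_fn_iff using integrable_cc smooth_cont by blast

lemma boxcut_integral_pos:
  fixes c :: "real^'n::finite"
  assumes r: "r > 0" shows "(\<integral>x. Re (boxcut c r x) \<partial>lborel) > 0"
proof -
  let ?l = "\<chi> j. c $ j - r" and ?u = "\<chi> j. c $ j + r"
  have fin: "emeasure lborel (cbox ?l ?u) < top"
    using emeasure_bounded_finite[OF bounded_cbox] by (simp add: less_top)
  have "0 < measure lborel (cbox ?l ?u)"
    using r by (simp add: measure_lborel_cbox_eq Basis_cart inner_axis inner_diff_left, intro prod_pos) (auto simp: inner_axis)
  also have "\<dots> = (\<integral>x. indicator (cbox ?l ?u) x \<partial>lborel)" by simp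
  also have "\<dots> \<le> (\<integral>x. Re (boxcut c r x) \<partial>lborel)"
  proof (rule integral_mono)
    show "integrable lborel (indicator (cbox ?l ?u) :: real^'n \<Rightarrow> real)" using fin by simp
    show "integrable lborel (\<lambda>x. Re (boxcut c r x))"
      using test_integrable[OF test_boxcut[OF r, of c]] by simp
    fix x :: "real^'n"
    show "indicator (cbox ?l ?u) x \<le> Re (boxcut c r x)"
    proof (cases "x \<in> cbox ?l ?u")
      case True
      then have "\<bar>x $ j - c $ j\<bar> \<le> r" for j by (auto simp: mem_box_cart abs_le_iff algebra_simps)
      then have "boxcut c r x = 1" using boxcut_1[OF r] by blast
      then show ?thesis by (simp add: indicator_def)
    qed (use boxcut_Re in auto)
  qed
  finally show ?thesis .
qed

lemma mass_pos: "mass TYPE('n::finite) n > 0"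
  unfolding mass_def by (rule boxcut_integral_pos) simp

lemma test_moll: "test_fn (moll n)"
  unfolding moll_def[abs_def] by (intro test_cmult test_boxcut) simp

lemma moll_norm: "norm (moll n (x::real^'n::finite)) = Re (moll n x)"
  unfolding moll_def using boxcut_Re[of 0 "1 / real (Suc n)" x] mass_pos[where ?'n = 'n, of n]
  by (metis (no_types, lifting) Re_complex_of_real less_imp_le mult_nonneg_nonneg norm_of_real of_real_mult abs_of_nonneg zero_le_divide_1_iff)

lemma moll_int_norm: "(\<integral>x. norm (moll n (x::real^'n::finite)) \<partial>lborel) = 1" "(\<integral>x. moll n (x::real^'n::finite) \<partial>lborel) = 1"
proof -
  have "(\<integral>x. norm (moll n (x::real^'n)) \<partial>lborel) = (\<integral>x. (1 / mass TYPE('n) n) * Re (boxcut (0::real^'n) (1 / real (Suc n)) x) \<partial>lborel)"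
    unfolding moll_norm by (simp add: moll_def)
  also have "\<dots> = (1 / mass TYPE('n) n) * mass TYPE('n) n"
    unfolding mass_def by (rule integral_mult_right_zero)
  finally show 1: "(\<integral>x. norm (moll n (x::real^'n)) \<partial>lborel) = 1" using mass_pos[where ?'n = 'n, of n] by simp
  have eq: "moll n x = complex_of_real (norm (moll n x))" for x :: "real^'n"
  proof -
    obtain b where "boxcut 0 (1 / real (Suc n)) x = complex_of_real b" using boxcut_real by blast
    then show ?thesis unfolding moll_norm unfolding moll_def by (simp del: of_nat_Suc)
  qed
  have "(\<integral>x. moll n (x::real^'n) \<partial>lborel) = (\<integral>x. complex_of_real (norm (moll n (x::real^'n))) \<partial>lborel)"
    by (rule Bochner_Integration.integral_cong[OF refl eq])
  also have "\<dots> = complex_of_real (\<integral>x. norm (moll n (x::real^'n)) \<partial>lborel)"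
    by (rule integral_complex_of_real)
  finally show "(\<integral>x. moll n (x::real^'n) \<partial>lborel) = 1" unfolding 1 by simp
qed

lemma moll_zero: "2 / real (Suc n) \<le> \<bar>x $ j\<bar> \<Longrightarrow> moll n x = 0"
  unfolding moll_def using boxcut_0[of "1 / real (Suc n)" x j 0] by simp

lemma moll_zero_norm:
  fixes x :: "real^'n::finite"
  assumes "norm x \<ge> real CARD('n) * (2 / real (Suc n))" shows "moll n x = 0"
proof (rule ccontr)
  assume "moll n x \<noteq> 0"
  then have "\<bar>x $ j\<bar> < 2 / real (Suc n)" for j using moll_zero[of n x j] by (meson not_less)
  then have "(\<Sum>j\<in>UNIV. \<bar>x $ j\<bar>) < (\<Sum>j\<in>(UNIV::'n set). 2 / real (Suc n))"
    by (intro sum_strict_mono) auto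
  then show False using assms norm_le_l1_cart[of x] by simp
qed

lemma moll_approx:
  fixes c :: "real^'n::finite \<Rightarrow> complex"
  assumes c: "continuous_on UNIV c" and e: "\<And>x. norm x < real CARD('n) * (2 / real (Suc n)) \<Longrightarrow> norm (c x - v) \<le> e"
  shows "norm ((\<integral>x. moll n x * c x \<partial>lborel) - v) \<le> e"
proof -
  let ?R = "real CARD('n) * (2 / real (Suc n))"
  have i: "integrable lborel (\<lambda>x. moll n x * g x)" if "continuous_on UNIV g" for g :: "real^'n \<Rightarrow> complex"
  proof (rule integrable_cc[where R = ?R])
    show "continuous_on UNIV (\<lambda>x. moll n x * g x)" by (intro continuous_on_mult that test_cont test_moll)
    show "moll n x * g x = 0" if "norm x > ?R" for x :: "real^'n" using moll_zero_norm[of n x] that by simp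
  qed
  have "(\<integral>x. moll n x * c x \<partial>lborel) - v = (\<integral>x. moll n x * c x \<partial>lborel) - (\<integral>x. moll n (x::real^'n) \<partial>lborel) * v"
    by (simp add: moll_int_norm)
  also have "(\<integral>x. moll n (x::real^'n) \<partial>lborel) * v = (\<integral>x. moll n (x::real^'n) * v \<partial>lborel)"
    by (rule Bochner_Integration.integral_mult_left_zero[symmetric])
  also have "(\<integral>x. moll n x * c x \<partial>lborel) - (\<integral>x. moll n (x::real^'n) * v \<partial>lborel) = (\<integral>x. moll n x * c x - moll n x * v \<partial>lborel)"
    by (rule Bochner_Integration.integral_diff[symmetric]) (intro i c continuous_on_const)+
  also have "norm \<dots> \<le> (\<integral>x. norm (moll n (x::real^'n)) * e \<partial>lborel)"
  proof (rule Bochner_Integration.integral_norm_bound_integral)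
    show "integrable lborel (\<lambda>x. moll n x * c x - moll n x * v)"
      by (intro Bochner_Integration.integrable_diff i c continuous_on_const)
    show "integrable lborel (\<lambda>x. norm (moll n (x::real^'n)) * e)"
      by (intro integrable_mult_left integrable_norm test_integrable test_moll)
    fix x :: "real^'n"
    have "norm (moll n x * c x - moll n x * v) = norm (moll n x) * norm (c x - v)"
      by (simp add: norm_mult flip: right_diff_distrib)
    also have "\<dots> \<le> norm (moll n x) * e"
      using e[of x] moll_zero_norm[of n x] by (cases "norm x < ?R") (auto intro: mult_left_mono)
    finally show "norm (moll n x * c x - moll n x * v) \<le> norm (moll n x) * e" .
  qed
  also have "\<dots> = e" by (simp add: moll_int_norm)
  finally show ?thesis .
qed

text \<open>Density in the form of an induction principle: a set of distributions that is a linear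
  subspace, sequentially closed, and contains some generators contains everything. Limits enter only
  when they are known to be distributions.\<close>

definition dclosed :: "((real^'n::finite \<Rightarrow> complex) \<Rightarrow> complex) set \<Rightarrow> bool" where
  "dclosed A \<longleftrightarrow> (\<lambda>f. 0) \<in> A \<and> (\<forall>a S R. S \<in> A \<and> R \<in> A \<longrightarrow> (\<lambda>f. a * S f + R f) \<in> A) \<and>
    (\<forall>Ss S. (\<forall>n. Ss n \<in> A) \<and> is_distr S \<and> (\<forall>f. test_fn f \<longrightarrow> (\<lambda>n. Ss n f) \<longlonglongrightarrow> S f) \<longrightarrow> S \<in> A)"

lemma dclosed_lin: "dclosed A \<Longrightarrow> S \<in> A \<Longrightarrow> R \<in> A \<Longrightarrow> (\<lambda>f. a * S f + R f) \<in> A"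
  by (simp add: dclosed_def)

lemma dclosed_lim: "dclosed A \<Longrightarrow> (\<And>n. Ss n \<in> A) \<Longrightarrow> is_distr S \<Longrightarrow> (\<And>f. test_fn f \<Longrightarrow> (\<lambda>n. Ss n f) \<longlonglongrightarrow> S f) \<Longrightarrow> S \<in> A"
  unfolding dclosed_def by blast

lemma dclosed_sum:
  assumes A: "dclosed A" and "finite I" "\<And>i. i \<in> I \<Longrightarrow> S i \<in> A"
  shows "(\<lambda>f. \<Sum>i\<in>I. a i * S i f) \<in> A"
  using assms(2,3)
proof (induction I rule: finite_induct)
  case empty
  then show ?case using A by (simp add: dclosed_def)
next
  case (insert i I)
  have "(\<lambda>f. a i * S i f + (\<Sum>i\<in>I. a i * S i f)) \<in> A"
    by (rule dclosed_lin[OF A]) (use insert in auto)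
  then show ?case using insert by simp
qed

lemma regdist_cont_distr: "continuous_on UNIV h \<Longrightarrow> is_distr (regdist h)"
  by (intro regdist_distr set_integrable_continuous_cball)

text \<open>The translate is written \<open>x * 1 + - y\<close> so that the results on affine
  substitutions x * a + b apply.\<close>

lemma moll_family:
  fixes c :: "real^'n::finite \<Rightarrow> complex"
  assumes "continuous_on UNIV c" "\<And>y. norm y > R \<Longrightarrow> c y = 0" "R \<ge> 0"
  shows "cc_family (\<lambda>y x. c y * moll n (x * 1 + - y)) (R + real CARD('n) * 2)"
proof
  show "cfam (\<lambda>y x. c y * moll n (x * 1 + - y))"
    by (intro cfam_scale assms cfam_affine test_smooth test_moll continuous_intros)
  fix y x :: "real^'n"
  show "c y * moll n (x * 1 + - y) = 0" if "norm y > R + real CARD('n) * 2" using that assms(2)[of y] by simp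
  show "c y * moll n (x * 1 + - y) = 0" if x: "norm x > R + real CARD('n) * 2"
  proof (cases "norm y > R")
    case False
    have "norm x \<le> norm (x - y) + norm y" by (metis norm_triangle_ineq diff_add_cancel)
    then have "norm (x - y) \<ge> real CARD('n) * 2" using False x by linarith
    moreover have "real CARD('n) * (2 / real (Suc n)) \<le> real CARD('n) * 2"
      by (intro mult_left_mono) (auto simp: divide_le_eq)
    ultimately show ?thesis using moll_zero_norm[where x = "x - y" and n = n] by simp
  qed (use assms in auto)
qed

lemma moll_conv_D:
  fixes f :: "real^'n::finite \<Rightarrow> complex"
  assumes f: "test_fn f"
  shows "D_conv (\<lambda>n x. \<integral>y. f y * moll n (x * 1 + - y) \<partial>lborel) f"
proof -
  obtain R0 where R0: "\<And>x. norm x > R0 \<Longrightarrow> f x = 0" using f unfolding test_fn_iff by auto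
  define R where "R = max R0 0"
  have R: "\<And>x. norm x > R \<Longrightarrow> f x = 0" "R \<ge> 0" using R0 by (auto simp: R_def)
  note cf = smooth_cont[OF test_smooth[OF f]]
  interpret A: cc_family "\<lambda>y x. f y * moll n (x * 1 + - y)" "R + real CARD('n) * 2" for n
    by (rule moll_family[OF cf R])
  \<comment> \<open>The same convolution with the roles exchanged: in this form derivatives fall on
    f, whose derivatives are uniformly continuous, while the form above keeps y in f and lets S act
    on translates of the mollifier.\<close>
  interpret B: cc_family "\<lambda>z x. moll n z * f (x * 1 + - z)" "R + real CARD('n) * 2" for n
  proof
    show "cfam (\<lambda>z x. moll n z * f (x * 1 + - z))"
      by (intro cfam_scale cfam_affine test_smooth f smooth_cont[OF test_smooth[OF test_moll]] continuous_intros)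
    fix y x :: "real^'n"
    have le: "real CARD('n) * (2 / real (Suc n)) \<le> real CARD('n) * 2"
      by (intro mult_left_mono) (auto simp: divide_le_eq)
    show "moll n y * f (x * 1 + - y) = 0" if "norm y > R + real CARD('n) * 2"
      using that le R moll_zero_norm[of n y] by simp
    show "moll n y * f (x * 1 + - y) = 0" if x: "norm x > R + real CARD('n) * 2"
    proof (cases "norm y \<ge> real CARD('n) * 2")
      case True
      then show ?thesis using le moll_zero_norm[of n y] by simp
    next
      case False
      have "norm x \<le> norm (x - y) + norm y" by (metis norm_triangle_ineq diff_add_cancel)
      then have "norm (x - y) > R" using False x by linarith
      then show ?thesis using R by simp
    qed
  qed
  have eq: "(\<integral>y. f y * moll n (x * 1 + - y) \<partial>lborel) = (\<integral>z. moll n z * f (x * 1 + - z) \<partial>lborel)" for n x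
  proof -
    have "(\<integral>y. f y * moll n (x * 1 + - y) \<partial>lborel) = complex_of_real (\<Prod>j\<in>(UNIV::'n set). \<bar>(-1::real^'n) $ j\<bar>) *
        (\<integral>z. f (z * (-1) + x) * moll n (x * 1 + - (z * (-1) + x)) \<partial>lborel)"
      by (rule integral_affine_cart)
        (auto intro!: borel_measurable_continuous_onI continuous_on_mult cf continuous_on_compose2[OF test_cont[OF test_moll, of UNIV]] continuous_on_diff continuous_on_const continuous_on_id)
    then show ?thesis by (simp add: mult.commute algebra_simps)
  qed
  show ?thesis
    unfolding D_conv_iff
  proof (intro conjI allI impI f A.int_test)
    show "\<exists>R. \<forall>n x. norm x > R \<longrightarrow> (\<integral>y. f y * moll n (x * 1 + - y) \<partial>lborel) = 0"
      by (intro exI[of _ "R + real CARD('n) * 2"] allI impI) (simp only: A.zx Bochner_Integration.integral_zero)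
    fix js and e :: real assume e: "e > 0"
    have "uniformly_continuous_on UNIV (iterpd js f)" by (intro test_uniform_cont test_iterpd f)
    then obtain d where d: "d > 0" "\<And>x y. norm (y - x) < d \<Longrightarrow> norm (iterpd js f y - iterpd js f x) < e / 2"
      using e unfolding uniformly_continuous_on_def dist_norm by (metis UNIV_I half_gt_zero)
    have "(\<lambda>n. real CARD('n) * 2 / real (Suc n)) \<longlonglongrightarrow> 0" by (rule LIMSEQ_Suc[OF lim_const_over_n])
    from LIMSEQ_D[OF this d(1)] obtain N where N: "\<And>n. n \<ge> N \<Longrightarrow> norm (real CARD('n) * 2 / real (Suc n) - 0) < d" by blast
    have "norm (iterpd js (\<lambda>x. \<integral>y. f y * moll n (x * 1 + - y) \<partial>lborel) x - iterpd js f x) < e" if n: "n \<ge> N" for n x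
    proof -
      have "iterpd js (\<lambda>x. \<integral>y. f y * moll n (x * 1 + - y) \<partial>lborel) x = (\<integral>z. moll n z * iterpd js f (x - z) \<partial>lborel)"
      proof -
        have "cw js (1::real^'n) = 1" by (induction js) auto
        then have "iterpd js (\<lambda>x. moll n z * f (x * 1 + - z)) x = moll n z * iterpd js f (x - z)" for z
          by (subst iterpd_cmult) (simp_all only: smooth_affine iterpd_affine test_smooth f, simp)
        then show ?thesis unfolding eq B.iterpd_int by simp
      qed
      moreover have "norm ((\<integral>z. moll n z * iterpd js f (x - z) \<partial>lborel) - iterpd js f x) \<le> e / 2"
      proof (rule moll_approx)
        show "continuous_on UNIV (\<lambda>z. iterpd js f (x - z))"
          by (intro continuous_on_compose2[OF smooth_cont[OF smooth_iterpd[OF test_smooth[OF f]], of UNIV]] continuous_intros) auto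
        fix z :: "real^'n" assume "norm z < real CARD('n) * (2 / real (Suc n))"
        then have "norm ((x - z) - x) < d" using N[OF n] by (simp add: norm_minus_commute)
        then show "norm (iterpd js f (x - z) - iterpd js f x) \<le> e / 2" using d(2) less_imp_le by blast
      qed
      ultimately show ?thesis using e by simp
    qed
    then show "\<exists>N. \<forall>n\<ge>N. \<forall>x. norm (iterpd js (\<lambda>x. \<integral>y. f y * moll n (x * 1 + - y) \<partial>lborel) x - iterpd js f x) < e" by blast
  qed
qed

text \<open>The translates of the mollifier are not compactly supported in the parameter y.
  Continuity being local, a cut-off equal to 1 near the point p makes them a
  \<open>cc_family\<close> without changing them near p.\<close>

lemma moll_distr_cont:
  fixes S :: "(real^'n::finite \<Rightarrow> complex) \<Rightarrow> complex"
  assumes S: "is_distr S" shows "continuous_on UNIV (\<lambda>y. S (\<lambda>x. moll n (x * 1 + - y)))"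
proof -
  have "isCont (\<lambda>y. S (\<lambda>x. moll n (x * 1 + - y))) p" for p
  proof -
    have tb: "test_fn (boxcut p 1)" by (rule test_boxcut) simp
    then obtain R0 where R0: "\<And>x. norm x > R0 \<Longrightarrow> boxcut p 1 x = 0" unfolding test_fn_iff by auto
    interpret A: cc_family "\<lambda>y x. boxcut p 1 y * moll n (x * 1 + - y)" "max R0 0 + real CARD('n) * 2"
      by (rule moll_family) (use smooth_cont[OF test_smooth[OF tb]] R0 in auto)
    have "continuous_on UNIV (\<lambda>y. S (\<lambda>x. boxcut p 1 y * moll n (x * 1 + - y)))"
      by (rule A.distr_family_cont[OF S])
    then have c: "isCont (\<lambda>y. S (\<lambda>x. boxcut p 1 y * moll n (x * 1 + - y))) p"
      by (simp add: continuous_on_eq_continuous_at)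
    have "eventually (\<lambda>y. y \<in> ball p 1) (nhds p)" by (rule eventually_nhds_in_open) auto
    then have "eventually (\<lambda>y. S (\<lambda>x. moll n (x * 1 + - y)) = S (\<lambda>x. boxcut p 1 y * moll n (x * 1 + - y))) (nhds p)"
    proof (rule eventually_mono)
      fix y assume "y \<in> ball p 1"
      then have "norm (y - p) \<le> 1" by (simp add: dist_norm norm_minus_commute)
      then have "\<bar>(y - p) $ j\<bar> \<le> 1" for j using component_le_norm_cart order_trans by blast
      then have "boxcut p 1 y = 1" by (intro boxcut_1) auto
      then show "S (\<lambda>x. moll n (x * 1 + - y)) = S (\<lambda>x. boxcut p 1 y * moll n (x * 1 + - y))" by simp
    qed
    then show ?thesis using isCont_cong[of "\<lambda>y. S (\<lambda>x. moll n (x * 1 + - y))"] c by simp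
  qed
  then show ?thesis by (simp add: continuous_at_imp_continuous_on)
qed

text \<open>By Fubini, pairing the regularised S with f is S applied to the mollified f, which
  converges to f in D.\<close>

lemma moll_distr_tendsto:
  fixes S :: "(real^'n::finite \<Rightarrow> complex) \<Rightarrow> complex"
  assumes S: "is_distr S" and f: "test_fn f"
  shows "(\<lambda>n. regdist (\<lambda>y. S (\<lambda>x. moll n (x * 1 + - y))) f) \<longlonglongrightarrow> S f"
proof -
  obtain R0 where R0: "\<And>x. norm x > R0 \<Longrightarrow> f x = 0" using f unfolding test_fn_iff by auto
  define R where "R = max R0 0"
  have R: "\<And>x. norm x > R \<Longrightarrow> f x = 0" "R \<ge> 0" using R0 by (auto simp: R_def)
  interpret A: cc_family "\<lambda>y x. f y * moll n (x * 1 + - y)" "R + real CARD('n) * 2" for n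
    by (rule moll_family[OF smooth_cont[OF test_smooth[OF f]] R])
  have "regdist (\<lambda>y. S (\<lambda>x. moll n (x * 1 + - y))) f = S (\<lambda>x. \<integral>y. f y * moll n (x * 1 + - y) \<partial>lborel)" for n
  proof -
    have "S (\<lambda>x. f y * moll n (x * 1 + - y)) = f y * S (\<lambda>x. moll n (x * 1 + - y))" for y
      by (intro distr_cmult S test_affine test_moll) simp
    then show ?thesis using f by (simp only: A.distr_fubini[OF S]) (simp add: regdist_def mult.commute)
  qed
  then show ?thesis using distr_conv[OF S moll_conv_D[OF f]] by simp
qed

lemma dense_regdist:
  assumes A: "dclosed A" and h: "\<And>h. continuous_on UNIV h \<Longrightarrow> regdist h \<in> A" and S: "is_distr S"
  shows "S \<in> A"
  by (rule dclosed_lim[OF A h[OF moll_distr_cont[OF S]] S moll_distr_tendsto[OF S]])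

text \<open>Three layers: Riemann sums reach the continuous densities of compact support, cut-offs
  reach all continuous densities, mollification reaches all distributions.\<close>

lemma dense_delta:
  fixes A :: "((real^'n::finite \<Rightarrow> complex) \<Rightarrow> complex) set"
  assumes A: "dclosed A" and d: "\<And>p. delta p \<in> A" and S: "is_distr S"
  shows "S \<in> A"
proof (rule dense_regdist[OF A _ S])
  fix h :: "real^'n \<Rightarrow> complex" assume h: "continuous_on UNIV h"
  have cs: "regdist k \<in> A" if k: "continuous_on UNIV k" "\<And>y. norm y > R \<Longrightarrow> k y = 0" for k R
  proof (rule dclosed_lim[OF A _ regdist_cont_distr[OF k(1)]])
    let ?R = "R + real DIM(real^'n)"
    show "(\<lambda>f. \<Sum>p\<in>grid m ` cball 0 ?R. (wt m ?R p * k p) * delta p f) \<in> A" for m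
      by (rule dclosed_sum[OF A finite_grid d])
    fix f :: "real^'n \<Rightarrow> complex" assume f: "test_fn f"
    have "(\<lambda>m. \<Sum>p\<in>grid m ` cball 0 ?R. wt m ?R p * (k p * f p)) \<longlonglongrightarrow> (\<integral>y. k y * f y \<partial>lborel)"
      by (rule riemann_sum[OF continuous_on_mult[OF k(1) test_cont[OF f]]]) (simp add: k)
    then show "(\<lambda>m. \<Sum>p\<in>grid m ` cball 0 ?R. (wt m ?R p * k p) * delta p f) \<longlonglongrightarrow> regdist k f"
      using f by (simp add: regdist_def delta_def mult.assoc)
  qed
  show "regdist h \<in> A"
  proof (rule dclosed_lim[OF A _ regdist_cont_distr[OF h]])
    fix n
    have t: "test_fn (boxcut (0::real^'n) (real (Suc n)))" by (rule test_boxcut) simp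
    then obtain R where R: "\<And>x. norm x > R \<Longrightarrow> boxcut (0::real^'n) (real (Suc n)) x = 0" unfolding test_fn_iff by auto
    show "regdist (\<lambda>x. h x * boxcut 0 (real (Suc n)) x) \<in> A"
      by (rule cs[where R = R, OF continuous_on_mult[OF h test_cont[OF t]]]) (simp add: R del: of_nat_Suc)
  next
    fix f :: "real^'n \<Rightarrow> complex" assume f: "test_fn f"
    then obtain R where R: "\<And>x. norm x > R \<Longrightarrow> f x = 0" unfolding test_fn_iff by auto
    obtain N where N: "real N \<ge> R" using real_arch_simple by blast
    have "regdist (\<lambda>x. h x * boxcut 0 (real (Suc n)) x) f = regdist h f" if "n \<ge> N" for n
    proof -
      have "h x * boxcut 0 (real (Suc n)) x * f x = h x * f x" for x
      proof (cases "norm x > R")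
        case False
        then have "\<bar>x $ j\<bar> \<le> real (Suc n)" for j
          using component_le_norm_cart[of x j] N that by linarith
        then show ?thesis using boxcut_1[of "real (Suc n)" x 0] by simp
      qed (use R in simp)
      then show ?thesis unfolding regdist_def by presburger
    qed
    then show "(\<lambda>n. regdist (\<lambda>x. h x * boxcut 0 (real (Suc n)) x) f) \<longlonglongrightarrow> regdist h f"
      by (intro tendsto_eventually eventually_sequentiallyI[of N]) auto
  qed
qed

inductive_set polyspan :: "(real^'n::finite \<Rightarrow> real) set" where
  polyspan_mono: "(\<lambda>x. \<Prod>j\<in>UNIV. (x $ j) ^ (\<alpha> j)) \<in> polyspan"
| polyspan_lin: "f \<in> polyspan \<Longrightarrow> g \<in> polyspan \<Longrightarrow> (\<lambda>x. a * f x + g x) \<in> polyspan"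

lemma polyspan_const: "(\<lambda>x. c) \<in> polyspan"
  using polyspan_lin[OF polyspan_mono[of "\<lambda>_. 0"] polyspan_mono[of "\<lambda>_. 0"], of "c - 1"] by simp

lemma polyspan_mult: "f \<in> polyspan \<Longrightarrow> g \<in> polyspan \<Longrightarrow> (\<lambda>x. f x * g x) \<in> polyspan"
proof (induction arbitrary: g rule: polyspan.induct)
  case (polyspan_mono \<alpha>)
  then show ?case
  proof (induction rule: polyspan.induct)
    case (polyspan_mono \<beta>)
    then show ?case using polyspan.polyspan_mono[of "\<lambda>j. \<alpha> j + \<beta> j"] by (simp add: power_add prod.distrib)
  next
    case (polyspan_lin f g a)
    then show ?case using polyspan.polyspan_lin[OF polyspan_lin.IH, of a] by (simp add: algebra_simps)
  qed
next
  case (polyspan_lin f h a)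
  then show ?case using polyspan.polyspan_lin[OF polyspan_lin.IH, of g g a] by (simp add: algebra_simps)
qed

lemma polyspan_sum: "(\<And>i. i \<in> I \<Longrightarrow> f i \<in> polyspan) \<Longrightarrow> (\<lambda>x. \<Sum>i\<in>I. a i * f i x) \<in> polyspan"
proof (induction I rule: infinite_finite_induct)
  case (insert i I)
  then show ?case using polyspan_lin[of "f i" "\<lambda>x. \<Sum>i\<in>I. a i * f i x" "a i"] by auto
qed (auto intro: polyspan_const)

lemma polyspan_coord: "(\<lambda>x. x $ j) \<in> polyspan"
proof -
  have "(\<Prod>i\<in>UNIV. (x $ i) ^ (if i = j then 1 else 0)) = x $ j" for x :: "real^'a"
    by (subst prod.remove[of _ j]) (auto intro!: prod.neutral)
  then show ?thesis using polyspan_mono[of "\<lambda>i. if i = j then 1 else 0"] by simp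
qed

lemma polyspan_real_polynomial: "real_polynomial_function f \<Longrightarrow> f \<in> polyspan"
proof (induction rule: real_polynomial_function.induct)
  case (linear f)
  interpret bounded_linear f by fact
  have "f x = (\<Sum>j\<in>UNIV. f (axis j 1) * x $ j)" for x
  proof -
    have "f x = f (\<Sum>j\<in>UNIV. (x $ j) *\<^sub>R axis j 1)"
      using basis_expansion[of x] by (simp add: scalar_mult_eq_scaleR)
    then show ?thesis by (simp add: sum scale mult.commute)
  qed
  moreover have "(\<lambda>x. \<Sum>j\<in>UNIV. f (axis j 1) * x $ j) \<in> polyspan" by (intro polyspan_sum polyspan_coord)
  moreover have eq: "f = (\<lambda>x. \<Sum>j\<in>UNIV. f (axis j 1) * x $ j)" using calculation(1) by (rule ext)
  ultimately show ?case by (subst eq)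
next
  case (add f g)
  then show ?case using polyspan_lin[of f g 1] by simp
qed (auto intro: polyspan_const polyspan_mult)

lemma polyspan_cont: "f \<in> polyspan \<Longrightarrow> continuous_on S f"
  by (induction rule: polyspan.induct) (auto intro!: continuous_intros)

lemma regdist_lin:
  assumes "continuous_on UNIV f" "continuous_on UNIV g"
  shows "regdist (\<lambda>x. a * f x + g x) = (\<lambda>h. a * regdist f h + regdist g h)"
proof
  fix h
  show "regdist (\<lambda>x. a * f x + g x) h = a * regdist f h + regdist g h"
  proof (cases "test_fn h")
    case True
    then obtain R where R: "\<And>x. norm x > R \<Longrightarrow> h x = 0" unfolding test_fn_iff by auto
    have i: "integrable lborel (\<lambda>x. k x * h x)" if "continuous_on UNIV k" for k
      by (rule integrable_cc[where R = R, OF continuous_on_mult[OF that test_cont[OF True]]]) (simp add: R)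
    have "(\<integral>x. (a * f x + g x) * h x \<partial>lborel) = (\<integral>x. a * (f x * h x) + g x * h x \<partial>lborel)"
      by (simp add: algebra_simps)
    also have "\<dots> = a * (\<integral>x. f x * h x \<partial>lborel) + (\<integral>x. g x * h x \<partial>lborel)"
      using i[OF assms(1)] i[OF assms(2)] by simp
    finally show ?thesis using True by (simp add: regdist_def)
  qed (simp add: regdist_def)
qed

text \<open>Stone-Weierstrass on growing balls: polynomial number n is within 2 / (n+1) of h on the
  ball of radius n. It is uncontrolled outside, but a given test function lives on a fixed ball.
  Real and imaginary parts are approximated separately.\<close>

lemma dense_monomial:
  fixes A :: "((real^'n::finite \<Rightarrow> complex) \<Rightarrow> complex) set"
  assumes A: "dclosed A" and m: "\<And>\<alpha>. monomial \<alpha> \<in> A" and S: "is_distr S"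
  shows "S \<in> A"
proof (rule dense_regdist[OF A _ S])
  fix h :: "real^'n \<Rightarrow> complex" assume h: "continuous_on UNIV h"
  have poly: "regdist (\<lambda>x. complex_of_real (f x)) \<in> A" if "f \<in> polyspan" for f
    using that
  proof (induction rule: polyspan.induct)
    case (polyspan_mono \<alpha>)
    then show ?case using m[of \<alpha>] by (simp add: monomial_def)
  next
    case (polyspan_lin f g a)
    have "regdist (\<lambda>x. complex_of_real a * complex_of_real (f x) + complex_of_real (g x)) =
       (\<lambda>h. complex_of_real a * regdist (\<lambda>x. complex_of_real (f x)) h + regdist (\<lambda>x. complex_of_real (g x)) h)"
      by (intro regdist_lin continuous_intros polyspan_cont polyspan_lin)
    then show ?case using dclosed_lin[OF A polyspan_lin.IH, of "complex_of_real a"] by simp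
  qed
  have ex: "\<exists>p\<in>polyspan. \<forall>x\<in>cball 0 R. \<bar>k x - p x\<bar> < e" if k: "continuous_on UNIV k" "e > 0" for k :: "real^'n \<Rightarrow> real" and e R
  proof -
    obtain g where "real_polynomial_function g" "\<And>x. x \<in> cball 0 R \<Longrightarrow> \<bar>k x - g x\<bar> < e"
      by (rule Stone_Weierstrass_real_polynomial_function[of "cball 0 R" k e])
        (use k in \<open>auto intro: continuous_on_subset\<close>)
    then show ?thesis using polyspan_real_polynomial by blast
  qed
  have "\<exists>p q. p \<in> polyspan \<and> q \<in> polyspan \<and> (\<forall>x\<in>cball 0 (real n). norm (h x - (\<i> * complex_of_real (q x) + complex_of_real (p x))) \<le> 2 / real (Suc n))" for n
  proof -
    have "continuous_on UNIV (\<lambda>x. Re (h x))" "continuous_on UNIV (\<lambda>x. Im (h x))" by (intro continuous_intros h)+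
    then obtain p q where p: "p \<in> polyspan" "\<forall>x\<in>cball 0 (real n). \<bar>Re (h x) - p x\<bar> < 1 / real (Suc n)"
      and q: "q \<in> polyspan" "\<forall>x\<in>cball 0 (real n). \<bar>Im (h x) - q x\<bar> < 1 / real (Suc n)"
      using ex[of "\<lambda>x. Re (h x)" "1 / real (Suc n)" "real n"] ex[of "\<lambda>x. Im (h x)" "1 / real (Suc n)" "real n"] by auto
    have "norm (h x - (\<i> * complex_of_real (q x) + complex_of_real (p x))) \<le> 2 / real (Suc n)" if x: "x \<in> cball 0 (real n)" for x
    proof -
      have "norm (h x - (\<i> * complex_of_real (q x) + complex_of_real (p x))) \<le> \<bar>Re (h x) - p x\<bar> + \<bar>Im (h x) - q x\<bar>"
        using cmod_le[of "h x - (\<i> * complex_of_real (q x) + complex_of_real (p x))"] by simp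
      also have "\<dots> \<le> 1 / real (Suc n) + 1 / real (Suc n)" using p q x by (intro add_mono) (auto intro: less_imp_le)
      finally show ?thesis by simp
    qed
    then show ?thesis using p q by blast
  qed
  then obtain p q where pq: "\<And>n. p n \<in> polyspan" "\<And>n. q n \<in> polyspan"
    "\<And>n x. x \<in> cball 0 (real n) \<Longrightarrow> norm (h x - (\<i> * complex_of_real (q n x) + complex_of_real (p n x))) \<le> 2 / real (Suc n)"
    by metis
  let ?k = "\<lambda>n x. \<i> * complex_of_real (q n x) + complex_of_real (p n x)"
  have ck: "continuous_on UNIV (?k n)" for n by (intro continuous_intros polyspan_cont pq)
  show "regdist h \<in> A"
  proof (rule dclosed_lim[OF A _ regdist_cont_distr[OF h]])
    fix n
    have "regdist (?k n) = (\<lambda>f. \<i> * regdist (\<lambda>x. complex_of_real (q n x)) f + regdist (\<lambda>x. complex_of_real (p n x)) f)"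
      by (intro regdist_lin continuous_intros polyspan_cont pq)
    then show "regdist (?k n) \<in> A" using dclosed_lin[OF A poly poly, OF pq(2) pq(1)] by simp
  next
    fix f :: "real^'n \<Rightarrow> complex" assume f: "test_fn f"
    then obtain R where R: "\<And>x. norm x > R \<Longrightarrow> f x = 0" unfolding test_fn_iff by auto
    obtain N where N: "real N \<ge> R" using real_arch_simple by blast
    have i: "integrable lborel (\<lambda>x. k x * f x)" if "continuous_on UNIV k" for k
      by (rule integrable_cc[where R = R, OF continuous_on_mult[OF that test_cont[OF f]]]) (simp add: R)
    define B where "B = (\<integral>x. norm (f x) \<partial>lborel)"
    have est: "norm (regdist (?k n) f - regdist h f) \<le> 2 * B / real (Suc n)" if n: "n \<ge> N" for n
    proof -
      have "regdist (?k n) f - regdist h f = (\<integral>x. ?k n x * f x - h x * f x \<partial>lborel)"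
        using f i[OF ck] i[OF h] by (simp add: regdist_def)
      also have "norm \<dots> \<le> (\<integral>x. 2 / real (Suc n) * norm (f x) \<partial>lborel)"
      proof (rule Bochner_Integration.integral_norm_bound_integral)
        show "integrable lborel (\<lambda>x. ?k n x * f x - h x * f x)"
          by (rule Bochner_Integration.integrable_diff[OF i[OF ck] i[OF h]])
        show "integrable lborel (\<lambda>x. 2 / real (Suc n) * norm (f x))"
          by (intro Bochner_Integration.integrable_mult_right integrable_norm test_integrable f)
        fix x :: "real^'n"
        have "norm (?k n x * f x - h x * f x) = norm (h x - ?k n x) * norm (f x)"
          by (metis norm_mult left_diff_distrib norm_minus_commute)
        also have "\<dots> \<le> 2 / real (Suc n) * norm (f x)"
        proof (cases "norm x > R")
          case False
          then have "x \<in> cball 0 (real n)" using N n by simp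
          then show ?thesis using pq(3) by (intro mult_right_mono) auto
        qed (use R in simp)
        finally show "norm (?k n x * f x - h x * f x) \<le> 2 / real (Suc n) * norm (f x)" .
      qed
      also have "\<dots> = 2 * B / real (Suc n)" by (simp add: B_def)
      finally show ?thesis .
    qed
    have "(\<lambda>n. 2 * B / real (Suc n)) \<longlonglongrightarrow> 0" by (rule LIMSEQ_Suc[OF lim_const_over_n])
    then have "(\<lambda>n. norm (regdist (?k n) f - regdist h f)) \<longlonglongrightarrow> 0"
      by (rule tendsto_sandwich[OF _ _ tendsto_const, rotated 2])
        (use est in \<open>auto intro!: eventually_sequentiallyI[of N] simp del: of_nat_Suc\<close>)
    then show "(\<lambda>n. regdist (?k n) f) \<longlonglongrightarrow> regdist h f"
      by (simp add: tendsto_norm_zero_iff LIM_zero_iff)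
  qed
qed


subsection \<open>Completeness and uniform boundedness\<close>

lemma uniform_Cauchy_limit:
  fixes g :: "nat \<Rightarrow> 'a \<Rightarrow> complex"
  assumes "\<And>e. e > 0 \<Longrightarrow> \<exists>N. \<forall>m\<ge>N. \<forall>n\<ge>N. \<forall>x. norm (g m x - g n x) < e"
  shows "\<And>x. (\<lambda>n. g n x) \<longlonglongrightarrow> lim (\<lambda>n. g n x)"
    and "\<And>e. e > 0 \<Longrightarrow> \<exists>N. \<forall>n\<ge>N. \<forall>x. norm (g n x - lim (\<lambda>n. g n x)) < e"
proof -
  have "Cauchy (\<lambda>n. g n x)" for x
  proof (rule CauchyI)
    fix e :: real assume "0 < e"
    from assms[OF this] show "\<exists>M. \<forall>m\<ge>M. \<forall>n\<ge>M. norm (g m x - g n x) < e" by blast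
  qed
  then show l: "(\<lambda>n. g n x) \<longlonglongrightarrow> lim (\<lambda>n. g n x)" for x
    by (simp add: Cauchy_convergent_iff convergent_LIMSEQ_iff)
  fix e :: real assume e: "e > 0"
  then obtain N where N: "\<And>m n x. m \<ge> N \<Longrightarrow> n \<ge> N \<Longrightarrow> norm (g m x - g n x) < e / 2"
    using assms[of "e/2"] by auto
  have "norm (g n x - lim (\<lambda>n. g n x)) < e" if "n \<ge> N" for n x
  proof -
    have "(\<lambda>m. norm (g n x - g m x)) \<longlonglongrightarrow> norm (g n x - lim (\<lambda>n. g n x))"
      by (intro tendsto_norm tendsto_diff tendsto_const l)
    then have "norm (g n x - lim (\<lambda>n. g n x)) \<le> e / 2"
      by (rule Lim_bounded[of _ _ N]) (use N that less_imp_le in blast)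
    then show ?thesis using e by simp
  qed
  then show "\<exists>N. \<forall>n\<ge>N. \<forall>x. norm (g n x - lim (\<lambda>n. g n x)) < e" by blast
qed

text \<open>All iterated derivatives converge uniformly. Along each line, the theorem on
  differentiating sequences identifies the limit of the \<open>j # js\<close> derivatives as the
  j-derivative of the limit for \<open>js\<close>.\<close>

lemma D_complete:
  fixes fs :: "nat \<Rightarrow> real^'n::finite \<Rightarrow> complex"
  assumes t: "\<And>n. test_fn (fs n)" and R: "\<And>n x. norm x > R \<Longrightarrow> fs n x = 0"
    and c: "\<And>js e. e > 0 \<Longrightarrow> \<exists>N. \<forall>m\<ge>N. \<forall>n\<ge>N. \<forall>x. norm (iterpd js (fs m) x - iterpd js (fs n) x) < e"
  shows "D_conv fs (\<lambda>x. lim (\<lambda>n. fs n x))"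
proof -
  define g where "g js x = lim (\<lambda>n. iterpd js (fs n) x)" for js x
  have gl: "(\<lambda>n. iterpd js (fs n) x) \<longlonglongrightarrow> g js x" for js x
    unfolding g_def by (rule uniform_Cauchy_limit(1)[OF c])
  have gu: "\<exists>N. \<forall>n\<ge>N. \<forall>x. norm (iterpd js (fs n) x - g js x) < e" if "e > 0" for js e
    unfolding g_def by (rule uniform_Cauchy_limit(2)[OF c that])
  have hp: "hpd j (g js) (g (j # js) x) x" for j js x
  proof -
    have "\<exists>G. \<forall>t\<in>UNIV. (\<lambda>n. iterpd js (fs n) (x + t *\<^sub>R axis j 1)) \<longlonglongrightarrow> G t \<and>
       (G has_derivative (\<lambda>h. h *\<^sub>R g (j # js) (x + t *\<^sub>R axis j 1))) (at t within UNIV)"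
    proof (rule has_derivative_sequence[where f' = "\<lambda>n t h. h *\<^sub>R iterpd (j # js) (fs n) (x + t *\<^sub>R axis j 1)" and ?x0.0 = 0])
      show "((\<lambda>t. iterpd js (fs n) (x + t *\<^sub>R axis j 1)) has_derivative (\<lambda>h. h *\<^sub>R iterpd (j # js) (fs n) (x + t *\<^sub>R axis j 1))) (at t within UNIV)" for n t
        unfolding has_vector_derivative_def[symmetric] iterpd.simps
        by (rule hpd_line) (intro smooth_hpd smooth_iterpd test_smooth t)
      show "\<forall>\<^sub>F n in sequentially. \<forall>t\<in>UNIV. \<forall>h. norm (h *\<^sub>R iterpd (j # js) (fs n) (x + t *\<^sub>R axis j 1) - h *\<^sub>R g (j # js) (x + t *\<^sub>R axis j 1)) \<le> e * norm h"
        if e: "e > 0" for e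
      proof -
        obtain N where N: "\<forall>n\<ge>N. \<forall>x. norm (iterpd (j # js) (fs n) x - g (j # js) x) < e" using gu[OF e] by blast
        have "norm (h *\<^sub>R iterpd (j # js) (fs n) y - h *\<^sub>R g (j # js) y) \<le> e * norm h" if "n \<ge> N" for n h y
        proof -
          have "norm (h *\<^sub>R iterpd (j # js) (fs n) y - h *\<^sub>R g (j # js) y) = \<bar>h\<bar> * norm (iterpd (j # js) (fs n) y - g (j # js) y)"
            by (metis norm_scaleR scaleR_diff_right)
          also have "\<dots> \<le> \<bar>h\<bar> * e"
            by (rule mult_left_mono[OF less_imp_le]) (use N that in blast, simp)
          finally show ?thesis by (simp add: mult.commute)
        qed
        then show ?thesis by (intro eventually_sequentiallyI[of N]) blast
      qed
      show "(\<lambda>n. iterpd js (fs n) (x + 0 *\<^sub>R axis j 1)) \<longlonglongrightarrow> g js x" using gl by simp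
    qed auto
    then obtain G where G0: "\<forall>t\<in>UNIV. (\<lambda>n. iterpd js (fs n) (x + t *\<^sub>R axis j 1)) \<longlonglongrightarrow> G t \<and>
       (G has_derivative (\<lambda>h. h *\<^sub>R g (j # js) (x + t *\<^sub>R axis j 1))) (at t within UNIV)" by blast
    then have G: "\<And>t. (\<lambda>n. iterpd js (fs n) (x + t *\<^sub>R axis j 1)) \<longlonglongrightarrow> G t"
       "(G has_derivative (\<lambda>h. h *\<^sub>R g (j # js) (x + 0 *\<^sub>R axis j 1))) (at 0)" by blast+
    have "G = (\<lambda>t. g js (x + t *\<^sub>R axis j 1))" using LIMSEQ_unique[OF G(1) gl] by blast
    then show ?thesis using G(2) by (simp add: hpd_def has_vector_derivative_def)
  qed
  have cont: "continuous_on UNIV (g js)" for js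
  proof (rule uniform_limit_theorem[of _ "\<lambda>n. iterpd js (fs n)" sequentially])
    show "\<forall>\<^sub>F n in sequentially. continuous_on UNIV (iterpd js (fs n))"
      by (intro always_eventually allI smooth_cont smooth_iterpd test_smooth t)
    show "uniform_limit UNIV (\<lambda>n. iterpd js (fs n)) (g js) sequentially"
      unfolding uniform_limit_iff eventually_sequentially dist_norm using gu by blast
  qed simp
  have sm: "smooth_fn (g [])"
  proof (rule smooth_coinduct[where P = "range g"])
    fix f and j :: 'n assume "f \<in> range g"
    then obtain js where "f = g js" by auto
    then show "continuous_on UNIV f" "\<exists>h\<in>range g. \<forall>x. hpd j f (h x) x"
      using cont hp by (simp, blast)
  qed auto
  have it: "iterpd js (g []) = g js" for js
  proof (induction js)
    case (Cons j js)
    then show ?case using hp[THEN hpd_pd, of j js] by auto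
  qed auto
  have "g [] x = 0" if "norm x > R" for x
    using gl[of "[]" x] R[OF that] by (simp add: LIMSEQ_const_iff)
  then have "D_conv fs (g [])"
    unfolding D_conv_iff it test_fn_iff[of "g []"] using t R gu sm by blast
  then show ?thesis by (simp add: g_def[abs_def])
qed

section \<open>Seminorms on test functions and the uniform boundedness principle\<close>

definition dbound :: "nat \<Rightarrow> real \<Rightarrow> (real^'n::finite \<Rightarrow> complex) \<Rightarrow> bool" where
  "dbound m e f \<longleftrightarrow> (\<forall>js x. length js \<le> m \<longrightarrow> norm (iterpd js f x) \<le> e)"

lemma dbound_mono: "dbound m e f \<Longrightarrow> m' \<le> m \<Longrightarrow> e \<le> e' \<Longrightarrow> dbound m' e' f"
  unfolding dbound_def by (meson order_trans)

lemma dbound_nonneg: "dbound m e f \<Longrightarrow> 0 \<le> e"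
  unfolding dbound_def by (metis list.size(3) norm_ge_zero order_trans zero_le)

lemma dbound_cmult: "smooth_fn f \<Longrightarrow> dbound m e f \<Longrightarrow> dbound m (norm c * e) (\<lambda>x. c * f x)"
  unfolding dbound_def by (simp add: iterpd_cmult norm_mult mult_left_mono)

lemma dbound_exists:
  assumes "test_fn f" shows "\<exists>e>0. dbound m e f"
proof -
  let ?L = "{js :: 'a list. length js \<le> m}"
  have fin: "finite ?L" using finite_lists_length_le[of "UNIV :: 'a set" m] by simp
  obtain C where C: "\<And>js x. norm (iterpd js f x) \<le> C js" "\<And>js. C js > 0" using test_bounded[OF assms] by metis
  show ?thesis
  proof (intro exI[of _ "sum C ?L"] conjI)
    show "0 < sum C ?L" using C(2) fin by (intro sum_pos) (auto intro: exI[of _ "[]"])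
    show "dbound m (sum C ?L) f" unfolding dbound_def
    proof (intro allI impI)
      fix js :: "'a list" and x assume "length js \<le> m"
      then have "C js \<le> sum C ?L" using C(2) fin by (intro member_le_sum) (auto intro: less_imp_le)
      then show "norm (iterpd js f x) \<le> sum C ?L" using C(1)[of js x] by linarith
    qed
  qed
qed

lemma dbound_zero: "dbound m 0 f \<Longrightarrow> f = (\<lambda>x. 0)"
  unfolding dbound_def by (metis (no_types) ext iterpd.simps(1) list.size(3) norm_le_zero_iff zero_le)

definition test_on :: "(real^'n::finite) set \<Rightarrow> (real^'n \<Rightarrow> complex) \<Rightarrow> bool" where
  "test_on B f \<longleftrightarrow> test_fn f \<and> (\<forall>x. x \<notin> B \<longrightarrow> f x = 0)"

definition cbound :: "(real^'n::finite) set \<Rightarrow> ((real^'n \<Rightarrow> complex) \<Rightarrow> complex) \<Rightarrow> nat \<Rightarrow> real \<Rightarrow> bool" where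
  "cbound B u m C \<longleftrightarrow> (\<forall>f e. test_on B f \<longrightarrow> dbound m e f \<longrightarrow> norm (u f) \<le> C * e)"

lemma cbound_mono: "cbound B u m C \<Longrightarrow> m \<le> m' \<Longrightarrow> C \<le> C' \<Longrightarrow> cbound B u m' C'"
  unfolding cbound_def by (meson dbound_mono dbound_nonneg mult_right_mono order.refl order_trans)

lemma test_on_cmult: "test_on B f \<Longrightarrow> test_on B (\<lambda>x. c * f x)"
  by (auto simp: test_on_def intro: test_cmult)

lemma test_on_add: "test_on B f \<Longrightarrow> test_on B g \<Longrightarrow> test_on B (\<lambda>x. f x + g x)"
  by (auto simp: test_on_def intro: test_add)

text \<open>Homogeneity: a violation of the estimate can be rescaled to any prescribed seminorm size
  e, so the summands of the gliding hump may be chosen as small as wanted.\<close>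

lemma not_cbound:
  assumes u: "is_distr u" and n: "\<not> cbound B u m C" "C \<ge> 0" and e: "e > 0"
  shows "\<exists>f. test_on B f \<and> dbound m e f \<and> norm (u f) > C * e"
proof -
  obtain f e0 where f: "test_on B f" "dbound m e0 f" "norm (u f) > C * e0"
    using n(1) unfolding cbound_def by (auto simp: not_le)
  have "e0 \<noteq> 0"
  proof
    assume "e0 = 0"
    then have "f = (\<lambda>x. 0)" using f dbound_zero by blast
    then show False using f distr_zero[OF u] \<open>e0 = 0\<close> by simp
  qed
  then have e0: "e0 > 0" using dbound_nonneg[OF f(2)] by simp
  let ?c = "complex_of_real (e / e0)"
  have nc: "norm ?c = e / e0" using e e0 by (simp only: norm_of_real) simp
  have "dbound m (norm ?c * e0) (\<lambda>x. ?c * f x)" using f unfolding test_on_def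
    by (intro dbound_cmult test_smooth) auto
  moreover have "norm (u (\<lambda>x. ?c * f x)) = e / e0 * norm (u f)"
    using f(1) distr_cmult[OF u, of f ?c] nc unfolding test_on_def by (simp only: norm_mult)
  moreover have "e / e0 * norm (u f) > C * e"
  proof -
    have "e / e0 * norm (u f) > e / e0 * (C * e0)" using f(3) e e0 by (intro mult_strict_left_mono) auto
    then show ?thesis using e0 by (simp add: mult.commute)
  qed
  ultimately show ?thesis using test_on_cmult[OF f(1), of ?c] nc e0 by auto
qed

text \<open>Otherwise there are f m with order-m seminorm at most 1 / (m+1) and |u (f m)| > m /
  (m+1). They tend to 0 in D, while their images exceed 1/2 from m = 1 on.\<close>

lemma cbound_exists:
  assumes u: "is_distr u" and B: "\<And>x. x \<in> B \<Longrightarrow> norm x \<le> R"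
  shows "\<exists>m C. C \<ge> 0 \<and> cbound B u m C"
proof (rule ccontr)
  assume "\<not> ?thesis"
  then have "\<not> cbound B u m (real m)" for m by (meson of_nat_0_le_iff)
  then have "\<exists>f. test_on B f \<and> dbound m (1 / real (Suc m)) f \<and> norm (u f) > real m * (1 / real (Suc m))" for m
    using not_cbound[OF u, of B m "real m" "1 / real (Suc m)"] by simp
  then obtain f where f: "\<And>m. test_on B (f m)" "\<And>m. dbound m (1 / real (Suc m)) (f m)"
      "\<And>m. norm (u (f m)) > real m * (1 / real (Suc m))" by metis
  have "D_conv f (\<lambda>x. 0)"
    unfolding D_conv_iff
  proof (intro conjI allI impI test_zero)
    show "test_fn (f n)" for n using f(1) by (simp add: test_on_def)
    show "\<exists>R. \<forall>n x. R < norm x \<longrightarrow> f n x = 0" using f(1) B unfolding test_on_def by (meson not_less)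
    fix js and e :: real assume e: "e > 0"
    obtain N where N: "1 / real (Suc N) < e" using nat_approx_posE[OF e] by blast
    have "norm (iterpd js (f n) x) < e" if "n \<ge> max N (length js)" for n x
    proof -
      have "norm (iterpd js (f n) x) \<le> 1 / real (Suc n)" using f(2)[of n] that unfolding dbound_def by simp
      also have "\<dots> \<le> 1 / real (Suc N)" using that by (intro divide_left_mono) auto
      finally show ?thesis using N by simp
    qed
    then show "\<exists>N. \<forall>n\<ge>N. \<forall>x. norm (iterpd js (f n) x - iterpd js (\<lambda>x. 0) x) < e"
      by (intro exI[of _ "max N (length js)"]) simp
  qed
  then have "(\<lambda>n. u (f n)) \<longlonglongrightarrow> 0" using distr_conv[OF u] distr_zero[OF u] by metis
  from LIMSEQ_D[OF this, of "1/2"] obtain N where N: "\<And>n. n \<ge> N \<Longrightarrow> norm (u (f n)) < 1/2" by auto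
  have "1/2 \<le> real (Suc N) * (1 / real (Suc (Suc N)))" by (simp add: field_simps)
  moreover have "norm (u (f (Suc N))) < 1/2" using N by simp
  ultimately show False using f(3)[of "Suc N"] by linarith
qed

lemma telescoping_bound:
  fixes a :: "nat \<Rightarrow> 'a::real_normed_vector"
  assumes "\<And>k. k \<ge> n \<Longrightarrow> norm (a (Suc k) - a k) \<le> (1/2) ^ k" "n \<le> m"
  shows "norm (a m - a n) \<le> 2 * (1/2) ^ n"
proof -
  have "norm (a m - a n) \<le> 2 * (1/2) ^ n - 2 * (1/2) ^ m" using assms(2)
  proof (induction m rule: dec_induct)
    case (step m)
    have "norm (a (Suc m) - a n) \<le> norm (a (Suc m) - a m) + norm (a m - a n)"
      using norm_triangle_ineq[of "a (Suc m) - a m" "a m - a n"] by simp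
    also have "\<dots> \<le> (1/2) ^ m + (2 * (1/2) ^ n - 2 * (1/2) ^ m)"
      using step assms(1)[of m] by (intro add_mono) auto
    also have "\<dots> = 2 * (1/2) ^ n - 2 * (1/2) ^ Suc m" by simp
    finally show ?case .
  qed simp
  then show ?thesis by (rule order_trans) simp
qed

text \<open>A gliding hump: if no common bound exists, one builds partial sums $s_k$ of a convergent series in
  $\mathcal{D}_B$ on which functionals $u_k\in U$ are unbounded; each new summand is chosen small with respect
  to the continuity bounds $(m,C)$ of all previously chosen functionals.\<close>

theorem uniform_boundedness:
  fixes U :: "((real^'n::finite \<Rightarrow> complex) \<Rightarrow> complex) set"
  assumes U: "\<And>u. u \<in> U \<Longrightarrow> is_distr u" and B: "\<And>x. x \<in> B \<Longrightarrow> norm x \<le> R"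
    and pw: "\<And>f. test_on B f \<Longrightarrow> \<exists>C. \<forall>u\<in>U. norm (u f) \<le> C"
  shows "\<exists>m C. C \<ge> 0 \<and> (\<forall>u\<in>U. cbound B u m C)"
proof (rule ccontr)
  assume "\<not> ?thesis"
  then have no: "\<exists>u\<in>U. \<not> cbound B u m C" if "C \<ge> 0" for m C using that by blast
  \<comment> \<open>A state consists of the partial sum s, the functional u chosen last, and an
    estimate (m, C) for it. Since Q makes m and C increase, the current pair also controls all
    functionals chosen before.\<close>
  define P where "P = (\<lambda>(k::nat) (s :: real^'n \<Rightarrow> complex, u :: (real^'n \<Rightarrow> complex) \<Rightarrow> complex, m :: nat, C :: real).
      test_on B s \<and> u \<in> U \<and> C \<ge> 0 \<and> cbound B u m C)"
  define Q where "Q = (\<lambda>(k::nat) (s :: real^'n \<Rightarrow> complex, u :: (real^'n \<Rightarrow> complex) \<Rightarrow> complex, m :: nat, C :: real) (s' :: real^'n \<Rightarrow> complex, u' :: (real^'n \<Rightarrow> complex) \<Rightarrow> complex, m' :: nat, C' :: real).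
      dbound (max k m) ((1/2) ^ k / (C + 1)) (\<lambda>x. s' x - s x) \<and> m \<le> m' \<and> C \<le> C' \<and> norm (u' s') \<ge> real k)"
  have "\<exists>F. \<forall>k. P k (F k) \<and> Q k (F k) (F (Suc k))"
  proof (rule dependent_nat_choice)
    obtain u where u: "u \<in> U" using no[of 0 0] by auto
    obtain m C where mC: "C \<ge> 0" "cbound B u m C" using cbound_exists[OF U[OF u] B] by blast
    have "P 0 ((\<lambda>x. 0), u, m, C)" using u mC by (simp add: P_def test_on_def)
    then show "\<exists>x. P 0 x" by blast
  next
    fix x and k :: nat assume "P k x"
    then obtain s u m C where x: "x = (s, u, m, C)" and p: "test_on B s" "u \<in> U" "C \<ge> 0" "cbound B u m C"
      unfolding P_def by (cases x) auto
    \<comment> \<open>An increment of this size changes every functional chosen so far by at most C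
      e <= (1/2)^k.\<close>
    define e where "e = (1/2) ^ k / (C + 1)"
    have e: "e > 0" unfolding e_def using p by (intro divide_pos_pos) auto
    obtain u' where u': "u' \<in> U" "\<not> cbound B u' (max k m) (2 * real k / e)"
      using no[of "2 * real k / e" "max k m"] e by auto
    obtain f where f: "test_on B f" "dbound (max k m) e f" "norm (u' f) > 2 * real k / e * e"
      using not_cbound[OF U[OF u'(1)] u'(2) _ e] e by auto
    have f3: "norm (u' f) > 2 * real k" using f(3) e by simp
    obtain m1 C1 where mC: "C1 \<ge> 0" "cbound B u' m1 C1" using cbound_exists[OF U[OF u'(1)] B] by blast
    \<comment> \<open>Either s is already large for u', or adding f makes it so: |u' f| > 2 k
      against |u' s| < k.\<close>
    have "\<exists>s'. test_on B s' \<and> dbound (max k m) e (\<lambda>x. s' x - s x) \<and> norm (u' s') \<ge> real k"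
    proof (cases "norm (u' s) \<ge> real k")
      case True
      have "dbound (max k m) e (\<lambda>x. s x - s x)" unfolding dbound_def using e by simp
      then show ?thesis using True p by blast
    next
      case False
      have eq: "u' (\<lambda>x. s x + f x) = u' s + u' f"
        using p f distr_add[OF U[OF u'(1)]] by (simp add: test_on_def)
      have "norm (u' s + u' f) \<ge> norm (u' f) - norm (u' s)"
        by (metis add.commute norm_diff_ineq)
      then have "norm (u' (\<lambda>x. s x + f x)) \<ge> real k" unfolding eq using f3 False by linarith
      then show ?thesis using test_on_add[OF p(1) f(1)] f(2) by (intro exI[of _ "\<lambda>x. s x + f x"]) simp
    qed
    then obtain s' where s': "test_on B s'" "dbound (max k m) e (\<lambda>x. s' x - s x)" "norm (u' s') \<ge> real k" by blast
    have "cbound B u' (max m m1) (max C C1)" by (rule cbound_mono[OF mC(2)]) auto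
    then have "P (Suc k) (s', u', max m m1, max C C1)" "Q k x (s', u', max m m1, max C C1)"
      using s' u' p mC unfolding P_def Q_def x e_def by auto
    then show "\<exists>y. P (Suc k) y \<and> Q k x y" by blast
  qed
  then obtain F where F: "\<And>k. P k (F k)" "\<And>k. Q k (F k) (F (Suc k))" by blast
  define s where "s k = fst (F k)" for k
  define u where "u k = fst (snd (F k))" for k
  define m where "m k = fst (snd (snd (F k)))" for k
  define C where "C k = snd (snd (snd (F k)))" for k
  have Fk: "F k = (s k, u k, m k, C k)" for k by (simp add: s_def u_def m_def C_def)
  have p: "test_on B (s k)" "u k \<in> U" "C k \<ge> 0" "cbound B (u k) (m k) (C k)" for k
    using F(1)[of k] unfolding Fk P_def by auto
  have q: "dbound (max k (m k)) ((1/2) ^ k / (C k + 1)) (\<lambda>x. s (Suc k) x - s k x)" "m k \<le> m (Suc k)" "C k \<le> C (Suc k)"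
    "norm (u (Suc k) (s (Suc k))) \<ge> real k" for k
    using F(2)[of k] unfolding Fk Q_def by auto
  have mono: "m i \<le> m k" "C i \<le> C k" if "i \<le> k" for i k
    using lift_Suc_mono_le[of m, OF q(2) that] lift_Suc_mono_le[of C, OF q(3) that] by auto
  have small: "norm (iterpd js (s (Suc k)) x - iterpd js (s k) x) \<le> (1/2) ^ k" if "length js \<le> k" for js k x
  proof -
    have "norm (iterpd js (\<lambda>x. s (Suc k) x - s k x) x) \<le> (1/2) ^ k / (C k + 1)"
      using q(1)[of k] that unfolding dbound_def by simp
    also have "\<dots> \<le> (1/2) ^ k" using p(3)[of k] by (simp add: divide_le_eq)
    finally show ?thesis using p(1) by (simp add: iterpd_diff test_smooth test_on_def)
  qed
  have conv: "D_conv s (\<lambda>x. lim (\<lambda>n. s n x))"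
  proof (rule D_complete[where R = R])
    show "test_fn (s n)" for n using p(1) by (simp add: test_on_def)
    show "s n x = 0" if "norm x > R" for n x using p(1)[of n] B[of x] that unfolding test_on_def by (meson not_less)
    fix js :: "'n list" and e :: real assume e: "e > 0"
    have "(\<lambda>n. 4 * (1/2) ^ n :: real) \<longlonglongrightarrow> 4 * 0" by (intro tendsto_mult tendsto_const LIMSEQ_power_zero) auto
    from LIMSEQ_D[OF this e] obtain N where N: "\<And>n. n \<ge> N \<Longrightarrow> 4 * (1/2::real) ^ n < e" by auto
    have tb: "norm (iterpd js (s n) x - iterpd js (s (max N (length js))) x) \<le> 2 * (1/2) ^ max N (length js)"
      if "n \<ge> max N (length js)" for n x
      by (rule telescoping_bound[OF small that]) auto
    have "norm (iterpd js (s i) x - iterpd js (s n) x) < e" if "i \<ge> max N (length js)" "n \<ge> max N (length js)" for i n x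
    proof -
      have "norm (iterpd js (s i) x - iterpd js (s n) x) \<le> 2 * (1/2) ^ max N (length js) + 2 * (1/2) ^ max N (length js)"
        using tb[OF that(1), of x] tb[OF that(2), of x]
          norm_triangle_ineq4[of "iterpd js (s i) x - iterpd js (s (max N (length js))) x" "iterpd js (s n) x - iterpd js (s (max N (length js))) x"]
        by simp
      then show ?thesis using N[of "max N (length js)"] by simp
    qed
    then show "\<exists>N. \<forall>m\<ge>N. \<forall>n\<ge>N. \<forall>x. norm (iterpd js (s m) x - iterpd js (s n) x) < e" by blast
  qed
  define S where "S = (\<lambda>x. lim (\<lambda>n. s n x))"
  have "test_on B S"
    unfolding test_on_def
  proof (intro conjI allI impI)
    show "test_fn S" using D_convD(2)[OF conv] by (simp add: S_def)
    fix x assume "x \<notin> B"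
    then have "s n x = 0" for n using p(1) by (simp add: test_on_def)
    then show "S x = 0" by (simp add: S_def)
  qed
  then obtain K where K: "\<And>v. v \<in> U \<Longrightarrow> norm (v S) \<le> K" using pw by blast
  \<comment> \<open>All later increments together move the value of \<open>u (Suc k)\<close> by no
    more than a geometric sum, so the value at the limit S is still at least k - 2.\<close>
  have low: "norm (u (Suc k) S) \<ge> real k - 2" for k
  proof -
    have d: "norm (u (Suc k) (s (Suc i)) - u (Suc k) (s i)) \<le> (1/2) ^ i" if "i \<ge> Suc k" for i
    proof -
      have "cbound B (u (Suc k)) (m i) (C i)" by (rule cbound_mono[OF p(4) mono[OF that]])
      moreover have "test_on B (\<lambda>x. s (Suc i) x - s i x)" using p(1) by (auto simp: test_on_def intro: test_diff)
      moreover have "dbound (m i) ((1/2) ^ i / (C i + 1)) (\<lambda>x. s (Suc i) x - s i x)"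
        by (rule dbound_mono[OF q(1)]) auto
      ultimately have "norm (u (Suc k) (\<lambda>x. s (Suc i) x - s i x)) \<le> C i * ((1/2) ^ i / (C i + 1))"
        unfolding cbound_def by blast
      also have "\<dots> \<le> (1/2) ^ i" using p(3)[of i] by (simp add: divide_le_eq algebra_simps)
      finally show ?thesis
        using distr_diff[OF U[OF p(2)], of "s (Suc i)" "s i" "Suc k"] p(1) by (simp add: test_on_def)
    qed
    have "norm (u (Suc k) (s i) - u (Suc k) (s (Suc k))) \<le> 2" if "i \<ge> Suc k" for i
    proof -
      have "norm (u (Suc k) (s i) - u (Suc k) (s (Suc k))) \<le> 2 * (1/2) ^ Suc k"
        by (rule telescoping_bound[OF d that])
      also have "\<dots> \<le> 2 * 1" by (intro mult_left_mono power_le_one) auto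
      also have "\<dots> = 2" by simp
      finally show ?thesis .
    qed
    moreover have "(\<lambda>i. norm (u (Suc k) (s i) - u (Suc k) (s (Suc k)))) \<longlonglongrightarrow> norm (u (Suc k) S - u (Suc k) (s (Suc k)))"
      unfolding S_def by (intro tendsto_norm tendsto_diff tendsto_const distr_conv[OF U[OF p(2)] conv])
    ultimately have "norm (u (Suc k) S - u (Suc k) (s (Suc k))) \<le> 2"
      by (intro Lim_bounded[of _ _ "Suc k"]) auto
    then show ?thesis using q(4)[of k] norm_triangle_ineq2[of "u (Suc k) (s (Suc k))" "u (Suc k) S"]
      by (simp add: norm_minus_commute)
  qed
  obtain k where "real k > K + 2" using reals_Archimedean2 by blast
  then show False using low[of k] K[OF p(2), of "Suc k"] by linarith
qed

subsection \<open>Integration by parts and antiderivatives\<close>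

lemma shift_bound:
  fixes k :: "real^'n::finite \<Rightarrow> complex"
  assumes k: "\<And>x. norm (k x) \<le> C" "\<And>x. norm x > R \<Longrightarrow> k x = 0" and x: "norm x \<le> M"
  shows "norm (k (x + t *\<^sub>R axis j 1)) \<le> C * indicator {- (R + M) .. R + M} t"
proof (cases "\<bar>t\<bar> \<le> R + M")
  case True
  then show ?thesis using k(1) by (auto simp: indicator_def)
next
  case False
  have "norm (t *\<^sub>R axis j 1 :: real^'n) \<le> norm (x + t *\<^sub>R axis j 1) + norm x"
    by (metis add.commute add_diff_cancel_left' norm_triangle_ineq4)
  then have "norm (x + t *\<^sub>R axis j 1) > R" using False x by simp
  then show ?thesis using k(2) order_trans[OF norm_ge_zero k(1)] by (auto simp: indicator_def)
qed

text \<open>The integral of the translates x -> f (x + t e_j) is constant in t by translation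
  invariance, and its derivative at 0 is the integral of \<open>pd j f\<close>.\<close>

lemma int_pd_zero:
  fixes f :: "real^'n::finite \<Rightarrow> complex"
  assumes f: "test_fn f" shows "(\<integral>x. pd j f x \<partial>lborel) = 0"
proof -
  obtain R where R: "\<And>x. norm x > R \<Longrightarrow> f x = 0" using f unfolding test_fn_iff by auto
  have R': "pd j f x = 0" if "norm x > R" for x using iterpd_zero_norm[of R f x "[j]"] R that by simp
  obtain C where C: "C > 0" "\<And>x. norm (pd j f x) \<le> C" using test_bounded[OF f, of "[j]"] by auto
  have c: "continuous_on UNIV (\<lambda>x. g (x + t *\<^sub>R axis j 1))" if "continuous_on UNIV g" for g :: "real^'n \<Rightarrow> complex" and t
    by (rule continuous_on_compose2[OF that]) (auto intro!: continuous_intros)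
  have far: "norm (x + t *\<^sub>R axis j 1) > R" if "norm x > R + \<bar>t\<bar>" for x :: "real^'n" and t
  proof -
    have "norm x \<le> norm (x + t *\<^sub>R axis j 1) + norm (t *\<^sub>R axis j 1 :: real^'n)"
      by (metis add_diff_cancel_right' norm_triangle_ineq4)
    then show ?thesis using that by simp
  qed
  have "((\<lambda>t. \<integral>x. f (x + t *\<^sub>R axis j 1) \<partial>lborel) has_vector_derivative (\<integral>x. pd j f (x + 0 *\<^sub>R axis j 1) \<partial>lborel)) (at 0)"
  proof (rule hvd_integral[where w = "\<lambda>x. C * indicator (cball 0 (R + 1)) x"])
    show "((\<lambda>t. f (x + t *\<^sub>R axis j 1)) has_vector_derivative pd j f (x + t *\<^sub>R axis j 1)) (at t)" for x t
      by (rule hpd_line) (intro smooth_hpd test_smooth f)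
    show "integrable lborel (\<lambda>x. f (x + t *\<^sub>R axis j 1))" for t
      by (rule integrable_cc[where R = "R + \<bar>t\<bar>", OF c[OF test_cont[OF f]]]) (use R far in auto)
    show "(\<lambda>x. pd j f (x + 0 *\<^sub>R axis j 1)) \<in> borel_measurable lborel"
      by (intro continuous_borel c test_cont test_pd f)
    show "integrable lborel (\<lambda>x. C * indicator (cball (0::real^'n) (R + 1)) x :: real)"
      by (intro Bochner_Integration.integrable_mult_right integrable_real_indicator) (auto simp: emeasure_cball_fin)
    show "norm (pd j f (x + t *\<^sub>R axis j 1)) \<le> C * indicator (cball 0 (R + 1)) x" if "\<bar>t\<bar> \<le> 1" for x t
    proof (cases "norm x \<le> R + 1")
      case False
      then show ?thesis using R'[OF far[of t x]] that by simp
    qed (use C in auto)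
  qed
  moreover have "(\<integral>x. f (x + t *\<^sub>R axis j 1) \<partial>lborel) = (\<integral>x. f x \<partial>lborel)" for t
    using integral_affine_cart[of 1 f "t *\<^sub>R axis j 1"] continuous_borel[OF test_cont[OF f]] by simp
  ultimately have "((\<lambda>t. \<integral>x. f x \<partial>lborel) has_vector_derivative (\<integral>x. pd j f x \<partial>lborel)) (at 0)" by simp
  then show ?thesis using vector_derivative_unique_at has_vector_derivative_const by blast
qed

text \<open>A is the integral of h over the half-line ending at x in direction j. It is supported in
  a bounded set because beyond the support of h in the positive direction the half-line carries the
  whole line integral, which is 0.\<close>

lemma antiderivative:
  fixes h :: "real^'n::finite \<Rightarrow> complex"
  assumes h: "test_fn h" and z: "\<And>x. (\<integral>t. h (x + t *\<^sub>R axis j 1) \<partial>lborel) = 0"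
  shows "\<exists>A. test_fn A \<and> pd j A = h"
proof -
  define A where "A k x = (\<integral>t. indicator {..0} t *\<^sub>R k (x + t *\<^sub>R axis j 1) \<partial>lborel)" for k :: "real^'n \<Rightarrow> complex" and x
  have c: "continuous_on UNIV (\<lambda>t. k (x + t *\<^sub>R axis j 1))" "continuous_on UNIV (\<lambda>x. k (x + t *\<^sub>R axis j 1))"
    if "continuous_on UNIV k" for k :: "real^'n \<Rightarrow> complex" and x t
    by (rule continuous_on_compose2[OF that]; auto intro!: continuous_intros)+
  have meas: "(\<lambda>t. indicator {..0} t *\<^sub>R k (x + t *\<^sub>R axis j 1)) \<in> borel_measurable lborel" if "test_fn k" for k x
    by (intro borel_measurable_scaleR borel_measurable_indicator continuous_borel c test_cont that) auto
  have wi: "integrable lborel (\<lambda>t. C * indicator {-M..M} t :: real)" for C M :: real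
    by (intro Bochner_Integration.integrable_mult_right integrable_real_indicator) (auto simp: emeasure_lborel_Icc_eq)
  have ind: "norm (indicator {..0::real} t *\<^sub>R v) \<le> w" if "norm v \<le> w" for t w and v :: complex
    using that order_trans[OF norm_ge_zero that] by (auto simp: indicator_def)
  have int: "integrable lborel (\<lambda>t. indicator {..0} t *\<^sub>R k (x + t *\<^sub>R axis j 1))" if k: "test_fn k" for k x
  proof -
    obtain R where R: "\<And>x. norm x > R \<Longrightarrow> k x = 0" using k unfolding test_fn_iff by auto
    obtain C where C: "C > 0" "\<And>x. norm (k x) \<le> C" using test_bounded[OF k, of "[]"] by auto
    show ?thesis
      by (rule Bochner_Integration.integrable_bound[OF wi[of C "R + norm x"] meas[OF k]])
        (intro AE_I2 ind order_trans[OF shift_bound[OF C(2) R order.refl]], use C in auto)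
  qed
  have cont: "continuous_on UNIV (A k)" if k: "test_fn k" for k
  proof -
    obtain R where R: "\<And>x. norm x > R \<Longrightarrow> k x = 0" using k unfolding test_fn_iff by auto
    obtain C where C: "C > 0" "\<And>x. norm (k x) \<le> C" using test_bounded[OF k, of "[]"] by auto
    show ?thesis unfolding continuous_on_sequentially
    proof (intro allI ballI impI; elim conjE)
      fix X :: "nat \<Rightarrow> real^'n" and a assume X: "X \<longlonglongrightarrow> a"
      then obtain M where M: "\<And>n. norm (X n) \<le> M" using convergent_imp_Bseq[of X] unfolding convergent_def Bseq_def by blast
      have "(\<lambda>n. A k (X n)) \<longlonglongrightarrow> A k a" unfolding A_def
      proof (rule integral_dominated_convergence[OF meas[OF k] meas[OF k] wi[of C "R + M"]])
        show "AE t in lborel. (\<lambda>n. indicator {..0} t *\<^sub>R k (X n + t *\<^sub>R axis j 1)) \<longlonglongrightarrow> indicator {..0} t *\<^sub>R k (a + t *\<^sub>R axis j 1)"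
          by (intro AE_I2 tendsto_scaleR tendsto_const continuous_on_tendsto_compose[OF test_cont[OF k, of UNIV]] tendsto_add X) auto
        show "AE t in lborel. norm (indicator {..0} t *\<^sub>R k (X n + t *\<^sub>R axis j 1)) \<le> C * indicator {- (R + M)..R + M} t" for n
          by (intro AE_I2 ind shift_bound C R M)
      qed
      then show "(A k \<circ> X) \<longlonglongrightarrow> A k a" by (simp add: o_def)
    qed
  qed
  have hp: "hpd i (A k) (A (pd i k) x) x" if k: "test_fn k" for i k x
  proof -
    have pk: "test_fn (pd i k)" by (rule test_pd[OF k])
    then obtain R where R: "\<And>x. norm x > R \<Longrightarrow> pd i k x = 0" unfolding test_fn_iff by auto
    obtain C where C: "C > 0" "\<And>x. norm (pd i k x) \<le> C" using test_bounded[OF k, of "[i]"] by auto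
    have "((\<lambda>s. \<integral>t. indicator {..0} t *\<^sub>R k ((x + t *\<^sub>R axis j 1) + s *\<^sub>R axis i 1) \<partial>lborel) has_vector_derivative
      (\<integral>t. indicator {..0} t *\<^sub>R pd i k ((x + t *\<^sub>R axis j 1) + 0 *\<^sub>R axis i 1) \<partial>lborel)) (at 0)"
    proof (rule hvd_integral[where w = "\<lambda>t. C * indicator {- (R + (norm x + 1))..R + (norm x + 1)} t"
          and f' = "\<lambda>t s. indicator {..0} t *\<^sub>R pd i k ((x + t *\<^sub>R axis j 1) + s *\<^sub>R axis i 1)"])
      have sw: "(x + t *\<^sub>R axis j 1) + s *\<^sub>R axis i 1 = (x + s *\<^sub>R axis i 1) + t *\<^sub>R axis j 1" for s t by simp
      show "((\<lambda>s. indicator {..0} t *\<^sub>R k ((x + t *\<^sub>R axis j 1) + s *\<^sub>R axis i 1)) has_vector_derivative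
         indicator {..0} t *\<^sub>R pd i k ((x + t *\<^sub>R axis j 1) + s *\<^sub>R axis i 1)) (at s)" for t s
      proof -
        have "((\<lambda>s. k ((x + t *\<^sub>R axis j 1) + s *\<^sub>R axis i 1)) has_vector_derivative pd i k ((x + t *\<^sub>R axis j 1) + s *\<^sub>R axis i 1)) (at s)"
          by (rule hpd_line) (intro smooth_hpd test_smooth k)
        then show ?thesis by (rule bounded_linear.has_vector_derivative[OF bounded_linear_scaleR_right])
      qed
      show "integrable lborel (\<lambda>t. indicator {..0} t *\<^sub>R k ((x + t *\<^sub>R axis j 1) + s *\<^sub>R axis i 1))" for s
        unfolding sw by (rule int[OF k])
      show "(\<lambda>t. indicator {..0} t *\<^sub>R pd i k ((x + t *\<^sub>R axis j 1) + 0 *\<^sub>R axis i 1)) \<in> borel_measurable lborel"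
        using meas[OF pk, of x] by simp
      show "integrable lborel (\<lambda>t. C * indicator {- (R + (norm x + 1))..R + (norm x + 1)} t)" by (rule wi)
      fix t s :: real assume s: "\<bar>s\<bar> \<le> 1"
      have "norm (x + s *\<^sub>R axis i 1) \<le> norm x + 1"
        by (rule order_trans[OF norm_triangle_ineq]) (use s in simp)
      then show "norm (indicator {..0} t *\<^sub>R pd i k ((x + t *\<^sub>R axis j 1) + s *\<^sub>R axis i 1)) \<le> C * indicator {- (R + (norm x + 1))..R + (norm x + 1)} t"
        unfolding sw by (intro ind shift_bound C R)
    qed
    then show ?thesis unfolding hpd_def A_def by (simp add: add_ac)
  qed
  have sm: "smooth_fn (A h)"
  proof (rule smooth_coinduct[where P = "A ` Collect test_fn"])
    fix f and i :: 'n assume "f \<in> A ` Collect test_fn"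
    then obtain k where k: "f = A k" "test_fn k" by auto
    then show "continuous_on UNIV f" using cont by simp
    show "\<exists>g\<in>A ` Collect test_fn. \<forall>x. hpd i f (g x) x"
      unfolding k(1) by (rule bexI[of _ "A (pd i k)"]) (use hp[OF k(2)] test_pd[OF k(2)] in auto)
  qed (use h in auto)
  obtain R0 where R0: "\<And>x. norm x > R0 \<Longrightarrow> h x = 0" using h unfolding test_fn_iff by auto
  define R where "R = max R0 0"
  have R: "\<And>x. norm x > R \<Longrightarrow> h x = 0" "R \<ge> 0" using R0 by (auto simp: R_def)
  have A0: "A h x = 0" if x: "norm x > real CARD('n) * R" for x
  proof (rule ccontr)
    assume n0: "A h x \<noteq> 0"
    have "\<exists>t\<le>0. h (x + t *\<^sub>R axis j 1) \<noteq> 0"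
    proof (rule ccontr)
      assume "\<not> ?thesis"
      then have "(\<lambda>t. indicator {..0} t *\<^sub>R h (x + t *\<^sub>R axis j 1)) = (\<lambda>t. 0)" by (force simp: indicator_def)
      then show False using n0 by (simp add: A_def)
    qed
    then obtain t where t: "t \<le> 0" "h (x + t *\<^sub>R axis j 1) \<noteq> 0" by blast
    then have "norm (x + t *\<^sub>R axis j 1) \<le> R" using R(1) by (meson not_less)
    then have co: "\<bar>(x + t *\<^sub>R axis j 1) $ i\<bar> \<le> R" for i using component_le_norm_cart order_trans by blast
    have "x $ j \<le> R"
    proof (rule ccontr)
      assume "\<not> x $ j \<le> R"
      have "h (x + s *\<^sub>R axis j 1) = 0" if "s > 0" for s
      proof -
        have "\<bar>(x + s *\<^sub>R axis j 1) $ j\<bar> > R" using \<open>\<not> x $ j \<le> R\<close> that R(2) by (simp add: axis_def)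
        then show ?thesis using component_le_norm_cart[of "x + s *\<^sub>R axis j 1" j] by (intro R) linarith
      qed
      then have "(\<lambda>t. indicator {..0} t *\<^sub>R h (x + t *\<^sub>R axis j 1)) = (\<lambda>t. h (x + t *\<^sub>R axis j 1))"
        by (force simp: indicator_def)
      then show False using n0 z[of x] by (simp add: A_def)
    qed
    moreover have "x $ j \<ge> - R" using co[of j] t by (simp add: axis_def)
    ultimately have "\<bar>x $ i\<bar> \<le> R" for i using co[of i] by (cases "i = j") (auto simp: axis_def)
    then have "norm x \<le> (\<Sum>i\<in>(UNIV::'n set). R)" by (intro order_trans[OF norm_le_l1_cart] sum_mono)
    then show False using x by simp
  qed
  have "pd j (A h) x = h x" for x
  proof -
    have "pd j (A h) x = A (pd j h) x" by (rule hpd_pd[OF hp[OF h]])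
    also have "\<dots> = h x"
    proof -
      let ?M = "R + norm x + 1"
      have far: "norm (x + t *\<^sub>R axis j 1) > R" if "t \<le> - ?M" for t
      proof -
        have "norm (t *\<^sub>R axis j 1 :: real^'n) \<le> norm (x + t *\<^sub>R axis j 1) + norm x"
          by (metis add.commute add_diff_cancel_left' norm_triangle_ineq4)
        then show ?thesis using that R(2) by simp
      qed
      have "A (pd j h) x = (\<integral>t. indicator {-?M..0} t *\<^sub>R pd j h (x + t *\<^sub>R axis j 1) \<partial>lborel)"
        unfolding A_def
      proof (rule Bochner_Integration.integral_cong[OF refl])
        fix t
        show "indicator {..0} t *\<^sub>R pd j h (x + t *\<^sub>R axis j 1) = indicator {-?M..0} t *\<^sub>R pd j h (x + t *\<^sub>R axis j 1)"
          using iterpd_zero_norm[of R h "x + t *\<^sub>R axis j 1" "[j]"] R far[of t]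
          by (cases "t \<le> - ?M") (auto simp: indicator_def)
      qed
      also have "\<dots> = h (x + 0 *\<^sub>R axis j 1) - h (x + (- ?M) *\<^sub>R axis j 1)"
      proof (rule integral_FTC_atLeastAtMost)
        show "- ?M \<le> 0" using R(2) norm_ge_zero[of x] by linarith
        show "((\<lambda>t. h (x + t *\<^sub>R axis j 1)) has_vector_derivative pd j h (x + t *\<^sub>R axis j 1)) (at t within {- ?M..0})" for t
          by (rule hpd_line) (intro smooth_hpd test_smooth h)
        show "continuous_on {- ?M..0} (\<lambda>t. pd j h (x + t *\<^sub>R axis j 1))"
          by (rule continuous_on_subset[OF c(1)[OF test_cont[OF test_pd[OF h]]]]) auto
      qed
      also have "\<dots> = h x" using R(1)[OF far[of "- ?M"]] by simp
      finally show ?thesis .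
    qed
    finally show ?thesis .
  qed
  then have "pd j (A h) = h" by blast
  moreover have "test_fn (A h)" unfolding test_fn_iff using sm A0 by blast
  ultimately show ?thesis by blast
qed


subsection \<open>Monomials\<close>

lemma hvd_seqD:
  fixes f :: "real \<Rightarrow> complex"
  assumes "(f has_vector_derivative d) (at 0)" "\<And>n. X n \<noteq> 0" "X \<longlonglongrightarrow> 0"
  shows "(\<lambda>n. (f (X n) - f 0) / of_real (X n)) \<longlonglongrightarrow> d"
proof -
  have "((\<lambda>t. norm (f t - f 0 - t *\<^sub>R d) / norm t) \<longlongrightarrow> 0) (at 0)"
    using assms(1) unfolding has_vector_derivative_def has_derivative_at by simp
  then have "(\<lambda>n. norm (f (X n) - f 0 - X n *\<^sub>R d) / norm (X n)) \<longlonglongrightarrow> 0"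
    using assms(2,3) unfolding tendsto_at_iff_sequentially by (auto simp: o_def)
  moreover have "norm (f (X n) - f 0 - X n *\<^sub>R d) / norm (X n) = norm ((f (X n) - f 0) / of_real (X n) - d)" for n
  proof -
    have "(f (X n) - f 0) / of_real (X n) - d = (f (X n) - f 0 - X n *\<^sub>R d) / of_real (X n)"
      using assms(2)[of n] by (simp add: diff_divide_distrib scaleR_conv_of_real)
    then show ?thesis by (simp add: norm_divide)
  qed
  ultimately have "(\<lambda>n. (f (X n) - f 0) / of_real (X n) - d) \<longlonglongrightarrow> 0"
    by (simp add: tendsto_norm_zero_iff)
  then show ?thesis by (rule LIM_zero_cancel)
qed

definition mon :: "('n::finite \<Rightarrow> nat) \<Rightarrow> real^'n \<Rightarrow> complex" where
  "mon \<alpha> x = complex_of_real (\<Prod>j\<in>UNIV. (x $ j) ^ (\<alpha> j))"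

lemma monomial_eq: "monomial \<alpha> = regdist (mon \<alpha>)"
  by (simp add: monomial_def mon_def[abs_def])

lemma smooth_X: "smooth_fn (\<lambda>x. complex_of_real (x $ j))"
  by (rule smooth_coord[OF smooth1_id])

lemma smooth_power: "smooth_fn f \<Longrightarrow> smooth_fn (\<lambda>x. f x ^ n)"
  by (induction n) (auto intro: smooth_mult)

lemma smooth_mon: "smooth_fn (mon \<alpha>)"
  unfolding mon_def[abs_def] of_real_prod of_real_power by (intro smooth_prod smooth_power smooth_X)

lemma is_distr_monomial: "is_distr (monomial \<alpha>)"
  unfolding monomial_eq by (rule regdist_cont_distr[OF smooth_cont[OF smooth_mon]])

lemma mon_dil: "mon \<alpha> (x * a) = mon \<alpha> x * mon \<alpha> a"
  by (simp add: mon_def power_mult_distrib prod.distrib)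

lemma pd_X: "pd i (\<lambda>x. complex_of_real (x $ j)) x = (if i = j then 1 else 0)"
proof (rule hpd_pd)
  have "((\<lambda>t. complex_of_real (x $ j + t * (if i = j then 1 else 0))) has_vector_derivative (if i = j then 1 else 0)) (at 0)"
    by (auto intro!: derivative_eq_intros)
  moreover have "(x + t *\<^sub>R axis i 1) $ j = x $ j + t * (if i = j then 1 else 0)" for t by (simp add: axis_def)
  ultimately show "hpd i (\<lambda>x. complex_of_real (x $ j)) (if i = j then 1 else 0) x" unfolding hpd_def by (simp only:)
qed

lemma theta_mon: "complex_of_real (x $ j) * pd j (mon \<alpha>) x = of_nat (\<alpha> j) * mon \<alpha> x"
proof -
  define c where "c = (\<Prod>i\<in>UNIV - {j}. (x $ i) ^ (\<alpha> i))"
  have line: "mon \<alpha> (x + t *\<^sub>R axis j 1) = complex_of_real ((x $ j + t) ^ \<alpha> j * c)" for t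
  proof -
    have "(\<Prod>i\<in>UNIV. ((x + t *\<^sub>R axis j 1) $ i) ^ (\<alpha> i)) = ((x + t *\<^sub>R axis j 1) $ j) ^ (\<alpha> j) * (\<Prod>i\<in>UNIV - {j}. ((x + t *\<^sub>R axis j 1) $ i) ^ (\<alpha> i))"
      by (rule prod.remove) auto
    also have "(\<Prod>i\<in>UNIV - {j}. ((x + t *\<^sub>R axis j 1) $ i) ^ (\<alpha> i)) = c"
      unfolding c_def by (rule prod.cong) (auto simp: axis_def)
    finally show ?thesis by (simp add: mon_def axis_def)
  qed
  have "((\<lambda>t. (x $ j + t) ^ \<alpha> j * c) has_real_derivative (real (\<alpha> j) * (x $ j + 0) ^ (\<alpha> j - 1) * c)) (at 0)"
    by (auto intro!: derivative_eq_intros)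
  then have "((\<lambda>t. complex_of_real ((x $ j + t) ^ \<alpha> j * c)) has_vector_derivative complex_of_real (real (\<alpha> j) * (x $ j + 0) ^ (\<alpha> j - 1) * c)) (at 0)"
    by (intro has_vector_derivative_of_real) (simp add: has_real_derivative_iff_has_vector_derivative)
  then have "pd j (mon \<alpha>) x = complex_of_real (real (\<alpha> j) * (x $ j) ^ (\<alpha> j - 1) * c)"
    by (intro hpd_pd) (simp add: hpd_def line)
  moreover have "mon \<alpha> x = complex_of_real ((x $ j) ^ \<alpha> j * c)" using line[of 0] by simp
  \<comment> \<open>At exponent 0 both sides vanish, so the truncated exponent does no harm.\<close>
  ultimately show ?thesis by (cases "\<alpha> j") auto
qed

text \<open>Monomials are homogeneous, so transposed dilations act on them as scalars. Together with
  \<open>monomial_theta\<close> this supplies the eigenvector hypothesis of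
  \<open>commute\<close>.\<close>

lemma monomial_dil:
  assumes a: "\<And>j. a $ j \<noteq> 0" and f: "test_fn f"
  shows "monomial \<alpha> (\<lambda>x. f (x * a)) = 1 / (complex_of_real (\<Prod>j\<in>UNIV. \<bar>a $ j\<bar>) * mon \<alpha> a) * monomial \<alpha> f"
proof -
  let ?p = "complex_of_real (\<Prod>j\<in>UNIV. \<bar>a $ j\<bar>)"
  have p: "?p \<noteq> 0" "mon \<alpha> a \<noteq> 0" using a by (auto simp: mon_def)
  have "monomial \<alpha> f = ?p * (\<integral>x. mon \<alpha> (x * a + 0) * f (x * a + 0) \<partial>lborel)"
    using integral_affine_cart[OF a continuous_borel[OF continuous_on_mult[OF smooth_cont[OF smooth_mon] test_cont[OF f]]], of \<alpha> 0] f
    by (simp add: monomial_eq regdist_def)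
  also have "\<dots> = ?p * (\<integral>x. mon \<alpha> a * (mon \<alpha> x * f (x * a)) \<partial>lborel)" by (simp add: mon_dil mult_ac)
  also have "\<dots> = ?p * (mon \<alpha> a * monomial \<alpha> (\<lambda>x. f (x * a)))"
    using test_dil[OF f a] by (simp add: monomial_eq regdist_def)
  finally show ?thesis using p by (simp add: field_simps)
qed

definition theta :: "'n::finite \<Rightarrow> (real^'n \<Rightarrow> complex) \<Rightarrow> real^'n \<Rightarrow> complex" where
  "theta j f x = complex_of_real (x $ j) * pd j f x"

lemma dop_theta: "dop (theta j)"
  unfolding theta_def[abs_def] by (rule dop_comp[OF dop_mult[OF smooth_X] dop_pd])

lemma theta_mult: "smooth_fn f \<Longrightarrow> smooth_fn g \<Longrightarrow> theta j (\<lambda>x. f x * g x) x = theta j f x * g x + f x * theta j g x"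
  by (simp add: theta_def pd_mult algebra_simps)

lemma monomial_theta:
  assumes f: "test_fn f"
  shows "monomial \<alpha> (theta j f) = - of_nat (\<alpha> j + 1) * monomial \<alpha> f"
proof -
  let ?g = "\<lambda>x. mon \<alpha> x * f x"
  have tg: "test_fn ?g" by (intro test_mult2 smooth_mon f)
  have tf: "test_fn (theta j f)" by (rule dopD(1)[OF dop_theta f])
  have t2: "test_fn (\<lambda>x. mon \<alpha> x * theta j f x)" by (intro test_mult2 smooth_mon tf)
  \<comment> \<open>The total derivative of x_j x^\<alpha> f integrates to 0; its expansion is the
    asserted relation.\<close>
  have "pd j (\<lambda>x. complex_of_real (x $ j) * ?g x) x = of_nat (\<alpha> j + 1) * ?g x + mon \<alpha> x * theta j f x" for x
  proof -
    have "pd j (\<lambda>x. complex_of_real (x $ j) * ?g x) x = ?g x + theta j ?g x"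
      by (subst pd_mult[OF smooth_X test_smooth[OF tg]]) (simp add: pd_X theta_def)
    also have "theta j ?g x = of_nat (\<alpha> j) * ?g x + mon \<alpha> x * theta j f x"
      by (subst theta_mult[OF smooth_mon test_smooth[OF f]]) (simp add: theta_def theta_mon[unfolded mult.commute[of "complex_of_real _"]] theta_mon mult_ac)
    finally show ?thesis by (simp add: algebra_simps)
  qed
  then have "(\<integral>x. of_nat (\<alpha> j + 1) * ?g x + mon \<alpha> x * theta j f x \<partial>lborel) = 0"
    using int_pd_zero[OF test_mult2[OF smooth_X tg], of j j] by presburger
  moreover have "(\<integral>x. of_nat (\<alpha> j + 1) * ?g x + mon \<alpha> x * theta j f x \<partial>lborel) =
      of_nat (\<alpha> j + 1) * (\<integral>x. ?g x \<partial>lborel) + (\<integral>x. mon \<alpha> x * theta j f x \<partial>lborel)"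
    using test_integrable[OF tg] test_integrable[OF t2]
    by (subst Bochner_Integration.integral_add) (auto simp del: of_nat_add of_nat_Suc)
  ultimately show ?thesis using f tf by (simp add: monomial_eq regdist_def add_eq_0_iff del: of_nat_add of_nat_Suc)
qed

subsection \<open>The transpose of a continuous operator\<close>

text \<open>Point evaluations of derivatives. L maps them to derivatives of the transposed function:
  \<open>L (dl js y) f\<close> is the js-derivative of \<open>G f\<close> at y.\<close>

definition dl :: "'n::finite list \<Rightarrow> real^'n \<Rightarrow> (real^'n \<Rightarrow> complex) \<Rightarrow> complex" where
  "dl js y = ddist (\<lambda>f. iterpd js f y)"

lemma is_distr_dl: "is_distr (dl js y)"
  unfolding dl_def by (rule distr_delta)

lemma dl_test [simp]: "test_fn f \<Longrightarrow> dl js y f = iterpd js f y"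
  by (simp add: dl_def)

lemma delta_dl: "delta y = dl [] y"
  by (simp add: delta_def dl_def)

locale contop =
  fixes L :: "((real^'n::finite \<Rightarrow> complex) \<Rightarrow> complex) \<Rightarrow> ((real^'n \<Rightarrow> complex) \<Rightarrow> complex)"
  assumes CL: "cont_lin_op L"
begin

lemma L_distr: "is_distr S \<Longrightarrow> is_distr (L S)"
  using CL by (simp add: cont_lin_op_def)

lemma L_lin: "is_distr S \<Longrightarrow> is_distr R \<Longrightarrow> L (\<lambda>f. a * S f + R f) = (\<lambda>f. a * L S f + L R f)"
  using CL by (simp add: cont_lin_op_def)

lemma L_lim:
  assumes "\<And>n. is_distr (Ss n)" "is_distr S" "\<And>f. test_fn f \<Longrightarrow> (\<lambda>n. Ss n f) \<longlonglongrightarrow> S f" "test_fn f"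
  shows "(\<lambda>n. L (Ss n) f) \<longlonglongrightarrow> L S f"
  using CL assms unfolding cont_lin_op_def by blast

lemma L_zero: "L (\<lambda>f. 0) = (\<lambda>f. 0)"
  using L_lin[OF is_distr_zero is_distr_zero, of 1] by (auto simp: fun_eq_iff)

lemma L_cmult: "is_distr S \<Longrightarrow> L (\<lambda>f. a * S f) = (\<lambda>f. a * L S f)"
  using L_lin[OF _ is_distr_zero, of S a] by (simp add: L_zero)

definition G :: "(real^'n \<Rightarrow> complex) \<Rightarrow> real^'n \<Rightarrow> complex" where
  "G f y = L (delta y) f"

lemma dl_cont: assumes f: "test_fn f" shows "continuous_on UNIV (\<lambda>y. L (dl js y) f)"
  unfolding continuous_on_sequentially o_def
proof (intro allI ballI impI; elim conjE)
  fix X and a :: "real^'n" assume X: "X \<longlonglongrightarrow> a"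
  show "(\<lambda>n. L (dl js (X n)) f) \<longlonglongrightarrow> L (dl js a) f"
  proof (rule L_lim[OF is_distr_dl is_distr_dl _ f])
    fix f :: "real^'n \<Rightarrow> complex" assume f: "test_fn f"
    have "(\<lambda>n. iterpd js f (X n)) \<longlonglongrightarrow> iterpd js f a"
      by (rule continuous_on_tendsto_compose[OF test_cont[OF test_iterpd[OF f], of UNIV] X]) auto
    then show "(\<lambda>n. dl js (X n) f) \<longlonglongrightarrow> dl js a f" using f by simp
  qed
qed

text \<open>Difference quotients of the functionals \<open>dl js\<close> in y converge weakly to
  \<open>dl (j # js) y\<close>, and L preserves weak limits. This is the source of the smoothness of
  \<open>G f\<close>.\<close>

lemma dl_hpd: assumes f: "test_fn f" shows "hpd j (\<lambda>y. L (dl js y) f) (L (dl (j # js) y) f) y"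
  unfolding hpd_def
proof (rule hvd_sequentially)
  fix X :: "nat \<Rightarrow> real" assume X: "\<And>n. X n \<noteq> 0" "X \<longlonglongrightarrow> 0"
  let ?y = "\<lambda>n. y + X n *\<^sub>R axis j 1" and ?c = "\<lambda>n. 1 / complex_of_real (X n)"
  let ?S = "\<lambda>n f. ?c n * dl js (?y n) f + - ?c n * dl js y f"
  have d: "is_distr (?S n)" for n by (intro is_distr_linear is_distr_cmult is_distr_dl)
  have "(\<lambda>n. L (?S n) f) \<longlonglongrightarrow> L (dl (j # js) y) f"
  proof (rule L_lim[OF d is_distr_dl _ f])
    fix f :: "real^'n \<Rightarrow> complex" assume f: "test_fn f"
    have "((\<lambda>t. iterpd js f (y + t *\<^sub>R axis j 1)) has_vector_derivative pd j (iterpd js f) y) (at 0)"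
      using smooth_hpd[OF smooth_iterpd[OF test_smooth[OF f]]] unfolding hpd_def .
    from hvd_seqD[OF this X(1) X(2)]
    show "(\<lambda>n. ?S n f) \<longlonglongrightarrow> dl (j # js) y f"
      using f by (simp add: diff_divide_distrib)
  qed
  moreover have "L (?S n) f = (L (dl js (?y n)) f - L (dl js (y + 0 *\<^sub>R axis j 1)) f) / complex_of_real (X n)" for n
    using L_lin[OF is_distr_dl is_distr_cmult[OF is_distr_dl], of "?c n" js "?y n" "- ?c n" js y] L_cmult[OF is_distr_dl, of "- ?c n" js y]
    by (simp add: diff_divide_distrib)
  ultimately show "(\<lambda>n. (L (dl js (?y n)) f - L (dl js (y + 0 *\<^sub>R axis j 1)) f) / complex_of_real (X n)) \<longlonglongrightarrow> L (dl (j # js) y) f"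
    by simp
qed

lemma G_eq: "G f = (\<lambda>y. L (dl [] y) f)"
  by (simp add: G_def[abs_def] delta_dl)

lemma G_smooth: assumes f: "test_fn f" shows "smooth_fn (G f)"
proof (rule smooth_coinduct[where P = "range (\<lambda>js y. L (dl js y) f)"])
  show "G f \<in> range (\<lambda>js y. L (dl js y) f)" unfolding G_eq by blast
next
  fix h and j :: 'n assume "h \<in> range (\<lambda>js y. L (dl js y) f)"
  then obtain js where h: "h = (\<lambda>y. L (dl js y) f)" by auto
  show "continuous_on UNIV h" unfolding h by (rule dl_cont[OF f])
  show "\<exists>g\<in>range (\<lambda>js y. L (dl js y) f). \<forall>x. hpd j h (g x) x"
    unfolding h by (rule bexI[OF _ rangeI[of _ "j # js"]]) (intro allI dl_hpd f)
qed

lemma iterpd_G: assumes f: "test_fn f" shows "iterpd js (G f) y = L (dl js y) f"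
proof (induction js arbitrary: y)
  case (Cons j js)
  then have "iterpd js (G f) = (\<lambda>y. L (dl js y) f)" by blast
  then show ?case using hpd_pd[OF dl_hpd[OF f]] by simp
qed (simp add: G_eq)

text \<open>If \<open>G f\<close> were non-zero at points y n tending to infinity, suitable
  multiples of the point masses at y n would tend weakly to 0, since a test function sees only
  finitely many of them, while their images under L keep the value 1 on f.\<close>

lemma G_bounded_support: assumes f: "test_fn f" shows "\<exists>R. \<forall>y. norm y > R \<longrightarrow> G f y = 0"
proof (rule ccontr)
  assume "\<not> ?thesis"
  then have "\<forall>n::nat. \<exists>y. norm y > real n \<and> G f y \<noteq> 0" by blast
  then obtain y where y: "\<And>n. norm (y n) > real n" "\<And>n. G f (y n) \<noteq> 0" by metis
  let ?S = "\<lambda>n h. 1 / G f (y n) * delta (y n) h"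
  have "(\<lambda>n. L (?S n) f) \<longlonglongrightarrow> L (\<lambda>h. 0) f"
  proof (rule L_lim[OF is_distr_cmult[OF is_distr_delta] is_distr_zero _ f])
    fix h :: "real^'n \<Rightarrow> complex" assume h: "test_fn h"
    then obtain R where R: "\<And>x. norm x > R \<Longrightarrow> h x = 0" unfolding test_fn_iff by auto
    obtain N where N: "real N \<ge> R" using real_arch_simple by blast
    have "?S n h = 0" if "n \<ge> N" for n
    proof -
      have "norm (y n) > R" using y(1)[of n] that N by (meson le_less_trans of_nat_mono order_trans)
      then show ?thesis using R h by (simp add: delta_def)
    qed
    then show "(\<lambda>n. ?S n h) \<longlonglongrightarrow> 0" by (intro tendsto_eventually eventually_sequentiallyI[of N])
  qed
  moreover have "L (?S n) f = 1" for n
    using L_cmult[OF is_distr_delta, of "1 / G f (y n)" "y n"] y(2)[of n] by (simp add: G_def)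
  ultimately show False by (simp add: L_zero LIMSEQ_const_iff)
qed

lemma G_test: "test_fn f \<Longrightarrow> test_fn (G f)"
  using G_smooth G_bounded_support by (simp add: test_fn_iff)

text \<open>Both sides are sequentially continuous in S, the right one because \<open>G f\<close> is
  a test function, and they agree on point masses by definition of \<open>G\<close>.\<close>

lemma G_eval: assumes S: "is_distr S" and f: "test_fn f" shows "L S f = S (G f)"
proof -
  define A where "A = {S. is_distr S \<and> L S f = S (G f)}"
  have "dclosed A" unfolding dclosed_def A_def
  proof (intro conjI allI impI; (elim conjE)?)
    show "(\<lambda>f. 0) \<in> {S. is_distr S \<and> L S f = S (G f)}" using is_distr_zero L_zero by simp
  next
    fix a S R assume "S \<in> {S. is_distr S \<and> L S f = S (G f)}" "R \<in> {S. is_distr S \<and> L S f = S (G f)}"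
    then show "(\<lambda>f. a * S f + R f) \<in> {S. is_distr S \<and> L S f = S (G f)}"
      using is_distr_linear[of S R a] L_lin[of S R a] by simp
  next
    fix Ss S assume a: "\<forall>n::nat. Ss n \<in> {S. is_distr S \<and> L S f = S (G f)}" "is_distr S"
      "\<forall>f. test_fn f \<longrightarrow> (\<lambda>n. Ss n f) \<longlonglongrightarrow> S f"
    have "(\<lambda>n. L (Ss n) f) \<longlonglongrightarrow> L S f" using a by (intro L_lim f) auto
    moreover have "(\<lambda>n. Ss n (G f)) \<longlonglongrightarrow> S (G f)" using a(3) G_test[OF f] by blast
    moreover have "(\<lambda>n. L (Ss n) f) = (\<lambda>n. Ss n (G f))" using a(1) by auto
    ultimately show "S \<in> {S. is_distr S \<and> L S f = S (G f)}" using a(2) LIMSEQ_unique by auto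
  qed
  moreover have "delta p \<in> A" for p using is_distr_delta G_test[OF f] by (simp add: A_def G_def delta_def)
  ultimately have "S \<in> A" using dense_delta S by blast
  then show ?thesis by (simp add: A_def)
qed

end

locale hadamard = contop L
  for L :: "((real^'n::finite \<Rightarrow> complex) \<Rightarrow> complex) \<Rightarrow> ((real^'n \<Rightarrow> complex) \<Rightarrow> complex)" +
  assumes eig: "\<And>\<alpha>. \<exists>m. L (monomial \<alpha>) = (\<lambda>f. m * monomial \<alpha> f)"
begin

text \<open>The distributions S with this property form a sequentially closed subspace. A monomial
  belongs to it because it is an eigenvector both of L and of the transpose of M, and density does
  the rest.\<close>

lemma commute:
  assumes M: "dop M" and c: "\<And>\<alpha>. \<exists>c. \<forall>f. test_fn f \<longrightarrow> monomial \<alpha> (M f) = c * monomial \<alpha> f"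
    and S: "is_distr S" and f: "test_fn f"
  shows "L (ddist (\<lambda>f. S (M f))) f = L S (M f)"
proof -
  let ?P = "\<lambda>S. is_distr S \<and> L (ddist (\<lambda>f. S (M f))) f = L S (M f)"
  define A where "A = {S. ?P S}"
  have d: "is_distr (ddist (\<lambda>f. S (M f)))" if "is_distr S" for S by (rule distr_ddist[OF that M])
  have Mf: "test_fn (M f)" by (rule dopD(1)[OF M f])
  have "dclosed A" unfolding dclosed_def A_def
  proof (intro conjI allI impI; (elim conjE)?)
    have "ddist (\<lambda>f :: real^'n \<Rightarrow> complex. 0) = (\<lambda>f. 0)" by (auto simp: ddist_def)
    then show "(\<lambda>f. 0) \<in> {S. ?P S}" using is_distr_zero L_zero by simp
  next
    fix a S R assume a: "S \<in> {S. ?P S}" "R \<in> {S. ?P S}"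
    have "ddist (\<lambda>f. a * S (M f) + R (M f)) = (\<lambda>f. a * ddist (\<lambda>f. S (M f)) f + ddist (\<lambda>f. R (M f)) f)"
      by (auto simp: ddist_def)
    then show "(\<lambda>f. a * S f + R f) \<in> {S. ?P S}"
      using a is_distr_linear[of S R a] L_lin[of S R a] L_lin[OF d d, of S R a] by simp
  next
    fix Ss S assume a: "\<forall>n::nat. Ss n \<in> {S. ?P S}" "is_distr S" "\<forall>f. test_fn f \<longrightarrow> (\<lambda>n. Ss n f) \<longlonglongrightarrow> S f"
    have "(\<lambda>n. L (Ss n) (M f)) \<longlonglongrightarrow> L S (M f)" using a by (intro L_lim Mf) auto
    moreover have "(\<lambda>n. L (ddist (\<lambda>f. Ss n (M f))) f) \<longlonglongrightarrow> L (ddist (\<lambda>f. S (M f))) f"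
    proof (rule L_lim[OF d d _ f])
      show "(\<lambda>n. ddist (\<lambda>f. Ss n (M f)) h) \<longlonglongrightarrow> ddist (\<lambda>f. S (M f)) h" if "test_fn h" for h
        using a(3) dopD(1)[OF M that] that by simp
    qed (use a in auto)
    moreover have "(\<lambda>n. L (ddist (\<lambda>f. Ss n (M f))) f) = (\<lambda>n. L (Ss n) (M f))" using a(1) by auto
    ultimately show "S \<in> {S. ?P S}" using a(2) LIMSEQ_unique by auto
  qed
  moreover have "monomial \<alpha> \<in> A" for \<alpha>
  proof -
    obtain c where c: "\<And>f. test_fn f \<Longrightarrow> monomial \<alpha> (M f) = c * monomial \<alpha> f" using c by blast
    obtain m where m: "L (monomial \<alpha>) = (\<lambda>f. m * monomial \<alpha> f)" using eig by blast
    have "ddist (\<lambda>f. monomial \<alpha> (M f)) = (\<lambda>f. c * monomial \<alpha> f)"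
      using c by (auto simp: ddist_def fun_eq_iff distr_nontest[OF is_distr_monomial])
    then show ?thesis unfolding A_def
      using is_distr_monomial[of \<alpha>] L_cmult[OF is_distr_monomial, of c \<alpha>] c[OF f] m by simp
  qed
  ultimately have "S \<in> A" using dense_monomial S by blast
  then show ?thesis by (simp add: A_def)
qed

lemma commute_dil:
  assumes "\<And>j. a $ j \<noteq> 0" "is_distr S" "test_fn f"
  shows "L (ddist (\<lambda>f. S (\<lambda>x. f (x * a)))) f = L S (\<lambda>x. f (x * a))"
proof (rule commute[OF dop_dil[OF assms(1)] _ assms(2,3)])
  fix \<alpha> show "\<exists>c. \<forall>f. test_fn f \<longrightarrow> monomial \<alpha> (\<lambda>x. f (x * a)) = c * monomial \<alpha> f"
    using monomial_dil[OF assms(1)] by blast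
qed

lemma commute_theta:
  assumes "is_distr S" "test_fn f"
  shows "L (ddist (\<lambda>f. S (theta j f))) f = L S (theta j f)"
proof (rule commute[OF dop_theta _ assms])
  fix \<alpha> show "\<exists>c. \<forall>f. test_fn f \<longrightarrow> monomial \<alpha> (theta j f) = c * monomial \<alpha> f"
    using monomial_theta by blast
qed

definition T :: "(real^'n \<Rightarrow> complex) \<Rightarrow> complex" where "T = L (delta 1)"

lemma T_distr: "is_distr T" unfolding T_def by (intro L_distr is_distr_delta)

lemma G_scale:
  assumes a: "\<And>j. a $ j \<noteq> 0" and f: "test_fn f" shows "G f (y * a) = G (\<lambda>x. f (x * a)) y"
proof -
  have "delta (y * a) = ddist (\<lambda>f. delta y (\<lambda>x. f (x * a)))"
    using test_dil[OF _ a] by (auto simp: delta_def ddist_def fun_eq_iff)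
  then show ?thesis using commute_dil[OF a is_distr_delta f, of y] by (simp add: G_def)
qed

text \<open>Every y without zero coordinates is a dilate of the point 1, so the point mass at y is
  obtained from the one at 1.\<close>

lemma G_T: "(\<And>j. y $ j \<noteq> 0) \<Longrightarrow> test_fn f \<Longrightarrow> G f y = T (\<lambda>x. f (x * y))"
  using G_scale[of y f 1] by (simp add: G_def T_def)

lemma G_theta: assumes f: "test_fn f" shows "G (theta j f) y = theta j (G f) y"
proof -
  have "ddist (\<lambda>f. delta y (theta j f)) = (\<lambda>f. complex_of_real (y $ j) * dl [j] y f)"
    using dopD(1)[OF dop_theta] by (auto simp: delta_def dl_def ddist_def theta_def fun_eq_iff)
  then show ?thesis
    using commute_theta[OF is_distr_delta f, of y j] L_cmult[OF is_distr_dl, of "complex_of_real (y $ j)" "[j]" y] iterpd_G[OF f, of "[j]" y]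
    by (simp add: G_def theta_def)
qed

text \<open>Where x_j = 0 only the second summand survives: there theta_j acts on b-th j-derivatives
  as multiplication by b.\<close>

lemma iterpd_theta_replicate:
  assumes f: "smooth_fn f"
  shows "iterpd (replicate b j) (theta j f) x = complex_of_real (x $ j) * iterpd (replicate (Suc b) j) f x + of_nat b * iterpd (replicate b j) f x"
proof (induction b arbitrary: x)
  case (Suc b)
  have s: "smooth_fn (iterpd js f)" for js by (rule smooth_iterpd[OF f])
  have "iterpd (replicate (Suc b) j) (theta j f) x = pd j (iterpd (replicate b j) (theta j f)) x" by simp
  also have "iterpd (replicate b j) (theta j f) = (\<lambda>x. of_nat b * iterpd (replicate b j) f x + complex_of_real (x $ j) * iterpd (replicate (Suc b) j) f x)"
    using Suc by (auto simp: add.commute)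
  also have "pd j (\<lambda>x. of_nat b * iterpd (replicate b j) f x + complex_of_real (x $ j) * iterpd (replicate (Suc b) j) f x) x =
     of_nat b * pd j (iterpd (replicate b j) f) x + (pd j (\<lambda>x. complex_of_real (x $ j)) x * iterpd (replicate (Suc b) j) f x +
       complex_of_real (x $ j) * pd j (iterpd (replicate (Suc b) j) f) x)"
    by (subst pd_linear[OF s smooth_mult[OF smooth_X s]], subst pd_mult[OF smooth_X s]) simp
  finally show ?case by (simp add: pd_X algebra_simps)
qed (simp add: theta_def)

text \<open>U is L applied to the b-th j-derivative at y. It inherits two relations, one under
  theta_j and one under the reflection in x_j = 0. They are played off against each other on x_j^b
  A, where A is a compactly supported j-primitive of the odd function h - h o r.\<close>

lemma G_monomial_flat:
  fixes h :: "real^'n \<Rightarrow> complex"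
  assumes h: "test_fn h" and y: "y $ j = 0"
  shows "iterpd (replicate b j) (G (\<lambda>x. complex_of_real (x $ j) ^ Suc b * h x)) y = 0"
proof -
  \<comment> \<open>The reflection in the hyperplane x_j = 0. It fixes y.\<close>
  define r :: "real^'n" where "r = (\<chi> i. if i = j then -1 else 1)"
  have r: "r $ i \<noteq> 0" for i by (simp add: r_def)
  have rr: "x * r * r = x" for x by (simp add: vec_eq_iff r_def)
  define D where "D = dl (replicate b j) y"
  define U where "U = L D"
  have U: "is_distr U" unfolding U_def D_def by (intro L_distr is_distr_dl)
  let ?\<kappa> = "\<lambda>x. complex_of_real (x $ j) ^ Suc b * h x"
  have tk: "test_fn ?\<kappa>" by (intro test_mult2 smooth_power smooth_X h)
  have hr: "test_fn (\<lambda>x. h (x * r))" by (rule test_dil[OF h r])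
  have tH: "test_fn (\<lambda>x. h x - h (x * r))" by (intro test_diff h hr)
  have "(\<integral>t. h (x + t *\<^sub>R axis j 1) - h ((x + t *\<^sub>R axis j 1) * r) \<partial>lborel) = 0" for x
  proof -
    obtain R where R: "\<And>x. norm x > R \<Longrightarrow> h x = 0" using h unfolding test_fn_iff by auto
    have c: "continuous_on UNIV (\<lambda>t::real. k (x + t *\<^sub>R axis j 1))" if "test_fn k" for k
      by (rule continuous_on_compose2[OF test_cont[OF that, of UNIV]]) (auto intro!: continuous_intros)
    have i: "integrable lborel (\<lambda>t::real. k (x + t *\<^sub>R axis j 1))" if k: "test_fn k" for k
    proof -
      obtain R where R: "\<And>x. norm x > R \<Longrightarrow> k x = 0" using k unfolding test_fn_iff by auto
      show ?thesis
      proof (rule integrable_cc[where R = "R + norm x", OF c[OF k]])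
        fix t :: real assume t: "norm t > R + norm x"
        have "norm (t *\<^sub>R axis j 1 :: real^'n) \<le> norm (x + t *\<^sub>R axis j 1) + norm x"
          by (metis add.commute add_diff_cancel_left' norm_triangle_ineq4)
        then have "norm (x + t *\<^sub>R axis j 1) > R" using t by simp
        then show "k (x + t *\<^sub>R axis j 1) = 0" by (rule R)
      qed
    qed
    \<comment> \<open>The substitution t -> - 2 x_j - t reflects the line in the hyperplane, so h
      and its reflection have equal line integrals and \<open>antiderivative\<close>
      applies.\<close>
    have "(\<integral>t. h (x + t *\<^sub>R axis j 1) \<partial>lborel) = \<bar>-1\<bar> *\<^sub>R (\<integral>t. h (x + (-2 * x $ j + -1 * t) *\<^sub>R axis j 1) \<partial>lborel)"
      by (rule lborel_integral_real_affine) simp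
    moreover have "x + (-2 * x $ j + -1 * t) *\<^sub>R axis j 1 = (x + t *\<^sub>R axis j 1) * r" for t
      by (auto simp: vec_eq_iff axis_def r_def)
    ultimately have "(\<integral>t. h (x + t *\<^sub>R axis j 1) \<partial>lborel) = (\<integral>t. h ((x + t *\<^sub>R axis j 1) * r) \<partial>lborel)"
      by (simp only:) simp
    then show ?thesis using Bochner_Integration.integral_diff[OF i[OF h] i[OF hr]] by simp
  qed
  then obtain A where A: "test_fn A" "pd j A = (\<lambda>x. h x - h (x * r))" using antiderivative[OF tH] by blast
  \<comment> \<open>Since theta_j multiplies x_j^b by b, the function theta_j \<psi> - b \<psi>
    equals x_j^(b+1) (h - h o r) = \<kappa> + (-1)^b \<kappa> o r, and U kills theta_j \<psi> - b
    \<psi>.\<close>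
  let ?\<psi> = "\<lambda>x. complex_of_real (x $ j) ^ b * A x"
  have tp: "test_fn ?\<psi>" by (intro test_mult2 smooth_power smooth_X A)
  have txj: "theta j (\<lambda>x. complex_of_real (x $ j) ^ b) x = of_nat b * complex_of_real (x $ j) ^ b" for x
  proof (induction b)
    case (Suc b)
    have "theta j (\<lambda>x. complex_of_real (x $ j) * complex_of_real (x $ j) ^ b) x =
        theta j (\<lambda>x. complex_of_real (x $ j)) x * complex_of_real (x $ j) ^ b + complex_of_real (x $ j) * theta j (\<lambda>x. complex_of_real (x $ j) ^ b) x"
      by (rule theta_mult) (intro smooth_power smooth_X)+
    then show ?case using Suc by (simp add: theta_def[of j "\<lambda>x. complex_of_real (x $ j)"] pd_X algebra_simps)
  qed (simp add: theta_def)
  have tt: "test_fn (theta j ?\<psi>)" by (rule dopD(1)[OF dop_theta tp])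
  have "theta j ?\<psi> x = of_nat b * ?\<psi> x + complex_of_real (x $ j) ^ b * theta j A x" for x
    using theta_mult[OF smooth_power[OF smooth_X, of j b] test_smooth[OF A(1)], of j x] by (simp add: txj)
  moreover have "complex_of_real (x $ j) ^ b * theta j A x = (- 1) ^ b * ?\<kappa> (x * r) + ?\<kappa> x" for x
    by (simp add: theta_def A r_def power_minus[of "complex_of_real (x $ j)"] algebra_simps power_add[symmetric])
  ultimately have eq: "theta j ?\<psi> = (\<lambda>x. of_nat b * ?\<psi> x + ((- 1) ^ b * ?\<kappa> (x * r) + ?\<kappa> x))" by (auto simp: fun_eq_iff)
  have "ddist (\<lambda>f. D (theta j f)) = (\<lambda>f. of_nat b * D f)"
    using dopD(1)[OF dop_theta] y by (auto simp: D_def dl_def ddist_def iterpd_theta_replicate test_smooth fun_eq_iff)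
  then have U1: "U (theta j ?\<psi>) = of_nat b * U ?\<psi>"
    using commute_theta[OF is_distr_dl tp, of "replicate b j" y j] L_cmult[OF is_distr_dl, of "of_nat b" "replicate b j" y]
    by (simp add: U_def D_def)
  have cwr: "cw (replicate b j) r = (- 1) ^ b" by (induction b) (auto simp: r_def)
  have yr: "y * r = y" using y by (auto simp: vec_eq_iff r_def)
  have "ddist (\<lambda>f. D (\<lambda>x. f (x * r))) = (\<lambda>f. (-1) ^ b * D f)"
    using test_dil[OF _ r] by (auto simp: D_def dl_def ddist_def iterpd_dil test_smooth cwr yr fun_eq_iff)
  then have U2: "U (\<lambda>x. ?\<kappa> (x * r)) = (-1) ^ b * U ?\<kappa>"
    using commute_dil[OF r is_distr_dl tk, of "replicate b j" y] L_cmult[OF is_distr_dl, of "(-1) ^ b" "replicate b j" y]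
    by (simp add: U_def D_def)
  have tkr: "test_fn (\<lambda>x. ?\<kappa> (x * r))" by (rule test_dil[OF tk r])
  have "U (theta j ?\<psi>) = of_nat b * U ?\<psi> + ((-1) ^ b * U (\<lambda>x. ?\<kappa> (x * r)) + U ?\<kappa>)"
    unfolding eq
    by (subst distr_linear[OF U tp test_linear[OF tkr tk]], subst distr_linear[OF U tkr tk]) simp
  \<comment> \<open>The reflection rule for U contributes a second sign (-1)^b, so the two terms add
    up to 2 U \<kappa> instead of cancelling.\<close>
  then have "((-1) ^ b * (-1) ^ b + 1) * U ?\<kappa> = 0" using U1 U2 by (simp add: algebra_simps)
  moreover have "(-1) ^ b * (-1) ^ b = (1::complex)" by (simp flip: power_add mult_2)
  ultimately have "U ?\<kappa> = 0" by simp
  then show ?thesis using iterpd_G[OF tk, of "replicate b j" y] by (simp add: U_def D_def)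
qed

end

text \<open>The j-derivative of f satisfies the hypotheses with K - 1; integrating its bound from
  the foot y0 of y on the hyperplane gains one more factor |y_j|.\<close>

lemma taylor_flat:
  assumes "smooth_fn f" "\<And>b y. b < K \<Longrightarrow> y $ j = 0 \<Longrightarrow> iterpd (replicate b j) f y = 0"
    "\<And>y. norm (iterpd (replicate K j) f y) \<le> C"
  shows "norm (f y) \<le> C * \<bar>y $ j\<bar> ^ K"
  using assms
proof (induction K arbitrary: f y)
  case (Suc K)
  have C: "C \<ge> 0" using Suc.prems(3)[of 0] order_trans[OF norm_ge_zero] by blast
  have snoc: "iterpd (replicate b j) (pd j f) = iterpd (replicate (Suc b) j) f" for b
    using iterpd_snoc[of "replicate b j" j f] by (simp add: replicate_append_same)
  have b: "norm (pd j f z) \<le> C * \<bar>z $ j\<bar> ^ K" for z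
    by (rule Suc.IH[OF smooth_pd[OF Suc.prems(1)]]) (use Suc.prems in \<open>simp_all only: snoc Suc_less_eq\<close>)
  define y0 where "y0 = y - (y $ j) *\<^sub>R axis j 1"
  have y0: "y0 $ j = 0" "y = y0 + (y $ j) *\<^sub>R axis j 1" by (auto simp: y0_def axis_def)
  have "norm (f (y0 + (y $ j) *\<^sub>R axis j 1) - f (y0 + 0 *\<^sub>R axis j 1)) \<le> (C * \<bar>y $ j\<bar> ^ K) * \<bar>y $ j\<bar>"
  proof (rule norm_diff_le_derivative)
    show "((\<lambda>t. f (y0 + t *\<^sub>R axis j 1)) has_vector_derivative pd j f (y0 + t *\<^sub>R axis j 1)) (at t)" for t
      by (rule hpd_line) (intro smooth_hpd Suc.prems)
    fix t assume t: "\<bar>t\<bar> \<le> \<bar>y $ j\<bar>"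
    have "norm (pd j f (y0 + t *\<^sub>R axis j 1)) \<le> C * \<bar>t\<bar> ^ K" using b[of "y0 + t *\<^sub>R axis j 1"] y0(1) by (simp add: axis_def)
    also have "\<dots> \<le> C * \<bar>y $ j\<bar> ^ K" using C t by (intro mult_left_mono power_mono) auto
    finally show "norm (pd j f (y0 + t *\<^sub>R axis j 1)) \<le> C * \<bar>y $ j\<bar> ^ K" .
  qed
  moreover have "f y0 = 0" using Suc.prems(2)[of 0 y0] y0 by simp
  ultimately show ?case using y0(2) by (simp add: mult_ac)
qed simp


subsection \<open>Logarithmic coordinates on the positive orthant\<close>

definition lnv :: "real^'n::finite \<Rightarrow> real^'n" where
  "lnv u = (\<chi> i. ln (u $ i))"

text \<open>For \<open>s = 1\<close> the pullback by the coordinatewise logarithm; \<open>s = -1\<close> composes it with \<open>u \<mapsto> 1 / u\<close>.\<close>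

definition lg :: "real \<Rightarrow> (real^'n::finite \<Rightarrow> complex) \<Rightarrow> real^'n \<Rightarrow> complex" where
  "lg s k u = (if \<forall>i. 0 < u $ i then k (s *\<^sub>R lnv u) else 0)"

lemma lg_npos: "\<not> (\<forall>i. 0 < u $ i) \<Longrightarrow> lg s k u = 0"
  unfolding lg_def by (rule if_not_P)

text \<open>The chain rule in logarithmic coordinates: d/du_j of k (s ln u) is s / u_j times (d_j
  k), and 1 / u_j = exp (- s \<tau>_j) at \<tau> = s ln u because s^2 = 1. The summand 0 fits the
  shape of \<open>smooth1_affine\<close>.\<close>

definition lgd :: "real \<Rightarrow> 'n::finite \<Rightarrow> (real^'n \<Rightarrow> complex) \<Rightarrow> real^'n \<Rightarrow> complex" where
  "lgd s j k \<tau> = complex_of_real (s * exp (- s * (\<tau> $ j) + 0)) * pd j k \<tau>"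

lemma dop_lgd: "dop (lgd s j)"
proof -
  have "smooth_fn (\<lambda>\<tau>. complex_of_real (s * exp (- s * (\<tau> $ j) + 0)))"
    unfolding of_real_mult by (intro smooth_cmult smooth_coord smooth1_affine smooth1_exp)
  then show ?thesis unfolding lgd_def[abs_def] by (rule dop_comp[OF dop_mult dop_pd])
qed

lemma ss_cases: "s * s = 1 \<Longrightarrow> s = 1 \<or> s = (-1::real)"
  by (metis power2_eq_1_iff power2_eq_square)

lemma lg_nonzero:
  assumes s: "s * s = 1" and R: "\<And>\<tau>. norm \<tau> > R \<Longrightarrow> k \<tau> = 0" and n: "lg s k u \<noteq> 0"
  shows "0 < u $ i" "exp (- R) \<le> u $ i" "u $ i \<le> exp R"
proof -
  have u: "\<And>i. 0 < u $ i" "k (s *\<^sub>R lnv u) \<noteq> 0" using n by (auto simp: lg_def split: if_splits)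
  then have "norm (s *\<^sub>R lnv u) \<le> R" using R by (meson not_less)
  then have "\<bar>(s *\<^sub>R lnv u) $ i\<bar> \<le> R" using component_le_norm_cart order_trans by blast
  moreover have "\<bar>s\<bar> = 1" using ss_cases[OF s] by auto
  ultimately have "\<bar>ln (u $ i)\<bar> \<le> R" by (simp add: lnv_def abs_mult)
  then have l: "- R \<le> ln (u $ i)" "ln (u $ i) \<le> R" by auto
  show "0 < u $ i" by (rule u)
  then show "exp (- R) \<le> u $ i" "u $ i \<le> exp R"
    using l by (simp_all add: ln_ge_iff[symmetric]) (metis exp_le_cancel_iff exp_ln)
qed

text \<open>Where the pullback is non-zero, every coordinate is at least exp (- R). It therefore
  vanishes on a strip along each face of the orthant, which is what makes the extension by 0
  smooth.\<close>

lemma lg_zero_near: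
  assumes s: "s * s = 1" and k: "test_fn k" and u: "u $ i \<le> 0"
  shows "\<exists>e>0. \<forall>v. v $ i < e \<longrightarrow> lg s k v = 0"
proof -
  obtain R where R: "\<And>\<tau>. norm \<tau> > R \<Longrightarrow> k \<tau> = 0" using k unfolding test_fn_iff by auto
  have "lg s k v = 0" if "v $ i < exp (- R)" for v
    using lg_nonzero(2)[OF s, where k = k and R = R and u = v and i = i, OF R] that by fastforce
  then show ?thesis by (intro exI[of _ "exp (- R)"]) auto
qed

lemma lg_cont:
  fixes k :: "real^'n::finite \<Rightarrow> complex"
  assumes s: "s * s = 1" and k: "test_fn k" shows "continuous_on UNIV (lg s k)"
proof -
  have "isCont (lg s k) u" for u
  proof (cases "\<forall>i. 0 < u $ i")
    case True
    have eq: "{v::real^'n. \<forall>i. 0 < v $ i} = (\<Inter>i. {v. 0 < v $ i})" by auto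
    have o: "open {v::real^'n. \<forall>i. 0 < v $ i}"
      unfolding eq by (intro open_INT open_Collect_less continuous_intros ballI finite_class.finite_UNIV)
    have "continuous_on {v::real^'n. \<forall>i. 0 < v $ i} (\<lambda>v. k (s *\<^sub>R lnv v))"
      unfolding lnv_def
      by (rule continuous_on_compose2[OF test_cont[OF k, of UNIV]]) (auto intro!: continuous_intros simp: less_le)
    then have "isCont (\<lambda>v. k (s *\<^sub>R lnv v)) u"
      using o True by (simp add: continuous_on_eq_continuous_at)
    moreover have "eventually (\<lambda>v. lg s k v = k (s *\<^sub>R lnv v)) (nhds u)"
      using eventually_nhds_in_open[OF o, of u] True by (auto elim!: eventually_mono simp: lg_def)
    ultimately show ?thesis using isCont_cong[of "lg s k" "\<lambda>v. k (s *\<^sub>R lnv v)" u] by simp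
  next
    case False
    then obtain i where "u $ i \<le> 0" by (auto simp: not_less)
    then obtain e where e: "e > 0" "\<And>v. v $ i < e \<Longrightarrow> lg s k v = 0" using lg_zero_near[OF s k] by blast
    have o: "open {v::real^'n. v $ i < e}" by (intro open_Collect_less continuous_intros)
    have "eventually (\<lambda>v. lg s k v = 0) (nhds u)"
      using eventually_nhds_in_open[OF o, of u] e \<open>u $ i \<le> 0\<close> by (auto elim!: eventually_mono)
    then have "isCont (lg s k) u = isCont (\<lambda>v. 0 :: complex) u" by (rule isCont_cong)
    then show ?thesis by simp
  qed
  then show ?thesis by (simp add: continuous_at_imp_continuous_on)
qed

lemma hpd_lg:
  fixes k :: "real^'n::finite \<Rightarrow> complex"
  assumes s: "s * s = 1" and k: "test_fn k" shows "hpd j (lg s k) (lg s (lgd s j k) u) u"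
proof (cases "\<forall>i. 0 < u $ i")
  case True
  let ?\<tau> = "s *\<^sub>R lnv u" and ?\<phi> = "\<lambda>t. s * (ln (u $ j + t) - ln (u $ j))"
  have uj: "0 < u $ j" using True by simp
  have "(?\<phi> has_vector_derivative s * (1 / (u $ j))) (at 0)"
    unfolding has_real_derivative_iff_has_vector_derivative[symmetric]
    using uj by (auto intro!: derivative_eq_intros)
  moreover have "((\<lambda>t. k (?\<tau> + t *\<^sub>R axis j 1)) has_vector_derivative pd j k ?\<tau>) (at (?\<phi> 0))"
    using smooth_hpd[OF test_smooth[OF k], of j ?\<tau>] by (simp add: hpd_def)
  ultimately have "((\<lambda>t. k (?\<tau> + t *\<^sub>R axis j 1)) \<circ> ?\<phi> has_vector_derivative (s * (1 / (u $ j))) *\<^sub>R pd j k ?\<tau>) (at 0)"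
    by (rule vector_diff_chain_at)
  moreover have "(s * (1 / (u $ j))) *\<^sub>R pd j k ?\<tau> = lg s (lgd s j k) u"
  proof -
    have "- s * (?\<tau> $ j) + 0 = - (s * s) * ln (u $ j)" by (simp add: lnv_def)
    also have "\<dots> = - ln (u $ j)" using s by simp
    finally have "exp (- s * (?\<tau> $ j) + 0) = 1 / u $ j" using uj by (simp only:) (simp add: exp_minus inverse_eq_divide)
    then show ?thesis using True by (simp add: lg_def lgd_def scaleR_conv_of_real)
  qed
  ultimately have 1: "((\<lambda>t. k (?\<tau> + t *\<^sub>R axis j 1)) \<circ> ?\<phi> has_vector_derivative lg s (lgd s j k) u) (at 0)" by simp
  have "((\<lambda>t. lg s k (u + t *\<^sub>R axis j 1)) has_vector_derivative lg s (lgd s j k) u) (at 0)"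
  proof (rule has_vector_derivative_transform_within_open[OF 1, of "{- u $ j<..}"])
    fix t assume "t \<in> {- u $ j<..}"
    then have "\<forall>i. 0 < (u + t *\<^sub>R axis j 1) $ i" using True by (auto simp: axis_def)
    moreover have "?\<tau> + ?\<phi> t *\<^sub>R axis j 1 = s *\<^sub>R lnv (u + t *\<^sub>R axis j 1)"
      by (auto simp: vec_eq_iff lnv_def axis_def algebra_simps)
    ultimately show "((\<lambda>t. k (?\<tau> + t *\<^sub>R axis j 1)) \<circ> ?\<phi>) t = lg s k (u + t *\<^sub>R axis j 1)"
      by (simp add: lg_def)
  qed (use uj in auto)
  then show ?thesis by (simp add: hpd_def)
next
  case False
  then obtain i where i: "u $ i \<le> 0" by (auto simp: not_less)
  then obtain e where e: "e > 0" "\<And>v. v $ i < e \<Longrightarrow> lg s k v = 0" using lg_zero_near[OF s k] by blast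
  have o: "open {t. (u + t *\<^sub>R axis j 1) $ i < e}" by (intro open_Collect_less continuous_intros)
  have "((\<lambda>t. 0::complex) has_vector_derivative 0) (at 0)" by simp
  then have "((\<lambda>t. lg s k (u + t *\<^sub>R axis j 1)) has_vector_derivative 0) (at 0)"
    by (rule has_vector_derivative_transform_within_open[OF _ o]) (use e i in auto)
  moreover have "lg s (lgd s j k) u = 0" unfolding lg_def using False by (rule if_not_P)
  ultimately show ?thesis by (simp add: hpd_def)
qed

lemma pd_lg: "s * s = 1 \<Longrightarrow> test_fn k \<Longrightarrow> pd j (lg s k) = lg s (lgd s j k)"
  by (rule ext) (intro hpd_pd hpd_lg)

lemma test_lg:
  fixes k :: "real^'n::finite \<Rightarrow> complex"
  assumes s: "s * s = 1" and k: "test_fn k" shows "test_fn (lg s k)"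
  unfolding test_fn_iff
proof
  show "smooth_fn (lg s k)"
  proof (rule smooth_coinduct[where P = "lg s ` Collect test_fn"])
    fix f :: "real^'n \<Rightarrow> complex" and j :: 'n assume "f \<in> lg s ` Collect test_fn"
    then obtain k where f: "f = lg s k" "test_fn k" by auto
    show "continuous_on UNIV f" unfolding f by (rule lg_cont[OF s f(2)])
    show "\<exists>g\<in>lg s ` Collect test_fn. \<forall>x. hpd j f (g x) x"
      unfolding f(1) by (rule bexI[of _ "lg s (lgd s j k)"]) (use hpd_lg[OF s f(2)] dopD(1)[OF dop_lgd f(2)] in auto)
  qed (use k in auto)
  obtain R where R: "\<And>\<tau>. norm \<tau> > R \<Longrightarrow> k \<tau> = 0" using k unfolding test_fn_iff by auto
  have "lg s k u = 0" if u: "norm u > (\<Sum>i\<in>(UNIV::'n set). exp R)" for u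
  proof (rule ccontr)
    assume "lg s k u \<noteq> 0"
    then have "0 < u $ i \<and> u $ i \<le> exp R" for i using lg_nonzero[OF s, where k = k and R = R, OF R] by blast
    then have "norm u \<le> (\<Sum>i\<in>(UNIV::'n set). exp R)" by (intro order_trans[OF norm_le_l1_cart] sum_mono) (metis abs_of_pos)
    then show False using u by simp
  qed
  then show "\<exists>R. \<forall>x. R < norm x \<longrightarrow> lg s k x = 0" by blast
qed

fun lgds :: "real \<Rightarrow> 'n::finite list \<Rightarrow> (real^'n \<Rightarrow> complex) \<Rightarrow> real^'n \<Rightarrow> complex" where
  "lgds s [] k = k" | "lgds s (j # js) k = lgd s j (lgds s js k)"

lemma dop_lgds: "dop (lgds s js)"
proof (induction js)
  case Nil
  then show ?case using dop_id by (simp add: lgds.simps(1)[abs_def])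
next
  case (Cons j js)
  then show ?case using dop_comp[OF dop_lgd Cons] by (simp add: lgds.simps(2)[abs_def])
qed

lemma iterpd_lg:
  assumes s: "s * s = 1" and k: "test_fn k" shows "iterpd js (lg s k) = lg s (lgds s js k)"
  by (induction js) (auto simp: pd_lg[OF s dopD(1)[OF dop_lgds k]])

text \<open>Derivatives of pullbacks are pullbacks of the operators \<open>lgds\<close>, and a
  pullback extended by 0 takes no values besides 0 and those of the original, so uniform convergence
  carries over.\<close>

lemma dop_lg: assumes s: "s * s = 1" shows "dop (lg s :: (real^'n::finite \<Rightarrow> complex) \<Rightarrow> _)"
  unfolding dop_def
proof (intro conjI allI impI test_lg s)
  fix fs :: "nat \<Rightarrow> real^'n \<Rightarrow> complex" and f assume c: "D_conv fs f"
  note t = D_convD(1,2)[OF c]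
  obtain R where R: "\<And>n x. norm x > R \<Longrightarrow> fs n x = 0" using D_convD(3)[OF c] by auto
  show "D_conv (\<lambda>n. lg s (fs n)) (lg s f)"
    unfolding D_conv_iff
  proof (intro conjI allI impI test_lg s t)
    have "lg s (fs n) u = 0" if u: "norm u > (\<Sum>i\<in>(UNIV::'n set). exp R)" for n u
    proof (rule ccontr)
      assume "lg s (fs n) u \<noteq> 0"
      then have "0 < u $ i \<and> u $ i \<le> exp R" for i using lg_nonzero[OF s, where k = "fs n" and R = R, OF R] by blast
      then have "norm u \<le> (\<Sum>i\<in>(UNIV::'n set). exp R)" by (intro order_trans[OF norm_le_l1_cart] sum_mono) (metis abs_of_pos)
      then show False using u by simp
    qed
    then show "\<exists>R. \<forall>n x. R < norm x \<longrightarrow> lg s (fs n) x = 0" by blast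
    fix js and e :: real assume e: "e > 0"
    obtain N where N: "\<forall>n\<ge>N. \<forall>x. norm (iterpd [] (lgds s js (fs n)) x - iterpd [] (lgds s js f) x) < e"
      using D_convD(4)[OF dopD(3)[OF dop_lgds c] e] by blast
    have "norm (lg s (lgds s js (fs n)) x - lg s (lgds s js f) x) < e" if "n \<ge> N" for n x
      using N that e by (simp add: lg_def)
    then show "\<exists>N. \<forall>n\<ge>N. \<forall>x. norm (iterpd js (lg s (fs n)) x - iterpd js (lg s f) x) < e"
      using t by (auto simp: iterpd_lg[OF s])
  qed
qed (auto simp: lg_def fun_eq_iff)

text \<open>With \<tau> = ln u this is the c-th power of the product of the coordinates of
  u.\<close>

definition expfac :: "real \<Rightarrow> real^'n::finite \<Rightarrow> complex" where
  "expfac c \<tau> = (\<Prod>i\<in>UNIV. complex_of_real (exp (c * (\<tau> $ i) + 0)))"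

lemma smooth_expfac: "smooth_fn (expfac c)"
  unfolding expfac_def[abs_def] by (intro smooth_prod smooth_coord smooth1_affine smooth1_exp)

subsection \<open>Decay and support of the distribution \<open>T\<close>\<close>

context hadamard
begin

lemma mon_split: "Suc b \<le> K \<Longrightarrow> mon (\<lambda>_. K) x = complex_of_real (x $ i) ^ Suc b * mon (\<lambda>l. if l = i then K - Suc b else K) x"
proof -
  assume b: "Suc b \<le> K"
  have "(\<Prod>l\<in>UNIV. (x $ l) ^ K) = (x $ i) ^ K * (\<Prod>l\<in>UNIV - {i}. (x $ l) ^ K)"
    by (rule prod.remove) auto
  moreover have "(\<Prod>l\<in>UNIV. (x $ l) ^ (if l = i then K - Suc b else K)) = (x $ i) ^ (K - Suc b) * (\<Prod>l\<in>UNIV - {i}. (x $ l) ^ (if l = i then K - Suc b else K))"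
    by (subst prod.remove[of _ i]) auto
  moreover have "(\<Prod>l\<in>UNIV - {i}. (x $ l) ^ (if l = i then K - Suc b else K)) = (\<Prod>l\<in>UNIV - {i}. (x $ l) ^ K)"
    by (rule prod.cong) auto
  moreover have "(x $ i) ^ K = (x $ i) ^ Suc b * (x $ i) ^ (K - Suc b)" using b by (metis le_add_diff_inverse power_add)
  ultimately show ?thesis unfolding mon_def by (simp add: mult_ac)
qed

text \<open>A pullback from logarithmic coordinates is divisible by the K-th power of every
  coordinate, with a test function as quotient. By \<open>G_monomial_flat\<close> its image is then
  flat to order K on every hyperplane, and \<open>taylor_flat\<close> turns this into the
  bound.\<close>

lemma G_lg_pointwise:
  assumes s: "s * s = 1" and k: "test_fn k"
  shows "\<exists>C. \<forall>y i. norm (G (lg s k) y) \<le> C * \<bar>y $ i\<bar> ^ K"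
proof -
  \<comment> \<open>The quotient by (x_1 ... x_d)^K in logarithmic coordinates: with \<tau> = s ln x
    and s^2 = 1, exp (- K s \<tau>_i) equals x_i^(-K).\<close>
  let ?k = "\<lambda>\<tau>. expfac (- (real K * s)) \<tau> * k \<tau>"
  define h where "h = lg s ?k"
  have th: "test_fn h" unfolding h_def by (intro test_lg s test_mult2 smooth_expfac k)
  have eq: "lg s k = (\<lambda>x. mon (\<lambda>_. K) x * h x)"
  proof
    fix x
    show "lg s k x = mon (\<lambda>_. K) x * h x"
    proof (cases "\<forall>i. 0 < x $ i")
      case True
      have "(x $ i) ^ K * exp (- (real K * s) * ((s *\<^sub>R lnv x) $ i) + 0) = 1" for i
      proof -
        have "- (real K * s) * ((s *\<^sub>R lnv x) $ i) + 0 = - (real K * ln (x $ i)) * (s * s)"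
          by (simp add: lnv_def algebra_simps)
        also have "\<dots> = - (real K * ln (x $ i))" using s by simp
        finally have e1: "- (real K * s) * ((s *\<^sub>R lnv x) $ i) + 0 = - (real K * ln (x $ i))" .
        have e2: "(x $ i) ^ K = exp (real K * ln (x $ i))" using True by (simp add: exp_of_nat_mult)
        show ?thesis unfolding e1 unfolding e2 by (simp flip: exp_add)
      qed
      then have "(\<Prod>i\<in>UNIV. (x $ i) ^ K * exp (- (real K * s) * ((s *\<^sub>R lnv x) $ i) + 0)) = 1" by (intro prod.neutral) auto
      then have "complex_of_real (\<Prod>i\<in>UNIV. (x $ i) ^ K * exp (- (real K * s) * ((s *\<^sub>R lnv x) $ i) + 0)) = 1" by (simp only: of_real_1)
      then have "mon (\<lambda>_. K) x * expfac (- (real K * s)) (s *\<^sub>R lnv x) = 1"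
        unfolding mon_def expfac_def by (simp only: of_real_prod of_real_mult prod.distrib)
      then show ?thesis using True by (simp add: h_def lg_def mult.assoc[symmetric])
    next
      case False
      then show ?thesis unfolding h_def lg_npos[OF False] by simp
    qed
  qed
  have tl: "test_fn (lg s k)" by (rule test_lg[OF s k])
  have "\<exists>C>0. \<forall>y. norm (iterpd (replicate K i) (G (lg s k)) y) \<le> C" for i
    by (rule test_bounded[OF G_test[OF tl]])
  then obtain C where C: "\<And>i. C i > 0" "\<And>i y. norm (iterpd (replicate K i) (G (lg s k)) y) \<le> C i" by metis
  have "norm (G (lg s k) y) \<le> sum C UNIV * \<bar>y $ i\<bar> ^ K" for y i
  proof -
    have "norm (G (lg s k) y) \<le> C i * \<bar>y $ i\<bar> ^ K"
    proof (rule taylor_flat[OF G_smooth[OF tl] _ C(2)])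
      fix b and y :: "real^'n" assume b: "b < K" "y $ i = 0"
      have "lg s k = (\<lambda>x. complex_of_real (x $ i) ^ Suc b * (mon (\<lambda>l. if l = i then K - Suc b else K) x * h x))"
        unfolding eq using b(1) by (auto simp: mon_split[of b K _ i] mult.assoc fun_eq_iff simp del: power_Suc)
      then show "iterpd (replicate b i) (G (lg s k)) y = 0"
        using G_monomial_flat[OF test_mult2[OF smooth_mon th] b(2)] by simp
    qed
    also have "\<dots> \<le> sum C UNIV * \<bar>y $ i\<bar> ^ K"
      using C(1) by (intro mult_right_mono member_le_sum) (auto intro: less_imp_le)
    finally show ?thesis .
  qed
  then show ?thesis by blast
qed

text \<open>The bound for a single kernel is made uniform by Banach-Steinhaus, applied to the
  functionals k -> |y_i|^(-K) T (lg s k (x * y)) over all admissible y and i.\<close>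

lemma lg_bound:
  assumes s: "s * s = 1"
  shows "\<exists>m C. C \<ge> 0 \<and> (\<forall>k e y i. test_on (cball 0 R) k \<longrightarrow> dbound m e k \<longrightarrow> (\<forall>j. y $ j \<noteq> 0) \<longrightarrow>
     norm (T (\<lambda>x. lg s k (x * y))) \<le> C * e * \<bar>y $ i\<bar> ^ K)"
proof -
  define u where "u y i = ddist (\<lambda>k. complex_of_real (1 / \<bar>y $ i\<bar> ^ K) * T (\<lambda>x. lg s k (x * y)))" for y :: "real^'n" and i
  define U where "U = {u y i | y i. \<forall>j. y $ j \<noteq> 0}"
  have dM: "dop (\<lambda>k x. lg s k (x * y))" if "\<forall>j. y $ j \<noteq> 0" for y :: "real^'n"
    using dop_comp[OF dop_dil dop_lg[OF s], of y] that by simp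
  have "\<exists>m C. C \<ge> 0 \<and> (\<forall>v\<in>U. cbound (cball 0 R) v m C)"
  proof (rule uniform_boundedness)
    fix v assume "v \<in> U"
    then obtain y i where v: "v = u y i" "\<forall>j. y $ j \<noteq> 0" unfolding U_def by auto
    show "is_distr v" unfolding v(1) u_def
      using distr_ddist[OF is_distr_cmult[OF T_distr] dM[OF v(2)]] .
  next
    show "norm x \<le> R" if "x \<in> cball 0 R" for x :: "real^'n" using that by simp
    fix k :: "real^'n \<Rightarrow> complex" assume "test_on (cball 0 R) k"
    then have k: "test_fn k" by (simp add: test_on_def)
    obtain C where C: "\<And>y i. norm (G (lg s k) y) \<le> C * \<bar>y $ i\<bar> ^ K" using G_lg_pointwise[OF s k] by blast
    have "norm (u y i k) \<le> C" if y: "\<forall>j. y $ j \<noteq> 0" for y i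
    proof -
      have "T (\<lambda>x. lg s k (x * y)) = G (lg s k) y" using G_T[OF _ test_lg[OF s k], of y] y by simp
      then have "norm (u y i k) = norm (G (lg s k) y) / \<bar>y $ i\<bar> ^ K"
        using k by (simp add: u_def norm_mult norm_divide norm_power)
      also have "\<dots> \<le> C" using C[of y i] y by (simp add: divide_le_eq)
      finally show ?thesis .
    qed
    then show "\<exists>C. \<forall>v\<in>U. norm (v k) \<le> C" unfolding U_def by blast
  qed
  then obtain m C where mC: "C \<ge> 0" "\<And>v. v \<in> U \<Longrightarrow> cbound (cball 0 R) v m C" by blast
  have "norm (T (\<lambda>x. lg s k (x * y))) \<le> C * e * \<bar>y $ i\<bar> ^ K"
    if k: "test_on (cball 0 R) k" "dbound m e k" and y: "\<forall>j. y $ j \<noteq> 0" for k e y i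
  proof -
    have "u y i \<in> U" using y by (auto simp: U_def)
    then have "norm (u y i k) \<le> C * e" using mC(2) k unfolding cbound_def by blast
    moreover have "norm (u y i k) = norm (T (\<lambda>x. lg s k (x * y))) / \<bar>y $ i\<bar> ^ K"
      using k(1) by (simp add: test_on_def u_def norm_mult norm_divide norm_power)
    moreover have "\<bar>y $ i\<bar> ^ K > 0" using y by simp
    ultimately show ?thesis by (simp add: divide_le_eq)
  qed
  then show ?thesis using mC(1) by blast
qed

text \<open>Suppose supports of \<open>G (f n)\<close> reach out to y n, going to infinity. On a
  fixed h only finitely many point evaluations at y n are non-zero, so any multiples of them are
  pointwise bounded; multiples adapted to f n then contradict the uniform bound.\<close>

lemma uniform_support:
  "\<exists>R>0. \<forall>f y. test_on {x. \<forall>j. \<bar>x $ j\<bar> \<le> 1} f \<longrightarrow> norm y > R \<longrightarrow> G f y = 0"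
proof (rule ccontr)
  let ?B = "{x :: real^'n. \<forall>j. \<bar>x $ j\<bar> \<le> 1}"
  assume "\<not> ?thesis"
  then have "\<exists>f y. test_on ?B f \<and> norm y > real (Suc n) \<and> G f y \<noteq> 0" for n
    by (metis of_nat_0_less_iff zero_less_Suc)
  then obtain f y where fy: "\<And>n. test_on ?B (f n)" "\<And>n. norm (y n) > real (Suc n)" "\<And>n. G (f n) (y n) \<noteq> 0" by metis
  have "\<exists>e>0. dbound n e (f n)" for n by (rule dbound_exists) (use fy(1)[of n] in \<open>simp add: test_on_def\<close>)
  then obtain M where M: "\<And>n. M n > 0" "\<And>n. dbound n (M n) (f n)" by metis
  \<comment> \<open>The n-th functional takes the value n M n at f n, where M n bounds the
    derivatives of f n up to order n.\<close>
  define c where "c n = complex_of_real (real n * M n) / G (f n) (y n)" for n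
  define U where "U = range (\<lambda>n f. c n * L (delta (y n)) f)"
  have "\<exists>m C. C \<ge> 0 \<and> (\<forall>v\<in>U. cbound ?B v m C)"
  proof (rule uniform_boundedness)
    show "is_distr v" if "v \<in> U" for v
      using that unfolding U_def by (auto intro!: is_distr_cmult L_distr is_distr_delta)
    show "norm x \<le> real CARD('n)" if "x \<in> ?B" for x :: "real^'n"
      using order_trans[OF norm_le_l1_cart[of x] sum_mono[of UNIV "\<lambda>i. \<bar>x $ i\<bar>" "\<lambda>_. 1"]] that by simp
    fix h :: "real^'n \<Rightarrow> complex" assume "test_on ?B h"
    then have h: "test_fn h" by (simp add: test_on_def)
    obtain R where R: "\<And>y. norm y > R \<Longrightarrow> G h y = 0" using G_bounded_support[OF h] by blast
    obtain N where N: "real N \<ge> R" using real_arch_simple by blast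
    let ?C = "\<Sum>n\<le>N. norm (c n * G h (y n))"
    have "norm (c n * L (delta (y n)) h) \<le> ?C" for n
    proof (cases "n \<le> N")
      case True
      then show ?thesis unfolding G_def by (intro member_le_sum) auto
    next
      case False
      then have "norm (y n) > R" using fy(2)[of n] N by linarith
      then show ?thesis using R by (simp add: G_def sum_nonneg)
    qed
    then show "\<exists>C. \<forall>v\<in>U. norm (v h) \<le> C" unfolding U_def by blast
  qed
  then obtain m C where mC: "C \<ge> 0" "\<And>v. v \<in> U \<Longrightarrow> cbound ?B v m C" by blast
  \<comment> \<open>For n >= m the bound M n is valid at order m; n > C then violates the uniform
    estimate.\<close>
  obtain n where n: "n \<ge> m" "real n > C"
    by (metis add.commute le_add2 less_le_trans linear of_nat_mono reals_Archimedean2 order_less_le_trans)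
  have "(\<lambda>f. c n * L (delta (y n)) f) \<in> U" by (auto simp: U_def)
  moreover have "dbound m (M n) (f n)" using dbound_mono[OF M(2)[of n] n(1)] by simp
  ultimately have "norm (c n * G (f n) (y n)) \<le> C * M n" using mC(2) fy(1) unfolding cbound_def G_def by blast
  moreover have "c n * G (f n) (y n) = complex_of_real (real n * M n)" using fy(3) by (simp add: c_def)
  moreover have "norm (complex_of_real (real n * M n)) = real n * M n"
    using M(1)[of n] by (simp only: norm_of_real) (simp add: less_imp_le)
  ultimately show False using M(1)[of n] n(2) by (simp add: not_le[symmetric])
qed

text \<open>A box around a point with |x_i| < \<epsilon> = 1 / (R + 1), thin in direction i, is
  stretched to the unit box. The compensating dilation y has |y_i| = R + 1, beyond the common
  support radius R, so \<open>G\<close> vanishes at y and T vanishes on the box.\<close>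

lemma T_support: "\<exists>\<epsilon>>0. dsupp T \<subseteq> Wset \<epsilon>"
proof -
  obtain R where R: "R > 0" "\<And>f y. test_on {x. \<forall>j. \<bar>x $ j\<bar> \<le> 1} f \<Longrightarrow> norm y > R \<Longrightarrow> G f y = 0"
    using uniform_support by blast
  define \<epsilon> where "\<epsilon> = 1 / (R + 1)"
  have \<epsilon>: "\<epsilon> > 0" using R by (simp add: \<epsilon>_def)
  have "x0 \<in> Wset \<epsilon>" if x0: "x0 \<in> dsupp T" for x0
  proof (rule ccontr)
    assume "x0 \<notin> Wset \<epsilon>"
    then obtain i where i: "\<bar>x0 $ i\<bar> < \<epsilon>" by (auto simp: Wset_def not_le)
    define M where "M = 1 + norm x0"
    have M: "M > 0" "\<And>l. \<bar>x0 $ l\<bar> < M" unfolding M_def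
      by (simp add: add_pos_nonneg) (rule le_less_trans[OF component_le_norm_cart], simp)
    define a :: "real^'n" where "a = (\<chi> l. if l = i then \<epsilon> else M)"
    define y :: "real^'n" where "y = (\<chi> l. 1 / a $ l)"
    have a0: "a $ l > 0" for l using \<epsilon> M by (simp add: a_def)
    have y0: "y $ l \<noteq> 0" for l using a0[of l] by (simp add: y_def)
    let ?U = "{x. \<forall>l. \<bar>x $ l\<bar> < a $ l}"
    have eq: "?U = (\<Inter>l. {x. \<bar>x $ l\<bar> < a $ l})" by auto
    have oU: "open ?U" unfolding eq by (intro open_INT open_Collect_less continuous_intros ballI finite_class.finite_UNIV)
    have "x0 \<in> ?U" using i M by (auto simp: a_def)
    moreover have "T f = 0" if f: "test_fn f" "tsupp f \<subseteq> ?U" for f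
    proof -
      let ?f = "\<lambda>u. f (u * a)"
      have tf: "test_fn ?f" using a0 by (intro test_dil f) (auto simp: less_imp_neq[THEN not_sym])
      have "test_on {x. \<forall>j. \<bar>x $ j\<bar> \<le> 1} ?f"
        unfolding test_on_def
      proof (intro conjI allI impI tf)
        fix u :: "real^'n" assume u: "u \<notin> {x. \<forall>j. \<bar>x $ j\<bar> \<le> 1}"
        then obtain j where "\<not> \<bar>u $ j\<bar> \<le> 1" by blast
        then have "\<bar>(u * a) $ j\<bar> > a $ j" using a0[of j] by (simp add: abs_mult)
        then have "u * a \<notin> ?U" by (auto simp: not_less intro!: exI[of _ j])
        then show "?f u = 0" using tsupp_zero f(2) by blast
      qed
      moreover have "norm y > R"
      proof -
        have "\<bar>y $ i\<bar> = R + 1" using R by (simp add: y_def a_def \<epsilon>_def)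
        then show ?thesis using component_le_norm_cart[of y i] by linarith
      qed
      ultimately have "G ?f y = 0" by (rule R(2))
      then have "T (\<lambda>x. ?f (x * y)) = 0" using G_T[OF y0 tf] by simp
      moreover have "x * y * a = x" for x :: "real^'n"
      proof -
        have "y * a = 1" using a0 by (simp add: vec_eq_iff y_def less_imp_neq[THEN not_sym])
        then show ?thesis by (simp add: mult.assoc)
      qed
      ultimately show "T f = 0" by simp
    qed
    ultimately have "x0 \<notin> dsupp T" using oU unfolding dsupp_def by blast
    then show False using x0 by simp
  qed
  then show ?thesis using \<epsilon> by blast
qed

end


subsection \<open>Multiplicative convolution with kernels in logarithmic coordinates\<close>

text \<open>The gap between \<eta> and \<epsilon> yields an open neighbourhood of the support on
  which f and h agree. Agreement on the support alone would not be enough, as T may involve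
  derivatives.\<close>

lemma distr_eq_near_support:
  fixes f h :: "real^'n::finite \<Rightarrow> complex"
  assumes T: "is_distr T" and supp: "dsupp T \<subseteq> Wset \<epsilon>" and "\<eta> < \<epsilon>"
    and f: "test_fn f" and h: "test_fn h" and eq: "\<And>x. (\<And>j. \<eta> < \<bar>x $ j\<bar>) \<Longrightarrow> f x = h x"
  shows "T f = T h"
proof -
  let ?U = "{x::real^'n. \<forall>j. \<eta> < \<bar>x $ j\<bar>}"
  have e: "?U = (\<Inter>j. {x. \<eta> < \<bar>x $ j\<bar>})" by auto
  have "open ?U" unfolding e by (intro open_INT open_Collect_less continuous_intros ballI finite_class.finite_UNIV)
  moreover have "dsupp T \<subseteq> ?U"
  proof
    fix x assume "x \<in> dsupp T"
    then have "\<And>j. \<epsilon> \<le> \<bar>x $ j\<bar>" using supp by (auto simp: Wset_def)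
    then show "x \<in> ?U" using \<open>\<eta> < \<epsilon>\<close> by (auto intro: less_le_trans)
  qed
  ultimately have "T (\<lambda>x. f x - h x) = 0"
    by (rule dsupp_vanish[OF T test_diff[OF f h]]) (use eq in simp)
  then show ?thesis using distr_diff[OF T f h] by simp
qed

definition iv :: "real^'n::finite \<Rightarrow> real^'n" where "iv z = (\<chi> i. 1 / z $ i)"

text \<open>The density of \<open>k\<close> with respect to \<open>\<Prod>ds\<^sub>i / s\<^sub>i\<close>, the Haar measure of the positive orthant.\<close>

definition wk :: "(real^'n::finite \<Rightarrow> complex) \<Rightarrow> real^'n \<Rightarrow> complex" where
  "wk k = lg 1 (\<lambda>\<tau>. expfac (-1) \<tau> * k \<tau>)"

lemma test_wk: "test_fn k \<Longrightarrow> test_fn (wk k)"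
  unfolding wk_def by (intro test_lg test_mult2 smooth_expfac) auto

lemma wk_pos:
  assumes "\<forall>i. 0 < s $ i" shows "wk k s = (\<Prod>i\<in>UNIV. complex_of_real (1 / s $ i)) * k (lnv s)"
proof -
  have "exp (-1 * (lnv s $ i) + 0) = 1 / s $ i" for i
    using assms by (simp add: lnv_def exp_minus inverse_eq_divide)
  then show ?thesis using assms by (simp only: wk_def lg_def expfac_def) simp
qed

lemma wk_npos: "\<not> (\<forall>i. 0 < s $ i) \<Longrightarrow> wk k s = 0"
  unfolding wk_def by (rule lg_npos)

lemma wk_linear: "wk (\<lambda>\<tau>. a * f \<tau> + g \<tau>) s = a * wk f s + wk g s"
proof (cases "\<forall>i. 0 < s $ i")
  case True
  then show ?thesis unfolding wk_pos[OF True] by (simp add: algebra_simps)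
next
  case False
  then show ?thesis by (simp only: wk_npos[OF False]) simp
qed

lemma wk_nonzero:
  assumes R: "\<And>\<tau>. norm \<tau> > r \<Longrightarrow> k \<tau> = 0" and n: "wk k s \<noteq> 0"
  shows "0 < s $ i" "exp (- r) \<le> s $ i" "s $ i \<le> exp r"
  using lg_nonzero[where k = "\<lambda>\<tau>. expfac (-1) \<tau> * k \<tau>" and s = 1 and R = r and u = s and i = i] R n by (auto simp: wk_def)

lemma pd_expfac: "pd j (expfac c) \<tau> = complex_of_real c * expfac c \<tau>"
proof (rule hpd_pd)
  have "expfac c (\<tau> + t *\<^sub>R axis j 1) = expfac c \<tau> * complex_of_real (exp (c * t))" for t
  proof -
    have "exp (c * ((\<tau> + t *\<^sub>R axis j 1) $ i) + 0) = exp (c * (\<tau> $ i) + 0) * (if i = j then exp (c * t) else 1)" for i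
      by (auto simp: axis_def distrib_left exp_add)
    then have "expfac c (\<tau> + t *\<^sub>R axis j 1) = (\<Prod>i\<in>UNIV. complex_of_real (exp (c * (\<tau> $ i) + 0)) * complex_of_real (if i = j then exp (c * t) else 1))"
      unfolding expfac_def by (simp only: of_real_mult)
    also have "\<dots> = expfac c \<tau> * (\<Prod>i\<in>UNIV. complex_of_real (if i = j then exp (c * t) else 1))"
      unfolding expfac_def by (rule prod.distrib)
    also have "(\<Prod>i\<in>UNIV. complex_of_real (if i = j then exp (c * t) else 1)) = complex_of_real (exp (c * t))"
      by (subst prod.remove[of _ j]) (auto intro!: prod.neutral)
    finally show ?thesis .
  qed
  moreover have "((\<lambda>t. exp (c * t)) has_real_derivative exp (c * 0) * c) (at 0)"
    by (auto intro!: derivative_eq_intros)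
  then have "((\<lambda>t. complex_of_real (exp (c * t))) has_vector_derivative complex_of_real (exp (c * 0) * c)) (at 0)"
    by (intro has_vector_derivative_of_real) (simp add: has_real_derivative_iff_has_vector_derivative)
  then have "((\<lambda>t. expfac c \<tau> * complex_of_real (exp (c * t))) has_vector_derivative expfac c \<tau> * complex_of_real (exp (c * 0) * c)) (at 0)"
    by (rule has_vector_derivative_mult_right)
  ultimately show "hpd j (expfac c) (complex_of_real c * expfac c \<tau>) \<tau>"
    unfolding hpd_def by (simp add: mult.commute)
qed

text \<open>In logarithmic coordinates theta_j becomes d_j, and the density 1 / s_j contributes the
  summand - \<open>wk k\<close>. The latter cancels in d_j (s_j wk k) = wk (d_j k), the form used to
  integrate by parts.\<close>

lemma theta_wk:
  assumes k: "test_fn k" shows "theta j (wk k) s = wk (pd j k) s - wk k s"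
proof (cases "\<forall>i. 0 < s $ i")
  case True
  let ?k = "\<lambda>\<tau>. expfac (-1) \<tau> * k \<tau>"
  have tk: "test_fn ?k" by (intro test_mult2 smooth_expfac k)
  have "theta j (wk k) s = complex_of_real (s $ j) * lg 1 (lgd 1 j ?k) s"
    unfolding theta_def wk_def by (subst pd_lg[OF _ tk]) auto
  also have "lg 1 (lgd 1 j ?k) s = complex_of_real (1 / s $ j) * pd j ?k (lnv s)"
    using True by (simp add: lg_def lgd_def lnv_def exp_minus inverse_eq_divide)
  also have "complex_of_real (s $ j) * (complex_of_real (1 / s $ j) * pd j ?k (lnv s)) = pd j ?k (lnv s)"
  proof -
    have "s $ j \<noteq> 0" using True by (metis less_irrefl)
    then show ?thesis by simp
  qed
  also have "pd j ?k (lnv s) = expfac (-1) (lnv s) * pd j k (lnv s) - expfac (-1) (lnv s) * k (lnv s)"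
    by (subst pd_mult[OF smooth_expfac test_smooth[OF k]]) (simp add: pd_expfac)
  finally have "theta j (wk k) s = expfac (-1) (lnv s) * pd j k (lnv s) - expfac (-1) (lnv s) * k (lnv s)" .
  moreover have "wk q s = expfac (-1) (lnv s) * q (lnv s)" for q using True by (simp add: wk_def lg_def)
  ultimately show ?thesis by (simp only:)
next
  case False
  have "theta j (wk k) s = complex_of_real (s $ j) * lg 1 (lgd 1 j (\<lambda>\<tau>. expfac (-1) \<tau> * k \<tau>)) s"
    unfolding theta_def wk_def by (subst pd_lg) (auto intro: test_mult2 smooth_expfac k)
  then show ?thesis unfolding lg_npos[OF False] wk_npos[OF False] by simp
qed

lemma pd_X_mult: "smooth_fn g \<Longrightarrow> pd j (\<lambda>x. complex_of_real (x $ j) * g x) x = g x + theta j g x"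
  by (subst pd_mult[OF smooth_X]) (auto simp: pd_X theta_def)

text \<open>Under s = exp \<tau> this is the Lebesgue integral of k, kept in the coordinate
  s.\<close>

definition Ik :: "(real^'n::finite \<Rightarrow> complex) \<Rightarrow> complex" where
  "Ik k = (\<integral>s. wk k s \<partial>lborel)"

lemma Ik_linear:
  assumes "test_fn f" "test_fn g" shows "Ik (\<lambda>\<tau>. a * f \<tau> + g \<tau>) = a * Ik f + Ik g"
  unfolding Ik_def wk_linear using test_integrable[OF test_wk[OF assms(1)]] test_integrable[OF test_wk[OF assms(2)]] by simp

lemma Ik_pd: assumes k: "test_fn k" shows "Ik (pd j k) = 0"
proof -
  have "pd j (\<lambda>s. complex_of_real (s $ j) * wk k s) s = wk (pd j k) s" for s
    by (simp add: pd_X_mult[OF test_smooth[OF test_wk[OF k]]] theta_wk[OF k])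
  then show ?thesis
    using int_pd_zero[OF test_mult2[OF smooth_X test_wk[OF k]], of j j] by (simp add: Ik_def)
qed

lemma Ik_iterpd: "test_fn k \<Longrightarrow> Ik (iterpd (replicate (Suc n) j) k) = 0"
  using Ik_pd[OF test_iterpd[of k "replicate n j"], of j] by simp

context hadamard
begin

text \<open>On the support of \<open>wk k\<close> the value \<open>G \<phi> s\<close> is T applied
  to the dilate of \<phi> by s, so \<open>B k\<close> is T smoothed multiplicatively by k.\<close>

definition B :: "(real^'n \<Rightarrow> complex) \<Rightarrow> (real^'n \<Rightarrow> complex) \<Rightarrow> complex" where
  "B k \<phi> = (\<integral>s. wk k s * G \<phi> s \<partial>lborel)"

lemma B_integrable: "test_fn k \<Longrightarrow> test_fn \<phi> \<Longrightarrow> integrable lborel (\<lambda>s. wk k s * G \<phi> s)"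
  by (intro test_integrable test_mult test_wk G_smooth)

lemma B_linear:
  assumes "test_fn f" "test_fn g" "test_fn \<phi>" shows "B (\<lambda>\<tau>. a * f \<tau> + g \<tau>) \<phi> = a * B f \<phi> + B g \<phi>"
proof -
  have "(\<integral>s. wk (\<lambda>\<tau>. a * f \<tau> + g \<tau>) s * G \<phi> s \<partial>lborel) = (\<integral>s. a * (wk f s * G \<phi> s) + wk g s * G \<phi> s \<partial>lborel)"
    unfolding wk_linear by (simp add: algebra_simps)
  also have "\<dots> = a * B f \<phi> + B g \<phi>"
    unfolding B_def using B_integrable assms by simp
  finally show ?thesis by (simp add: B_def)
qed

lemma B_sum:
  assumes "finite I" "\<And>i. i \<in> I \<Longrightarrow> test_fn (f i)" "test_fn \<phi>"
  shows "B (\<lambda>\<tau>. \<Sum>i\<in>I. f i \<tau>) \<phi> = (\<Sum>i\<in>I. B (f i) \<phi>)"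
  using assms(1,2)
proof (induction I rule: finite_induct)
  case empty
  have "wk (\<lambda>\<tau>. 0) s = 0" for s :: "real^'n" using wk_linear[of 0 "\<lambda>\<tau>. 0" "\<lambda>\<tau>. 0" s] by (simp add: wk_def lg_def)
  then show ?case by (simp add: B_def)
next
  case (insert i I)
  then have "B (\<lambda>\<tau>. 1 * f i \<tau> + (\<Sum>i\<in>I. f i \<tau>)) \<phi> = 1 * B (f i) \<phi> + B (\<lambda>\<tau>. \<Sum>i\<in>I. f i \<tau>) \<phi>"
    by (intro B_linear test_sum assms(3)) auto
  then show ?case using insert by simp
qed

text \<open>The total derivative d_j (s_j wk k G \<phi>) integrates to 0. The density term cancels,
  and \<open>G\<close> commutes with theta_j, so a derivative of the kernel becomes - theta_j on the
  test function.\<close>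

lemma B_parts:
  assumes k: "test_fn k" and c: "test_fn \<phi>" shows "B (pd j k) \<phi> = B k (\<lambda>x. - theta j \<phi> x)"
proof -
  have tc: "test_fn (theta j \<phi>)" by (rule dopD(1)[OF dop_theta c])
  have Gm: "G (\<lambda>x. - theta j \<phi> x) s = - theta j (G \<phi>) s" for s
    using distr_cmult[OF L_distr[OF is_distr_delta] tc, of s "-1"] G_theta[OF c, of j s] by (simp add: G_def)
  have s: "smooth_fn (wk k)" "smooth_fn (G \<phi>)" by (intro test_smooth test_wk k G_test c)+
  have "pd j (\<lambda>s. complex_of_real (s $ j) * (wk k s * G \<phi> s)) s = wk (pd j k) s * G \<phi> s - wk k s * G (\<lambda>x. - theta j \<phi> x) s" for s
    unfolding pd_X_mult[OF smooth_mult[OF s]] theta_mult[OF s] theta_wk[OF k] Gm by (simp add: algebra_simps)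
  then have "(\<integral>s. wk (pd j k) s * G \<phi> s - wk k s * G (\<lambda>x. - theta j \<phi> x) s \<partial>lborel) = 0"
    using int_pd_zero[OF test_mult2[OF smooth_X test_mult[OF test_wk[OF k] s(2)]], of j j] by simp
  moreover have "test_fn (\<lambda>x. - theta j \<phi> x)" using test_cmult[OF tc, of "-1"] by simp
  ultimately show ?thesis
    using Bochner_Integration.integral_diff[OF B_integrable[OF test_pd[OF k] c] B_integrable[OF k], of "\<lambda>x. - theta j \<phi> x" j]
    by (simp add: B_def)
qed

text \<open>The density of \<open>B k\<close>, that is, the smoothed T as a function of z:
  \<open>lg (-1) k (x * iv z)\<close> is k at ln (z / x), and the product is the Haar density. The
  value 0 is assigned on the null set of the hyperplanes.\<close>

definition tk :: "(real^'n \<Rightarrow> complex) \<Rightarrow> real^'n \<Rightarrow> complex" where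
  "tk k z = (if \<forall>i. z $ i \<noteq> 0 then T (\<lambda>x. lg (-1) k (x * iv z)) * (\<Prod>i\<in>UNIV. complex_of_real \<bar>1 / z $ i\<bar>) else 0)"

lemma iv_nz: "(\<forall>i. z $ i \<noteq> 0) \<Longrightarrow> iv z $ i \<noteq> 0"
  by (simp add: iv_def)

lemma test_lgm: "test_fn k \<Longrightarrow> test_fn (lg (-1) k)"
  by (rule test_lg) auto

lemma lgm_nonzero:
  assumes "\<And>\<tau>. norm \<tau> > r \<Longrightarrow> k \<tau> = 0" "lg (-1) k u \<noteq> 0"
  shows "0 < u $ i" "exp (- r) \<le> u $ i" "u $ i \<le> exp r"
  using lg_nonzero[where s = "-1" and R = r and k = k and u = u and i = i] assms by auto

text \<open>As a function of x the kernel lives in |x_i| <= |z_i| exp r, which stays away from the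
  support of T.\<close>

lemma tk_zero:
  assumes supp: "dsupp T \<subseteq> Wset \<epsilon>" and k: "test_fn k" and R: "\<And>\<tau>. norm \<tau> > r \<Longrightarrow> k \<tau> = 0"
    and z: "\<bar>z $ i\<bar> * exp r < \<epsilon>"
  shows "tk k z = 0"
proof (cases "\<forall>i. z $ i \<noteq> 0")
  case True
  have "T (\<lambda>x. lg (-1) k (x * iv z)) = T (\<lambda>x. 0)"
  proof (rule distr_eq_near_support[OF T_distr supp z test_dil[OF test_lgm[OF k] iv_nz[OF True]] test_zero])
    fix x :: "real^'n" assume x: "\<And>j. \<bar>z $ i\<bar> * exp r < \<bar>x $ j\<bar>"
    show "lg (-1) k (x * iv z) = 0"
    proof (rule ccontr)
      assume n: "lg (-1) k (x * iv z) \<noteq> 0"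
      have "0 < (x * iv z) $ i" by (rule lgm_nonzero(1)[OF R n])
      moreover have "(x * iv z) $ i \<le> exp r" by (rule lgm_nonzero(3)[OF R n])
      ultimately have "\<bar>x $ i / z $ i\<bar> \<le> exp r" by (simp add: iv_def)
      then have "\<bar>x $ i\<bar> \<le> \<bar>z $ i\<bar> * exp r" using True by (simp add: divide_le_eq mult.commute)
      then show False using x[of i] by simp
    qed
  qed
  then show ?thesis by (simp add: tk_def distr_zero[OF T_distr])
next
  case False
  then show ?thesis unfolding tk_def by (rule if_not_P)
qed

text \<open>The pointwise form of the substitution s = z / x: the Jacobian 1 / |x_i| times the
  density x_i / z_i is 1 / |z_i| where z / x is positive, and there ln (z / x) = - ln (x /
  z).\<close>

lemma kernel_swap:
  fixes x z :: "real^'n"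
  assumes x: "\<forall>i. x $ i \<noteq> 0" and z: "\<forall>i. z $ i \<noteq> 0"
  shows "complex_of_real (\<Prod>i\<in>UNIV. \<bar>iv x $ i\<bar>) * wk k (z * iv x) = (\<Prod>i\<in>UNIV. complex_of_real \<bar>1 / z $ i\<bar>) * lg (-1) k (x * iv z)"
proof (cases "\<forall>i. 0 < (z * iv x) $ i")
  case True
  have p: "0 < (x * iv z) $ i" for i
    using True[rule_format, of i] by (auto simp: iv_def zero_less_divide_iff)
  have "(-1) *\<^sub>R lnv (x * iv z) = lnv (z * iv x)"
  proof -
    have "- ln (x $ i / z $ i) = ln (z $ i / x $ i)" for i
      using ln_inverse[of "x $ i / z $ i"] p[of i] by (simp add: iv_def)
    then show ?thesis by (simp add: vec_eq_iff lnv_def iv_def)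
  qed
  then have 1: "lg (-1) k (x * iv z) = k (lnv (z * iv x))" using p by (simp add: lg_def)
  have "\<bar>iv x $ i\<bar> * (1 / (z * iv x) $ i) = \<bar>1 / z $ i\<bar>" for i
  proof -
    have "(x * iv z) $ i = \<bar>x $ i\<bar> / \<bar>z $ i\<bar>" using p[of i] by (simp add: iv_def flip: abs_divide)
    then have "1 / (z * iv x) $ i = \<bar>x $ i\<bar> / \<bar>z $ i\<bar>" by (simp add: iv_def)
    then show ?thesis using x by (simp add: iv_def)
  qed
  then have "(\<Prod>i\<in>UNIV. complex_of_real (\<bar>iv x $ i\<bar> * (1 / (z * iv x) $ i))) = (\<Prod>i\<in>UNIV. complex_of_real \<bar>1 / z $ i\<bar>)" by simp
  then have "complex_of_real (\<Prod>i\<in>UNIV. \<bar>iv x $ i\<bar>) * (\<Prod>i\<in>UNIV. complex_of_real (1 / (z * iv x) $ i)) = (\<Prod>i\<in>UNIV. complex_of_real \<bar>1 / z $ i\<bar>)"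
    by (simp only: of_real_prod of_real_mult prod.distrib)
  then show ?thesis unfolding 1 wk_pos[OF True] by (simp add: mult.assoc[symmetric])
next
  case False
  then have F2: "\<not> (\<forall>i. 0 < (x * iv z) $ i)" by (auto simp: iv_def zero_less_divide_iff)
  show ?thesis unfolding wk_npos[OF False] lg_npos[OF F2] by simp
qed

text \<open>T is moved outside the s-integral, s = z / x is substituted, and T is moved back inside.
  Both 1 / x and 1 / z are singular on the hyperplanes; cut-offs in x and in z restore families to
  which \<open>distr_fubini\<close> applies, without changing the values.\<close>

lemma B_repr:
  assumes k: "test_fn k" and c: "test_fn \<phi>"
  shows "B k \<phi> = (\<integral>z. \<phi> z * tk k z \<partial>lborel)"
proof -
  obtain \<epsilon> where \<epsilon>: "\<epsilon> > 0" "dsupp T \<subseteq> Wset \<epsilon>" using T_support by blast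
  obtain r where r: "\<And>\<tau>. norm \<tau> > r \<Longrightarrow> k \<tau> = 0" using k unfolding test_fn_iff by auto
  obtain S0 where "\<And>x. norm x > S0 \<Longrightarrow> \<phi> x = 0" using c unfolding test_fn_iff by auto
  then obtain S where S: "S \<ge> 0" "\<And>x. norm x > S \<Longrightarrow> \<phi> x = 0"
    by (metis dual_order.strict_trans2 max.cobounded1 max.cobounded2)
  obtain Q where Q: "\<And>s. norm s > Q \<Longrightarrow> wk k s = 0" using test_wk[OF k] unfolding test_fn_iff by auto
  \<comment> \<open>\<open>planecut \<delta>\<close> is 1 where all |x_j| > 2 \<delta>, hence near
    the support of T, as 2 \<delta> < \<epsilon>.\<close>
  define \<delta> where "\<delta> = \<epsilon> / 3"
  \<comment> \<open>If all |x_i| > \<delta>, a non-zero kernel forces |z_i| >= \<delta> exp (- r) =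
    2 \<eta> for all i, the region where \<open>planecut \<eta>\<close> is 1.\<close>
  define \<eta> where "\<eta> = \<delta> * exp (- r) / 2"
  have \<delta>: "\<delta> > 0" "2 * \<delta> < \<epsilon>" using \<epsilon> by (auto simp: \<delta>_def)
  have \<eta>: "\<eta> > 0" "2 * \<eta> = \<delta> * exp (- r)" "2 * \<eta> * exp r = \<delta>" using \<delta> by (auto simp: \<eta>_def simp flip: exp_add)
  let ?M = "\<Sum>i\<in>(UNIV::'n set). S * exp r"
  have box: "norm x \<le> ?M" if "\<And>i. \<bar>x $ i\<bar> \<le> S * exp r" for x :: "real^'n"
    by (intro order_trans[OF norm_le_l1_cart] sum_mono that)
  have Sco: "\<bar>z $ i\<bar> \<le> S" if "\<phi> z \<noteq> 0" for z i
  proof -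
    have "norm z \<le> S" using S(2)[of z] that by fastforce
    then show ?thesis using component_le_norm_cart[of z i] by linarith
  qed
  interpret F: cc_family "\<lambda>s x. wk k s * \<phi> (x * s + 0)" "max Q ?M"
  proof
    show "cfam (\<lambda>s x. wk k s * \<phi> (x * s + 0))"
      by (intro cfam_scale cfam_affine test_cont[OF test_wk[OF k]] test_smooth c continuous_on_id continuous_on_const)
    fix s x :: "real^'n"
    show "wk k s * \<phi> (x * s + 0) = 0" if "norm s > max Q ?M" using Q that by simp
    show "wk k s * \<phi> (x * s + 0) = 0" if n: "norm x > max Q ?M"
    proof (rule ccontr)
      assume "wk k s * \<phi> (x * s + 0) \<noteq> 0"
      then have a: "wk k s \<noteq> 0" "\<phi> (x * s) \<noteq> 0" by auto
      have "\<bar>x $ i\<bar> \<le> S * exp r" for i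
      proof -
        have s: "0 < s $ i" "exp (- r) \<le> s $ i" using wk_nonzero[OF r a(1)] by auto
        have "\<bar>x $ i\<bar> * exp (- r) \<le> \<bar>x $ i\<bar> * s $ i" using s by (intro mult_left_mono) auto
        also have "\<dots> \<le> S" using Sco[OF a(2), of i] s by (simp add: abs_mult)
        finally have "\<bar>x $ i\<bar> * exp (- r) * exp r \<le> S * exp r" by (intro mult_right_mono) auto
        then show ?thesis by (simp add: mult.assoc flip: exp_add)
      qed
      then show False using box n by fastforce
    qed
  qed
  define A where "A = (\<lambda>x. \<integral>s. wk k s * \<phi> (x * s + 0) \<partial>lborel)"
  have tA: "test_fn A" unfolding A_def by (rule F.int_test)
  have "T (\<lambda>x. wk k s * \<phi> (x * s + 0)) = wk k s * G \<phi> s" for s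
  proof (cases "\<forall>i. 0 < s $ i")
    case True
    then have s: "s $ i \<noteq> 0" for i by (metis less_irrefl)
    show ?thesis using distr_cmult[OF T_distr test_dil[OF c s], of "wk k s"] G_T[OF s c] by simp
  next
    case False
    show ?thesis unfolding wk_npos[OF False] by (simp add: distr_zero[OF T_distr])
  qed
  then have 1: "B k \<phi> = T A" unfolding A_def F.distr_fubini[OF T_distr] by (simp add: B_def)
  have pc1: "planecut \<delta> x = 1" if "\<And>j. 2 * \<delta> < \<bar>x $ j\<bar>" for x :: "real^'n"
    by (rule planecut_1[OF \<delta>(1) less_imp_le[OF that]])
  have 2: "T A = T (\<lambda>x. planecut \<delta> x * A x)"
    by (rule distr_eq_near_support[OF T_distr \<epsilon>(2) \<delta>(2) tA test_mult2[OF smooth_planecut tA]]) (simp add: pc1)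
  \<comment> \<open>A continuous substitute for 1 / z, equal to it where all |z_i| > \<eta>.
    Elsewhere \<open>planecut \<eta>\<close> makes the amplitude a vanish.\<close>
  define riv where "riv z = (\<chi> i. z $ i / max ((z $ i)\<^sup>2) (\<eta>\<^sup>2))" for z :: "real^'n"
  have riv: "riv z = iv z" if "\<And>i. \<eta> < \<bar>z $ i\<bar>" for z :: "real^'n"
  proof -
    have "z $ i / max ((z $ i)\<^sup>2) (\<eta>\<^sup>2) = 1 / z $ i" for i
    proof -
      have "\<eta>\<^sup>2 \<le> (z $ i)\<^sup>2" using that[of i] \<eta>(1) by (simp add: abs_le_square_iff[symmetric])
      then show ?thesis using that[of i] \<eta>(1) by (simp add: max_def power2_eq_square)
    qed
    then show ?thesis by (simp add: riv_def iv_def)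
  qed
  have criv: "continuous_on UNIV riv"
    unfolding riv_def by (intro continuous_intros) (use \<eta>(1) in \<open>auto simp: max_def dest: sym\<close>)
  define a where "a z = planecut \<eta> z * \<phi> z * (\<Prod>i\<in>UNIV. complex_of_real \<bar>riv z $ i\<bar>)" for z
  have ca: "continuous_on UNIV a" unfolding a_def[abs_def]
    by (intro continuous_on_mult smooth_cont smooth_planecut test_smooth c continuous_on_prod continuous_on_of_real continuous_on_rabs continuous_on_component criv)
  have a0: "a z = 0" if "\<bar>z $ i\<bar> \<le> \<eta>" for z i
    using planecut_0[OF \<eta>(1) that] by (simp add: a_def)
  interpret H: cc_family "\<lambda>z x. a z * (planecut \<delta> x * lg (-1) k (x * riv z + 0))" "max S ?M"
  proof
    show "cfam (\<lambda>z x. a z * (planecut \<delta> x * lg (-1) k (x * riv z + 0)))"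
      by (intro cfam_scale cfam_mult cfam_const cfam_affine ca criv smooth_planecut test_smooth test_lgm k continuous_on_const)
    fix z x :: "real^'n"
    show "a z * (planecut \<delta> x * lg (-1) k (x * riv z + 0)) = 0" if "norm z > max S ?M" using S that by (simp add: a_def)
    show "a z * (planecut \<delta> x * lg (-1) k (x * riv z + 0)) = 0" if n: "norm x > max S ?M"
    proof (rule ccontr)
      assume "a z * (planecut \<delta> x * lg (-1) k (x * riv z + 0)) \<noteq> 0"
      then have b: "a z \<noteq> 0" "lg (-1) k (x * riv z) \<noteq> 0" by auto
      then have zi: "\<And>i. \<eta> < \<bar>z $ i\<bar>" using a0 by (meson not_le)
      have cz: "\<phi> z \<noteq> 0" using b(1) by (auto simp: a_def)
      have "\<bar>x $ i\<bar> \<le> S * exp r" for i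
      proof -
        have "0 < (x * riv z) $ i" by (rule lgm_nonzero(1)[OF r b(2)])
        moreover have "(x * riv z) $ i \<le> exp r" by (rule lgm_nonzero(3)[OF r b(2)])
        ultimately have "\<bar>x $ i / z $ i\<bar> \<le> exp r" unfolding riv[OF zi] by (simp add: iv_def)
        then have "\<bar>x $ i\<bar> \<le> \<bar>z $ i\<bar> * exp r" using zi[of i] \<eta>(1) by (simp add: divide_le_eq mult.commute split: if_splits)
        also have "\<dots> \<le> S * exp r" using Sco[OF cz] by (intro mult_right_mono) auto
        finally show ?thesis .
      qed
      then show False using box n by fastforce
    qed
  qed
  have 3: "planecut \<delta> x * A x = (\<integral>z. a z * (planecut \<delta> x * lg (-1) k (x * riv z + 0)) \<partial>lborel)" for x
  proof (cases "\<exists>i. \<bar>x $ i\<bar> \<le> \<delta>")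
    case True
    then have "planecut \<delta> x = 0" using planecut_0[OF \<delta>(1)] by blast
    then show ?thesis by simp
  next
    case False
    then have x: "\<And>i. \<delta> < \<bar>x $ i\<bar>" by (meson not_le)
    then have xn: "\<forall>i. x $ i \<noteq> 0" using \<delta>(1) by (metis abs_zero not_less_iff_gr_or_eq order_less_trans)
    let ?p = "complex_of_real (\<Prod>i\<in>UNIV. \<bar>iv x $ i\<bar>)"
    have "A x = ?p * (\<integral>z. wk k (z * iv x + 0) * \<phi> (x * (z * iv x + 0) + 0) \<partial>lborel)"
      unfolding A_def
      by (rule integral_affine_cart[OF iv_nz[OF xn]])
        (intro continuous_borel continuous_on_mult test_cont test_wk k continuous_on_compose2[OF test_cont[OF c, of UNIV]] continuous_intros subset_UNIV)
    also have "(\<lambda>z. wk k (z * iv x + 0) * \<phi> (x * (z * iv x + 0) + 0)) = (\<lambda>z. wk k (z * iv x) * \<phi> z)"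
    proof
      fix z
      have "x * (z * iv x) = z" using xn by (simp add: vec_eq_iff iv_def)
      then show "wk k (z * iv x + 0) * \<phi> (x * (z * iv x + 0) + 0) = wk k (z * iv x) * \<phi> z" by simp
    qed
    finally have Ax: "A x = (\<integral>z. ?p * (wk k (z * iv x) * \<phi> z) \<partial>lborel)" by simp
    have key: "?p * (wk k (z * iv x) * \<phi> z) = a z * lg (-1) k (x * riv z + 0)" for z
    proof -
      have small: "wk k (z * iv x) = 0" if "\<bar>z $ i\<bar> < 2 * \<eta>" for i
      proof (rule ccontr)
        assume n: "wk k (z * iv x) \<noteq> 0"
        have "exp (- r) \<le> (z * iv x) $ i" by (rule wk_nonzero(2)[OF r n])
        moreover have "0 < (z * iv x) $ i" by (rule wk_nonzero(1)[OF r n])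
        ultimately have "exp (- r) \<le> \<bar>z $ i / x $ i\<bar>" by (simp add: iv_def del: abs_divide)
        then have "\<bar>x $ i\<bar> * exp (- r) \<le> \<bar>z $ i\<bar>" using xn by (simp add: le_divide_eq mult.commute)
        moreover have "\<delta> * exp (- r) \<le> \<bar>x $ i\<bar> * exp (- r)" using x[of i] by (intro mult_right_mono) auto
        ultimately show False using that \<eta>(2) by linarith
      qed
      show ?thesis
      proof (cases "\<exists>i. \<bar>z $ i\<bar> \<le> \<eta>")
        case True
        then obtain i where i: "\<bar>z $ i\<bar> \<le> \<eta>" by blast
        then have "\<bar>z $ i\<bar> < 2 * \<eta>" using \<eta>(1) by linarith
        then show ?thesis using small a0[OF i] by simp
      next
        case False
        then have zi: "\<And>i. \<eta> < \<bar>z $ i\<bar>" by (meson not_le)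
        then have zn: "\<forall>i. z $ i \<noteq> 0" using \<eta>(1) by (metis abs_zero not_less_iff_gr_or_eq order_less_trans)
        have sw: "?p * wk k (z * iv x) = (\<Prod>i\<in>UNIV. complex_of_real \<bar>riv z $ i\<bar>) * lg (-1) k (x * riv z)"
          using kernel_swap[OF xn zn, of k] unfolding riv[OF zi] by (simp add: iv_def)
        show ?thesis
        proof (cases "\<forall>i. 2 * \<eta> \<le> \<bar>z $ i\<bar>")
          case True
          then have "planecut \<eta> z = 1" using planecut_1[OF \<eta>(1)] by blast
          then show ?thesis using sw by (simp add: a_def mult_ac)
        next
          case False
          then have "wk k (z * iv x) = 0" using small by (meson not_le)
          then show ?thesis using sw by (auto simp: a_def)
        qed
      qed
    qed
    have "planecut \<delta> x * A x = planecut \<delta> x * (\<integral>z. a z * lg (-1) k (x * riv z + 0) \<partial>lborel)"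
      unfolding Ax key ..
    also have "\<dots> = (\<integral>z. planecut \<delta> x * (a z * lg (-1) k (x * riv z + 0)) \<partial>lborel)" by simp
    finally show ?thesis by (simp add: mult_ac)
  qed
  have "T (\<lambda>x. a z * (planecut \<delta> x * lg (-1) k (x * riv z + 0))) = \<phi> z * tk k z" for z
  proof -
    have small: "tk k z = 0" if "\<bar>z $ i\<bar> < 2 * \<eta>" for i
    proof (rule tk_zero[OF \<epsilon>(2) k r])
      have "\<bar>z $ i\<bar> * exp r < 2 * \<eta> * exp r" using that by (intro mult_strict_right_mono) auto
      also have "\<dots> < \<epsilon>" using \<eta>(3) \<delta> by simp
      finally show "\<bar>z $ i\<bar> * exp r < \<epsilon>" .
    qed
    show ?thesis
    proof (cases "\<exists>i. \<bar>z $ i\<bar> \<le> \<eta>")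
      case True
      then obtain i where i: "\<bar>z $ i\<bar> \<le> \<eta>" by blast
      then have "\<bar>z $ i\<bar> < 2 * \<eta>" using \<eta>(1) by linarith
      then show ?thesis using small a0[OF i] by (simp add: distr_zero[OF T_distr])
    next
      case False
      then have zi: "\<And>i. \<eta> < \<bar>z $ i\<bar>" by (meson not_le)
      then have zn: "\<forall>i. z $ i \<noteq> 0" using \<eta>(1) by (metis abs_zero not_less_iff_gr_or_eq order_less_trans)
      have tl: "test_fn (\<lambda>x. lg (-1) k (x * riv z))" unfolding riv[OF zi] by (rule test_dil[OF test_lgm[OF k] iv_nz[OF zn]])
      have tp: "test_fn (\<lambda>x. planecut \<delta> x * lg (-1) k (x * riv z))" by (rule test_mult2[OF smooth_planecut tl])
      have "T (\<lambda>x. planecut \<delta> x * lg (-1) k (x * riv z)) = T (\<lambda>x. lg (-1) k (x * riv z))"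
        by (rule distr_eq_near_support[OF T_distr \<epsilon>(2) \<delta>(2) tp tl]) (simp add: pc1)
      then have "T (\<lambda>x. a z * (planecut \<delta> x * lg (-1) k (x * riv z + 0))) = planecut \<eta> z * (\<phi> z * tk k z)"
        using distr_cmult[OF T_distr tp, of "a z"] zn by (simp add: a_def tk_def riv[OF zi] iv_def[of z] mult_ac)
      also have "\<dots> = \<phi> z * tk k z"
      proof (cases "\<forall>i. 2 * \<eta> \<le> \<bar>z $ i\<bar>")
        case True
        then have "planecut \<eta> z = 1" using planecut_1[OF \<eta>(1)] by blast
        then show ?thesis by simp
      next
        case False
        then have "tk k z = 0" using small by (meson not_le)
        then show ?thesis by simp
      qed
      finally show ?thesis .
    qed
  qed
  then show ?thesis unfolding 1 2 unfolding 3 H.distr_fubini[OF T_distr] by simp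
qed

text \<open>\<open>lg_bound\<close> at y = 1 / z, with i the index of the largest |z_i|: the factor
  |y_i|^p is |z_i|^(-p), comparable to |z|^(-p). The density factor is bounded because
  \<open>tk\<close> vanishes near the hyperplanes.\<close>

lemma tk_bound:
  "\<exists>m C. C \<ge> 0 \<and> (\<forall>k e z. test_on (cball 0 1) k \<longrightarrow> dbound m e k \<longrightarrow> (1 + (norm z)\<^sup>2) powr (real p / 2) * norm (tk k z) \<le> C * e)"
proof -
  obtain \<epsilon> where \<epsilon>: "\<epsilon> > 0" "dsupp T \<subseteq> Wset \<epsilon>" using T_support by blast
  obtain m C where mC: "C \<ge> 0" "\<And>k e y i. test_on (cball 0 1) k \<Longrightarrow> dbound m e k \<Longrightarrow> (\<forall>j. y $ j \<noteq> 0) \<Longrightarrow>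
     norm (T (\<lambda>x. lg (-1) k (x * y))) \<le> C * e * \<bar>y $ i\<bar> ^ p"
  proof -
    have "\<exists>m C. C \<ge> 0 \<and> (\<forall>k e y i. test_on (cball 0 1) k \<longrightarrow> dbound m e k \<longrightarrow> (\<forall>j. y $ j \<noteq> 0) \<longrightarrow>
       norm (T (\<lambda>x. lg (-1) k (x * y))) \<le> C * e * \<bar>y $ i\<bar> ^ p)"
      by (rule lg_bound) simp
    then show ?thesis using that by blast
  qed
  \<comment> \<open>\<open>tk_zero\<close> for kernel radius r = 1: \<open>tk k z\<close> is 0
    unless every |z_i| is at least c.\<close>
  define c where "c = \<epsilon> / exp 1"
  have c: "c > 0" using \<epsilon> by (simp add: c_def)
  \<comment> \<open>For the largest coordinate, |z_i| >= c gives sqrt (1 + |z|^2) <= 1 + |z| <=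
    |z_i| / c + d |z_i|.\<close>
  define D where "D = 1 / c + real CARD('n)"
  have D: "D > 0" using c by (simp add: D_def add_pos_nonneg)
  define K where "K = D ^ p * (1 / c) ^ CARD('n)"
  have K: "K > 0" using D c by (simp add: K_def)
  have "(1 + (norm z)\<^sup>2) powr (real p / 2) * norm (tk k z) \<le> (K * C) * e"
    if k: "test_on (cball 0 1) k" "dbound m e k" for k e z
  proof (cases "tk k z = 0")
    case True
    then show ?thesis using K mC(1) dbound_nonneg[OF k(2)] by simp
  next
    case False
    then have zn: "\<forall>i. z $ i \<noteq> 0" by (auto simp: tk_def split: if_splits)
    have zc: "c \<le> \<bar>z $ i\<bar>" for i
    proof (rule ccontr)
      assume "\<not> c \<le> \<bar>z $ i\<bar>"
      then have "\<bar>z $ i\<bar> * exp 1 < \<epsilon>" by (simp add: c_def not_le less_divide_eq)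
      then have "tk k z = 0" using k(1) by (intro tk_zero[OF \<epsilon>(2), of k 1 z i]) (auto simp: test_on_def)
      then show False using False by simp
    qed
    obtain i where i: "\<And>l. \<bar>z $ l\<bar> \<le> \<bar>z $ i\<bar>"
    proof -
      have "Max (range (\<lambda>l. \<bar>z $ l\<bar>)) \<in> range (\<lambda>l. \<bar>z $ l\<bar>)" by (rule Max_in) auto
      then obtain i where "Max (range (\<lambda>l. \<bar>z $ l\<bar>)) = \<bar>z $ i\<bar>" by blast
      then show ?thesis using that[of i] Max_ge[of "range (\<lambda>l. \<bar>z $ l\<bar>)"] by auto
    qed
    have zi: "\<bar>z $ i\<bar> > 0" using zn by simp
    have "sqrt (1 + (norm z)\<^sup>2) \<le> D * \<bar>z $ i\<bar>"
    proof -
      have "sqrt (1 + (norm z)\<^sup>2) \<le> sqrt 1 + sqrt ((norm z)\<^sup>2)" by (rule sqrt_add_le_add_sqrt) auto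
      also have "\<dots> = 1 + norm z" by simp
      also have "norm z \<le> (\<Sum>l\<in>(UNIV::'n set). \<bar>z $ i\<bar>)" by (intro order_trans[OF norm_le_l1_cart] sum_mono i)
      also have "1 + (\<Sum>l\<in>(UNIV::'n set). \<bar>z $ i\<bar>) \<le> \<bar>z $ i\<bar> / c + real CARD('n) * \<bar>z $ i\<bar>"
        using zc[of i] c by (simp add: le_divide_eq)
      also have "\<dots> = D * \<bar>z $ i\<bar>" by (simp add: D_def algebra_simps)
      finally show ?thesis by simp
    qed
    then have "sqrt (1 + (norm z)\<^sup>2) ^ p \<le> (D * \<bar>z $ i\<bar>) ^ p" by (intro power_mono) auto
    moreover have "(1 + (norm z)\<^sup>2) powr (real p / 2) = sqrt (1 + (norm z)\<^sup>2) ^ p"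
    proof -
      have pos: "1 + (norm z)\<^sup>2 > 0" by (simp add: add_pos_nonneg)
      then have "sqrt (1 + (norm z)\<^sup>2) ^ p = ((1 + (norm z)\<^sup>2) powr (1/2)) powr real p"
        by (simp add: powr_half_sqrt powr_realpow)
      then show ?thesis by (simp add: powr_powr)
    qed
    ultimately have w: "(1 + (norm z)\<^sup>2) powr (real p / 2) \<le> D ^ p * \<bar>z $ i\<bar> ^ p" by (simp add: power_mult_distrib)
    have P: "(\<Prod>l\<in>(UNIV::'n set). \<bar>1 / z $ l\<bar>) \<le> (1 / c) ^ CARD('n)"
    proof -
      have "(\<Prod>l\<in>(UNIV::'n set). \<bar>1 / z $ l\<bar>) \<le> (\<Prod>l\<in>(UNIV::'n set). 1 / c)"
        using zc c by (intro prod_mono) (auto intro!: divide_left_mono mult_pos_pos simp: zn)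
      then show ?thesis by simp
    qed
    have "norm (T (\<lambda>x. lg (-1) k (x * iv z))) \<le> C * e * \<bar>iv z $ i\<bar> ^ p"
      by (rule mC(2)[OF k]) (use zn in \<open>simp add: iv_def\<close>)
    then have t: "norm (T (\<lambda>x. lg (-1) k (x * iv z))) * \<bar>z $ i\<bar> ^ p \<le> C * e"
      using zi by (simp add: iv_def power_divide divide_le_eq le_divide_eq mult.commute)
    have "norm (tk k z) = norm (T (\<lambda>x. lg (-1) k (x * iv z))) * (\<Prod>l\<in>UNIV. \<bar>1 / z $ l\<bar>)"
    proof -
      have "norm (\<Prod>l\<in>UNIV. complex_of_real \<bar>1 / z $ l\<bar>) = (\<Prod>l\<in>UNIV. \<bar>1 / z $ l\<bar>)"
        unfolding of_real_prod[symmetric] norm_of_real by (simp add: abs_prod)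
      then show ?thesis using zn by (simp add: tk_def norm_mult)
    qed
    then have "(1 + (norm z)\<^sup>2) powr (real p / 2) * norm (tk k z) \<le>
       (D ^ p * \<bar>z $ i\<bar> ^ p) * (norm (T (\<lambda>x. lg (-1) k (x * iv z))) * (1 / c) ^ CARD('n))"
      using w P D by (simp only:) (intro mult_mono mult_nonneg_nonneg prod_nonneg; simp)
    also have "\<dots> = K * (norm (T (\<lambda>x. lg (-1) k (x * iv z))) * \<bar>z $ i\<bar> ^ p)" by (simp add: K_def mult_ac)
    also have "\<dots> \<le> K * (C * e)" using K t by (intro mult_left_mono) auto
    finally show ?thesis by (simp add: mult.assoc)
  qed
  moreover have "K * C \<ge> 0" using K mC by simp
  ultimately show ?thesis by blast
qed

lemma tk_measurable: assumes k: "test_fn k" shows "tk k \<in> borel_measurable lborel"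
proof -
  let ?S = "{z::real^'n. \<forall>i. z $ i \<noteq> 0}"
  have e: "?S = (\<Inter>i. {z. z $ i \<noteq> 0})" by auto
  have "open ?S" unfolding e by (intro open_INT open_Collect_neq continuous_intros ballI finite_class.finite_UNIV)
  then have S: "?S \<in> sets lborel" by simp
  have comp: "(\<lambda>z::real^'n. z $ i) \<in> borel_measurable borel" for i
    by (intro borel_measurable_continuous_onI continuous_intros)
  have ivm: "(iv :: real^'n \<Rightarrow> real^'n) \<in> borel_measurable borel"
    unfolding borel_measurable_euclidean_space[where f = "iv :: real^'n \<Rightarrow> real^'n"]
    by (auto simp: Basis_cart inner_axis iv_def intro!: borel_measurable_divide comp)
  have Gm: "G (lg (-1) k) \<in> borel_measurable borel"
    using continuous_borel[OF test_cont[OF G_test[OF test_lgm[OF k]]]] by simp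
  have "tk k z = indicator ?S z *\<^sub>R (G (lg (-1) k) (iv z) * (\<Prod>i\<in>UNIV. complex_of_real \<bar>1 / z $ i\<bar>))" for z
  proof (cases "\<forall>i. z $ i \<noteq> 0")
    case True
    then show ?thesis using G_T[OF iv_nz[OF True] test_lgm[OF k]] by (simp add: tk_def)
  next
    case False
    then show ?thesis unfolding tk_def by (subst if_not_P) auto
  qed
  then have eq: "tk k = (\<lambda>z. indicator ?S z *\<^sub>R (G (lg (-1) k) (iv z) * (\<Prod>i\<in>UNIV. complex_of_real \<bar>1 / z $ i\<bar>)))" by blast
  have "(\<lambda>z. indicator ?S z *\<^sub>R (G (lg (-1) k) (iv z) * (\<Prod>i\<in>UNIV. complex_of_real \<bar>1 / z $ i\<bar>))) \<in> borel_measurable borel"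
    by (intro borel_measurable_scaleR borel_measurable_indicator borel_measurable_times borel_measurable_prod
        measurable_compose[OF ivm Gm] measurable_compose[OF _ borel_measurable_of_real] borel_measurable_abs
        borel_measurable_divide comp borel_measurable_const) (use S in simp)
  then show ?thesis unfolding eq by simp
qed

end


subsection \<open>Approximate identities with vanishing moments\<close>

lemma line_integrable:
  fixes k :: "real^'n::finite \<Rightarrow> complex"
  assumes k: "test_fn k" shows "integrable lborel (\<lambda>t::real. k (x + t *\<^sub>R axis j 1))"
proof -
  obtain R where R: "\<And>x. norm x > R \<Longrightarrow> k x = 0" using k unfolding test_fn_iff by auto
  show ?thesis
  proof (rule integrable_cc[where R = "R + norm x"])
    show "continuous_on UNIV (\<lambda>t::real. k (x + t *\<^sub>R axis j 1))"
      by (rule continuous_on_compose2[OF test_cont[OF k, of UNIV]]) (auto intro!: continuous_intros)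
    fix t :: real assume t: "norm t > R + norm x"
    have "norm (t *\<^sub>R axis j 1 :: real^'n) \<le> norm (x + t *\<^sub>R axis j 1) + norm x"
      by (metis add.commute add_diff_cancel_left' norm_triangle_ineq4)
    then have "norm (x + t *\<^sub>R axis j 1) > R" using t by simp
    then show "k (x + t *\<^sub>R axis j 1) = 0" by (rule R)
  qed
qed

definition dj :: "'n::finite \<Rightarrow> real^'n" where "dj j = (\<chi> i. if i = j then 2 else 1)"

text \<open>The factor 2 preserves the integral over every line in direction j.\<close>

definition sc :: "'n::finite \<Rightarrow> (real^'n \<Rightarrow> complex) \<Rightarrow> real^'n \<Rightarrow> complex" where
  "sc j f \<tau> = 2 * f (\<tau> * dj j)"

text \<open>Order \<open>n\<close> of the kernel in direction \<open>j\<close>: refining its scale in that direction by 2 costs an \<open>n\<close>-fold derivative.\<close>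

definition scale_order :: "'n::finite \<Rightarrow> nat \<Rightarrow> (real^'n \<Rightarrow> complex) \<Rightarrow> bool" where
  "scale_order j n f \<longleftrightarrow> (\<exists>\<eta>. test_fn \<eta> \<and> (\<forall>\<tau>. sc j f \<tau> - f \<tau> = iterpd (replicate n j) \<eta> \<tau>))"

lemma test_sc: "test_fn f \<Longrightarrow> test_fn (sc j f)"
  unfolding sc_def[abs_def] by (intro test_cmult test_dil) (auto simp: dj_def)

lemma iterpd_sc:
  assumes f: "smooth_fn f"
  shows "iterpd (replicate n l) (sc j f) \<tau> = (if l = j then 2 ^ n else 1) * sc j (iterpd (replicate n l) f) \<tau>"
proof -
  have "cw (replicate n l) (dj j) = (if l = j then 2 ^ n else 1)" by (induction n) (auto simp: dj_def)
  then show ?thesis unfolding sc_def[abs_def] by (simp add: iterpd_cmult smooth_dil f iterpd_dil)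
qed

text \<open>Both functions have the same integral over each j-line, so their difference has a
  compactly supported j-primitive: order 1 comes for free.\<close>

lemma scale_antiderivative:
  fixes f :: "real^'n::finite \<Rightarrow> complex"
  assumes f: "test_fn f" shows "\<exists>\<eta>. test_fn \<eta> \<and> pd j \<eta> = (\<lambda>\<tau>. sc j f \<tau> - f \<tau>)"
proof (rule antiderivative[OF test_diff[OF test_sc[OF f] f]])
  fix x :: "real^'n"
  have "(\<integral>t. f (x + t *\<^sub>R axis j 1) \<partial>lborel) = \<bar>2\<bar> *\<^sub>R (\<integral>t. f (x + (x $ j + 2 * t) *\<^sub>R axis j 1) \<partial>lborel)"
    by (rule lborel_integral_real_affine) simp
  moreover have "x + (x $ j + 2 * t) *\<^sub>R axis j 1 = (x + t *\<^sub>R axis j 1) * dj j" for t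
    by (auto simp: vec_eq_iff axis_def dj_def)
  ultimately have "(\<integral>t. f (x + t *\<^sub>R axis j 1) \<partial>lborel) = (\<integral>t. sc j f (x + t *\<^sub>R axis j 1) \<partial>lborel)"
    by (simp only: sc_def) (simp add: scaleR_conv_of_real)
  then show "(\<integral>t. sc j f (x + t *\<^sub>R axis j 1) - f (x + t *\<^sub>R axis j 1) \<partial>lborel) = 0"
    using Bochner_Integration.integral_diff[OF line_integrable[OF test_sc[OF f]] line_integrable[OF f]] by simp
qed

lemma scale_order_sc:
  assumes g: "scale_order l n f" and lj: "l \<noteq> j" shows "scale_order l n (sc j f)"
proof -
  obtain \<eta> where \<eta>: "test_fn \<eta>" "\<And>\<tau>. sc l f \<tau> - f \<tau> = iterpd (replicate n l) \<eta> \<tau>" using g by (auto simp: scale_order_def)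
  have "sc l (sc j f) \<tau> - sc j f \<tau> = iterpd (replicate n l) (sc j \<eta>) \<tau>" for \<tau>
  proof -
    have "sc l (sc j f) \<tau> - sc j f \<tau> = 2 * (sc l f (\<tau> * dj j) - f (\<tau> * dj j))"
      by (simp add: sc_def algebra_simps)
    also have "\<dots> = sc j (iterpd (replicate n l) \<eta>) \<tau>" unfolding \<eta>(2) by (simp add: sc_def)
    finally show ?thesis using iterpd_sc[OF test_smooth[OF \<eta>(1)], of n l j \<tau>] lj by simp
  qed
  then show ?thesis unfolding scale_order_def using test_sc[OF \<eta>(1)] by blast
qed

lemma scale_order_linear:
  assumes "scale_order l n f" "scale_order l n g" shows "scale_order l n (\<lambda>x. a * f x + b * g x)"
proof -
  obtain \<eta> where \<eta>: "test_fn \<eta>" "\<And>\<tau>. sc l f \<tau> - f \<tau> = iterpd (replicate n l) \<eta> \<tau>" using assms by (auto simp: scale_order_def)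
  obtain \<xi> where \<xi>: "test_fn \<xi>" "\<And>\<tau>. sc l g \<tau> - g \<tau> = iterpd (replicate n l) \<xi> \<tau>" using assms by (auto simp: scale_order_def)
  have "sc l (\<lambda>x. a * f x + b * g x) \<tau> - (a * f \<tau> + b * g \<tau>) = iterpd (replicate n l) (\<lambda>x. a * \<eta> x + b * \<xi> x) \<tau>" for \<tau>
  proof -
    have "sc l (\<lambda>x. a * f x + b * g x) \<tau> - (a * f \<tau> + b * g \<tau>) = a * (sc l f \<tau> - f \<tau>) + b * (sc l g \<tau> - g \<tau>)"
      by (simp add: sc_def algebra_simps)
    then show ?thesis unfolding \<eta>(2) \<xi>(2)
      by (simp add: iterpd_linear iterpd_cmult smooth_cmult test_smooth \<eta>(1) \<xi>(1))
  qed
  then show ?thesis unfolding scale_order_def using test_linear[OF \<eta>(1) test_cmult[OF \<xi>(1)], of a b] by blast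
qed

lemma Ik_sc: assumes f: "test_fn f" shows "Ik (sc j f) = Ik f"
proof -
  obtain \<eta> where \<eta>: "test_fn \<eta>" "pd j \<eta> = (\<lambda>\<tau>. sc j f \<tau> - f \<tau>)" using scale_antiderivative[OF f] by blast
  have "Ik (\<lambda>\<tau>. 1 * pd j \<eta> \<tau> + f \<tau>) = 1 * Ik (pd j \<eta>) + Ik f" by (rule Ik_linear[OF test_pd[OF \<eta>(1)] f])
  then show ?thesis unfolding Ik_pd[OF \<eta>(1)] unfolding \<eta>(2) by simp
qed

text \<open>Richardson extrapolation: a suitable combination of q and \<open>sc j q\<close> raises
  the order in direction j by one and keeps the mass and the orders in the directions treated
  before. The outer induction runs over directions, the inner one over the order.\<close>

lemma scale_order_exists:
  fixes \<Omega> :: "real^'n::finite \<Rightarrow> complex"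
  assumes \<Omega>: "test_fn \<Omega>"
  shows "\<exists>\<rho> :: real^'n \<Rightarrow> complex. test_fn \<rho> \<and> Ik \<rho> = Ik \<Omega> \<and> (\<forall>j. scale_order j N \<rho>)"
proof -
  have all: "\<exists>\<rho>. test_fn \<rho> \<and> Ik \<rho> = Ik \<Omega> \<and> (\<forall>j\<in>S. scale_order j N \<rho>)" if "finite S" for S :: "'n set" and N
    using that
  proof (induction S rule: finite_induct)
    case empty
    then show ?case using \<Omega> by auto
  next
    case (insert j S)
    have "\<exists>q. test_fn q \<and> Ik q = Ik \<Omega> \<and> (\<forall>l\<in>S. scale_order l N q) \<and> scale_order j n q" for n
    proof (induction n)
      case 0
      obtain \<rho> where \<rho>: "test_fn \<rho>" "Ik \<rho> = Ik \<Omega>" "\<forall>l\<in>S. scale_order l N \<rho>" using insert.IH by blast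
      have "scale_order j 0 \<rho>" unfolding scale_order_def using test_diff[OF test_sc[OF \<rho>(1)] \<rho>(1)] by auto
      then show ?case using \<rho> by blast
    next
      case (Suc n)
      then obtain q where q: "test_fn q" "Ik q = Ik \<Omega>" "\<And>l. l \<in> S \<Longrightarrow> scale_order l N q" "scale_order j n q" by blast
      show ?case
      proof (cases "n = 0")
        \<comment> \<open>At n = 0 the number p used for larger n would be 1 and the extrapolation
          weights infinite; order 1 holds outright.\<close>
        case True
        obtain \<eta> where "test_fn \<eta>" "pd j \<eta> = (\<lambda>\<tau>. sc j q \<tau> - q \<tau>)" using scale_antiderivative[OF q(1)] by blast
        then have "scale_order j (Suc n) q" unfolding scale_order_def True by (intro exI[of _ \<eta>]) simp
        then show ?thesis using q by blast
      next
        case False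
        obtain \<eta> where \<eta>: "test_fn \<eta>" "\<And>\<tau>. sc j q \<tau> - q \<tau> = iterpd (replicate n j) \<eta> \<tau>" using q(4) by (auto simp: scale_order_def)
        obtain \<xi> where \<xi>: "test_fn \<xi>" "pd j \<xi> = (\<lambda>\<tau>. sc j \<eta> \<tau> - \<eta> \<tau>)" using scale_antiderivative[OF \<eta>(1)] by blast
        define p :: complex where "p = 2 ^ n"
        have p: "p \<noteq> 0" "p \<noteq> 1"
        proof -
          have "(1::real) < 2 ^ n" using False by simp
          then have "(2::real) ^ n \<noteq> 1" by simp
          then have "complex_of_real (2 ^ n) \<noteq> 1" by (simp only: of_real_eq_1_iff) simp
          then show "p \<noteq> 1" by (simp add: p_def)
        qed (simp add: p_def)
        \<comment> \<open>\<open>sc j\<close> multiplies \<open>n\<close>-fold \<open>j\<close>-derivatives by \<open>p = 2 ^ n\<close>, so the leading terms cancel in the combination below\<close>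
        define c where "c = p / (p - 1)"
        define q' where "q' = (\<lambda>\<tau>. c * sc j q \<tau> + (- c / p) * q \<tau>)"
        have tq: "test_fn q'" unfolding q'_def by (intro test_linear test_cmult test_sc q)
        have "Ik q' = c * Ik (sc j q) + Ik (\<lambda>\<tau>. (- c / p) * q \<tau>)"
          unfolding q'_def by (intro Ik_linear test_sc test_cmult q)
        also have "Ik (\<lambda>\<tau>. (- c / p) * q \<tau>) = (- c / p) * Ik q"
          using Ik_linear[OF q(1) test_zero, of "- c / p"] by (simp add: Ik_def wk_def lg_def)
        finally have "Ik q' = c * (1 - 1 / p) * Ik q" by (simp add: Ik_sc[OF q(1)] algebra_simps)
        \<comment> \<open>The weights c and - c / p of the two dilates add up to 1, so the mass is
          unchanged.\<close>
        also have "c * (1 - 1 / p) = 1" using p by (simp add: c_def field_simps)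
        finally have I: "Ik q' = Ik \<Omega>" using q by simp
        have gS: "scale_order l N q'" if "l \<in> S" for l
          unfolding q'_def using that insert.hyps(2) q(3) by (intro scale_order_linear scale_order_sc) auto
        have "sc j q' \<tau> - q' \<tau> = iterpd (replicate (Suc n) j) (\<lambda>x. (c / p) * \<xi> x) \<tau>" for \<tau>
        proof -
          have sm: "smooth_fn \<eta>" "smooth_fn (sc j \<eta>)" "smooth_fn \<xi>" using \<eta> \<xi> by (auto intro: test_smooth test_sc)
          have "sc j q' \<tau> - q' \<tau> = c * (2 * (sc j q (\<tau> * dj j) - q (\<tau> * dj j))) - c / p * (sc j q \<tau> - q \<tau>)"
            unfolding q'_def by (simp add: sc_def algebra_simps)
          also have "\<dots> = c * sc j (iterpd (replicate n j) \<eta>) \<tau> - c / p * iterpd (replicate n j) \<eta> \<tau>"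
            unfolding \<eta>(2) by (simp add: sc_def)
          also have "sc j (iterpd (replicate n j) \<eta>) \<tau> = 1 / p * iterpd (replicate n j) (sc j \<eta>) \<tau>"
            using iterpd_sc[OF sm(1), of n j j \<tau>] p(1) by (simp add: p_def)
          also have "c * (1 / p * iterpd (replicate n j) (sc j \<eta>) \<tau>) - c / p * iterpd (replicate n j) \<eta> \<tau>
             = c / p * iterpd (replicate n j) (\<lambda>\<tau>. sc j \<eta> \<tau> - \<eta> \<tau>) \<tau>"
            using sm by (simp add: iterpd_diff algebra_simps)
          also have "\<dots> = c / p * iterpd (replicate n j @ [j]) \<xi> \<tau>" unfolding iterpd_snoc \<xi>(2) ..
          also have "\<dots> = iterpd (replicate (Suc n) j) (\<lambda>x. (c / p) * \<xi> x) \<tau>"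
            by (simp only: replicate_append_same[symmetric] replicate_Suc iterpd_cmult[OF sm(3)])
          finally show ?thesis .
        qed
        then have "scale_order j (Suc n) q'" unfolding scale_order_def using test_cmult[OF \<xi>(1), of "c / p"] by blast
        then show ?thesis using tq I gS by blast
      qed
    qed
    from this[of N] show ?case by auto
  qed
  show ?thesis using all[OF finite, of UNIV N] unfolding ball_UNIV .
qed

definition dls :: "'n::finite list \<Rightarrow> real^'n" where "dls ls = (\<chi> i. if i \<in> set ls then 2 else 1)"

definition dilate_dirs :: "'n::finite list \<Rightarrow> (real^'n \<Rightarrow> complex) \<Rightarrow> real^'n \<Rightarrow> complex" where
  "dilate_dirs ls f \<tau> = 2 ^ length ls * f (\<tau> * dls ls)"

text \<open>The full dilation is carried out one direction at a time; the step in direction j is an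
  N-fold j-derivative because \<open>\<rho>\<close> has order N there.\<close>

lemma dilate_dirs_telescope:
  assumes \<rho>: "test_fn \<rho>" "\<And>j. scale_order j N \<rho>" and "distinct ls"
  shows "\<exists>\<kappa>. (\<forall>j. test_fn (\<kappa> j)) \<and> (\<forall>\<tau>. dilate_dirs ls \<rho> \<tau> - \<rho> \<tau> = (\<Sum>j\<in>set ls. iterpd (replicate N j) (\<kappa> j) \<tau>))"
  using assms(3)
proof (induction ls)
  case Nil
  have "\<tau> * dls [] = \<tau>" for \<tau> :: "real^'a" by (simp add: vec_eq_iff dls_def)
  then show ?case by (intro exI[of _ "\<lambda>j x. 0"]) (simp add: dilate_dirs_def)
next
  case (Cons j ls)
  then obtain \<kappa> where \<kappa>: "\<And>j. test_fn (\<kappa> j)" "\<And>\<tau>. dilate_dirs ls \<rho> \<tau> - \<rho> \<tau> = (\<Sum>j\<in>set ls. iterpd (replicate N j) (\<kappa> j) \<tau>)" by auto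
  obtain \<eta> where \<eta>: "test_fn \<eta>" "\<And>\<tau>. sc j \<rho> \<tau> - \<rho> \<tau> = iterpd (replicate N j) \<eta> \<tau>" using \<rho>(2)[of j] by (auto simp: scale_order_def)
  have tA: "test_fn (dilate_dirs ls \<eta>)" unfolding dilate_dirs_def[abs_def] by (intro test_cmult test_dil \<eta>) (simp add: dls_def)
  have dd: "\<tau> * dls (j # ls) = \<tau> * dls ls * dj j" for \<tau> using Cons.prems by (auto simp: vec_eq_iff dls_def dj_def)
  \<comment> \<open>Direction j has not been dilated yet, so N derivatives in j pass through the
    dilation \<open>dls ls\<close> without a factor.\<close>
  have cwj: "cw (replicate N j) (dls ls) = 1" using Cons.prems by (induction N) (auto simp: dls_def)
  have "dilate_dirs (j # ls) \<rho> \<tau> - \<rho> \<tau> = (\<Sum>i\<in>set (j # ls). iterpd (replicate N i) ((\<kappa>(j := dilate_dirs ls \<eta>)) i) \<tau>)" for \<tau>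
  proof -
    have "dilate_dirs (j # ls) \<rho> \<tau> - dilate_dirs ls \<rho> \<tau> = 2 ^ length ls * (sc j \<rho> (\<tau> * dls ls) - \<rho> (\<tau> * dls ls))"
      by (simp add: dilate_dirs_def sc_def dd algebra_simps)
    also have "\<dots> = iterpd (replicate N j) (dilate_dirs ls \<eta>) \<tau>"
      unfolding \<eta>(2) dilate_dirs_def[abs_def] using \<eta>(1) cwj by (simp add: iterpd_cmult smooth_dil test_smooth iterpd_dil)
    finally have 1: "dilate_dirs (j # ls) \<rho> \<tau> - \<rho> \<tau> = iterpd (replicate N j) (dilate_dirs ls \<eta>) \<tau> + (dilate_dirs ls \<rho> \<tau> - \<rho> \<tau>)"
      by (simp add: diff_eq_eq)
    have "(\<Sum>i\<in>set ls. iterpd (replicate N i) ((\<kappa>(j := dilate_dirs ls \<eta>)) i) \<tau>) = (\<Sum>i\<in>set ls. iterpd (replicate N i) (\<kappa> i) \<tau>)"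
      by (rule sum.cong) (use Cons.prems in auto)
    then show ?thesis unfolding 1 \<kappa>(2) using Cons.prems by simp
  qed
  moreover have "\<forall>i. test_fn ((\<kappa>(j := dilate_dirs ls \<eta>)) i)" using \<kappa>(1) tA by auto
  ultimately show ?case by blast
qed

definition sv :: "nat \<Rightarrow> real^'n::finite" where "sv n = (\<chi> i. 2 ^ n)"

lemma sv_scale: "\<tau> * sv n = (2 ^ n) *\<^sub>R \<tau>"
  by (simp add: vec_eq_iff sv_def)

lemma cw_sv: "cw js (sv n) = 2 ^ (n * length js)"
  by (induction js) (auto simp: sv_def power_add)

text \<open>The integrand is nonnegative and at least 2^(-d) on the cube [1,2]^d, where 0 <= ln s_i
  <= s_i - 1 <= 1 keeps the logarithm on the plateau of the cut-off.\<close>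

lemma Ik_boxcut: "Ik (boxcut 0 1 :: real^'n::finite \<Rightarrow> complex) \<noteq> 0"
proof -
  let ?O = "boxcut 0 1 :: real^'n \<Rightarrow> complex"
  have tO: "test_fn ?O" by (rule test_boxcut) simp
  let ?l = "(\<chi> i. 1) :: real^'n" and ?u = "(\<chi> i. 2) :: real^'n"
  have nn: "0 \<le> Re (wk ?O s)" for s
  proof (cases "\<forall>i. 0 < s $ i")
    case True
    obtain b where b: "?O (lnv s) = complex_of_real b" "0 \<le> b" using boxcut_real by blast
    have "wk ?O s = complex_of_real ((\<Prod>i\<in>UNIV. 1 / s $ i) * b)" unfolding wk_pos[OF True] b(1) by simp
    then have "Re (wk ?O s) = (\<Prod>i\<in>UNIV. 1 / s $ i) * b" by (simp only: Re_complex_of_real)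
    then show ?thesis using b True by (simp add: prod_nonneg less_imp_le)
  next
    case False
    show ?thesis unfolding wk_npos[OF False] by simp
  qed
  have low: "(1/2) ^ CARD('n) * indicator (cbox ?l ?u) s \<le> Re (wk ?O s)" for s
  proof (cases "s \<in> cbox ?l ?u")
    case True
    then have s: "1 \<le> s $ i" "s $ i \<le> 2" for i by (auto simp: mem_box_cart)
    then have pos: "\<forall>i. 0 < s $ i" by (meson less_le_trans zero_less_one)
    have "?O (lnv s) = 1"
    proof (rule boxcut_1)
      fix j
      have "ln (s $ j) \<le> s $ j - 1" using pos by (intro ln_le_minus_one) auto
      moreover have "0 \<le> ln (s $ j)" using s by (intro ln_ge_zero) auto
      ultimately show "\<bar>lnv s $ j - 0 $ j\<bar> \<le> 1" using s(2)[of j] by (simp add: lnv_def)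
    qed simp
    then have "wk ?O s = complex_of_real (\<Prod>i\<in>UNIV. 1 / s $ i)" unfolding wk_pos[OF pos] by simp
    then have "Re (wk ?O s) = (\<Prod>i\<in>UNIV. 1 / s $ i)" by (simp only: Re_complex_of_real)
    moreover have "(\<Prod>i\<in>(UNIV::'n set). 1/2) \<le> (\<Prod>i\<in>UNIV. 1 / s $ i)"
      using s pos by (intro prod_mono) (auto intro!: divide_left_mono)
    ultimately show ?thesis using True by simp
  qed (use nn in simp)
  have fin: "emeasure lborel (cbox ?l ?u) < top"
    using emeasure_bounded_finite[OF bounded_cbox] by (simp add: less_top)
  have "measure lborel (cbox ?l ?u) = (\<Prod>b\<in>(Basis::(real^'n) set). 1)"
    by (subst measure_lborel_cbox_eq) (auto simp: Basis_cart inner_axis intro!: prod.cong prod.neutral)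
  then have "0 < (1/2) ^ CARD('n) * measure lborel (cbox ?l ?u)" by simp
  also have "\<dots> = (\<integral>s. (1/2) ^ CARD('n) * indicator (cbox ?l ?u) s \<partial>lborel)" by simp
  also have "\<dots> \<le> (\<integral>s. Re (wk ?O s) \<partial>lborel)"
    by (rule integral_mono)
      (use low fin test_integrable[OF test_wk[OF tO]] in \<open>auto intro!: Bochner_Integration.integrable_mult_right integrable_real_indicator\<close>)
  also have "\<dots> = Re (Ik ?O)" unfolding Ik_def
    using integral_Re[OF test_integrable[OF test_wk[OF tO]]] by simp
  finally show ?thesis by auto
qed

text \<open>Dilates of one kernel of order \<open>N\<close> in every direction. The dilation gains \<open>N - d - m = 1\<close> powers of
  \<open>2\<^sup>-\<^sup>n\<close>, whence the geometric bound on the first \<open>m\<close> derivatives of \<open>\<kappa> n j\<close>.\<close>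

lemma approximate_identity_exists:
  fixes m :: nat
  defines "N \<equiv> CARD('n::finite) + m + 1"
  shows "\<exists>(\<rho> :: nat \<Rightarrow> real^'n \<Rightarrow> complex) \<kappa> C. C \<ge> 0 \<and> (\<forall>n. test_on (cball 0 1) (\<rho> n)) \<and> (\<forall>n j. test_on (cball 0 1) (\<kappa> n j)) \<and>
    (\<forall>n \<tau>. \<rho> (Suc n) \<tau> - \<rho> n \<tau> = (\<Sum>j\<in>UNIV. iterpd (replicate N j) (\<kappa> n j) \<tau>)) \<and>
    (\<forall>n j. dbound m (C * (1/2) ^ n) (\<kappa> n j)) \<and> Ik (\<rho> 0) \<noteq> 0 \<and> (\<forall>n. Ik (\<rho> n) = Ik (\<rho> 0)) \<and>
    (\<forall>n \<tau>. norm \<tau> > (1/2) ^ n \<longrightarrow> \<rho> n \<tau> = 0) \<and> (\<forall>n \<tau>. norm (\<rho> n \<tau>) \<le> C * 2 ^ (CARD('n) * n))"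
proof -
  let ?d = "CARD('n)"
  obtain r :: "real^'n \<Rightarrow> complex" where r: "test_fn r" "Ik r \<noteq> 0" "\<And>j. scale_order j N r"
    using scale_order_exists[OF test_boxcut[of 1 0], of N] Ik_boxcut by (metis zero_less_one)
  obtain ls :: "'n list" where ls: "set ls = UNIV" "distinct ls" using finite_distinct_list[of "UNIV :: 'n set"] by auto
  obtain k where k: "\<And>j. test_fn (k j)" "\<And>\<tau>. dilate_dirs ls r \<tau> - r \<tau> = (\<Sum>j\<in>UNIV. iterpd (replicate N j) (k j) \<tau>)"
    using dilate_dirs_telescope[OF r(1,3) ls(2)] unfolding ls(1) by blast
  have len: "length ls = ?d" using distinct_card[OF ls(2)] ls(1) by simp
  have dls: "dls ls = sv 1" by (simp add: vec_eq_iff dls_def sv_def ls(1))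
  have dilate_dirs: "dilate_dirs ls r \<tau> = 2 ^ ?d * r (\<tau> * sv 1)" for \<tau> by (simp add: dilate_dirs_def len dls)
  define \<rho> where "\<rho> n \<tau> = 2 ^ (?d * n) * r (\<tau> * sv n)" for n and \<tau> :: "real^'n"
  \<comment> \<open>N derivatives of a function dilated by 2^n bring out 2^(N n). Dividing by it
    leaves the factor 2^(d n) that the telescoping identity asks for.\<close>
  define \<kappa> where "\<kappa> n j \<tau> = (2 ^ (?d * n) / 2 ^ (N * n)) * k j (\<tau> * sv n)" for n j and \<tau> :: "real^'n"
  have sn: "sv n $ i \<noteq> 0" for n and i :: 'n by (simp add: sv_def)
  have t\<rho>: "test_fn (\<rho> n)" for n unfolding \<rho>_def[abs_def] by (intro test_cmult test_dil r sn)
  have t\<kappa>: "test_fn (\<kappa> n j)" for n j unfolding \<kappa>_def[abs_def] by (intro test_cmult test_dil k sn)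
  have it\<kappa>: "iterpd js (\<kappa> n j) \<tau> = (2 ^ (?d * n) / 2 ^ (N * n)) * (2 ^ (n * length js) * iterpd js (k j) (\<tau> * sv n))" for js n j \<tau>
    unfolding \<kappa>_def[abs_def] iterpd_cmult[OF smooth_dil[OF test_smooth[OF k(1)]]]
    by (simp only: iterpd_dil[OF test_smooth[OF k(1)]] cw_sv of_real_power of_real_numeral)
  have tel: "\<rho> (Suc n) \<tau> - \<rho> n \<tau> = (\<Sum>j\<in>UNIV. iterpd (replicate N j) (\<kappa> n j) \<tau>)" for n \<tau>
  proof -
    have sv: "\<tau> * sv (Suc n) = \<tau> * sv n * sv 1" by (simp add: vec_eq_iff sv_def)
    have "\<rho> (Suc n) \<tau> - \<rho> n \<tau> = 2 ^ (?d * n) * (dilate_dirs ls r (\<tau> * sv n) - r (\<tau> * sv n))"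
      unfolding \<rho>_def dilate_dirs sv by (simp add: power_add algebra_simps)
    also have "\<dots> = (\<Sum>j\<in>UNIV. iterpd (replicate N j) (\<kappa> n j) \<tau>)"
      unfolding k(2) it\<kappa> by (simp add: sum_distrib_left mult.commute)
    finally show ?thesis .
  qed
  have N0: "N = Suc (?d + m)" by (simp add: N_def)
  have I: "Ik (\<rho> n) = Ik r" for n
  proof (induction n)
    case 0
    have "\<tau> * sv 0 = \<tau>" for \<tau> :: "real^'n" by (simp add: vec_eq_iff sv_def)
    then have "\<rho> 0 = r" by (simp add: \<rho>_def[abs_def])
    then show ?case by simp
  next
    case (Suc n)
    have S: "Ik (\<lambda>\<tau>. \<Sum>j\<in>J. iterpd (replicate N j) (\<kappa> n j) \<tau>) = 0" if "finite J" for J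
      using that
    proof (induction J rule: finite_induct)
      case empty
      then show ?case by (simp add: Ik_def wk_def lg_def)
    next
      case (insert j J)
      have "Ik (\<lambda>\<tau>. 1 * iterpd (replicate N j) (\<kappa> n j) \<tau> + (\<Sum>j\<in>J. iterpd (replicate N j) (\<kappa> n j) \<tau>)) =
         1 * Ik (iterpd (replicate N j) (\<kappa> n j)) + Ik (\<lambda>\<tau>. \<Sum>j\<in>J. iterpd (replicate N j) (\<kappa> n j) \<tau>)"
        by (intro Ik_linear test_sum test_iterpd t\<kappa>)
      then show ?case using insert Ik_iterpd[OF t\<kappa>, of "?d + m" j n j] by (simp add: N0 del: replicate_Suc)
    qed
    have eq: "\<rho> (Suc n) = (\<lambda>\<tau>. 1 * \<rho> n \<tau> + (\<Sum>j\<in>UNIV. iterpd (replicate N j) (\<kappa> n j) \<tau>))"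
      using tel[of n] by (auto simp: fun_eq_iff algebra_simps)
    have "Ik (\<rho> (Suc n)) = 1 * Ik (\<rho> n) + Ik (\<lambda>\<tau>. \<Sum>j\<in>UNIV. iterpd (replicate N j) (\<kappa> n j) \<tau>)"
      unfolding eq by (intro Ik_linear t\<rho> test_sum test_iterpd t\<kappa>)
    then show ?case using S[of UNIV] Suc by simp
  qed
  obtain R1 where R1: "\<And>x. norm x > R1 \<Longrightarrow> r x = 0" using r(1) unfolding test_fn_iff by auto
  have "\<exists>R. \<forall>x. norm x > R \<longrightarrow> k j x = 0" for j using k(1)[of j] unfolding test_fn_iff by auto
  then obtain Rk where Rk: "\<And>j x. norm x > Rk j \<Longrightarrow> k j x = 0" by metis
  \<comment> \<open>Discarding the first n0 scales brings the support at scale n into the ball of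
    radius 2^(-n), hence into the unit ball for all n.\<close>
  obtain n0 :: nat where n0: "(2::real) ^ n0 \<ge> max R1 (\<Sum>j\<in>UNIV. \<bar>Rk j\<bar>)"
  proof -
    obtain n0 :: nat where "real n0 \<ge> max R1 (\<Sum>j\<in>UNIV. \<bar>Rk j\<bar>)" using real_arch_simple by blast
    moreover have "real n0 \<le> 2 ^ n0" by (metis less_imp_le of_nat_less_two_power)
    ultimately show ?thesis using that order_trans by blast
  qed
  have far: "norm (\<tau> * sv (n + n0)) > 2 ^ n0" if "norm \<tau> > (1/2) ^ n" for n and \<tau> :: "real^'n"
  proof -
    have "(2::real) ^ (n + n0) * (1/2) ^ n < 2 ^ (n + n0) * norm \<tau>" using that by simp
    then show ?thesis by (simp add: sv_scale power_add power_divide)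
  qed
  have z\<rho>: "\<rho> (n + n0) \<tau> = 0" if "norm \<tau> > (1/2) ^ n" for n \<tau>
  proof -
    have "norm (\<tau> * sv (n + n0)) > R1" using far[OF that] n0 by linarith
    then show ?thesis using R1 by (simp add: \<rho>_def)
  qed
  have z\<kappa>: "\<kappa> (n + n0) j \<tau> = 0" if "norm \<tau> > (1/2) ^ n" for n j \<tau>
  proof -
    have "\<bar>Rk j\<bar> \<le> (\<Sum>j\<in>UNIV. \<bar>Rk j\<bar>)" by (intro member_le_sum) auto
    then have "norm (\<tau> * sv (n + n0)) > Rk j" using far[OF that] n0 by linarith
    then show ?thesis using Rk by (simp add: \<kappa>_def)
  qed
  have le1: "(1/2) ^ n < norm \<tau>" if "\<tau> \<notin> cball 0 1" for n and \<tau> :: "real^'n"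
  proof -
    have "(1/2::real) ^ n \<le> 1" by (rule power_le_one) auto
    then show ?thesis using that by simp
  qed
  obtain Cr where Cr: "Cr > 0" "\<And>x. norm (r x) \<le> Cr" using test_bounded[OF r(1), of "[]"] by auto
  have "\<exists>e>0. dbound m e (k j)" for j by (rule dbound_exists[OF k(1)])
  then obtain Ck where Ck: "\<And>j. Ck j > 0" "\<And>j. dbound m (Ck j) (k j)" by metis
  \<comment> \<open>The shift by n0 scales costs a factor 2^(d n0) in the sup bound of the
    kernels.\<close>
  define C where "C = max (Cr * 2 ^ (?d * n0)) (sum Ck UNIV)"
  have C0: "C \<ge> 0" using Cr by (simp add: C_def le_max_iff_disj)
  have b\<rho>: "norm (\<rho> (n + n0) \<tau>) \<le> C * 2 ^ (?d * n)" for n \<tau>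
  proof -
    have "norm (\<rho> (n + n0) \<tau>) = 2 ^ (?d * (n + n0)) * norm (r (\<tau> * sv (n + n0)))"
      unfolding \<rho>_def by (simp add: norm_mult norm_power)
    also have "\<dots> \<le> 2 ^ (?d * (n + n0)) * Cr" by (intro mult_left_mono Cr) auto
    also have "\<dots> = Cr * 2 ^ (?d * n0) * 2 ^ (?d * n)" by (simp add: power_add distrib_left)
    also have "\<dots> \<le> C * 2 ^ (?d * n)" unfolding C_def by (intro mult_right_mono) auto
    finally show ?thesis .
  qed
  have b\<kappa>: "dbound m (C * (1/2) ^ n) (\<kappa> (n + n0) j)" for n j
    unfolding dbound_def
  proof (intro allI impI)
    fix js :: "'n list" and x :: "real^'n" assume js: "length js \<le> m"
    let ?n = "n + n0"
    have "norm (iterpd js (\<kappa> ?n j) x) = (2 ^ (?d * ?n) / 2 ^ (N * ?n)) * (2 ^ (?n * length js) * norm (iterpd js (k j) (x * sv ?n)))"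
      unfolding it\<kappa> by (simp add: norm_mult norm_divide norm_power)
    also have "\<dots> \<le> (2 ^ (?d * ?n) / 2 ^ (N * ?n)) * (2 ^ (?n * m) * Ck j)"
      using Ck(2)[of j] js unfolding dbound_def
      by (intro mult_left_mono mult_mono power_increasing) (auto simp: mult_le_mono2)
    also have "\<dots> = (1/2) ^ ?n * Ck j"
    proof -
      have "(2::real) ^ (N * ?n) = 2 ^ (?d * ?n) * 2 ^ (?n * m) * 2 ^ ?n"
        unfolding N_def by (simp add: power_add[symmetric] algebra_simps)
      then show ?thesis by (simp add: power_divide)
    qed
    also have "\<dots> \<le> (1/2) ^ n * C"
    proof (rule mult_mono)
      show "(1/2::real) ^ (n + n0) \<le> (1/2) ^ n" by (rule power_decreasing) auto
      have "Ck j \<le> sum Ck UNIV" using Ck(1) by (intro member_le_sum) (auto intro: less_imp_le)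
      then show "Ck j \<le> C" by (simp add: C_def)
    qed (use Ck(1)[of j] in auto)
    finally show "norm (iterpd js (\<kappa> (n + n0) j) x) \<le> C * (1/2) ^ n" by (simp add: mult.commute)
  qed
  show ?thesis
  proof (intro exI[of _ "\<lambda>n. \<rho> (n + n0)"] exI[of _ "\<lambda>n. \<kappa> (n + n0)"] exI[of _ C] conjI allI impI)
    show "test_on (cball 0 1) (\<rho> (n + n0))" for n unfolding test_on_def using t\<rho> z\<rho> le1 by blast
    show "test_on (cball 0 1) (\<kappa> (n + n0) j)" for n j unfolding test_on_def using t\<kappa> z\<kappa> le1 by blast
    show "Ik (\<rho> (0 + n0)) \<noteq> 0" using I r(2) by simp
    show "Ik (\<rho> (n + n0)) = Ik (\<rho> (0 + n0))" for n unfolding I ..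
    show "\<rho> (Suc n + n0) \<tau> - \<rho> (n + n0) \<tau> = (\<Sum>j\<in>UNIV. iterpd (replicate N j) (\<kappa> (n + n0) j) \<tau>)" for n \<tau>
      using tel[of "n + n0" \<tau>] by simp
  qed (use C0 b\<kappa> z\<rho> b\<rho> in auto)
qed


subsection \<open>Sums of Euler derivatives of decaying functions\<close>

definition wgt :: "nat \<Rightarrow> real^'n::finite \<Rightarrow> real" where
  "wgt p x = (1 + (norm x)\<^sup>2) powr (real p / 2)"

lemma wgt_ge1: "1 \<le> wgt p x"
  unfolding wgt_def by (rule ge_one_powr_ge_zero) auto

definition bdp :: "nat \<Rightarrow> (real^'n::finite \<Rightarrow> complex) \<Rightarrow> bool" where
  "bdp p t \<longleftrightarrow> t \<in> borel_measurable lborel \<and> (\<exists>C. AE x in lborel. norm (complex_of_real (wgt p x) * t x) \<le> C)"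

lemma bdp_bounded:
  assumes "bdp p t" shows "\<exists>C\<ge>0. AE x in lborel. norm (t x) \<le> C"
proof -
  obtain C where C: "AE x in lborel. norm (complex_of_real (wgt p x) * t x) \<le> C" using assms by (auto simp: bdp_def)
  have "norm (t x) \<le> max C 0" if "norm (complex_of_real (wgt p x) * t x) \<le> C" for x
  proof -
    have "1 * norm (t x) \<le> norm (complex_of_real (wgt p x)) * norm (t x)"
      using wgt_ge1[of p x] by (intro mult_right_mono) auto
    then show ?thesis using that by (simp add: norm_mult)
  qed
  then have "AE x in lborel. norm (t x) \<le> max C 0" by (rule eventually_mono[OF C])
  then show ?thesis using max.cobounded2 by blast
qed

lemma bdp_integrable:
  assumes t: "bdp p t" and f: "test_fn f" shows "integrable lborel (\<lambda>x. t x * f x)"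
proof -
  obtain C where C: "C \<ge> 0" "AE x in lborel. norm (t x) \<le> C" using bdp_bounded[OF t] by blast
  have m: "t \<in> borel_measurable lborel" using t by (simp add: bdp_def)
  show ?thesis
  proof (rule Bochner_Integration.integrable_bound)
    show "integrable lborel (\<lambda>x. C * norm (f x))"
      by (intro Bochner_Integration.integrable_mult_right Bochner_Integration.integrable_norm test_integrable f)
    show "(\<lambda>x. t x * f x) \<in> borel_measurable lborel"
      using borel_measurable_integrable[OF test_integrable[OF f]] m by (rule borel_measurable_times[rotated])
    show "AE x in lborel. norm (t x * f x) \<le> norm (C * norm (f x))"
      using C(2) by (rule AE_mp) (use C(1) in \<open>auto simp: norm_mult abs_mult intro!: mult_right_mono AE_I2\<close>)
  qed
qed

lemma bdp_zero: "bdp p (\<lambda>x. 0)"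
  unfolding bdp_def by (auto intro: exI[of _ 0])

lemma bdp_linear:
  assumes s: "bdp p s" and t: "bdp p t" shows "bdp p (\<lambda>x. a * s x + t x)"
proof -
  obtain C where C: "AE x in lborel. norm (complex_of_real (wgt p x) * s x) \<le> C" using s by (auto simp: bdp_def)
  obtain D where D: "AE x in lborel. norm (complex_of_real (wgt p x) * t x) \<le> D" using t by (auto simp: bdp_def)
  have "AE x in lborel. norm (complex_of_real (wgt p x) * (a * s x + t x)) \<le> norm a * C + D"
    using C D
  proof eventually_elim
    case (elim x)
    have "complex_of_real (wgt p x) * (a * s x + t x) = a * (complex_of_real (wgt p x) * s x) + complex_of_real (wgt p x) * t x"
      by (simp add: algebra_simps)
    then have "norm (complex_of_real (wgt p x) * (a * s x + t x)) \<le> norm (a * (complex_of_real (wgt p x) * s x)) + norm (complex_of_real (wgt p x) * t x)"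
      by (metis norm_triangle_ineq)
    also have "norm (a * (complex_of_real (wgt p x) * s x)) \<le> norm a * C"
      unfolding norm_mult[of a] using elim(1) by (intro mult_left_mono) auto
    finally show ?case using elim(2) by linarith
  qed
  then show ?thesis using s t by (auto simp: bdp_def)
qed

text \<open>The condition of \<open>OH_dist\<close> for one decay order p, with the reversal of
  words already undone.\<close>

definition OHc :: "nat \<Rightarrow> ((real^'n::finite \<Rightarrow> complex) \<Rightarrow> complex) \<Rightarrow> bool" where
  "OHc p u \<longleftrightarrow> (\<exists>W t. finite W \<and> (\<forall>w\<in>W. bdp p (t w)) \<and>
     (\<forall>f. test_fn f \<longrightarrow> u f = (\<Sum>w\<in>W. \<integral>x. t w x * euler_tw w f x \<partial>lborel)))"

text \<open>Integration by parts with respect to the Haar measure yields - theta_j, whereas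
  \<open>euler_t\<close> is the transpose with respect to Lebesgue measure. They differ by the
  identity.\<close>

definition nt :: "'n::finite \<Rightarrow> (real^'n \<Rightarrow> complex) \<Rightarrow> real^'n \<Rightarrow> complex" where
  "nt j f x = - theta j f x"

lemma dop_nt: "dop (nt j)"
proof -
  have "dop (\<lambda>f x. (-1) * theta j f x + 0)" by (rule dop_linear[OF dop_theta dop_zero])
  then show ?thesis by (simp add: nt_def[abs_def])
qed

lemma dop_euler_t: "dop (euler_t j)"
proof -
  have "dop (\<lambda>f x. (-1) * f x + nt j f x)" by (rule dop_linear[OF dop_id dop_nt])
  then show ?thesis by (simp add: nt_def theta_def euler_t_def[abs_def])
qed

lemma dop_euler_tw: "dop (euler_tw w)"
proof (induction w)
  case Nil
  then show ?case using dop_id by (simp add: euler_tw.simps(1)[abs_def])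
next
  case (Cons j w)
  have "dop (\<lambda>f. euler_t j (euler_tw w f))" by (rule dop_comp[OF dop_euler_t Cons])
  then show ?case by (simp add: euler_tw.simps(2)[abs_def])
qed

lemma dop_nt_pow: "dop (nt j ^^ n)"
proof (induction n)
  case 0
  then show ?case using dop_id by (simp add: id_def)
next
  case (Suc n)
  then show ?case using dop_comp[OF dop_nt Suc] by (simp add: comp_def)
qed

lemma nt_euler: "nt j f = (\<lambda>x. 1 * euler_t j f x + f x)"
  by (simp add: nt_def[abs_def] theta_def euler_t_def)

lemma OHc_cong: "OHc p u \<Longrightarrow> (\<And>f. test_fn f \<Longrightarrow> v f = u f) \<Longrightarrow> OHc p v"
  unfolding OHc_def by auto

lemma OHc_base: "bdp p t \<Longrightarrow> OHc p (\<lambda>f. \<integral>x. t x * euler_tw w f x \<partial>lborel)"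
  unfolding OHc_def by (intro exI[of _ "{w}"] exI[of _ "\<lambda>_. t"]) auto

lemma OHc_linear:
  assumes u: "OHc p u" and v: "OHc p v" shows "OHc p (\<lambda>f. a * u f + v f)"
proof -
  obtain W s where s: "finite W" "\<And>w. w \<in> W \<Longrightarrow> bdp p (s w)"
    "\<And>f. test_fn f \<Longrightarrow> u f = (\<Sum>w\<in>W. \<integral>x. s w x * euler_tw w f x \<partial>lborel)" using u by (auto simp: OHc_def)
  obtain V t where t: "finite V" "\<And>w. w \<in> V \<Longrightarrow> bdp p (t w)"
    "\<And>f. test_fn f \<Longrightarrow> v f = (\<Sum>w\<in>V. \<integral>x. t w x * euler_tw w f x \<partial>lborel)" using v by (auto simp: OHc_def)
  \<comment> \<open>Extension by 0 to all words, so that both sums can run over W \<union>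
    V.\<close>
  define s' where "s' w = (if w \<in> W then s w else (\<lambda>x. 0))" for w
  define t' where "t' w = (if w \<in> V then t w else (\<lambda>x. 0))" for w
  have b: "bdp p (s' w)" "bdp p (t' w)" for w using s(2) t(2) bdp_zero by (auto simp: s'_def t'_def)
  have "a * u f + v f = (\<Sum>w\<in>W \<union> V. \<integral>x. (a * s' w x + t' w x) * euler_tw w f x \<partial>lborel)" if f: "test_fn f" for f
  proof -
    have e: "test_fn (euler_tw w f)" for w by (rule dopD(1)[OF dop_euler_tw f])
    have "(\<integral>x. (a * s' w x + t' w x) * euler_tw w f x \<partial>lborel) = (\<integral>x. a * (s' w x * euler_tw w f x) + t' w x * euler_tw w f x \<partial>lborel)" for w
      by (simp add: algebra_simps)
    then have "(\<integral>x. (a * s' w x + t' w x) * euler_tw w f x \<partial>lborel)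
       = a * (\<integral>x. s' w x * euler_tw w f x \<partial>lborel) + (\<integral>x. t' w x * euler_tw w f x \<partial>lborel)" for w
      using bdp_integrable[OF b(1) e] bdp_integrable[OF b(2) e] by simp
    moreover have "u f = (\<Sum>w\<in>W \<union> V. \<integral>x. s' w x * euler_tw w f x \<partial>lborel)"
      unfolding s(3)[OF f] by (rule sum.mono_neutral_cong_left) (use s(1) t(1) in \<open>auto simp: s'_def\<close>)
    moreover have "v f = (\<Sum>w\<in>W \<union> V. \<integral>x. t' w x * euler_tw w f x \<partial>lborel)"
      unfolding t(3)[OF f] by (rule sum.mono_neutral_cong_left) (use s(1) t(1) in \<open>auto simp: t'_def\<close>)
    ultimately show ?thesis by (simp add: sum.distrib sum_distrib_left)
  qed
  then show ?thesis unfolding OHc_def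
    by (intro exI[of _ "W \<union> V"] exI[of _ "\<lambda>w x. a * s' w x + t' w x"]) (use s(1) t(1) bdp_linear[OF b] in auto)
qed

lemma OHc_sum:
  assumes "finite I" "\<And>i. i \<in> I \<Longrightarrow> OHc p (u i)" shows "OHc p (\<lambda>f. \<Sum>i\<in>I. u i f)"
  using assms
proof (induction I rule: finite_induct)
  case empty
  then show ?case unfolding OHc_def by (intro exI[of _ "{}"]) auto
next
  case (insert i I)
  have "OHc p (\<lambda>f. 1 * u i f + (\<Sum>i\<in>I. u i f))" by (rule OHc_linear) (use insert in auto)
  then show ?case using insert.hyps by simp
qed

text \<open>As \<open>nt j\<close> is \<open>euler_t j\<close> plus the identity, one factor is
  traded for the longer word j # w plus the word w itself. The induction therefore ranges over all
  words.\<close>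

lemma OHc_nt: assumes t: "bdp p t" shows "OHc p (\<lambda>f. \<integral>x. t x * (nt j ^^ n) (euler_tw w f) x \<partial>lborel)"
proof (induction n arbitrary: w)
  case 0
  then show ?case using OHc_base[OF t] by simp
next
  case (Suc n)
  show ?case
  proof (rule OHc_cong[OF OHc_linear[OF Suc[of "j # w"] Suc[of w], of 1]])
    fix f :: "real^'a \<Rightarrow> complex" assume f: "test_fn f"
    let ?e = "euler_tw w f"
    have te: "test_fn ?e" "test_fn (euler_tw (j # w) f)" by (rule dopD(1)[OF dop_euler_tw f])+
    have "(nt j ^^ Suc n) ?e = (nt j ^^ n) (nt j ?e)" by (simp only: funpow_Suc_right comp_def)
    also have "\<dots> = (\<lambda>x. 1 * (nt j ^^ n) (euler_tw (j # w) f) x + (nt j ^^ n) ?e x)"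
      unfolding nt_euler[of j ?e] using dopD(2)[OF dop_nt_pow te(2,1), of n j 1] by simp
    finally have "(nt j ^^ Suc n) ?e = (\<lambda>x. (nt j ^^ n) (euler_tw (j # w) f) x + (nt j ^^ n) ?e x)" by simp
    then have "(\<integral>x. t x * (nt j ^^ Suc n) ?e x \<partial>lborel) = (\<integral>x. t x * (nt j ^^ n) (euler_tw (j # w) f) x + t x * (nt j ^^ n) ?e x \<partial>lborel)"
      by (simp add: distrib_left)
    also have "\<dots> = 1 * (\<integral>x. t x * (nt j ^^ n) (euler_tw (j # w) f) x \<partial>lborel) + (\<integral>x. t x * (nt j ^^ n) ?e x \<partial>lborel)"
      using bdp_integrable[OF t dopD(1)[OF dop_nt_pow te(2)]] bdp_integrable[OF t dopD(1)[OF dop_nt_pow te(1)]] by simp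
    finally show "(\<integral>x. t x * (nt j ^^ Suc n) ?e x \<partial>lborel) = 1 * (\<integral>x. t x * (nt j ^^ n) (euler_tw (j # w) f) x \<partial>lborel) + (\<integral>x. t x * (nt j ^^ n) ?e x \<partial>lborel)" .
  qed
qed

text \<open>\<open>euler_dist w\<close> applies the reversed word, so the two forms differ by the
  bijection \<open>rev\<close> on the index sets.\<close>

lemma OH_dist_iff:
  fixes T :: "(real^'n::finite \<Rightarrow> complex) \<Rightarrow> complex"
  shows "OH_dist T \<longleftrightarrow> is_distr T \<and> (\<forall>p. OHc p T)"
proof -
  have "OHc p T \<longleftrightarrow> (\<exists>W t. finite W \<and> (\<forall>w\<in>W. bdp p (t w)) \<and> (\<forall>f. test_fn f \<longrightarrow> T f = (\<Sum>w\<in>W. euler_dist w (t w) f)))"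
    (is "?L \<longleftrightarrow> ?R") for p
  proof
    assume ?L
    then obtain W t where t: "finite W" "\<And>w. w \<in> W \<Longrightarrow> bdp p (t w)"
      "\<And>f. test_fn f \<Longrightarrow> T f = (\<Sum>w\<in>W. \<integral>x. t w x * euler_tw w f x \<partial>lborel)" by (auto simp: OHc_def)
    show ?R
      by (intro exI[of _ "rev ` W"] exI[of _ "\<lambda>w. t (rev w)"]) (use t in \<open>auto simp: sum.reindex euler_dist_def\<close>)
  next
    assume ?R
    then obtain W t where t: "finite W" "\<And>w. w \<in> W \<Longrightarrow> bdp p (t w)"
      "\<And>f. test_fn f \<Longrightarrow> T f = (\<Sum>w\<in>W. euler_dist w (t w) f)" by auto
    show ?L unfolding OHc_def
      by (intro exI[of _ "rev ` W"] exI[of _ "\<lambda>w. t (rev w)"]) (use t in \<open>auto simp: sum.reindex euler_dist_def\<close>)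
  qed
  then show ?thesis unfolding OH_dist_def by (simp only: bdp_def wgt_def)
qed

subsection \<open>A Hadamard operator is a multiplicative convolution operator\<close>

context hadamard
begin

lemma B_iterpd:
  assumes k: "test_fn k" and f: "test_fn \<phi>" shows "B (iterpd (replicate N j) k) \<phi> = B k ((nt j ^^ N) \<phi>)"
  using f
proof (induction N arbitrary: \<phi>)
  case (Suc N)
  have "B (pd j (iterpd (replicate N j) k)) \<phi> = B (iterpd (replicate N j) k) (nt j \<phi>)"
    using B_parts[OF test_iterpd[OF k] Suc.prems] by (simp add: nt_def[abs_def])
  also have "\<dots> = B k ((nt j ^^ N) (nt j \<phi>))" by (rule Suc.IH[OF dopD(1)[OF dop_nt Suc.prems]])
  finally show ?case by (simp only: funpow_Suc_right comp_def) simp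
qed simp

text \<open>The densities \<open>wk (\<rho> n)\<close> have mass c, bounded L1 norm, and supports
  shrinking to the point 1, so the averages of \<open>G \<phi>\<close> tend to c times its value
  there, which is T \<phi>.\<close>

lemma B_limit:
  fixes \<rho> :: "nat \<Rightarrow> real^'n \<Rightarrow> complex"
  assumes \<rho>: "\<And>n. test_fn (\<rho> n)" and I: "\<And>n. Ik (\<rho> n) = c" and z: "\<And>n \<tau>. norm \<tau> > (1/2) ^ n \<Longrightarrow> \<rho> n \<tau> = 0"
    and C: "\<And>n \<tau>. norm (\<rho> n \<tau>) \<le> C * 2 ^ (CARD('n) * n)" and f: "test_fn \<phi>"
  shows "(\<lambda>n. B (\<rho> n) \<phi>) \<longlonglongrightarrow> c * T \<phi>"
proof (rule LIMSEQ_I)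
  fix e :: real assume e: "e > 0"
  let ?d = "CARD('n)"
  have C0: "C \<ge> 0" using order_trans[OF norm_ge_zero C[of 0 0]] by simp
  \<comment> \<open>A bound for the L1 norms: the sup bound e^d C 2^(d n) times the volume (4 /
    2^n)^d of the box carrying \<open>wk (\<rho> n)\<close>.\<close>
  define K where "K = (exp 1 * 4) ^ ?d * C"
  have K0: "K \<ge> 0" using C0 by (simp add: K_def)
  define e' where "e' = e / (K + 1)"
  have e': "e' > 0" using e K0 by (simp add: e'_def)
  have "K * e < (K + 1) * e" using e by simp
  then have Ke: "K * e' < e" using K0 by (simp add: e'_def divide_less_eq mult.commute)
  have "continuous (at 1) (G \<phi>)" using smooth_cont[OF G_smooth[OF f], of UNIV] by (simp add: continuous_on_eq_continuous_at)
  then obtain \<delta> where \<delta>: "\<delta> > 0" "\<And>s. dist s 1 < \<delta> \<Longrightarrow> dist (G \<phi> s) (G \<phi> 1) < e'"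
    using e' unfolding continuous_at_eps_delta by blast
  obtain N where N: "(1/2) ^ N < \<delta> / (2 * ?d)"
    using real_arch_pow_inv[of "\<delta> / (2 * ?d)" "1/2"] \<delta> by auto
  have "norm (B (\<rho> n) \<phi> - c * T \<phi>) < e" if n: "n \<ge> N" for n
  proof -
    define h where "h = (1/2::real) ^ n"
    have h: "h > 0" "h \<le> 1" by (auto simp: h_def power_le_one)
    have "h \<le> (1/2) ^ N" unfolding h_def using n by (intro power_decreasing) auto
    then have "h < \<delta> / (2 * ?d)" using N by linarith
    then have hd: "?d * (2 * h) < \<delta>" by (simp add: field_simps)
    have zh: "\<And>\<tau>. norm \<tau> > h \<Longrightarrow> \<rho> n \<tau> = 0" using z by (simp add: h_def)
    let ?l = "(\<chi> i. 1 - 2 * h) :: real^'n" and ?u = "(\<chi> i. 1 + 2 * h) :: real^'n"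
    define M where "M = exp 1 ^ ?d * (C * 2 ^ (?d * n))"
    have M0: "M \<ge> 0" using C0 by (simp add: M_def)
    have supp: "\<bar>s $ i - 1\<bar> \<le> 2 * h" if w: "wk (\<rho> n) s \<noteq> 0" for s i
    proof -
      \<comment> \<open>For 0 < h <= 1, exp h <= 1 + h + h^2 <= 1 + 2 h and exp (- h) >= 1 - h, so s
        stays within 2 h of 1 in each coordinate.\<close>
      have "exp (- h) \<le> s $ i" by (rule wk_nonzero(2)[OF zh w])
      moreover have "s $ i \<le> exp h" by (rule wk_nonzero(3)[OF zh w])
      moreover have "1 + (- h) \<le> exp (- h)" by (rule exp_ge_add_one_self)
      moreover have "exp h \<le> 1 + h + h\<^sup>2" using h by (intro exp_bound) auto
      moreover have "h\<^sup>2 \<le> h" using h by (simp add: power2_eq_square mult_left_le)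
      ultimately show ?thesis using h by linarith
    qed
    have wb: "norm (wk (\<rho> n) s) \<le> M" for s
    proof (cases "wk (\<rho> n) s = 0")
      case False
      have s: "0 < s $ i" "exp (- h) \<le> s $ i" for i using wk_nonzero(1,2)[OF zh False] by auto
      then have p: "\<forall>i. 0 < s $ i" by blast
      have "norm (wk (\<rho> n) s) = (\<Prod>i\<in>UNIV. norm (complex_of_real (1 / s $ i))) * norm (\<rho> n (lnv s))"
        unfolding wk_pos[OF p] by (simp only: norm_mult prod_norm)
      also have "\<dots> \<le> (\<Prod>i\<in>(UNIV::'n set). exp 1) * (C * 2 ^ (?d * n))"
      proof (intro mult_mono prod_mono conjI norm_ge_zero C prod_nonneg)
        fix i
        have "exp (- 1) \<le> exp (- h)" using h by simp
        then have "exp (- 1) \<le> s $ i" using s(2)[of i] by linarith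
        then have "1 / s $ i \<le> 1 / exp (- 1)" using s by (intro divide_left_mono) auto
        then show "norm (complex_of_real (1 / s $ i)) \<le> exp 1" using s(1)[of i]
          by (simp add: exp_minus norm_divide inverse_eq_divide)
      qed auto
      finally show ?thesis by (simp add: M_def)
    qed (use M0 in simp)
    have fin: "emeasure lborel (cbox ?l ?u) < top"
      using emeasure_bounded_finite[OF bounded_cbox] by (simp add: less_top)
    have b: "(?u - ?l) \<bullet> b = 4 * h" "?l \<bullet> b \<le> ?u \<bullet> b" if "b \<in> Basis" for b
      using that h by (auto simp: Basis_cart inner_axis inner_diff_left)
    have "measure lborel (cbox ?l ?u) = (\<Prod>b\<in>(Basis::(real^'n) set). (?u - ?l) \<bullet> b)"
      using b(2) by (subst measure_lborel_cbox_eq) auto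
    also have "\<dots> = (\<Prod>b\<in>(Basis::(real^'n) set). 4 * h)" by (rule prod.cong[OF refl b(1)])
    finally have vol: "measure lborel (cbox ?l ?u) = (4 * h) ^ ?d" by simp
    have hp: "(h * 2 ^ n) ^ ?d = 1" by (simp add: h_def power_divide)
    have MK: "M * (4 * h) ^ ?d = K"
    proof -
      have "M * (4 * h) ^ ?d = (exp 1 * 4) ^ ?d * C * (h * 2 ^ n) ^ ?d"
        by (simp add: M_def power_mult_distrib power_mult[symmetric] mult_ac)
      then show ?thesis by (simp add: hp K_def)
    qed
    have iw: "integrable lborel (\<lambda>s. wk (\<rho> n) s)" by (rule test_integrable[OF test_wk[OF \<rho>]])
    have G1: "G \<phi> 1 = T \<phi>" using G_T[of 1, OF _ f] by simp
    have "B (\<rho> n) \<phi> - c * T \<phi> = (\<integral>s. wk (\<rho> n) s * G \<phi> s \<partial>lborel) - (\<integral>s. wk (\<rho> n) s * G \<phi> 1 \<partial>lborel)"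
      using I[of n] by (simp add: B_def Ik_def G1)
    also have "\<dots> = (\<integral>s. wk (\<rho> n) s * G \<phi> s - wk (\<rho> n) s * G \<phi> 1 \<partial>lborel)"
      using B_integrable[OF \<rho> f] iw by (intro Bochner_Integration.integral_diff[symmetric]) auto
    finally have "norm (B (\<rho> n) \<phi> - c * T \<phi>) \<le> (\<integral>s. norm (wk (\<rho> n) s * G \<phi> s - wk (\<rho> n) s * G \<phi> 1) \<partial>lborel)"
      by simp
    also have "\<dots> \<le> (\<integral>s. (M * e') * indicator (cbox ?l ?u) s \<partial>lborel)"
    proof (rule integral_mono)
      show "integrable lborel (\<lambda>s. norm (wk (\<rho> n) s * G \<phi> s - wk (\<rho> n) s * G \<phi> 1))"
        using B_integrable[OF \<rho> f] iw by (intro Bochner_Integration.integrable_norm Bochner_Integration.integrable_diff) auto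
      show "integrable lborel (\<lambda>s. (M * e') * indicator (cbox ?l ?u) s :: real)"
        using fin by (intro Bochner_Integration.integrable_mult_right integrable_real_indicator) auto
      fix s :: "real^'n"
      show "norm (wk (\<rho> n) s * G \<phi> s - wk (\<rho> n) s * G \<phi> 1) \<le> (M * e') * indicator (cbox ?l ?u) s"
      proof (cases "wk (\<rho> n) s = 0")
        case True
        then show ?thesis using M0 e' by simp
      next
        case False
        note s = supp[OF False]
        have "norm (s - 1) \<le> (\<Sum>i\<in>UNIV. \<bar>(s - 1) $ i\<bar>)" by (rule norm_le_l1_cart)
        also have "\<dots> \<le> (\<Sum>i\<in>(UNIV::'n set). 2 * h)" by (intro sum_mono) (use s in simp)
        also have "\<dots> < \<delta>" using hd by simp
        finally have "norm (G \<phi> s - G \<phi> 1) < e'" using \<delta>(2)[of s] by (simp add: dist_norm)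
        then have "norm (wk (\<rho> n) s) * norm (G \<phi> s - G \<phi> 1) \<le> M * e'" using wb M0 by (intro mult_mono) auto
        moreover have "1 - 2 * h \<le> s $ i \<and> s $ i \<le> 1 + 2 * h" for i using s[of i] by linarith
        then have "s \<in> cbox ?l ?u" by (simp add: mem_box_cart)
        ultimately show ?thesis by (simp add: norm_mult[symmetric] right_diff_distrib)
      qed
    qed
    also have "\<dots> = M * e' * (4 * h) ^ ?d" using vol by simp
    also have "\<dots> = K * e'" using MK by (simp add: mult_ac)
    finally show ?thesis using Ke by linarith
  qed
  then show "\<exists>N. \<forall>n\<ge>N. norm (B (\<rho> n) \<phi> - c * T \<phi>) < e" by blast
qed

text \<open>\<open>Ik (\<rho> 0)\<close> times T \<phi> is the limit of
  \<open>B (\<rho> n) \<phi>\<close>. Telescoping leaves \<open>B (\<rho> 0) \<phi>\<close> and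
  terms \<open>B\<close> of N-fold derivatives of \<kappa> n j; once the derivatives sit on \<phi>,
  what remains are densities \<open>tk (\<kappa> n j)\<close> whose weighted size is geometric in
  n.\<close>

lemma T_OHc: "OHc p T"
proof -
  have "\<exists>m C1. C1 \<ge> 0 \<and> (\<forall>k e z. test_on (cball 0 1) k \<longrightarrow> dbound m e k \<longrightarrow> wgt p z * norm (tk k z) \<le> C1 * e)"
    unfolding wgt_def by (rule tk_bound)
  then obtain m C1 where C1': "C1 \<ge> 0 \<and> (\<forall>k e z. test_on (cball 0 1) k \<longrightarrow> dbound m e k \<longrightarrow> wgt p z * norm (tk k z) \<le> C1 * e)"
    by (elim exE)
  note C1 = conjunct1[OF C1'] conjunct2[OF C1', rule_format]
  define N where "N = CARD('n) + m + 1"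
  obtain \<rho> :: "nat \<Rightarrow> real^'n \<Rightarrow> complex" and \<kappa> C where K: "C \<ge> 0" "\<forall>n. test_on (cball 0 1) (\<rho> n)"
      "\<forall>n j. test_on (cball 0 1) (\<kappa> n j)"
      "\<forall>n \<tau>. \<rho> (Suc n) \<tau> - \<rho> n \<tau> = (\<Sum>j\<in>UNIV. iterpd (replicate N j) (\<kappa> n j) \<tau>)"
      "\<forall>n j. dbound m (C * (1/2) ^ n) (\<kappa> n j)" "Ik (\<rho> 0) \<noteq> 0" "\<forall>n. Ik (\<rho> n) = Ik (\<rho> 0)"
      "\<forall>n \<tau>. norm \<tau> > (1/2) ^ n \<longrightarrow> \<rho> n \<tau> = 0" "\<forall>n \<tau>. norm (\<rho> n \<tau>) \<le> C * 2 ^ (CARD('n) * n)"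
    using approximate_identity_exists[where 'n = 'n and m = m] unfolding N_def[symmetric] by (elim exE conjE) (rule that; assumption)
  note C = K(1) and \<rho> = K(2)[rule_format] and \<kappa> = K(3)[rule_format] and tel = K(4)[rule_format]
    and d = K(5)[rule_format] and c0 = K(6) and cn = K(7)[rule_format] and z = K(8)[rule_format] and Cb = K(9)[rule_format]
  have t\<rho>: "test_fn (\<rho> n)" and t\<kappa>: "test_fn (\<kappa> n j)" for n j using \<rho> \<kappa> by (auto simp: test_on_def)
  define D where "D = C1 * C"
  have D0: "D \<ge> 0" using C1 C by (simp add: D_def)
  have wb: "wgt p z * norm (tk (\<kappa> n j) z) \<le> D * (1/2) ^ n" for n j z
    using C1(2)[OF \<kappa> d, of z n j] by (simp add: D_def mult.assoc)
  have nb: "norm (tk (\<kappa> n j) z) \<le> D * (1/2) ^ n" for n j z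
  proof -
    have "1 * norm (tk (\<kappa> n j) z) \<le> wgt p z * norm (tk (\<kappa> n j) z)" by (intro mult_right_mono wgt_ge1) auto
    then show ?thesis using wb[of z n j] by linarith
  qed
  have sg: "summable (\<lambda>n. D * (1/2) ^ n)" by (intro summable_mult summable_geometric) auto
  have sn: "summable (\<lambda>n. norm (tk (\<kappa> n j) z))" for j z
    by (rule summable_comparison_test'[OF sg, where N = 0]) (use nb in simp)
  \<comment> \<open>The operator falling on \<phi> depends on j but not on n, so the whole series
    over the scales n collapses into one density per direction.\<close>
  define U where "U j z = (\<Sum>n. tk (\<kappa> n j) z)" for j z
  have mU: "U j \<in> borel_measurable lborel" for j unfolding U_def[abs_def]
    by (intro borel_measurable_suminf tk_measurable t\<kappa>)
  have bU: "bdp p (U j)" for j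
  proof -
    have "norm (complex_of_real (wgt p z) * U j z) \<le> (\<Sum>n. D * (1/2) ^ n)" for z
    proof -
      have w0: "0 \<le> wgt p z" using wgt_ge1[of p z] by linarith
      have "norm (complex_of_real (wgt p z) * U j z) = wgt p z * norm (U j z)" using w0 by (simp add: norm_mult)
      also have "\<dots> \<le> wgt p z * (\<Sum>n. norm (tk (\<kappa> n j) z))"
        unfolding U_def by (intro mult_left_mono summable_norm sn w0)
      also have "\<dots> = (\<Sum>n. wgt p z * norm (tk (\<kappa> n j) z))" by (rule suminf_mult[OF sn, symmetric])
      also have "\<dots> \<le> (\<Sum>n. D * (1/2) ^ n)" by (intro suminf_le wb summable_mult sn sg)
      finally show ?thesis .
    qed
    then show ?thesis using mU by (auto simp: bdp_def intro!: exI[of _ "\<Sum>n. D * (1/2) ^ n"])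
  qed
  have b0: "bdp p (tk (\<rho> 0))"
  proof -
    obtain e where e: "dbound m e (\<rho> 0)" using dbound_exists[OF t\<rho>] by blast
    have "norm (complex_of_real (wgt p z) * tk (\<rho> 0) z) \<le> C1 * e" for z
      using C1(2)[OF \<rho> e, of z] wgt_ge1[of p z] by (simp add: norm_mult)
    then show ?thesis using tk_measurable[OF t\<rho>] by (auto simp: bdp_def intro!: exI[of _ "C1 * e"])
  qed
  \<comment> \<open>The identity is written as \<open>(nt j0 ^^ 0) (euler_tw [] \<phi>)\<close> so
    that \<open>OHc_nt\<close> covers the first term too.\<close>
  have main: "T \<phi> = (1 / Ik (\<rho> 0)) * ((\<integral>z. tk (\<rho> 0) z * (nt j0 ^^ 0) (euler_tw [] \<phi>) z \<partial>lborel) +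
      (\<Sum>j\<in>UNIV. \<integral>z. U j z * (nt j ^^ N) (euler_tw [] \<phi>) z \<partial>lborel))" if f: "test_fn \<phi>" for \<phi> and j0 :: 'n
  proof -
    have lim: "(\<lambda>n. B (\<rho> n) \<phi>) \<longlonglongrightarrow> Ik (\<rho> 0) * T \<phi>" by (rule B_limit[OF t\<rho> cn z Cb f])
    have s1: "(\<lambda>n. B (\<rho> (Suc n)) \<phi> - B (\<rho> n) \<phi>) sums (Ik (\<rho> 0) * T \<phi> - B (\<rho> 0) \<phi>)" by (rule telescope_sums[OF lim])
    have t\<psi>: "test_fn ((nt j ^^ N) \<phi>)" for j by (rule dopD(1)[OF dop_nt_pow f])
    have step: "B (\<rho> (Suc n)) \<phi> - B (\<rho> n) \<phi> = (\<Sum>j\<in>UNIV. \<integral>z. (nt j ^^ N) \<phi> z * tk (\<kappa> n j) z \<partial>lborel)" for n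
    proof -
      have "\<rho> (Suc n) = (\<lambda>\<tau>. 1 * \<rho> n \<tau> + (\<Sum>j\<in>UNIV. iterpd (replicate N j) (\<kappa> n j) \<tau>))"
        using tel[of n] by (auto simp: fun_eq_iff algebra_simps)
      then have "B (\<rho> (Suc n)) \<phi> = 1 * B (\<rho> n) \<phi> + B (\<lambda>\<tau>. \<Sum>j\<in>UNIV. iterpd (replicate N j) (\<kappa> n j) \<tau>) \<phi>"
        by (simp only:) (intro B_linear t\<rho> test_sum test_iterpd t\<kappa> f)
      also have "B (\<lambda>\<tau>. \<Sum>j\<in>UNIV. iterpd (replicate N j) (\<kappa> n j) \<tau>) \<phi> = (\<Sum>j\<in>UNIV. B (iterpd (replicate N j) (\<kappa> n j)) \<phi>)"
        by (intro B_sum test_iterpd t\<kappa> f finite)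
      finally show ?thesis by (simp add: B_iterpd[OF t\<kappa> f] B_repr[OF t\<kappa> t\<psi>])
    qed
    have s2: "(\<lambda>n. \<integral>z. (nt j ^^ N) \<phi> z * tk (\<kappa> n j) z \<partial>lborel) sums (\<integral>z. (nt j ^^ N) \<phi> z * U j z \<partial>lborel)" for j
    proof -
      let ?f = "\<lambda>n z. (nt j ^^ N) \<phi> z * tk (\<kappa> n j) z"
      have i\<psi>: "integrable lborel (\<lambda>z. norm ((nt j ^^ N) \<phi> z))"
        by (intro Bochner_Integration.integrable_norm test_integrable t\<psi>)
      have fb: "norm (?f n z) \<le> (D * (1/2) ^ n) * norm ((nt j ^^ N) \<phi> z)" for n z
        using mult_right_mono[OF nb norm_ge_zero] by (simp add: norm_mult mult.commute)
      have fint: "integrable lborel (?f n)" for n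
      proof (rule Bochner_Integration.integrable_bound[OF Bochner_Integration.integrable_mult_right[OF i\<psi>, of "D * (1/2) ^ n"]])
        show "?f n \<in> borel_measurable lborel"
          by (intro borel_measurable_times tk_measurable t\<kappa> borel_measurable_integrable[OF test_integrable[OF t\<psi>]])
        show "AE z in lborel. norm (?f n z) \<le> norm (D * (1/2) ^ n * norm ((nt j ^^ N) \<phi> z))"
          using fb by (intro AE_I2 order_trans[OF fb]) simp
      qed
      have "(\<lambda>n. \<integral>z. ?f n z \<partial>lborel) sums (\<integral>z. (\<Sum>n. ?f n z) \<partial>lborel)"
      proof (rule sums_integral[OF fint])
        have "summable (\<lambda>n. norm (?f n z))" for z unfolding norm_mult by (intro summable_mult sn)
        then show "AE z in lborel. summable (\<lambda>n. norm (?f n z))" by (intro AE_I2)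
        show "summable (\<lambda>n. \<integral>z. norm (?f n z) \<partial>lborel)"
        proof (rule summable_comparison_test'[where N = 0])
          show "summable (\<lambda>n. D * (1/2) ^ n * (\<integral>z. norm ((nt j ^^ N) \<phi> z) \<partial>lborel))" by (rule summable_mult2[OF sg])
          fix n
          have "(\<integral>z. norm (?f n z) \<partial>lborel) \<le> (\<integral>z. (D * (1/2) ^ n) * norm ((nt j ^^ N) \<phi> z) \<partial>lborel)"
            by (intro integral_mono fb Bochner_Integration.integrable_mult_right i\<psi> Bochner_Integration.integrable_norm fint)
          then show "norm (\<integral>z. norm (?f n z) \<partial>lborel) \<le> D * (1/2) ^ n * (\<integral>z. norm ((nt j ^^ N) \<phi> z) \<partial>lborel)" by simp
        qed
      qed
      moreover have "(\<Sum>n. ?f n z) = (nt j ^^ N) \<phi> z * U j z" for z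
        unfolding U_def by (rule suminf_mult[OF summable_norm_cancel[OF sn]])
      ultimately show ?thesis by simp
    qed
    have "Ik (\<rho> 0) * T \<phi> - B (\<rho> 0) \<phi> = (\<Sum>j\<in>UNIV. \<integral>z. (nt j ^^ N) \<phi> z * U j z \<partial>lborel)"
      by (rule sums_unique2[OF s1[unfolded step]]) (rule sums_sum[OF s2])
    then have "Ik (\<rho> 0) * T \<phi> = (\<integral>z. \<phi> z * tk (\<rho> 0) z \<partial>lborel) + (\<Sum>j\<in>UNIV. \<integral>z. (nt j ^^ N) \<phi> z * U j z \<partial>lborel)"
      using B_repr[OF t\<rho> f, of 0] by (simp add: diff_eq_eq add.commute)
    then show ?thesis using c0 by (simp add: nonzero_eq_divide_eq mult.commute)
  qed
  obtain j0 :: 'n where True by blast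
  \<comment> \<open>The coefficient 1 and the empty sum bring the expression into the form a u + v
    of \<open>OHc_linear\<close>.\<close>
  have "OHc p (\<lambda>\<phi>. (1 / Ik (\<rho> 0)) * (1 * (\<integral>z. tk (\<rho> 0) z * (nt j0 ^^ 0) (euler_tw [] \<phi>) z \<partial>lborel) +
      (\<Sum>j\<in>UNIV. \<integral>z. U j z * (nt j ^^ N) (euler_tw [] \<phi>) z \<partial>lborel)) + (\<Sum>j\<in>({}::nat set). 0))"
    by (intro OHc_linear OHc_sum OHc_nt b0 bU) auto
  then show ?thesis by (rule OHc_cong) (use main[of _ j0] in simp)
qed

lemma T_OH: "OH_dist T"
  unfolding OH_dist_iff using T_distr T_OHc by blast

end

section \<open>Uniqueness of the extension across the hyperplanes, and the operator as a
  convolution\<close>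

lemma nz_dense_eq:
  fixes f g :: "real^'n::finite \<Rightarrow> complex"
  assumes f: "continuous_on UNIV f" and g: "continuous_on UNIV g" and eq: "\<And>y. (\<And>j. y $ j \<noteq> 0) \<Longrightarrow> f y = g y"
  shows "f = g"
proof
  fix y :: "real^'n"
  define s where "s n = (\<chi> i. if y $ i = 0 then inverse (real (Suc n)) else y $ i)" for n
  have "s \<longlonglongrightarrow> y"
  proof (rule vec_tendstoI)
    show "(\<lambda>n. s n $ i) \<longlonglongrightarrow> y $ i" for i
      using LIMSEQ_inverse_real_of_nat by (cases "y $ i = 0") (auto simp: s_def simp del: of_nat_Suc)
  qed
  then have "(\<lambda>n. f (s n)) \<longlonglongrightarrow> f y" "(\<lambda>n. g (s n)) \<longlonglongrightarrow> g y"
    using f g by (auto simp: continuous_on_eq_continuous_at intro: isCont_tendsto_compose)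
  moreover have "f (s n) = g (s n)" for n by (rule eq) (simp add: s_def del: of_nat_Suc)
  ultimately show "f y = g y" using LIMSEQ_unique by (simp only:) blast
qed

text \<open>Resolves the definite description in \<open>mstar\<close>: two continuous extensions
  coincide because they agree on the dense set of points without zero coordinates.\<close>

lemma mstar_eq:
  fixes T S :: "(real^'n::finite \<Rightarrow> complex) \<Rightarrow> complex"
  assumes f: "test_fn f" and g: "test_fn g" "\<And>y. (\<forall>j. y $ j \<noteq> 0) \<Longrightarrow> g y = T (\<lambda>x. f (x * y))"
  shows "mstar S T f = S g"
proof -
  have "(THE g. test_fn g \<and> (\<forall>y. (\<forall>j. y $ j \<noteq> 0) \<longrightarrow> g y = T (\<lambda>x. f (x * y)))) = g"
  proof (rule the_equality)
    fix h assume h: "test_fn h \<and> (\<forall>y. (\<forall>j. y $ j \<noteq> 0) \<longrightarrow> h y = T (\<lambda>x. f (x * y)))"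
    show "h = g" by (rule nz_dense_eq) (use h g test_cont in auto)
  qed (use g in blast)
  then show ?thesis using f by (simp add: mstar_def)
qed

lemma (in hadamard) L_mstar:
  assumes S: "is_distr S" shows "L S = mstar S T"
proof
  fix f
  show "L S f = mstar S T f"
  proof (cases "test_fn f")
    case True
    have "mstar S T f = S (G f)" by (rule mstar_eq[OF True G_test[OF True]]) (simp add: G_T True)
    then show ?thesis using G_eval[OF S True] by simp
  next
    case False
    then show ?thesis using distr_nontest[OF L_distr[OF S]] by (simp add: mstar_def)
  qed
qed


subsection \<open>Convolution with a distribution of rapid decay\<close>

lemma wgt_ge: assumes "a > 0" "a\<^sup>2 \<le> 1 + (norm x)\<^sup>2" shows "a ^ k \<le> wgt k x"
proof -
  have "a ^ k = a powr (2 * (real k / 2))" using powr_realpow[OF assms(1), of k] by simp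
  also have "\<dots> = (a powr 2) powr (real k / 2)" by (simp only: powr_powr)
  also have "\<dots> = (a\<^sup>2) powr (real k / 2)" using powr_realpow[OF assms(1), of 2] by simp
  also have "\<dots> \<le> wgt k x" unfolding wgt_def using assms by (intro powr_mono2) auto
  finally show ?thesis .
qed

lemma wgt_add: "wgt (a + b) x = wgt a x * wgt b x"
  unfolding wgt_def by (simp add: add_divide_distrib powr_add)

lemma wgt_mono: "a \<le> b \<Longrightarrow> wgt a x \<le> wgt b x"
  using wgt_add[of a "b - a" x] mult_left_mono[OF wgt_ge1[of "b - a" x], of "wgt a x"] wgt_ge1[of a x] by simp

lemma wgt_measurable: "wgt k \<in> borel_measurable lborel"
  unfolding wgt_def[abs_def] by measurable

text \<open>Domination by a dyadic step function: cube number n has half-side 2^(n+1) and carries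
  the value 2^(-n(d+1)), so its contribution 4^d 2^(-n) is summable.\<close>

lemma integrable_inverse_wgt: "integrable lborel (\<lambda>x::real^'n::finite. 1 / wgt (CARD('n) + 1) x)"
proof -
  let ?d = "CARD('n)"
  let ?u = "\<lambda>n::nat. (\<chi> i. 2 * 2 ^ n) :: real^'n"
  let ?f = "\<lambda>n x. (1/2) ^ (n * (?d + 1)) * indicator (cbox (- ?u n) (?u n)) x :: real"
  have vol: "measure lborel (cbox (- ?u n) (?u n)) = (4 * 2 ^ n) ^ ?d" for n
  proof -
    have b: "(?u n - (- ?u n)) \<bullet> b = 4 * 2 ^ n" "(- ?u n) \<bullet> b \<le> ?u n \<bullet> b" if "b \<in> Basis" for b
      using that by (auto simp: Basis_cart inner_axis inner_diff_left)
    have "measure lborel (cbox (- ?u n) (?u n)) = (\<Prod>b\<in>(Basis::(real^'n) set). (?u n - (- ?u n)) \<bullet> b)"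
      using b(2) by (subst measure_lborel_cbox_eq) auto
    also have "\<dots> = (\<Prod>b\<in>(Basis::(real^'n) set). 4 * 2 ^ n)" by (rule prod.cong[OF refl b(1)])
    finally show ?thesis by simp
  qed
  have fin: "emeasure lborel (cbox (- ?u n) (?u n)) < top" for n
    using emeasure_bounded_finite[OF bounded_cbox] by (simp add: less_top)
  have i: "integrable lborel (?f n)" for n
    using fin by (intro Bochner_Integration.integrable_mult_right integrable_real_indicator) auto
  have I: "(\<integral>x. ?f n x \<partial>lborel) = 4 ^ ?d * (1/2) ^ n" for n
  proof -
    have "(\<integral>x. ?f n x \<partial>lborel) = (1/2) ^ (n * (?d + 1)) * (4 * 2 ^ n) ^ ?d" using vol[of n] by simp
    also have "\<dots> = 4 ^ ?d * (1/2) ^ n * ((1/2) ^ (n * ?d) * 2 ^ (n * ?d))"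
      by (simp only: power_mult_distrib power_mult[symmetric] add_mult_distrib2 power_add mult_1_right) (simp add: mult_ac)
    also have "(1/2::real) ^ (n * ?d) * 2 ^ (n * ?d) = 1" by (simp add: power_divide)
    finally show ?thesis by simp
  qed
  have fg: "norm (?f n x) \<le> (1/2) ^ n" for n and x :: "real^'n"
  proof -
    have "(1/2::real) ^ (n * (?d + 1)) \<le> (1/2) ^ n" by (rule power_decreasing) auto
    then show ?thesis by (auto simp: indicator_def)
  qed
  have sm: "summable (\<lambda>n. norm (?f n x))" for x :: "real^'n"
    by (rule summable_comparison_test'[where g = "\<lambda>n. (1/2::real) ^ n" and N = 0]) (use fg in \<open>auto intro!: summable_geometric\<close>)
  have nn: "norm (?f n x) = ?f n x" for n and x :: "real^'n" by (simp add: indicator_def)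
  have int: "integrable lborel (\<lambda>x. \<Sum>n. ?f n x)"
  proof (rule integrable_suminf[OF i])
    show "AE x in lborel. summable (\<lambda>n. norm (?f n x))" using sm by (intro AE_I2)
    show "summable (\<lambda>n. \<integral>x. norm (?f n x) \<partial>lborel)"
      unfolding nn I by (intro summable_mult summable_geometric) auto
  qed
  show ?thesis
  proof (rule Bochner_Integration.integrable_bound[OF int])
    show "(\<lambda>x::real^'n. 1 / wgt (?d + 1) x) \<in> borel_measurable lborel"
      by (intro borel_measurable_divide wgt_measurable borel_measurable_const)
    have le: "1 / wgt (?d + 1) x \<le> (\<Sum>n. ?f n x)" for x :: "real^'n"
    proof -
      define a where "a = max 1 (norm x)"
      \<comment> \<open>The least m has the form n + 1, since a >= 1. Then x lies in cube n, while a
        >= 2^n bounds the weight below by 2^(n(d+1)).\<close>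
      define m where "m = (LEAST m. a < 2 ^ m)"
      obtain m0 :: nat where "a < 2 ^ m0" using real_arch_pow[of 2 a] by auto
      then have m: "a < 2 ^ m" unfolding m_def by (rule LeastI)
      have "1 \<le> a" by (simp add: a_def)
      then have "m \<noteq> 0" using m by (intro notI) simp
      then obtain n where n: "m = Suc n" by (cases m) auto
      then have "\<not> a < 2 ^ n" unfolding m_def by (intro not_less_Least) simp
      then have n1: "2 ^ n \<le> a" by simp
      have a2: "a\<^sup>2 \<le> 1 + (norm x)\<^sup>2" unfolding a_def by (simp add: max_def power_le_one)
      have "((2::real) ^ n) ^ (?d + 1) \<le> a ^ (?d + 1)" using n1 by (intro power_mono) auto
      also have "\<dots> \<le> wgt (?d + 1) x" using a2 by (intro wgt_ge) (auto simp: a_def)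
      finally have "1 / wgt (?d + 1) x \<le> 1 / (2 ^ n) ^ (?d + 1)" by (intro divide_left_mono) (auto simp del: power_Suc intro!: mult_pos_pos less_le_trans[OF zero_less_one wgt_ge1])
      also have "\<dots> = ?f n x"
      proof -
        have "\<bar>x $ i\<bar> \<le> 2 * 2 ^ n" for i
          using component_le_norm_cart[of x i] m n by (simp add: a_def)
        then have "x \<in> cbox (- ?u n) (?u n)" by (auto simp: mem_box_cart abs_le_iff minus_le_iff)
        then show ?thesis by (simp add: power_divide power_mult[symmetric] del: power_Suc)
      qed
      also have "\<dots> = (\<Sum>k\<in>{n}. ?f k x)"
      proof -
        have "sum g {n} = g n" for g :: "nat \<Rightarrow> real" by simp
        then show ?thesis by (rule sym)
      qed
      also have "\<dots> \<le> (\<Sum>n. ?f n x)" using sm[of x] unfolding nn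
        by (intro sum_le_suminf) (auto simp: indicator_def)
      finally show ?thesis .
    qed
    show "AE x in lborel. norm (1 / wgt (?d + 1) (x::real^'n)) \<le> norm (\<Sum>n. ?f n x)"
    proof (intro AE_I2)
      fix x :: "real^'n"
      have "0 \<le> 1 / wgt (?d + 1) x" using wgt_ge1[of "?d + 1" x] by simp
      then show "norm (1 / wgt (?d + 1) x) \<le> norm (\<Sum>n. ?f n x)" using le[of x] by (simp only: real_norm_def)
    qed
  qed
qed

lemma norm_cw: "norm (cw js x) \<le> wgt (length js) x"
proof -
  have 1: "norm (cw js x) \<le> norm x ^ length js"
  proof (induction js)
    case (Cons j js)
    then show ?case using component_le_norm_cart[of x j] by (auto simp: norm_mult intro!: mult_mono)
  qed simp
  show ?thesis
  proof (cases "x = 0")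
    case True
    have "(0::real) ^ length js \<le> 1" by (rule power_le_one) auto
    then show ?thesis using 1 wgt_ge1[of "length js" x] True by simp
  next
    case False
    then have "norm x ^ length js \<le> wgt (length js) x" by (intro wgt_ge) auto
    then show ?thesis using 1 by linarith
  qed
qed

text \<open>The decay budget p is spent in two parts: \<open>length js\<close> powers absorb the
  monomial \<open>cw js\<close>, and d + 1 powers give integrability.\<close>

lemma bdp_cw_integrable:
  fixes t :: "real^'n::finite \<Rightarrow> complex"
  assumes t: "bdp p t" and p: "length js + (CARD('n) + 1) \<le> p"
  shows "integrable lborel (\<lambda>x. t x * cw js x)"
proof -
  let ?D = "CARD('n) + 1"
  obtain C where C: "AE x in lborel. norm (complex_of_real (wgt p x) * t x) \<le> C" using t by (auto simp: bdp_def)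
  show ?thesis
  proof (rule Bochner_Integration.integrable_bound)
    show "integrable lborel (\<lambda>x::real^'n. C * (1 / wgt ?D x))"
      by (intro Bochner_Integration.integrable_mult_right integrable_inverse_wgt)
    show "(\<lambda>x. t x * cw js x) \<in> borel_measurable lborel"
      using t unfolding bdp_def by (intro borel_measurable_times continuous_borel[OF cont_cw]) blast
    show "AE x in lborel. norm (t x * cw js x) \<le> norm (C * (1 / wgt ?D x))"
      using C
    proof eventually_elim
      case (elim x)
      have w: "wgt ?D x > 0" using wgt_ge1[of ?D x] by linarith
      have "norm (t x * cw js x) * wgt ?D x \<le> norm (t x) * (wgt (length js) x * wgt ?D x)"
        using mult_left_mono[OF norm_cw[of js x], of "norm (t x) * wgt ?D x"] w by (simp add: norm_mult mult_ac)
      also have "\<dots> \<le> norm (t x) * wgt p x" unfolding wgt_add[symmetric] by (intro mult_left_mono wgt_mono p) auto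
      also have "\<dots> \<le> C" using elim wgt_ge1[of p x] by (simp add: norm_mult mult.commute)
      finally have "norm (t x * cw js x) \<le> C * (1 / wgt ?D x)" using w by (simp add: pos_le_divide_eq)
      then show ?case unfolding real_norm_def by linarith
    qed
  qed
qed

text \<open>The js-derivative in y of the integral of t(x) \<phi>(y x): each derivative brings down
  one coordinate of x, and these are collected in \<open>cw js\<close>.\<close>

definition Qw :: "(real^'n::finite \<Rightarrow> complex) \<Rightarrow> (real^'n \<Rightarrow> complex) \<Rightarrow> 'n list \<Rightarrow> real^'n \<Rightarrow> complex" where
  "Qw t \<phi> js y = (\<integral>x. t x * cw js x * iterpd js \<phi> (y * x) \<partial>lborel)"

context
  fixes t \<phi> :: "real^'n::finite \<Rightarrow> complex" and p :: nat
  assumes t: "bdp p t" and \<phi>: "test_fn \<phi>"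
begin

lemma cont_dil_test: "continuous_on UNIV (\<lambda>x. iterpd js \<phi> (y * x))" "continuous_on UNIV (\<lambda>y. iterpd js \<phi> (y * x))"
  by (intro continuous_on_compose2[OF test_cont[OF test_iterpd[OF \<phi>], of UNIV]] continuous_intros; simp)+

lemma Qw_meas: "(\<lambda>x. t x * cw js x * iterpd js \<phi> (y * x)) \<in> borel_measurable lborel"
  using t unfolding bdp_def
  by (intro borel_measurable_times continuous_borel[OF cont_cw] continuous_borel[OF cont_dil_test(1)]) blast

lemma Qw_bound: "\<exists>w. integrable lborel w \<and> (\<forall>x y. norm (t x * cw js x * iterpd js \<phi> (y * x)) \<le> w x)"
  if p: "length js + (CARD('n) + 1) \<le> p"
proof -
  obtain C where C: "C > 0" "\<And>x. norm (iterpd js \<phi> x) \<le> C" using test_bounded[OF \<phi>] by blast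
  have "integrable lborel (\<lambda>x. norm (t x * cw js x) * C)"
    by (intro Bochner_Integration.integrable_mult_left Bochner_Integration.integrable_norm bdp_cw_integrable[OF t p])
  moreover have "norm (t x * cw js x * iterpd js \<phi> (y * x)) \<le> norm (t x * cw js x) * C" for x y
    unfolding norm_mult[of "t x * cw js x"] by (intro mult_left_mono C) auto
  ultimately show ?thesis by blast
qed

lemma Qw_integrable:
  assumes p: "length js + (CARD('n) + 1) \<le> p"
  shows "integrable lborel (\<lambda>x. t x * cw js x * iterpd js \<phi> (y * x))"
proof -
  obtain w where w: "integrable lborel w" "\<And>x y. norm (t x * cw js x * iterpd js \<phi> (y * x)) \<le> w x" using Qw_bound[OF p] by blast
  show ?thesis
    by (rule Bochner_Integration.integrable_bound[OF w(1) Qw_meas]) (use w(2) in \<open>force intro: order_trans[OF _ abs_ge_self]\<close>)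
qed

lemma Qw_cont:
  assumes p: "length js + (CARD('n) + 1) \<le> p" shows "continuous_on UNIV (Qw t \<phi> js)"
proof -
  obtain w where w: "integrable lborel w" "\<And>x y. norm (t x * cw js x * iterpd js \<phi> (y * x)) \<le> w x" using Qw_bound[OF p] by blast
  show ?thesis unfolding Qw_def[abs_def]
    by (rule cont_integral[OF _ Qw_meas w]) (intro continuous_intros cont_dil_test)
qed

lemma Qw_hpd:
  assumes p: "Suc (length js) + (CARD('n) + 1) \<le> p" shows "hpd j (Qw t \<phi> js) (Qw t \<phi> (j # js) y) y"
proof -
  obtain w where w: "integrable lborel w" "\<And>x y. norm (t x * cw (j # js) x * iterpd (j # js) \<phi> (y * x)) \<le> w x"
    using Qw_bound[of "j # js"] p by auto
  let ?f = "\<lambda>x s. t x * cw js x * iterpd js \<phi> ((y + s *\<^sub>R axis j 1) * x)"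
  let ?f' = "\<lambda>x s. t x * cw (j # js) x * iterpd (j # js) \<phi> ((y + s *\<^sub>R axis j 1) * x)"
  have "((\<lambda>s. \<integral>x. ?f x s \<partial>lborel) has_vector_derivative (\<integral>x. ?f' x 0 \<partial>lborel)) (at 0)"
  proof (rule hvd_integral[OF _ _ Qw_meas w(1) w(2)])
    fix x s
    have "hpd j (iterpd js \<phi>) (iterpd (j # js) \<phi> v) v" for v
      using smooth_hpd[OF test_smooth[OF test_iterpd[OF \<phi>]]] by simp
    from hpd_affine[OF this, where a = x and b = 0]
    have "hpd j (\<lambda>v. iterpd js \<phi> (v * x)) (complex_of_real (x $ j) * iterpd (j # js) \<phi> (v * x)) v" for v by simp
    from has_vector_derivative_mult_right[OF hpd_line[OF this, where S = UNIV], of "t x * cw js x" y s]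
    show "((\<lambda>s. ?f x s) has_vector_derivative ?f' x s) (at s)" by (simp add: mult_ac)
    show "integrable lborel (\<lambda>x. ?f x s)" by (rule Qw_integrable) (use p in simp)
  qed
  then show ?thesis by (simp add: hpd_def Qw_def)
qed

end

lemma hpd_sum:
  assumes "finite W" "\<And>w. w \<in> W \<Longrightarrow> hpd j (f w) (d w) x" shows "hpd j (\<lambda>x. \<Sum>w\<in>W. f w x) (\<Sum>w\<in>W. d w) x"
  using assms
proof (induction W rule: finite_induct)
  case empty
  then show ?case using hpd_const[of j 0 x] by simp
next
  case (insert w W)
  then show ?case using hpd_add[of j "f w" "d w" x "\<lambda>x. \<Sum>w\<in>W. f w x" "\<Sum>w\<in>W. d w"] by simp
qed

lemma iterpd_sum_Qw:
  fixes t :: "'w \<Rightarrow> real^'n::finite \<Rightarrow> complex"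
  assumes W: "finite W" and t: "\<And>w. w \<in> W \<Longrightarrow> bdp p (t w)" and \<phi>: "\<And>w. test_fn (\<phi> w)"
    and p: "length js + (CARD('n) + 1) \<le> p"
  shows "iterpd js (\<lambda>y. \<Sum>w\<in>W. Qw (t w) (\<phi> w) [] y) = (\<lambda>y. \<Sum>w\<in>W. Qw (t w) (\<phi> w) js y)"
  using p
proof (induction js)
  case (Cons j js)
  then have IH: "iterpd js (\<lambda>y. \<Sum>w\<in>W. Qw (t w) (\<phi> w) [] y) = (\<lambda>y. \<Sum>w\<in>W. Qw (t w) (\<phi> w) js y)" by simp
  have "pd j (\<lambda>y. \<Sum>w\<in>W. Qw (t w) (\<phi> w) js y) y = (\<Sum>w\<in>W. Qw (t w) (\<phi> w) (j # js) y)" for y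
    by (intro hpd_pd hpd_sum W Qw_hpd[OF t \<phi>]) (use Cons.prems in auto)
  then show ?case by (simp only: iterpd.simps IH)
qed simp

lemma euler_t_dil: "smooth_fn f \<Longrightarrow> euler_t j (\<lambda>x. f (x * y)) = (\<lambda>x. euler_t j f (x * y))"
  using iterpd_dil[of f "[j]" y] by (auto simp: euler_t_def fun_eq_iff mult_ac)

lemma smooth_euler_t: "smooth_fn f \<Longrightarrow> smooth_fn (euler_t j f)"
proof -
  assume f: "smooth_fn f"
  have "euler_t j f = (\<lambda>x. (-1) * f x + (-1) * (complex_of_real (x $ j) * pd j f x))" by (simp add: euler_t_def[abs_def])
  moreover have "smooth_fn (\<lambda>x. (-1) * f x + (-1) * (complex_of_real (x $ j) * pd j f x))"
    by (intro smooth_linear smooth_cmult smooth_mult smooth_X smooth_pd f)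
  ultimately show ?thesis by simp
qed

lemma smooth_euler_tw: "smooth_fn f \<Longrightarrow> smooth_fn (euler_tw w f)"
  by (induction w) (auto intro: smooth_euler_t)

text \<open>Euler derivatives commute with dilations. In a representation of T the parameter y thus
  enters only through the argument x * y of the fixed test function \<open>euler_tw w f\<close>,
  also when coordinates of y tend to 0.\<close>

lemma euler_tw_dil: "smooth_fn f \<Longrightarrow> euler_tw w (\<lambda>x. f (x * y)) = (\<lambda>x. euler_tw w f (x * y))"
  by (induction w) (auto simp: euler_t_dil smooth_euler_tw)

locale rapid =
  fixes T :: "(real^'n::finite \<Rightarrow> complex) \<Rightarrow> complex" and \<epsilon> :: real
  assumes OH: "OH_dist T" and eps: "\<epsilon> > 0" and supp: "dsupp T \<subseteq> Wset \<epsilon>"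
begin

lemma T_distr: "is_distr T" using OH by (simp add: OH_dist_iff)

lemma repr: "\<exists>W t. finite W \<and> (\<forall>w\<in>W. bdp p (t w)) \<and> (\<forall>f. test_fn f \<longrightarrow> T f = (\<Sum>w\<in>W. \<integral>x. t w x * euler_tw w f x \<partial>lborel))"
  using OH unfolding OH_dist_iff OHc_def by blast

text \<open>A representation of decay order p admits p - d - 1 derivatives in y under the integral,
  on the hyperplanes as well. No single p gives smoothness, but all representations define the same
  continuous function, because they agree wherever no y_j vanishes.\<close>

lemma extension_exists:
  assumes f: "test_fn f" shows "\<exists>g. test_fn g \<and> (\<forall>y. (\<forall>j. y $ j \<noteq> 0) \<longrightarrow> g y = T (\<lambda>x. f (x * y)))"
proof -
  let ?D = "CARD('n) + 1"
  have "\<forall>p. \<exists>W t. finite W \<and> (\<forall>w\<in>W. bdp p (t w)) \<and> (\<forall>f. test_fn f \<longrightarrow> T f = (\<Sum>w\<in>W. \<integral>x. t w x * euler_tw w f x \<partial>lborel))"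
    using repr by blast
  then obtain W t where W: "\<And>p. finite (W p)" "\<And>p w. w \<in> W p \<Longrightarrow> bdp p (t p w)"
    "\<And>p f. test_fn f \<Longrightarrow> T f = (\<Sum>w\<in>W p. \<integral>x. t p w x * euler_tw w f x \<partial>lborel)" by (simp only: choice_iff) blast
  have te: "test_fn (euler_tw w f)" for w by (rule dopD(1)[OF dop_euler_tw f])
  define Q where "Q p js y = (\<Sum>w\<in>W p. Qw (t p w) (euler_tw w f) js y)" for p js y
  have Q_T: "Q p [] y = T (\<lambda>x. f (x * y))" if y: "\<forall>j. y $ j \<noteq> 0" for p y
  proof -
    have "test_fn (\<lambda>x. f (x * y))" using y by (intro test_dil f) auto
    then show ?thesis
      by (simp add: W(3)[of _ p] Q_def Qw_def euler_tw_dil[OF test_smooth[OF f]] mult.commute)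
  qed
  have Qc: "continuous_on UNIV (Q p js)" if "length js + ?D \<le> p" for p js
    unfolding Q_def[abs_def] by (intro continuous_on_sum Qw_cont[OF W(2) te] that)
  \<comment> \<open>The smallest order already defines the function; derivatives of a given order
    are then computed from a representation with large enough p.\<close>
  define h where "h = Q ?D []"
  have hQ: "h = Q p []" if "?D \<le> p" for p
    unfolding h_def by (rule nz_dense_eq) (use that in \<open>auto intro!: Qc simp: Q_T\<close>)
  have it: "iterpd js h = Q p js" if "length js + ?D \<le> p" for p js
    using iterpd_sum_Qw[where \<phi> = "\<lambda>w. euler_tw w f", OF W(1)[of p] W(2) te that] hQ[of p] that unfolding Q_def[abs_def] by simp
  have sm: "smooth_fn h"
    unfolding smooth_fn_def
  proof (intro allI conjI)
    fix js :: "'n list" and j and x :: "real^'n"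
    let ?p = "Suc (length js) + ?D"
    have i: "iterpd js h = Q ?p js" by (rule it) simp
    show "continuous_on UNIV (iterpd js h)" unfolding i by (rule Qc) simp
    have "hpd j (Q ?p js) (\<Sum>w\<in>W ?p. Qw (t ?p w) (euler_tw w f) (j # js) x) x"
      unfolding Q_def[abs_def] by (intro hpd_sum W(1) Qw_hpd[OF W(2) te]) auto
    then show "(\<lambda>t. iterpd js h (x + t *\<^sub>R axis j 1)) differentiable at 0"
      unfolding i hpd_def by (rule differentiableI_vector)
  qed
  have hT: "h y = T (\<lambda>x. f (x * y))" if "\<forall>j. y $ j \<noteq> 0" for y unfolding h_def by (rule Q_T[OF that])
  obtain R0 where "\<And>x. norm x > R0 \<Longrightarrow> f x = 0" using f unfolding test_fn_iff by auto
  then obtain R where R: "R > 0" "\<And>x. norm x > R \<Longrightarrow> f x = 0"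
    by (metis less_max_iff_disj max.strict_boundedE zero_less_one)
  \<comment> \<open>Near the support of T all |x_j| exceed \<epsilon> / 2, so a coordinate |y_j| > 2
    R / \<epsilon> pushes x * y out of the support of f. If |y| > S, such a coordinate
    exists.\<close>
  define S where "S = (\<Sum>i\<in>(UNIV::'n set). 2 * R / \<epsilon>)"
  have far: "T (\<lambda>x. f (x * y)) = 0" if y: "\<forall>j. y $ j \<noteq> 0" "norm y > S" for y
  proof -
    have "\<exists>j. \<bar>y $ j\<bar> > 2 * R / \<epsilon>"
    proof (rule ccontr)
      assume "\<not> ?thesis"
      then have "norm y \<le> S" unfolding S_def by (intro order_trans[OF norm_le_l1_cart] sum_mono) (simp add: not_less)
      then show False using y by simp
    qed
    then obtain j where j: "\<bar>y $ j\<bar> > 2 * R / \<epsilon>" by blast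
    have "T (\<lambda>x. f (x * y)) = T (\<lambda>x. 0)"
    proof (rule distr_eq_near_support[OF T_distr supp, of "\<epsilon> / 2"])
      fix x :: "real^'n" assume x: "\<And>j. \<epsilon> / 2 < \<bar>x $ j\<bar>"
      have "R = \<epsilon> / 2 * (2 * R / \<epsilon>)" using eps by simp
      also have "\<dots> < \<bar>x $ j\<bar> * \<bar>y $ j\<bar>" using x[of j] j eps R(1) by (intro mult_strict_mono) auto
      also have "\<dots> \<le> norm (x * y)" using component_le_norm_cart[of "x * y" j] by (simp add: abs_mult)
      finally show "f (x * y) = 0" by (rule R(2))
    qed (use y eps in \<open>auto intro!: test_dil f\<close>)
    then show ?thesis by (simp add: distr_zero[OF T_distr])
  qed
  \<comment> \<open>Vanishing for |y| > S is known off the hyperplanes only. The continuous factor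
    max 0 (|y| - S) turns it into an identity of continuous functions on the whole space, to which
    density applies.\<close>
  have z: "(\<lambda>y. h y * complex_of_real (max 0 (norm y - S))) = (\<lambda>y. 0)"
  proof (rule nz_dense_eq)
    show "continuous_on UNIV (\<lambda>y. h y * complex_of_real (max 0 (norm y - S)))"
      by (intro continuous_intros smooth_cont sm)
    fix y :: "real^'n" assume y: "\<And>j. y $ j \<noteq> 0"
    show "h y * complex_of_real (max 0 (norm y - S)) = 0"
      using far[of y] hT[of y] y by (cases "norm y > S") auto
  qed auto
  have "h y = 0" if "norm y > S" for y using fun_cong[OF z, of y] that by simp
  then have "test_fn h" unfolding test_fn_iff using sm by blast
  then show ?thesis using hT by blast
qed

end


subsection \<open>Families with uniformly bounded Euler derivatives\<close>

lemma euler_tw_snoc: "euler_tw (w @ [j]) f = euler_tw w (euler_t j f)"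
  by (induction w) auto

lemma euler_t_add: "smooth_fn f \<Longrightarrow> smooth_fn g \<Longrightarrow> euler_t j (\<lambda>x. f x + g x) = (\<lambda>x. euler_t j f x + euler_t j g x)"
  using iterpd_add[of f g "[j]"] by (simp add: euler_t_def[abs_def] algebra_simps)

lemma euler_tw_add: "smooth_fn f \<Longrightarrow> smooth_fn g \<Longrightarrow> euler_tw w (\<lambda>x. f x + g x) = (\<lambda>x. euler_tw w f x + euler_tw w g x)"
  by (induction w) (auto simp: euler_t_add smooth_euler_tw)

text \<open>The Leibniz rule for - (1 + theta_j), which accounts for the extra term f g.\<close>

lemma euler_t_mult:
  "smooth_fn f \<Longrightarrow> smooth_fn g \<Longrightarrow> euler_t j (\<lambda>x. f x * g x) = (\<lambda>x. euler_t j f x * g x + (f x * euler_t j g x + f x * g x))"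
  by (simp add: euler_t_def[abs_def] pd_mult algebra_simps)

definition eub :: "('i \<Rightarrow> real^'n::finite \<Rightarrow> complex) \<Rightarrow> bool" where
  "eub F \<longleftrightarrow> (\<forall>i. smooth_fn (F i)) \<and> (\<forall>w. \<exists>C. \<forall>i x. norm (euler_tw w (F i) x) \<le> C)"

lemma eub_euler_t: assumes "eub F" shows "eub (\<lambda>i. euler_t j (F i))"
  unfolding eub_def
proof (intro conjI allI)
  show "smooth_fn (euler_t j (F i))" for i using assms by (simp add: eub_def smooth_euler_t)
  show "\<exists>C. \<forall>i x. norm (euler_tw w (euler_t j (F i)) x) \<le> C" for w
    using assms unfolding eub_def euler_tw_snoc[symmetric] by blast
qed

lemma eub_mult:
  assumes "eub F" "eub G" shows "eub (\<lambda>i x. F i x * G i x)"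
proof -
  have "\<exists>C. \<forall>i x. norm (euler_tw w (\<lambda>x. F i x * G i x) x) \<le> C" for w
    using assms
  proof (induction w arbitrary: F G rule: rev_induct)
    case Nil
    obtain C where C: "\<And>i x. norm (euler_tw [] (F i) x) \<le> C" using Nil(1) unfolding eub_def by blast
    obtain D where D: "\<And>i x. norm (euler_tw [] (G i) x) \<le> D" using Nil(2) unfolding eub_def by blast
    have C': "norm (F i x) \<le> C" and D': "norm (G i x) \<le> D" for i x using C D by auto
    have "norm (F i x * G i x) \<le> C * D" for i x
      unfolding norm_mult using order_trans[OF norm_ge_zero C'] by (intro mult_mono C' D') auto
    then show ?case by auto
  next
    case (snoc j w)
    have sm: "smooth_fn (F i)" "smooth_fn (G i)" for i using snoc.prems by (auto simp: eub_def)
    obtain A where A: "\<And>i x. norm (euler_tw w (\<lambda>x. euler_t j (F i) x * G i x) x) \<le> A"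
      using snoc.IH[OF eub_euler_t[OF snoc.prems(1), of j] snoc.prems(2)] by blast
    obtain B where B: "\<And>i x. norm (euler_tw w (\<lambda>x. F i x * euler_t j (G i) x) x) \<le> B"
      using snoc.IH[OF snoc.prems(1) eub_euler_t[OF snoc.prems(2), of j]] by blast
    obtain C where C: "\<And>i x. norm (euler_tw w (\<lambda>x. F i x * G i x) x) \<le> C"
      using snoc.IH[OF snoc.prems] by blast
    have "norm (euler_tw (w @ [j]) (\<lambda>x. F i x * G i x) x) \<le> A + (B + C)" for i x
    proof -
      have "euler_tw (w @ [j]) (\<lambda>x. F i x * G i x) x = euler_tw w (\<lambda>x. euler_t j (F i) x * G i x) x
        + (euler_tw w (\<lambda>x. F i x * euler_t j (G i) x) x + euler_tw w (\<lambda>x. F i x * G i x) x)"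
        by (simp add: euler_tw_snoc euler_t_mult sm euler_tw_add smooth_add smooth_mult smooth_euler_t)
      then show ?thesis by (simp only:) (intro norm_triangle_mono A B C)
    qed
    then show ?case by blast
  qed
  moreover have "smooth_fn (\<lambda>x. F i x * G i x)" for i using assms by (auto simp: eub_def intro: smooth_mult)
  ultimately show ?thesis by (simp add: eub_def)
qed

text \<open>All dilates of one test function share their bounds on Euler derivatives, however large
  or small the dilation; partial derivatives would not allow this.\<close>

lemma eub_dil:
  assumes f: "test_fn f" shows "eub (\<lambda>i x. f (x * a i))"
  unfolding eub_def euler_tw_dil[OF test_smooth[OF f]]
proof (intro conjI allI)
  show "smooth_fn (\<lambda>x. f (x * a i))" for i by (rule smooth_dil[OF test_smooth[OF f]])
  show "\<exists>C. \<forall>i x. norm (euler_tw w f (x * a i)) \<le> C" for w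
    using test_bounded[OF dopD(1)[OF dop_euler_tw f], of "[]" w] by auto
qed

section \<open>Eigenvalues of convolution operators\<close>

lemma AE_nz: "AE y in lborel. \<forall>j. (y::real^'n::finite) $ j \<noteq> 0"
proof -
  have "AE y in lborel. (y::real^'n) $ j \<noteq> 0" for j
  proof -
    have "closed {y::real^'n. y $ j = 0}" by (intro closed_Collect_eq continuous_intros)
    then have "{y::real^'n. y $ j = 0} \<in> sets lborel" by simp
    then have "{y::real^'n. y $ j = 0} \<in> null_sets lborel"
      using negligible_standard_hyperplane_cart[of j] unfolding negligible_iff_null_sets by (simp only: null_sets_completion_iff)
    from AE_not_in[OF this] show ?thesis by simp
  qed
  then show ?thesis by (simp add: AE_all_countable)
qed

lemma monomial_nonzero: "\<exists>f. test_fn f \<and> monomial \<alpha> f \<noteq> 0" for \<alpha> :: "'n::finite \<Rightarrow> nat"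
proof -
  \<comment> \<open>Centred at (3, ..., 3), the cut-off lives where all coordinates are at least 1,
    so every monomial is at least 1 there.\<close>
  define f :: "real^'n \<Rightarrow> complex" where "f = boxcut (\<chi> i. 3) 1"
  have t: "test_fn f" unfolding f_def by (rule test_boxcut) simp
  have i: "integrable lborel (\<lambda>x. mon \<alpha> x * f x)" by (intro test_integrable test_mult2 smooth_mon t)
  have "0 < (\<integral>x. Re (f x) \<partial>lborel)" unfolding f_def by (rule boxcut_integral_pos) simp
  also have "\<dots> \<le> (\<integral>x. Re (mon \<alpha> x * f x) \<partial>lborel)"
  proof (rule integral_mono)
    show "integrable lborel (\<lambda>x. Re (f x))" by (intro integrable_Re test_integrable t)
    show "integrable lborel (\<lambda>x. Re (mon \<alpha> x * f x))" by (intro integrable_Re i)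
    fix x
    obtain b where b: "f x = complex_of_real b" "0 \<le> b" unfolding f_def using boxcut_real by blast
    show "Re (f x) \<le> Re (mon \<alpha> x * f x)"
    proof (cases "\<forall>j. \<bar>x $ j - 3\<bar> < 2")
      case True
      have "1 \<le> x $ j" for j using True[rule_format, of j] by linarith
      then have "1 \<le> (\<Prod>j\<in>UNIV. (x $ j) ^ (\<alpha> j))" by (intro prod_ge_1) auto
      from mult_right_mono[OF this b(2)] show ?thesis
        by (simp only: mon_def b(1) Re_complex_of_real mult_1_left flip: of_real_mult)
    next
      case False
      then obtain j where "2 * 1 \<le> \<bar>x $ j - (\<chi> i. 3) $ j\<bar>" by (auto simp: not_less)
      then have "f x = 0" unfolding f_def by (rule boxcut_0[rotated]) simp
      then show ?thesis by simp
    qed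
  qed
  also have "\<dots> = Re (monomial \<alpha> f)" using t integral_Re[OF i] by (simp add: monomial_eq regdist_def)
  finally show ?thesis using t by auto
qed

text \<open>The origin of the eigenvalue formula: substituting z = x y produces the factor
  x^(-\<alpha>) divided by the product of the |x_j|, which is
  \<open>eig_fn \<alpha> x\<close>.\<close>

lemma eig_fn_integral:
  fixes x :: "real^'n::finite"
  assumes x: "\<forall>j. x $ j \<noteq> 0" and f: "test_fn f"
  shows "(\<integral>y. mon \<alpha> y * f (x * y) \<partial>lborel) = eig_fn \<alpha> x * monomial \<alpha> f"
proof -
  let ?p = "complex_of_real (\<Prod>i\<in>UNIV. \<bar>iv x $ i\<bar>)"
  have "(\<integral>y. mon \<alpha> y * f (x * y) \<partial>lborel) = ?p * (\<integral>z. mon \<alpha> (z * iv x + 0) * f (x * (z * iv x + 0)) \<partial>lborel)"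
  proof (rule integral_affine_cart)
    show "(\<lambda>y. mon \<alpha> y * f (x * y)) \<in> borel_measurable lborel"
      by (intro continuous_borel continuous_on_mult[OF smooth_cont[OF smooth_mon]] continuous_on_compose2[OF test_cont[OF f, of UNIV]]
          continuous_intros subset_UNIV)
  qed (use x in \<open>simp add: iv_def\<close>)
  also have "\<dots> = ?p * (\<integral>z. mon \<alpha> (iv x) * (mon \<alpha> z * f z) \<partial>lborel)"
  proof -
    have "x * (z * iv x + 0) = z" for z using x by (simp add: vec_eq_iff iv_def)
    then show ?thesis by (simp add: mon_dil mult_ac)
  qed
  also have "\<dots> = (?p * mon \<alpha> (iv x)) * monomial \<alpha> f" using f by (simp add: monomial_eq regdist_def)
  also have "?p * mon \<alpha> (iv x) = eig_fn \<alpha> x"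
  proof -
    have "\<bar>1 / x $ i\<bar> * (1 / x $ i) ^ \<alpha> i = x $ i / \<bar>x $ i\<bar> / (x $ i) ^ (\<alpha> i + 1)" for i
      using x by (simp add: power_divide)
    then have "(\<Prod>i\<in>UNIV. \<bar>iv x $ i\<bar> * (iv x $ i) ^ \<alpha> i) = sigma_sgn x / (\<Prod>j\<in>UNIV. (x $ j) ^ (\<alpha> j + 1))"
      unfolding sigma_sgn_def prod_dividef[symmetric] by (intro prod.cong) (auto simp: iv_def)
    then show ?thesis unfolding mon_def eig_fn_def of_real_mult[symmetric] prod.distrib by simp
  qed
  finally show ?thesis .
qed

context rapid
begin

text \<open>Decay of order d + 1 makes the densities integrable, so uniform bounds on Euler
  derivatives are all that T sees.\<close>

lemma bounded_family:
  assumes F: "eub F" "\<And>i. test_fn (F i)" shows "\<exists>K. \<forall>i. norm (T (F i)) \<le> K"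
proof -
  let ?D = "CARD('n) + 1"
  obtain W t where W: "finite W" "\<And>w. w \<in> W \<Longrightarrow> bdp ?D (t w)"
    "\<And>f. test_fn f \<Longrightarrow> T f = (\<Sum>w\<in>W. \<integral>x. t w x * euler_tw w f x \<partial>lborel)" using repr[of ?D] by blast
  have "\<forall>w. \<exists>C. \<forall>i x. norm (euler_tw w (F i) x) \<le> C" using F(1) by (simp add: eub_def)
  then obtain C where C: "\<And>w i x. norm (euler_tw w (F i) x) \<le> C w" by (simp only: choice_iff) blast
  have "norm (T (F i)) \<le> (\<Sum>w\<in>W. \<integral>x. norm (t w x) * C w \<partial>lborel)" for i
  proof -
    have "norm (T (F i)) \<le> (\<Sum>w\<in>W. norm (\<integral>x. t w x * euler_tw w (F i) x \<partial>lborel))"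
      unfolding W(3)[OF F(2)] by (rule norm_sum)
    also have "\<dots> \<le> (\<Sum>w\<in>W. \<integral>x. norm (t w x) * C w \<partial>lborel)"
    proof (rule sum_mono)
      fix w assume w: "w \<in> W"
      have it: "integrable lborel (t w)" using bdp_cw_integrable[OF W(2)[OF w], of "[]"] by simp
      have ie: "integrable lborel (\<lambda>x. t w x * euler_tw w (F i) x)"
        by (rule bdp_integrable[OF W(2)[OF w] dopD(1)[OF dop_euler_tw F(2)]])
      have "norm (\<integral>x. t w x * euler_tw w (F i) x \<partial>lborel) \<le> (\<integral>x. norm (t w x * euler_tw w (F i) x) \<partial>lborel)" by simp
      also have "\<dots> \<le> (\<integral>x. norm (t w x) * C w \<partial>lborel)"
        by (intro integral_mono Bochner_Integration.integrable_norm Bochner_Integration.integrable_mult_left it ie)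
          (auto simp: norm_mult intro!: mult_left_mono C)
      finally show "norm (\<integral>x. t w x * euler_tw w (F i) x \<partial>lborel) \<le> (\<integral>x. norm (t w x) * C w \<partial>lborel)" .
    qed
    finally show ?thesis .
  qed
  then show ?thesis by blast
qed

context
  fixes rf cf :: "real^'n \<Rightarrow> complex" and r :: real and U :: "(real^'n) set" and \<delta> :: real
  assumes rf: "test_fn rf" and r: "r > 0" "\<And>x. x \<in> ball 0 r \<Longrightarrow> rf x = 1"
    and cf: "smooth_fn cf" and U: "open U" "dsupp T \<subseteq> U" "\<And>x. x \<in> U \<Longrightarrow> cf x = 1"
    and d: "\<delta> > 0" "\<And>x j. \<bar>x $ j\<bar> < \<delta> \<Longrightarrow> cf x = 0"
begin

definition dn :: "nat \<Rightarrow> real^'n" where "dn n = (\<chi> i. 1 / real (Suc n))"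

lemma dn_scale: "x * dn n = (1 / real (Suc n)) *\<^sub>R x"
  by (simp add: vec_eq_iff dn_def del: of_nat_Suc)

text \<open>Integrated over y it is \<open>monomial \<alpha> f\<close> times the cut-off function
  \<open>eig_fn \<alpha>\<close>; with T applied for fixed y it tends to y^\<alpha> times T (f (x *
  y)). Fubini compares the two.\<close>

definition Fam :: "('n \<Rightarrow> nat) \<Rightarrow> (real^'n \<Rightarrow> complex) \<Rightarrow> nat \<Rightarrow> real^'n \<Rightarrow> real^'n \<Rightarrow> complex" where
  "Fam \<alpha> f n y x = mon \<alpha> y * ((rf (x * dn n) * cf x) * f (x * y))"

text \<open>Where cf is non-zero all |x_j| are at least \<delta>, which bounds |y_j| by R2 /
  \<delta> independently of n. Only the radius in x grows with n, through the dilated rf.\<close>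

lemma Fam_family:
  assumes f: "test_fn f" shows "\<exists>R. \<forall>n. \<exists>R'\<ge>R. cc_family (Fam \<alpha> f n) R' \<and> (\<forall>y x. norm y > R \<longrightarrow> Fam \<alpha> f n y x = 0)"
proof -
  obtain R1 where R1: "\<And>x. norm x > R1 \<Longrightarrow> rf x = 0" using rf unfolding test_fn_iff by auto
  obtain R2 where R2: "\<And>x. norm x > R2 \<Longrightarrow> f x = 0" using f unfolding test_fn_iff by auto
  define R where "R = (\<Sum>i\<in>(UNIV::'n set). R2 / \<delta>)"
  have zy: "Fam \<alpha> f n y x = 0" if y: "norm y > R" for n y x
  proof (rule ccontr)
    assume "Fam \<alpha> f n y x \<noteq> 0"
    then have n: "cf x \<noteq> 0" "f (x * y) \<noteq> 0" by (auto simp: Fam_def)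
    have "\<bar>y $ j\<bar> \<le> R2 / \<delta>" for j
    proof -
      have "\<delta> * \<bar>y $ j\<bar> \<le> \<bar>x $ j\<bar> * \<bar>y $ j\<bar>" using d(2)[of x j] n(1) by (intro mult_right_mono) (auto simp: not_less[symmetric])
      also have "\<dots> \<le> norm (x * y)" using component_le_norm_cart[of "x * y" j] by (simp add: abs_mult)
      also have "\<dots> \<le> R2" using R2[of "x * y"] n(2) by (simp add: not_less[symmetric]) blast
      finally show ?thesis using d(1) by (simp add: le_divide_eq mult.commute)
    qed
    then have "norm y \<le> R" unfolding R_def by (intro order_trans[OF norm_le_l1_cart] sum_mono)
    then show False using y by simp
  qed
  have "\<exists>R'\<ge>R. cc_family (Fam \<alpha> f n) R' \<and> (\<forall>y x. norm y > R \<longrightarrow> Fam \<alpha> f n y x = 0)" for n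
  proof (intro exI[of _ "max R (R1 * real (Suc n))"] conjI allI impI zy)
    show "cc_family (Fam \<alpha> f n) (max R (R1 * real (Suc n)))"
    proof
      have "cfam (\<lambda>y x. mon \<alpha> y * ((rf (x * dn n) * cf x) * f (x * y + 0)))"
        by (intro cfam_scale cfam_mult cfam_const cfam_affine smooth_mult smooth_dil cf test_smooth rf f smooth_cont smooth_mon continuous_on_id continuous_on_const)
      then show "cfam (Fam \<alpha> f n)" by (simp add: Fam_def[abs_def])
      fix y x :: "real^'n"
      show "Fam \<alpha> f n y x = 0" if "norm y > max R (R1 * real (Suc n))" using zy that by simp
      show "Fam \<alpha> f n y x = 0" if "norm x > max R (R1 * real (Suc n))"
      proof -
        have "R1 * real (Suc n) < norm x" using that by simp
        then have "R1 < norm x / real (Suc n)" by (simp add: less_divide_eq del: of_nat_Suc)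
        then have "rf (x * dn n) = 0" by (intro R1) (simp add: dn_scale del: of_nat_Suc)
        then show ?thesis by (simp add: Fam_def)
      qed
    qed
  qed auto
  then show ?thesis by blast
qed

lemma Fam_int:
  assumes f: "test_fn f"
  shows "(\<integral>y. Fam \<alpha> f n y x \<partial>lborel) = monomial \<alpha> f * (rf ((1 / real (Suc n)) *\<^sub>R x) * cf x * eig_fn \<alpha> x)"
proof (cases "\<forall>j. x $ j \<noteq> 0")
  case True
  have "(\<integral>y. Fam \<alpha> f n y x \<partial>lborel) = (\<integral>y. (rf (x * dn n) * cf x) * (mon \<alpha> y * f (x * y)) \<partial>lborel)"
    by (simp add: Fam_def mult_ac)
  also have "\<dots> = (rf (x * dn n) * cf x) * (eig_fn \<alpha> x * monomial \<alpha> f)"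
    by (simp add: eig_fn_integral[OF True f])
  finally show ?thesis by (simp add: dn_scale mult_ac)
next
  case False
  then obtain j where "x $ j = 0" by blast
  then have "cf x = 0" using d(2)[of x j] d(1) by simp
  then show ?thesis by (simp add: Fam_def)
qed

text \<open>Smoothness of the cut-off \<open>eig_fn\<close> is obtained without differentiating the
  quotient: up to a non-zero constant it is the y-integral of a smooth family.\<close>

lemma test_cut_eig: "test_fn (\<lambda>x. rf ((1 / real (Suc n)) *\<^sub>R x) * cf x * eig_fn \<alpha> x)"
proof -
  obtain f :: "real^'n \<Rightarrow> complex" where f: "test_fn f" "monomial \<alpha> f \<noteq> 0" using monomial_nonzero by blast
  obtain R where "cc_family (Fam \<alpha> f n) R" using Fam_family[OF f(1)] by blast
  then interpret cc_family "Fam \<alpha> f n" R .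
  have "test_fn (\<lambda>x. (1 / monomial \<alpha> f) * (monomial \<alpha> f * (rf ((1 / real (Suc n)) *\<^sub>R x) * cf x * eig_fn \<alpha> x)))"
    using test_cmult[OF int_test] unfolding Fam_int[OF f(1)] .
  then show ?thesis using f(2) by simp
qed

text \<open>The cut-off cf equals 1 near the support of T and drops out. What remains is a product
  of dilates of two test functions, which \<open>bounded_family\<close> controls uniformly.\<close>

lemma T_Fam: assumes f: "test_fn f" and y: "\<forall>j. y $ j \<noteq> 0"
  shows "T (Fam \<alpha> f n y) = mon \<alpha> y * T (\<lambda>x. rf (x * dn n) * f (x * y))"
proof -
  have ty: "test_fn (\<lambda>x. f (x * y))" using y by (intro test_dil f) auto
  have sr: "smooth_fn (\<lambda>x. rf (x * dn n))" by (rule smooth_dil[OF test_smooth[OF rf]])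
  have t1: "test_fn (\<lambda>x. rf (x * dn n) * f (x * y))" by (rule test_mult2[OF sr ty])
  have t2: "test_fn (\<lambda>x. (rf (x * dn n) * cf x) * f (x * y))" by (intro test_mult2 smooth_mult sr cf ty)
  have "T (\<lambda>x. (rf (x * dn n) * cf x) * f (x * y) - rf (x * dn n) * f (x * y)) = 0"
    by (rule dsupp_vanish[OF T_distr test_diff[OF t2 t1] U(1,2)]) (simp add: U(3))
  then have "T (\<lambda>x. (rf (x * dn n) * cf x) * f (x * y)) = T (\<lambda>x. rf (x * dn n) * f (x * y))"
    using distr_diff[OF T_distr t2 t1] by simp
  then show ?thesis unfolding Fam_def[abs_def] by (simp add: distr_cmult[OF T_distr t2])
qed

text \<open>By Fubini the left side is the y-integral of T (Fam \<alpha> f n y). For fixed y without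
  zero coordinates the integrand is eventually constant, equal to y^\<alpha> g(y); a uniform bound
  on a fixed ball of y permits dominated convergence.\<close>

lemma eig_limit:
  assumes f: "test_fn f" and g: "test_fn g" "\<And>y. (\<forall>j. y $ j \<noteq> 0) \<Longrightarrow> g y = T (\<lambda>x. f (x * y))"
  shows "(\<lambda>n. monomial \<alpha> f * T (\<lambda>x. rf ((1 / real (Suc n)) *\<^sub>R x) * cf x * eig_fn \<alpha> x)) \<longlonglongrightarrow> monomial \<alpha> g"
proof -
  obtain R where R: "\<And>n. \<exists>R'\<ge>R. cc_family (Fam \<alpha> f n) R' \<and> (\<forall>y x. norm y > R \<longrightarrow> Fam \<alpha> f n y x = 0)"
    using Fam_family[OF f] by blast
  have cc: "\<exists>R'. cc_family (Fam \<alpha> f n) R'" for n using R[of n] by blast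
  have zy: "Fam \<alpha> f n y x = 0" if "norm y > R" for n y x using R[of n] that by blast
  have fub: "monomial \<alpha> f * T (\<lambda>x. rf ((1 / real (Suc n)) *\<^sub>R x) * cf x * eig_fn \<alpha> x) = (\<integral>y. T (Fam \<alpha> f n y) \<partial>lborel)" for n
  proof -
    obtain R' where "cc_family (Fam \<alpha> f n) R'" using cc by blast
    from cc_family.distr_fubini[OF this T_distr]
    show ?thesis unfolding Fam_int[OF f] distr_cmult[OF T_distr test_cut_eig] .
  qed
  have meas: "(\<lambda>y. T (Fam \<alpha> f n y)) \<in> borel_measurable lborel" for n
  proof -
    obtain R' where "cc_family (Fam \<alpha> f n) R'" using cc by blast
    from cc_family.distr_family_cont[OF this T_distr] show ?thesis by (rule continuous_borel)
  qed
  \<comment> \<open>One family indexed by all pairs (n, y). Where y has a zero coordinate the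
    dilation 1 is put in its place, so that every member is a test function.\<close>
  define a :: "nat \<times> (real^'n) \<Rightarrow> real^'n" where "a p = (if \<forall>j. snd p $ j \<noteq> 0 then snd p else 1)" for p
  have a: "a p $ j \<noteq> 0" for p j by (simp add: a_def)
  have "\<exists>K. \<forall>p. norm (T (\<lambda>x. rf (x * dn (fst p)) * f (x * a p))) \<le> K"
    by (intro bounded_family eub_mult eub_dil rf f test_mult2 smooth_dil test_dil test_smooth a)
  then obtain K where K0: "\<And>p. norm (T (\<lambda>x. rf (x * dn (fst p)) * f (x * a p))) \<le> K" by blast
  have K: "norm (T (\<lambda>x. rf (x * dn n) * f (x * y))) \<le> K" if "\<forall>j. y $ j \<noteq> 0" for n y
    using K0[of "(n, y)"] that by (simp add: a_def)
  have "(\<lambda>n. \<integral>y. T (Fam \<alpha> f n y) \<partial>lborel) \<longlonglongrightarrow> (\<integral>y. mon \<alpha> y * g y \<partial>lborel)"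
  proof (rule integral_dominated_convergence)
    show "(\<lambda>y. mon \<alpha> y * g y) \<in> borel_measurable lborel"
      by (intro continuous_borel continuous_on_mult smooth_cont smooth_mon test_smooth g(1))
    show "(\<lambda>y. T (Fam \<alpha> f n y)) \<in> borel_measurable lborel" for n by (rule meas)
    have "continuous_on UNIV (\<lambda>y. complex_of_real (norm (mon \<alpha> y) * K))"
      by (intro continuous_intros smooth_cont smooth_mon)
    from integrable_Re[OF set_integrable_continuous_cball[OF this, of R, unfolded set_integrable_def]]
    show "integrable lborel (\<lambda>y. indicator (cball 0 R) y *\<^sub>R (norm (mon \<alpha> y) * K))" by simp
    show "AE y in lborel. (\<lambda>n. T (Fam \<alpha> f n y)) \<longlonglongrightarrow> mon \<alpha> y * g y"
      using AE_nz
    proof eventually_elim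
      case (elim y)
      obtain R2 where R2: "\<And>x. norm x > R2 \<Longrightarrow> f (x * y) = 0" using test_dil[OF f, of y] elim unfolding test_fn_iff by auto
      \<comment> \<open>For n >= N, |x| <= R2 implies |x| / (n+1) < r, where rf is 1.\<close>
      obtain N :: nat where N: "R2 / r < real N" using reals_Archimedean2 by blast
      have "T (Fam \<alpha> f n y) = mon \<alpha> y * g y" if n: "n \<ge> N" for n
      proof -
        have "rf (x * dn n) * f (x * y) = f (x * y)" for x
        proof (cases "norm x > R2")
          case False
          have "R2 / r < real (Suc n)" using N n by simp
          then have "norm x < r * real (Suc n)" using False r(1) by (simp add: divide_less_eq mult.commute del: of_nat_Suc)
          then have "norm (x * dn n) < r" unfolding dn_scale by (simp add: divide_less_eq del: of_nat_Suc)
          then show ?thesis using r(2)[of "x * dn n"] by simp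
        qed (simp add: R2)
        then have "(\<lambda>x. rf (x * dn n) * f (x * y)) = (\<lambda>x. f (x * y))" by (rule ext)
        then show ?thesis using T_Fam[OF f elim, of \<alpha> n] g(2)[OF elim] by (simp only:)
      qed
      then show ?case by (intro tendsto_eventually) (auto simp: eventually_sequentially)
    qed
    show "AE y in lborel. norm (T (Fam \<alpha> f n y)) \<le> indicator (cball 0 R) y *\<^sub>R (norm (mon \<alpha> y) * K)" for n
      using AE_nz
    proof eventually_elim
      case (elim y)
      show ?case
      proof (cases "norm y > R")
        case True
        then have "Fam \<alpha> f n y = (\<lambda>x. 0)" using zy by blast
        then show ?thesis using True by (simp add: distr_zero[OF T_distr])
      next
        case False
        then show ?thesis unfolding T_Fam[OF f elim] using K[OF elim, of n] by (simp add: norm_mult mult_left_mono)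
      qed
    qed
  qed
  then show ?thesis unfolding fub using g(1) by (simp add: monomial_eq regdist_def)
qed

end

lemma mstar_extension:
  assumes "test_fn f"
  shows "\<exists>g. test_fn g \<and> (\<forall>y. (\<forall>j. y $ j \<noteq> 0) \<longrightarrow> g y = T (\<lambda>x. f (x * y))) \<and> (\<forall>S. mstar S T f = S g)"
proof -
  obtain g where g: "test_fn g" "\<forall>y. (\<forall>j. y $ j \<noteq> 0) \<longrightarrow> g y = T (\<lambda>x. f (x * y))"
    using extension_exists[OF assms] by blast
  moreover have "mstar S T f = S g" for S by (rule mstar_eq[OF assms g(1)]) (use g(2) in blast)
  ultimately show ?thesis by blast
qed

lemma eigenvalue_ext_value:
  assumes LT: "L (monomial \<alpha>) = mstar (monomial \<alpha>) T" and m: "L (monomial \<alpha>) = (\<lambda>f. m * monomial \<alpha> f)"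
  shows "ext_value T (eig_fn \<alpha>) m"
  unfolding ext_value_def
proof (intro allI impI; elim conjE exE)
  fix rf cf :: "real^'n \<Rightarrow> complex" and r \<delta> :: real and U
  assume "test_fn rf" "r > 0" "\<forall>x\<in>ball 0 r. rf x = 1" "smooth_fn cf" "open U" "dsupp T \<subseteq> U" "\<forall>x\<in>U. cf x = 1"
    "\<delta> > 0" "\<forall>x. (\<exists>j. \<bar>x $ j\<bar> < \<delta>) \<longrightarrow> cf x = 0"
  note c = this
  let ?c = "\<lambda>n. T (\<lambda>x. rf ((1 / real (Suc n)) *\<^sub>R x) * cf x * eig_fn \<alpha> x)"
  obtain f :: "real^'n \<Rightarrow> complex" where f: "test_fn f" "monomial \<alpha> f \<noteq> 0" using monomial_nonzero by blast
  obtain g where g: "test_fn g" "\<forall>y. (\<forall>j. y $ j \<noteq> 0) \<longrightarrow> g y = T (\<lambda>x. f (x * y))" "\<forall>S. mstar S T f = S g"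
    using mstar_extension[OF f(1)] by blast
  have "(\<lambda>n. monomial \<alpha> f * ?c n) \<longlonglongrightarrow> monomial \<alpha> g"
    by (rule eig_limit[OF c(1,2) _ c(4-6) _ c(8) _ f(1) g(1)]) (use c g(2) in blast)+
  moreover have "monomial \<alpha> g = m * monomial \<alpha> f" using fun_cong[OF m, of f] LT g(3) by simp
  ultimately have "(\<lambda>n. monomial \<alpha> f * ?c n / monomial \<alpha> f) \<longlonglongrightarrow> m * monomial \<alpha> f / monomial \<alpha> f"
    using f(2) by (intro tendsto_divide tendsto_const) auto
  then show "?c \<longlonglongrightarrow> m" using f(2) by simp
qed

text \<open>In \<open>eig_limit\<close> the function f enters the left side only through the scalar
  \<open>monomial \<alpha> f\<close>. One f0 with non-zero scalar shows that the limit m of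
  \<open>?c\<close> exists, and then every f gives m times its scalar.\<close>

lemma mstar_eigenvector: "\<exists>m. \<forall>f. mstar (monomial \<alpha>) T f = m * monomial \<alpha> f"
proof -
  \<comment> \<open>\<open>planecut \<delta>\<close> is 1 where all |x_j| > 2 \<delta>, an open set
    containing the support of T because 2 \<delta> < \<epsilon>.\<close>
  define \<delta> where "\<delta> = \<epsilon> / 3"
  have \<delta>: "\<delta> > 0" "2 * \<delta> < \<epsilon>" using eps by (auto simp: \<delta>_def)
  let ?U = "{x::real^'n. \<forall>j. 2 * \<delta> < \<bar>x $ j\<bar>}"
  have e: "?U = (\<Inter>j. {x. 2 * \<delta> < \<bar>x $ j\<bar>})" by auto
  have U: "open ?U" unfolding e by (intro open_INT open_Collect_less continuous_intros ballI finite_class.finite_UNIV)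
  have sU: "dsupp T \<subseteq> ?U"
  proof
    fix x assume "x \<in> dsupp T"
    then have "\<And>j. \<epsilon> \<le> \<bar>x $ j\<bar>" using supp by (auto simp: Wset_def)
    then show "x \<in> ?U" using \<delta>(2) by (auto intro: less_le_trans)
  qed
  let ?c = "\<lambda>n. T (\<lambda>x. boxcut 0 1 ((1 / real (Suc n)) *\<^sub>R x) * planecut \<delta> x * eig_fn \<alpha> x)"
  have b1: "boxcut 0 1 x = 1" if "x \<in> ball 0 1" for x :: "real^'n"
    using that component_le_norm_cart[of x] by (intro boxcut_1) (auto intro: order_trans less_imp_le)
  have lim: "(\<lambda>n. monomial \<alpha> f * ?c n) \<longlonglongrightarrow> mstar (monomial \<alpha>) T f" if f: "test_fn f" for f
  proof -
    obtain g where g: "test_fn g" "\<forall>y. (\<forall>j. y $ j \<noteq> 0) \<longrightarrow> g y = T (\<lambda>x. f (x * y))" "\<forall>S. mstar S T f = S g"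
      using mstar_extension[OF f] by blast
    have "(\<lambda>n. monomial \<alpha> f * ?c n) \<longlonglongrightarrow> monomial \<alpha> g"
    proof (rule eig_limit[OF test_boxcut zero_less_one b1 smooth_planecut U sU _ \<delta>(1) _ f g(1)])
      show "planecut \<delta> x = 1" if "x \<in> ?U" for x using that by (intro planecut_1 \<delta>) (auto intro: less_imp_le)
      show "planecut \<delta> x = 0" if "\<bar>x $ j\<bar> < \<delta>" for x :: "real^'n" and j using that by (intro planecut_0 \<delta> less_imp_le)
    qed (use g(2) in auto)
    then show ?thesis using g(3) by simp
  qed
  obtain f0 :: "real^'n \<Rightarrow> complex" where f0: "test_fn f0" "monomial \<alpha> f0 \<noteq> 0" using monomial_nonzero by blast
  define m where "m = mstar (monomial \<alpha>) T f0 / monomial \<alpha> f0"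
  have "(\<lambda>n. monomial \<alpha> f0 * ?c n / monomial \<alpha> f0) \<longlonglongrightarrow> m"
    unfolding m_def by (intro tendsto_divide tendsto_const lim f0)
  then have c: "?c \<longlonglongrightarrow> m" using f0(2) by simp
  have "mstar (monomial \<alpha>) T f = m * monomial \<alpha> f" for f
  proof (cases "test_fn f")
    case True
    have "(\<lambda>n. monomial \<alpha> f * ?c n) \<longlonglongrightarrow> monomial \<alpha> f * m" by (intro tendsto_mult tendsto_const c)
    then show ?thesis using LIMSEQ_unique[OF lim[OF True]] by (simp add: mult.commute)
  next
    case False
    then show ?thesis by (simp add: mstar_def monomial_eq regdist_def)
  qed
  then show ?thesis by blast
qed

end

theorem mainTheorem1:
  fixes L :: "((real^'n::finite \<Rightarrow> complex) \<Rightarrow> complex) \<Rightarrow> ((real^'n \<Rightarrow> complex) \<Rightarrow> complex)"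
  assumes "cont_lin_op L"
  shows "(hadamard_op L \<longleftrightarrow>
            (\<exists>T \<epsilon>. OH_dist T \<and> \<epsilon> > 0 \<and> dsupp T \<subseteq> Wset \<epsilon> \<and>
                   (\<forall>S. is_distr S \<longrightarrow> L S = mstar S T)))
       \<and> (\<forall>T \<epsilon>. OH_dist T \<and> \<epsilon> > 0 \<and> dsupp T \<subseteq> Wset \<epsilon> \<and>
                 (\<forall>S. is_distr S \<longrightarrow> L S = mstar S T) \<longrightarrow>
              (\<forall>\<alpha> m. L (monomial \<alpha>) = (\<lambda>f. m * monomial \<alpha> f) \<longrightarrow>
                 ext_value T (eig_fn \<alpha>) m))"
proof (intro conjI iffI allI impI; (elim exE conjE)?)
  assume "hadamard_op L"
  then interpret hadamard L by unfold_locales (auto simp: hadamard_op_def)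
  obtain \<epsilon> where "\<epsilon> > 0" "dsupp T \<subseteq> Wset \<epsilon>" using T_support by blast
  then show "\<exists>T \<epsilon>. OH_dist T \<and> \<epsilon> > 0 \<and> dsupp T \<subseteq> Wset \<epsilon> \<and> (\<forall>S. is_distr S \<longrightarrow> L S = mstar S T)"
    using T_OH L_mstar by blast
next
  fix T :: "(real^'n \<Rightarrow> complex) \<Rightarrow> complex" and \<epsilon> :: real
  assume T: "OH_dist T" "\<epsilon> > 0" "dsupp T \<subseteq> Wset \<epsilon>" and L: "\<forall>S. is_distr S \<longrightarrow> L S = mstar S T"
  interpret rapid T \<epsilon> by unfold_locales (fact T)+
  have "L (monomial \<alpha>) = mstar (monomial \<alpha>) T" for \<alpha> using L is_distr_monomial by blast
  then show "hadamard_op L" using assms mstar_eigenvector unfolding hadamard_op_def fun_eq_iff by simp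
next
  fix T :: "(real^'n \<Rightarrow> complex) \<Rightarrow> complex" and \<epsilon> :: real and \<alpha> m
  assume T: "OH_dist T" "\<epsilon> > 0" "dsupp T \<subseteq> Wset \<epsilon>" and L: "\<forall>S. is_distr S \<longrightarrow> L S = mstar S T"
    and m: "L (monomial \<alpha>) = (\<lambda>f. m * monomial \<alpha> f)"
  interpret rapid T \<epsilon> by unfold_locales (fact T)+
  have "L (monomial \<alpha>) = mstar (monomial \<alpha>) T" using L is_distr_monomial by blast
  then show "ext_value T (eig_fn \<alpha>) m" by (rule eigenvalue_ext_value) (fact m)
qed

end
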